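(* Let $d\ge2$ and let $(\tilde W_t)_{t\ge0}$ be the gap process of the $d$-particle PushTASEP started from a fixed initial configuration. Then as $n\to\infty$, $$\big(n^{-1/2}\tilde W_{nt}\big)_{t\ge0}\Rightarrow\tilde{\mathcal W}$$ in distribution in $D([0,\infty),\mathbb R^{d-1})$, where $\tilde{\mathcal W}$ is the SRBM associated with $(\mathbb R^{d-1}_{\ge0},\mathbf 0,\Sigma_{\mathrm{PT}},R_{\mathrm{PT}},\delta_{\mathbf 0})$.
   Context: PushTASEP: a continuous-time process of $d$ particles at distinct sites of $\mathbb Z$, each carrying an independent rate-$1$ exponential clock; when a particle's clock rings it jumps one site to the right, pushing the maximal block of consecutively occupied sites immediately to its right one site to the right. With particle positions $\xi^{(1)}_t<\dots<\xi^{(d)}_t$, the gap process is $\tilde W_t=(\tilde W^1_t,\dots,\tilde W^{d-1}_t)$, $\tilde W^i_t=\xi^{(i+1)}_t-\xi^{(i)}_t-1$. Matrices: $\mathrm{tridiag}_r(a,b,c)$ is the $r\times r$ tridiagonal matrix with diagonal $b$, subdiagonal $a$, superdiagonal $c$. $\Sigma_{\mathrm{PT}}=\mathrm{tridiag}_{d-1}(-1,2,-1)$, $R_{\mathrm{PT}}=\mathrm{tridiag}_{d-1}(-1,1,0)$. SRBM: given $m\ge1$, $\theta\in\mathbb R^m$, a covariance matrix $\Gamma$, an $m\times m$ matrix $R$ and a probability measure $\nu$ on $\mathbb R^m_{\ge0}$, an SRBM associated with $(\mathbb R^m_{\ge0},\theta,\Gamma,R,\nu)$ is an $(\mathcal F_t)$-adapted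 $m$-dimensional process $W$ on a filtered probability space such that a.s.: (1) $W=X+RY$; (2) $W$ has continuous paths in $\mathbb R^m_{\ge0}$; (3) $X$ is an $m$-dimensional Brownian motion with drift $\theta$, covariance $\Gamma$, $X(0)\sim\nu$, and $X(t)-X(0)-\theta t$ is an $(\mathcal F_t)$-martingale; (4) $Y$ is $(\mathcal F_t)$-adapted, and for each $i$: $Y_i(0)=0$, $Y_i$ continuous nondecreasing, $\int_0^\infty\mathbf 1_{(0,\infty)}(W_i(s))\,dY_i(s)=0$. For the data above it is unique in law. *)

theory Defs
  imports "HOL-Probability.Probability"
begin

section \<open>Vectors in R^m, represented as nat => real (only coordinates i < m matter)\<close>

definition vdist :: "nat \<Rightarrow> (nat \<Rightarrow> real) \<Rightarrow> (nat \<Rightarrow> real) \<Rightarrow> real" where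
  "vdist m a b = sqrt (\<Sum>i<m. (a i - b i)^2)"

text \<open>Cadlag paths on [0,oo): right-continuous with left limits, coordinatewise for i < m.
  Values at negative times and at coordinates i >= m are irrelevant.\<close>
definition Dspace :: "nat \<Rightarrow> (real \<Rightarrow> nat \<Rightarrow> real) set" where
  "Dspace m = {x. \<forall>i<m. \<forall>t\<ge>0. ((\<lambda>s. x s i) \<longlongrightarrow> x t i) (at_right t) \<and>
                     (t > 0 \<longrightarrow> (\<exists>L. ((\<lambda>s. x s i) \<longlongrightarrow> L) (at_left t)))}"

text \<open>Ethier--Kurtz's class Lambda: strictly increasing continuous maps of [0,oo) onto [0,oo)
  with gamma(lambda) = sup_{s>t>=0} |log((lambda s - lambda t)/(s - t))| finite.\<close>
definition SkLambda :: "(real \<Rightarrow> real) set" where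
  "SkLambda = {l. strict_mono_on {0..} l \<and> continuous_on {0..} l \<and> l ` {0..} = {0..} \<and>
       (\<exists>C. \<forall>s t. 0 \<le> t \<and> t < s \<longrightarrow> \<bar>ln ((l s - l t) / (s - t))\<bar> \<le> C)}"

text \<open>J1 convergence of a sequence (Ethier--Kurtz, Prop. 3.5.3): there are l_k in Lambda with
  gamma(l_k) -> 0 and sup_{0<=t<=T} |x_k(t) - x(l_k(t))| -> 0 for every T > 0.\<close>
definition sk_conv :: "nat \<Rightarrow> (nat \<Rightarrow> real \<Rightarrow> nat \<Rightarrow> real) \<Rightarrow> (real \<Rightarrow> nat \<Rightarrow> real) \<Rightarrow> bool" where
  "sk_conv m xs x \<longleftrightarrow> (\<exists>l. (\<forall>k. l k \<in> SkLambda) \<and>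
     (\<forall>\<epsilon>>0. eventually (\<lambda>k. \<forall>s t. 0 \<le> t \<and> t < s \<longrightarrow>
                 \<bar>ln ((l k s - l k t) / (s - t))\<bar> \<le> \<epsilon>) sequentially) \<and>
     (\<forall>T>0. \<forall>\<epsilon>>0. eventually (\<lambda>k. \<forall>t\<in>{0..T}. vdist m (xs k t) (x (l k t)) \<le> \<epsilon>) sequentially))"

definition sk_continuous :: "nat \<Rightarrow> ((real \<Rightarrow> nat \<Rightarrow> real) \<Rightarrow> real) \<Rightarrow> bool" where
  "sk_continuous m f \<longleftrightarrow> (\<forall>xs x. (\<forall>k. xs k \<in> Dspace m) \<longrightarrow> x \<in> Dspace m \<longrightarrow> sk_conv m xs x \<longrightarrow>
       (\<lambda>k. f (xs k)) \<longlonglongrightarrow> f x)"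

text \<open>Convergence in distribution in D([0,oo),R^m): E f(Z_n) -> E f(W) for every bounded
  J1-continuous f. Expectations are taken w.r.t. the completed probability measures, so that
  modifications of the processes on null sets are harmless.\<close>
definition conv_distr_D :: "nat \<Rightarrow> 'a measure \<Rightarrow> (nat \<Rightarrow> 'a \<Rightarrow> real \<Rightarrow> nat \<Rightarrow> real)
      \<Rightarrow> 'b measure \<Rightarrow> ('b \<Rightarrow> real \<Rightarrow> nat \<Rightarrow> real) \<Rightarrow> bool" where
  "conv_distr_D m P Z M W \<longleftrightarrow> (\<forall>f. bounded (range f) \<longrightarrow> sk_continuous m f \<longrightarrow>
       (\<lambda>n. \<integral>\<omega>. f (Z n \<omega>) \<partial>completion P) \<longlonglongrightarrow> (\<integral>\<omega>. f (W \<omega>) \<partial>completion M))"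

text \<open>Particle i jumps one step to the right and pushes the block to its right:
  y_i = x_i + 1, y_j = max x_j (y_{j-1} + 1) for j > i (particles indexed 0..d-1 in order).\<close>
fun push :: "nat \<Rightarrow> (nat \<Rightarrow> int) \<Rightarrow> nat \<Rightarrow> int" where
  "push i x 0 = (if i = 0 then x 0 + 1 else x 0)"
| "push i x (Suc j) = (if Suc j < i then x (Suc j) else if Suc j = i then x (Suc j) + 1
                        else max (x (Suc j)) (push i x j + 1))"

text \<open>k-th ring time (k = 0,1,...) of clock i, given the i.i.d. exponential waiting times E i k.\<close>
definition ring_time :: "(nat \<Rightarrow> nat \<Rightarrow> real) \<Rightarrow> nat \<Rightarrow> nat \<Rightarrow> real" where
  "ring_time E i k = (\<Sum>j\<le>k. E i j)"

definition pt_config :: "nat \<Rightarrow> (nat \<Rightarrow> int) \<Rightarrow> (nat \<Rightarrow> nat \<Rightarrow> real) \<Rightarrow> real \<Rightarrow> nat \<Rightarrow> int" where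
  "pt_config d x0 E t = fold (push)
      (concat (map (\<lambda>s. filter (\<lambda>i. \<exists>k. s = ring_time E i k) [0..<d])
         (sorted_list_of_set {s. s \<le> t \<and> (\<exists>i<d. \<exists>k. s = ring_time E i k)}))) x0"

definition gaps :: "nat \<Rightarrow> (nat \<Rightarrow> int) \<Rightarrow> nat \<Rightarrow> real" where
  "gaps d x i = (if i < d - 1 then real_of_int (x (Suc i) - x i - 1) else 0)"

definition is_filtration :: "'b measure \<Rightarrow> (real \<Rightarrow> 'b set set) \<Rightarrow> bool" where
  "is_filtration M F \<longleftrightarrow> (\<forall>t. sigma_algebra (space M) (F t) \<and> F t \<subseteq> sets M) \<and>
      (\<forall>s t. s \<le> t \<longrightarrow> F s \<subseteq> F t)"

definition adapted :: "'b measure \<Rightarrow> (real \<Rightarrow> 'b set set) \<Rightarrow> nat \<Rightarrow> (real \<Rightarrow> 'b \<Rightarrow> nat \<Rightarrow> real) \<Rightarrow> bool" where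
  "adapted M F m V \<longleftrightarrow> (\<forall>t\<ge>0. \<forall>i<m. \<forall>B\<in>sets borel. {\<omega>\<in>space M. V t \<omega> i \<in> B} \<in> F t)"

text \<open>X is an m-dimensional (F_t)-Brownian motion with drift theta, covariance Gamma and
  X(0) ~ nu: continuous paths, adapted, and for 0 <= s <= t the increment X(t) - X(s) is
  independent of F_s with law N((t-s) theta, (t-s) Gamma) (encoded by the joint
  characteristic function with indicators of F_s-sets); moreover X(t) - X(0) - theta t is an
  (F_t)-martingale.\<close>
definition brownian :: "'b measure \<Rightarrow> (real \<Rightarrow> 'b set set) \<Rightarrow> nat \<Rightarrow> (nat \<Rightarrow> real) \<Rightarrow>
      (nat \<Rightarrow> nat \<Rightarrow> real) \<Rightarrow> (nat \<Rightarrow> real) measure \<Rightarrow> (real \<Rightarrow> 'b \<Rightarrow> nat \<Rightarrow> real) \<Rightarrow> bool" where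
  "brownian M F m \<theta> \<Gamma> \<nu> X \<longleftrightarrow>
     adapted M F m X \<and>
     (AE \<omega> in M. \<forall>i<m. continuous_on {0..} (\<lambda>t. X t \<omega> i)) \<and>
     distr M (PiM {..<m} (\<lambda>_. borel)) (\<lambda>\<omega>. restrict (X 0 \<omega>) {..<m}) = \<nu> \<and>
     (\<forall>s t u A. 0 \<le> s \<and> s \<le> t \<and> A \<in> F s \<longrightarrow>
        (\<integral>\<omega>. indicator A \<omega> * cis (\<Sum>i<m. u i * (X t \<omega> i - X s \<omega> i)) \<partial>M) =
        complex_of_real (measure M A) * cis ((t - s) * (\<Sum>i<m. u i * \<theta> i)) *
        complex_of_real (exp (- (t - s) / 2 * (\<Sum>i<m. \<Sum>j<m. u i * \<Gamma> i j * u j)))) \<and>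
     (\<forall>i<m. \<forall>t\<ge>0. integrable M (\<lambda>\<omega>. X t \<omega> i - X 0 \<omega> i - \<theta> i * t)) \<and>
     (\<forall>i<m. \<forall>s t A. 0 \<le> s \<and> s \<le> t \<and> A \<in> F s \<longrightarrow>
        (\<integral>\<omega>. indicator A \<omega> * (X t \<omega> i - X 0 \<omega> i - \<theta> i * t) \<partial>M) =
        (\<integral>\<omega>. indicator A \<omega> * (X s \<omega> i - X 0 \<omega> i - \<theta> i * s) \<partial>M))"

definition srbm :: "'b measure \<Rightarrow> (real \<Rightarrow> 'b set set) \<Rightarrow> nat \<Rightarrow> (nat \<Rightarrow> real) \<Rightarrow>
      (nat \<Rightarrow> nat \<Rightarrow> real) \<Rightarrow> (nat \<Rightarrow> nat \<Rightarrow> real) \<Rightarrow> (nat \<Rightarrow> real) measure \<Rightarrow>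
      (real \<Rightarrow> 'b \<Rightarrow> nat \<Rightarrow> real) \<Rightarrow> (real \<Rightarrow> 'b \<Rightarrow> nat \<Rightarrow> real) \<Rightarrow>
      (real \<Rightarrow> 'b \<Rightarrow> nat \<Rightarrow> real) \<Rightarrow> bool" where
  "srbm M F m \<theta> \<Gamma> R \<nu> W X Y \<longleftrightarrow>
     prob_space M \<and> is_filtration M F \<and>
     adapted M F m W \<and> adapted M F m Y \<and> brownian M F m \<theta> \<Gamma> \<nu> X \<and>
     (AE \<omega> in M.
        (\<forall>t\<ge>0. \<forall>i<m. W t \<omega> i = X t \<omega> i + (\<Sum>j<m. R i j * Y t \<omega> j)) \<and>
        (\<forall>i<m. continuous_on {0..} (\<lambda>t. W t \<omega> i)) \<and>
        (\<forall>t\<ge>0. \<forall>i<m. W t \<omega> i \<ge> 0) \<and>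
        (\<forall>i<m. Y 0 \<omega> i = 0 \<and> continuous_on {0..} (\<lambda>t. Y t \<omega> i) \<and> mono_on {0..} (\<lambda>t. Y t \<omega> i) \<and>
           emeasure (interval_measure (\<lambda>t. Y (max 0 t) \<omega> i)) {t. 0 \<le> t \<and> W t \<omega> i > 0} = 0))"

definition tridiag :: "nat \<Rightarrow> real \<Rightarrow> real \<Rightarrow> real \<Rightarrow> nat \<Rightarrow> nat \<Rightarrow> real" where
  "tridiag r a b c i j = (if i < r \<and> j < r then
      (if i = j then b else if i = j + 1 then a else if j = i + 1 then c else 0) else 0)"

definition Sigma_PT :: "nat \<Rightarrow> nat \<Rightarrow> nat \<Rightarrow> real" where
  "Sigma_PT d = tridiag (d - 1) (-1) 2 (-1)"

definition R_PT :: "nat \<Rightarrow> nat \<Rightarrow> nat \<Rightarrow> real" where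
  "R_PT d = tridiag (d - 1) (-1) 1 0"

end

theory Submission
  imports Defs
begin

text \<open>The gaps are a deterministic functional of the clocks: almost surely no two clocks ring together, and
  then particle i + 1 is pushed exactly when particle i would otherwise overtake it, so the gap path is the
  one-sided reflection of the path of differences of the counting processes of consecutive clocks, the push
  count of one gap feeding the next. The reflection with matrix tridiag(-1, 1, 0) is an iterated running
  minimum, hence it is solved explicitly, is Lipschitz for the uniform distance, and commutes with Brownian
  scaling. The counting processes are inverses of partial sums of the exponential waiting times. These
  converge to independent Brownian motions: the increments over a grid by the central limit theorem, the
  oscillation inside the grid cells by Ottaviani's inequality with fourth moments. A portmanteau argument
  with Lipschitz minorants transfers this to the reflected paths. The differences of consecutive
  Brownian motions have covariance tridiag(-1, 2, -1), so reflecting them yields the SRBM; its law is unique since the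
  driving Brownian motion determines it.\<close>

section \<open>Laws and characteristic functions\<close>

text \<open>Convergence is tested against every bounded functional that is sequentially
  J1-continuous, and such a functional is not known to be measurable beforehand. Paths are therefore
  sampled on a grid and rounded to multiples of 1/k: any function of finitely many integer variables
  is measurable, and continuity recovers the functional as an almost sure limit, measurable for the
  completed measure. Genuine time changes occur only here, for paths with jumps, since sampling
  delays a jump to the next grid point. All other limits are continuous paths, where locally uniform
  convergence suffices.

  The same obstacle shapes the portmanteau step: the minorants are infima over the values of the
  functional along all prelimit walks, so they exist for every path, and continuity of the
  reflection enters only through one compactness-free argument by contradiction.

  The theorem speaks of every SRBM with the given data on any space. Convergence is proved for one
  explicit SRBM and then moved to the others.\<close>

lemma countable_data_measurable:
  fixes K :: "'i \<Rightarrow> 'a \<Rightarrow> int" and q :: "('i \<Rightarrow> int) \<Rightarrow> real"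
  assumes fin: "finite I" and K: "\<And>a. a \<in> I \<Longrightarrow> K a \<in> measurable M (count_space UNIV)"
  shows "(\<lambda>\<omega>. q (\<lambda>a\<in>I. K a \<omega>)) \<in> borel_measurable M"
proof -
  let ?A = "PiE I (\<lambda>_. UNIV :: int set)"
  \<comment> \<open>On a countable range the discrete sigma-algebra is available, and every
    \<open>q\<close> is measurable for it.\<close>
  have cnt: "countable ?A" using fin by (intro countable_PiE) auto
  have "(\<lambda>\<omega>. \<lambda>a\<in>I. K a \<omega>) \<in> measurable M (count_space ?A)"
  proof (subst measurable_count_space_eq_countable[OF cnt], safe)
    fix c assume c: "c \<in> ?A"
    have "(\<lambda>\<omega>. \<lambda>a\<in>I. K a \<omega>) -` {c} \<inter> space M = {\<omega>\<in>space M. \<forall>a\<in>I. K a \<omega> = c a}"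
      using c by (auto simp: fun_eq_iff PiE_def extensional_def restrict_def)
    also have "\<dots> \<in> sets M"
    proof (rule sets.sets_Collect_finite_All[OF _ fin])
      fix a assume "a \<in> I"
      from K[OF this] show "{\<omega>\<in>space M. K a \<omega> = c a} \<in> sets M" by measurable
    qed
    finally show "(\<lambda>\<omega>. \<lambda>a\<in>I. K a \<omega>) -` {c} \<inter> space M \<in> sets M" .
  qed auto
  from measurable_compose[OF this, of q borel] show ?thesis by simp
qed

text \<open>Rounding the coordinates to multiples of 1/(r + 1) leaves countable data, where
  measurability is automatic; the Lipschitz bound makes the rounded values converge. The bound also
  forces \<open>\<phi>\<close> to depend on the coordinates in \<open>I\<close> alone.\<close>

lemma lipschitz_measurable:
  fixes U :: "'i \<Rightarrow> 'a \<Rightarrow> real" and \<phi> :: "('i \<Rightarrow> real) \<Rightarrow> real"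
  assumes fin: "finite I" and U: "\<And>a. a \<in> I \<Longrightarrow> U a \<in> borel_measurable M"
    and lip: "\<And>v v'. \<bar>\<phi> v - \<phi> v'\<bar> \<le> C * (\<Sum>a\<in>I. \<bar>v a - v' a\<bar>)"
  shows "(\<lambda>\<omega>. \<phi> (\<lambda>a. U a \<omega>)) \<in> borel_measurable M"
proof (rule borel_measurable_LIMSEQ_real)
  let ?q = "\<lambda>r (c :: 'i \<Rightarrow> int). \<phi> (\<lambda>a. real_of_int (c a) / real (Suc r))"
  let ?D = "\<lambda>r \<omega>. ?q r (\<lambda>a\<in>I. \<lfloor>real (Suc r) * U a \<omega>\<rfloor>)"
  show "?D r \<in> borel_measurable M" for r
    by (rule countable_data_measurable[OF fin]) (use U in measurable)
  fix \<omega>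
  have rnd: "\<bar>real_of_int \<lfloor>real (Suc r) * x\<rfloor> / real (Suc r) - x\<bar> \<le> 1 / real (Suc r)" for r x
  proof -
    have "real_of_int \<lfloor>real (Suc r) * x\<rfloor> / real (Suc r) - x = (real_of_int \<lfloor>real (Suc r) * x\<rfloor> - real (Suc r) * x) / real (Suc r)"
      by (simp add: field_simps del: of_nat_Suc)
    also have "\<bar>\<dots>\<bar> = \<bar>real_of_int \<lfloor>real (Suc r) * x\<rfloor> - real (Suc r) * x\<bar> / real (Suc r)" by (simp add: abs_divide)
    also have "\<dots> \<le> 1 / real (Suc r)" by (intro divide_right_mono) linarith+
    finally show ?thesis .
  qed
  have C: "\<bar>?D r \<omega> - \<phi> (\<lambda>a. U a \<omega>)\<bar> \<le> \<bar>C\<bar> * (real (card I) * inverse (real (Suc r)))" for r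
  proof -
    have "\<bar>?D r \<omega> - \<phi> (\<lambda>a. U a \<omega>)\<bar> \<le> C * (\<Sum>a\<in>I. \<bar>real_of_int \<lfloor>real (Suc r) * U a \<omega>\<rfloor> / real (Suc r) - U a \<omega>\<bar>)"
      by (rule order_trans[OF lip]) (simp del: of_nat_Suc)
    also have "\<dots> \<le> \<bar>C\<bar> * (\<Sum>a\<in>I. \<bar>real_of_int \<lfloor>real (Suc r) * U a \<omega>\<rfloor> / real (Suc r) - U a \<omega>\<bar>)"
      by (intro mult_right_mono sum_nonneg) auto
    also have "\<dots> \<le> \<bar>C\<bar> * (\<Sum>a\<in>I. 1 / real (Suc r))"
      by (intro mult_left_mono sum_mono rnd) auto
    finally show ?thesis by (simp add: inverse_eq_divide)
  qed
  have "(\<lambda>r. \<bar>C\<bar> * (real (card I) * inverse (real (Suc r)))) \<longlonglongrightarrow> \<bar>C\<bar> * (real (card I) * 0)"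
    by (intro tendsto_mult tendsto_const LIMSEQ_inverse_real_of_nat)
  then have "(\<lambda>r. ?D r \<omega> - \<phi> (\<lambda>a. U a \<omega>)) \<longlonglongrightarrow> 0"
    using C by (intro Lim_null_comparison[OF always_eventually[OF allI], of "\<lambda>r. ?D r \<omega> - \<phi> (\<lambda>a. U a \<omega>)"]) (simp_all del: of_nat_Suc)
  then show "(\<lambda>r. ?D r \<omega>) \<longlonglongrightarrow> \<phi> (\<lambda>a. U a \<omega>)" by (simp add: LIM_zero_iff)
qed

section \<open>Uniqueness theorems for weighted characteristic functions\<close>

lemma prob_integrable_bounded:
  fixes f :: "'a \<Rightarrow> 'b :: {banach, second_countable_topology}"
  assumes "prob_space M" "f \<in> borel_measurable M" "\<And>x. norm (f x) \<le> c"
  shows "integrable M f"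
proof -
  interpret prob_space M by fact
  show ?thesis by (rule integrable_const_bound[where B=c]) (use assms in auto)
qed

lemma cis_measurable [measurable]: "cis \<in> borel_measurable borel"
  unfolding cis_conv_exp by measurable

lemma cnj_measurable [measurable]: "cnj \<in> borel_measurable borel"
  by (intro borel_measurable_continuous_onI continuous_intros)

text \<open>Levy's uniqueness theorem for signed weights: adding a constant to the weight turns it into a
  probability density.\<close>

lemma char_unique_real_weight:
  fixes Z :: "'a \<Rightarrow> real" and Z' :: "'b \<Rightarrow> real" and g :: "'a \<Rightarrow> real" and g' :: "'b \<Rightarrow> real"
  assumes M: "prob_space M" and M': "prob_space M'"
    and [measurable]: "Z \<in> borel_measurable M" "Z' \<in> borel_measurable M'"
      "g \<in> borel_measurable M" "g' \<in> borel_measurable M'"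
    and bnd: "\<And>\<omega>. \<bar>g \<omega>\<bar> \<le> c" "\<And>\<omega>. \<bar>g' \<omega>\<bar> \<le> c"
    and ch: "\<And>v. (\<integral>\<omega>. cis (v * Z \<omega>) \<partial>M) = (\<integral>\<omega>. cis (v * Z' \<omega>) \<partial>M')"
    and chg: "\<And>v. (\<integral>\<omega>. complex_of_real (g \<omega>) * cis (v * Z \<omega>) \<partial>M) = (\<integral>\<omega>. complex_of_real (g' \<omega>) * cis (v * Z' \<omega>) \<partial>M')"
    and B[measurable]: "B \<in> sets borel"
  shows "(\<integral>\<omega>. g \<omega> * indicator B (Z \<omega>) \<partial>M) = (\<integral>\<omega>. g' \<omega> * indicator B (Z' \<omega>) \<partial>M')"
proof -
  interpret M: prob_space M by fact
  interpret M': prob_space M' by fact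
  have main: "(\<integral>\<omega>. w \<omega> * indicator B (Z \<omega>) \<partial>M) = (\<integral>\<omega>. w' \<omega> * indicator B (Z' \<omega>) \<partial>M')"
    if [measurable]: "w \<in> borel_measurable M" "w' \<in> borel_measurable M'"
      and pos: "\<And>\<omega>. 1 \<le> w \<omega>" "\<And>\<omega>. 1 \<le> w' \<omega>" and bd: "\<And>\<omega>. \<bar>w \<omega>\<bar> \<le> e" "\<And>\<omega>. \<bar>w' \<omega>\<bar> \<le> e"
      and cw: "\<And>v. (\<integral>\<omega>. complex_of_real (w \<omega>) * cis (v * Z \<omega>) \<partial>M) = (\<integral>\<omega>. complex_of_real (w' \<omega>) * cis (v * Z' \<omega>) \<partial>M')"
    for w w' e
  proof -
    have iw[simp]: "integrable M w" "integrable M' w'"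
      using prob_integrable_bounded[OF M \<open>w \<in> _\<close>, of e] prob_integrable_bounded[OF M' \<open>w' \<in> _\<close>, of e] bd by simp_all
    \<comment> \<open>Both weights are normalised by the same total mass: the weighted transforms at
      v = 0 agree.\<close>
    define I where "I = (\<integral>\<omega>. w \<omega> \<partial>M)"
    have I': "I = (\<integral>\<omega>. w' \<omega> \<partial>M')" using cw[of 0] by (simp add: I_def)
    have "(\<integral>\<omega>. 1 \<partial>M) \<le> I" unfolding I_def by (rule integral_mono) (use pos in auto)
    then have I1: "I \<ge> 1" by (simp add: M.prob_space)
    have gen: "real_distribution (distr (density M (\<lambda>\<omega>. ennreal (w \<omega> / I))) borel Z) \<and>
       char (distr (density M (\<lambda>\<omega>. ennreal (w \<omega> / I))) borel Z) v = (\<integral>\<omega>. complex_of_real (w \<omega>) * cis (v * Z \<omega>) \<partial>M) / I \<and>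
       measure (distr (density M (\<lambda>\<omega>. ennreal (w \<omega> / I))) borel Z) B = (\<integral>\<omega>. w \<omega> * indicator B (Z \<omega>) \<partial>M) / I"
      if "prob_space M" and [measurable]: "w \<in> borel_measurable M" "Z \<in> borel_measurable M" and iw: "integrable M w" and Iw: "I = (\<integral>\<omega>. w \<omega> \<partial>M)"
        and pos: "\<And>\<omega>. 1 \<le> w \<omega>" for M :: "'c measure" and w Z v
    proof -
      interpret N: prob_space M by fact
      have w0: "0 \<le> w \<omega>" for \<omega> using pos[of \<omega>] by linarith
      have 1: "emeasure (density M (\<lambda>\<omega>. ennreal (w \<omega> / I))) (space (density M (\<lambda>\<omega>. ennreal (w \<omega> / I)))) = 1"
      proof -
        have "(\<integral>\<^sup>+\<omega>. ennreal (w \<omega> / I) \<partial>M) = ennreal (\<integral>\<omega>. w \<omega> / I \<partial>M)"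
          by (intro nn_integral_eq_integral) (use iw w0 I1 in auto)
        also have "\<dots> = 1" using I1 Iw by simp
        finally show ?thesis by (simp add: emeasure_density cong: nn_integral_cong)
      qed
      interpret D: prob_space "density M (\<lambda>\<omega>. ennreal (w \<omega> / I))" by (rule prob_spaceI) (rule 1)
      have rd: "real_distribution (distr (density M (\<lambda>\<omega>. ennreal (w \<omega> / I))) borel Z)"
        by (rule D.real_distribution_distr) simp
      have ch: "char (distr (density M (\<lambda>\<omega>. ennreal (w \<omega> / I))) borel Z) v = (\<integral>\<omega>. complex_of_real (w \<omega>) * cis (v * Z \<omega>) \<partial>M) / I"
      proof -
        have "char (distr (density M (\<lambda>\<omega>. ennreal (w \<omega> / I))) borel Z) v = (\<integral>\<omega>. cis (v * Z \<omega>) \<partial>density M (\<lambda>\<omega>. ennreal (w \<omega> / I)))"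
          unfolding char_def by (subst integral_distr) (auto simp: cis_conv_exp)
        also have "\<dots> = (\<integral>\<omega>. (w \<omega> / I) *\<^sub>R cis (v * Z \<omega>) \<partial>M)"
          by (subst integral_density) (use w0 I1 in \<open>auto simp: cis_conv_exp\<close>)
        also have "\<dots> = (\<integral>\<omega>. complex_of_real (w \<omega>) * cis (v * Z \<omega>) / I \<partial>M)"
          by (intro Bochner_Integration.integral_cong) (auto simp: scaleR_conv_of_real)
        finally show ?thesis by simp
      qed
      have "measure (distr (density M (\<lambda>\<omega>. ennreal (w \<omega> / I))) borel Z) B = (\<integral>x. indicator B x \<partial>distr (density M (\<lambda>\<omega>. ennreal (w \<omega> / I))) borel Z)"
        by simp
      also have "\<dots> = (\<integral>\<omega>. indicator B (Z \<omega>) \<partial>density M (\<lambda>\<omega>. ennreal (w \<omega> / I)))"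
        by (subst integral_distr) auto
      also have "\<dots> = (\<integral>\<omega>. (w \<omega> / I) *\<^sub>R indicator B (Z \<omega>) \<partial>M)"
        by (subst integral_density) (use w0 I1 in auto)
      also have "\<dots> = (\<integral>\<omega>. w \<omega> * indicator B (Z \<omega>) / I \<partial>M)"
        by (intro Bochner_Integration.integral_cong) auto
      also have "\<dots> = (\<integral>\<omega>. w \<omega> * indicator B (Z \<omega>) \<partial>M) / I" by simp
      finally show ?thesis using rd ch by blast
    qed
    note G = gen[OF M \<open>w \<in> _\<close> \<open>Z \<in> _\<close> iw(1) I_def pos(1)] and G' = gen[OF M' \<open>w' \<in> _\<close> \<open>Z' \<in> _\<close> iw(2) I' pos(2)]
    have "distr (density M (\<lambda>\<omega>. ennreal (w \<omega> / I))) borel Z = distr (density M' (\<lambda>\<omega>. ennreal (w' \<omega> / I))) borel Z'"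
      by (rule Levy_uniqueness) (use G G' in \<open>simp_all add: cw fun_eq_iff\<close>)
    then have "(\<integral>\<omega>. w \<omega> * indicator B (Z \<omega>) \<partial>M) / I = (\<integral>\<omega>. w' \<omega> * indicator B (Z' \<omega>) \<partial>M') / I"
      using conjunct2[OF conjunct2[OF G]] conjunct2[OF conjunct2[OF G']] by metis
    then show ?thesis using I1 by simp
  qed
  have c0: "0 \<le> c" using bnd(1)[of undefined] by linarith
  have int[simp]: "integrable M (\<lambda>\<omega>. cis (v * Z \<omega>))" "integrable M' (\<lambda>\<omega>. cis (v * Z' \<omega>))" for v
    by (rule prob_integrable_bounded[OF M, where c=1] prob_integrable_bounded[OF M', where c=1]; simp)+
  have int1[simp]: "integrable M (\<lambda>\<omega>. complex_of_real (g \<omega>) * cis (v * Z \<omega>))" "integrable M' (\<lambda>\<omega>. complex_of_real (g' \<omega>) * cis (v * Z' \<omega>))"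
    for v
    by (rule prob_integrable_bounded[OF M, where c=c] prob_integrable_bounded[OF M', where c=c]; simp add: norm_mult bnd)+
  have int2[simp]: "integrable M (\<lambda>\<omega>. indicat_real B (Z \<omega>))" "integrable M' (\<lambda>\<omega>. indicat_real B (Z' \<omega>))"
    by (rule prob_integrable_bounded[OF M, where c=1] prob_integrable_bounded[OF M', where c=1]; simp add: indicator_def)+
  have int3[simp]: "integrable M (\<lambda>\<omega>. g \<omega> * indicator B (Z \<omega>))" "integrable M' (\<lambda>\<omega>. g' \<omega> * indicator B (Z' \<omega>))"
    by (rule prob_integrable_bounded[OF M, where c=c] prob_integrable_bounded[OF M', where c=c]; simp add: indicator_def c0 bnd abs_mult)+
  have A: "(\<integral>\<omega>. (1::real) * indicator B (Z \<omega>) \<partial>M) = (\<integral>\<omega>. 1 * indicator B (Z' \<omega>) \<partial>M')"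
    by (rule main[of _ _ 1]) (use ch in auto)
  \<comment> \<open>The shift by c + 1 moves the weights into [1, 2 c + 1], where
    \<open>main\<close> applies; the contribution of the constant is removed with
    \<open>A\<close>.\<close>
  have "(\<integral>\<omega>. (g \<omega> + (c + 1)) * indicator B (Z \<omega>) \<partial>M) = (\<integral>\<omega>. (g' \<omega> + (c + 1)) * indicator B (Z' \<omega>) \<partial>M')"
  proof (rule main[of _ _ "2 * c + 1"])
    show "1 \<le> g \<omega> + (c + 1)" "\<bar>g \<omega> + (c + 1)\<bar> \<le> 2 * c + 1" for \<omega> using bnd(1)[of \<omega>] by linarith+
    show "1 \<le> g' \<omega> + (c + 1)" "\<bar>g' \<omega> + (c + 1)\<bar> \<le> 2 * c + 1" for \<omega> using bnd(2)[of \<omega>] by linarith+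
    show "(\<integral>\<omega>. complex_of_real (g \<omega> + (c + 1)) * cis (v * Z \<omega>) \<partial>M) = (\<integral>\<omega>. complex_of_real (g' \<omega> + (c + 1)) * cis (v * Z' \<omega>) \<partial>M')" for v
      using chg[of v] ch[of v] by (simp add: ring_distribs)
  qed simp_all
  then show ?thesis using A by (simp add: ring_distribs)
qed

text \<open>Real and imaginary part are combinations of the weight and its conjugate, and the
  transform of the conjugate weight at v is the conjugate of the transform at -v.\<close>

lemma char_unique_weight:
  fixes Z :: "'a \<Rightarrow> real" and Z' :: "'b \<Rightarrow> real" and g :: "'a \<Rightarrow> complex" and g' :: "'b \<Rightarrow> complex"
  assumes M: "prob_space M" and M': "prob_space M'"
    and [measurable]: "Z \<in> borel_measurable M" "Z' \<in> borel_measurable M'"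
      "g \<in> borel_measurable M" "g' \<in> borel_measurable M'"
    and bnd: "\<And>\<omega>. norm (g \<omega>) \<le> c" "\<And>\<omega>. norm (g' \<omega>) \<le> c"
    and ch: "\<And>v. (\<integral>\<omega>. cis (v * Z \<omega>) \<partial>M) = (\<integral>\<omega>. cis (v * Z' \<omega>) \<partial>M')"
    and chg: "\<And>v. (\<integral>\<omega>. g \<omega> * cis (v * Z \<omega>) \<partial>M) = (\<integral>\<omega>. g' \<omega> * cis (v * Z' \<omega>) \<partial>M')"
    and B[measurable]: "B \<in> sets borel"
  shows "(\<integral>\<omega>. g \<omega> * indicator B (Z \<omega>) \<partial>M) = (\<integral>\<omega>. g' \<omega> * indicator B (Z' \<omega>) \<partial>M')"
proof -
  interpret M: prob_space M by fact
  interpret M': prob_space M' by fact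
  have c0: "0 \<le> c" using bnd(1)[of undefined] norm_ge_zero order_trans by blast
  have int[simp]: "integrable M (\<lambda>\<omega>. g \<omega> * cis (v * Z \<omega>))" "integrable M' (\<lambda>\<omega>. g' \<omega> * cis (v * Z' \<omega>))"
    "integrable M (\<lambda>\<omega>. cnj (g \<omega>) * cis (v * Z \<omega>))" "integrable M' (\<lambda>\<omega>. cnj (g' \<omega>) * cis (v * Z' \<omega>))"
    for v
    by (rule prob_integrable_bounded[OF M, where c=c] prob_integrable_bounded[OF M', where c=c]; simp add: norm_mult bnd)+
  have int2[simp]: "integrable M (\<lambda>\<omega>. g \<omega> * indicator B (Z \<omega>))" "integrable M' (\<lambda>\<omega>. g' \<omega> * indicator B (Z' \<omega>))"
    by (rule prob_integrable_bounded[OF M, where c=c] prob_integrable_bounded[OF M', where c=c]; simp add: indicator_def c0 bnd norm_mult)+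
  have cj: "(\<integral>\<omega>. cnj (g \<omega>) * cis (v * Z \<omega>) \<partial>M) = (\<integral>\<omega>. cnj (g' \<omega>) * cis (v * Z' \<omega>) \<partial>M')" for v
  proof -
    have e: "cnj z * cis (v * x) = cnj (z * cis (- v * x))" for z x by (simp add: cis_cnj)
    show ?thesis unfolding e Bochner_Integration.integral_cnj by (rule arg_cong[OF chg])
  qed
  have re: "complex_of_real (Re z) * w = (z * w + cnj z * w) / 2" for z w
    by (simp add: complex_eq_iff field_simps)
  have im: "complex_of_real (Im z) * w = (z * w - cnj z * w) * (- \<i> / 2)" for z w
    by (simp add: complex_eq_iff field_simps)
  have R: "(\<integral>\<omega>. Re (g \<omega>) * indicator B (Z \<omega>) \<partial>M) = (\<integral>\<omega>. Re (g' \<omega>) * indicator B (Z' \<omega>) \<partial>M')"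
  proof (rule char_unique_real_weight[where c=c, OF M M'])
    show "\<bar>Re (g \<omega>)\<bar> \<le> c" for \<omega> using abs_Re_le_cmod[of "g \<omega>"] bnd(1)[of \<omega>] by linarith
    show "\<bar>Re (g' \<omega>)\<bar> \<le> c" for \<omega> using abs_Re_le_cmod[of "g' \<omega>"] bnd(2)[of \<omega>] by linarith
    show "(\<integral>\<omega>. complex_of_real (Re (g \<omega>)) * cis (v * Z \<omega>) \<partial>M) = (\<integral>\<omega>. complex_of_real (Re (g' \<omega>)) * cis (v * Z' \<omega>) \<partial>M')" for v
      unfolding re using chg[of v] cj[of v] by simp
  qed (use ch in simp_all)
  have I: "(\<integral>\<omega>. Im (g \<omega>) * indicator B (Z \<omega>) \<partial>M) = (\<integral>\<omega>. Im (g' \<omega>) * indicator B (Z' \<omega>) \<partial>M')"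
  proof (rule char_unique_real_weight[where c=c, OF M M'])
    show "\<bar>Im (g \<omega>)\<bar> \<le> c" for \<omega> using abs_Im_le_cmod[of "g \<omega>"] bnd(1)[of \<omega>] by linarith
    show "\<bar>Im (g' \<omega>)\<bar> \<le> c" for \<omega> using abs_Im_le_cmod[of "g' \<omega>"] bnd(2)[of \<omega>] by linarith
    show "(\<integral>\<omega>. complex_of_real (Im (g \<omega>)) * cis (v * Z \<omega>) \<partial>M) = (\<integral>\<omega>. complex_of_real (Im (g' \<omega>)) * cis (v * Z' \<omega>) \<partial>M')" for v
      unfolding im using chg[of v] cj[of v] by simp
  qed (use ch in simp_all)
  have ind: "Re (z * indicator B x) = Re z * indicator B x" "Im (z * indicator B x) = Im z * indicator B x" for z and x :: real
    by (auto simp: indicator_def)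
  show ?thesis
    using R I by (simp only: complex_eq_iff integral_Re[symmetric] integral_Im[symmetric] int2 ind)
qed

text \<open>Exponentials are traded for indicators one coordinate at a time: the indicators already
  obtained, together with the remaining exponentials, form a bounded weight for the one-dimensional
  theorem. Keeping a weight \<open>g\<close> in the result is what later yields independence and not
  only equality of laws.\<close>

lemma char_unique_boxes:
  fixes U :: "'i \<Rightarrow> 'a \<Rightarrow> real" and V :: "'i \<Rightarrow> 'b \<Rightarrow> real" and g :: "'a \<Rightarrow> complex" and g' :: "'b \<Rightarrow> complex"
  assumes M: "prob_space M" and M': "prob_space M'" and fin: "finite I"
    and U: "\<And>i. i \<in> I \<Longrightarrow> U i \<in> borel_measurable M" and V: "\<And>i. i \<in> I \<Longrightarrow> V i \<in> borel_measurable M'"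
    and [measurable]: "g \<in> borel_measurable M" "g' \<in> borel_measurable M'"
    and bnd: "\<And>\<omega>. norm (g \<omega>) \<le> c" "\<And>\<omega>. norm (g' \<omega>) \<le> c"
    and ch: "\<And>u. (\<integral>\<omega>. cis (\<Sum>i\<in>I. u i * U i \<omega>) \<partial>M) = (\<integral>\<omega>. cis (\<Sum>i\<in>I. u i * V i \<omega>) \<partial>M')"
    and chg: "\<And>u. (\<integral>\<omega>. g \<omega> * cis (\<Sum>i\<in>I. u i * U i \<omega>) \<partial>M) = (\<integral>\<omega>. g' \<omega> * cis (\<Sum>i\<in>I. u i * V i \<omega>) \<partial>M')"
    and B: "\<And>i. i \<in> I \<Longrightarrow> B i \<in> sets borel"
  shows "(\<integral>\<omega>. g \<omega> * (\<Prod>i\<in>I. indicator (B i) (U i \<omega>)) \<partial>M) = (\<integral>\<omega>. g' \<omega> * (\<Prod>i\<in>I. indicator (B i) (V i \<omega>)) \<partial>M')"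
proof -
  have "\<forall>u. (\<integral>\<omega>. g \<omega> * (\<Prod>i\<in>J. indicator (B i) (U i \<omega>)) * cis (\<Sum>i\<in>I - J. u i * U i \<omega>) \<partial>M)
     = (\<integral>\<omega>. g' \<omega> * (\<Prod>i\<in>J. indicator (B i) (V i \<omega>)) * cis (\<Sum>i\<in>I - J. u i * V i \<omega>) \<partial>M')"
    if "finite J" "J \<subseteq> I" for J
    using that
  proof (induction J rule: finite_induct)
    case empty
    then show ?case using chg by simp
  next
    case (insert a J)
    have a: "a \<in> I" "J \<subseteq> I" "finite (I - J)" "a \<in> I - J" using insert fin by auto
    have sp: "(\<Sum>i\<in>I - J. u i * f i) = u a * f a + (\<Sum>i\<in>I - insert a J. u i * f i)" for u and f :: "'i \<Rightarrow> real"
      using a by (subst sum.remove[of _ a]) (auto intro!: sum.cong)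
    show ?case
    proof
      fix u
      let ?G = "\<lambda>\<omega>. g \<omega> * (\<Prod>i\<in>J. indicator (B i) (U i \<omega>)) * cis (\<Sum>i\<in>I - insert a J. u i * U i \<omega>)"
      let ?G' = "\<lambda>\<omega>. g' \<omega> * (\<Prod>i\<in>J. indicator (B i) (V i \<omega>)) * cis (\<Sum>i\<in>I - insert a J. u i * V i \<omega>)"
      have nle: "norm (z * (\<Prod>i\<in>J. indicator (B i) (f i)) * cis t) \<le> c" if "norm z \<le> c" for z :: complex and t and f :: "'i \<Rightarrow> real"
      proof -
        have "norm (\<Prod>i\<in>J. indicator (B i) (f i) :: complex) \<le> 1"
          unfolding prod_norm[symmetric] by (rule prod_le_1) (auto simp: indicator_def)
        then have "norm z * norm (\<Prod>i\<in>J. indicator (B i) (f i) :: complex) \<le> c * 1"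
          by (intro mult_mono that) (use that norm_ge_zero order_trans in blast)+
        then show ?thesis by (simp add: norm_mult)
      qed
      have [measurable]: "(\<lambda>\<omega>. \<Sum>i\<in>I - insert a J. u i * U i \<omega>) \<in> borel_measurable M"
         "(\<lambda>\<omega>. \<Sum>i\<in>I - insert a J. u i * V i \<omega>) \<in> borel_measurable M'"
        by (intro borel_measurable_sum borel_measurable_times; use U V in force)+
      have [measurable]: "(\<lambda>\<omega>. \<Prod>i\<in>J. indicator (B i) (U i \<omega>) :: complex) \<in> borel_measurable M"
         "(\<lambda>\<omega>. \<Prod>i\<in>J. indicator (B i) (V i \<omega>) :: complex) \<in> borel_measurable M'"
      proof -
        have "(\<lambda>\<omega>. indicator (B i) (U i \<omega>) :: complex) \<in> borel_measurable M" "(\<lambda>\<omega>. indicator (B i) (V i \<omega>) :: complex) \<in> borel_measurable M'" if "i \<in> J" for i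
          using U[of i] V[of i] B[of i] a that by (auto intro!: measurable_compose[OF _ borel_measurable_indicator])
        then show "(\<lambda>\<omega>. \<Prod>i\<in>J. indicator (B i) (U i \<omega>) :: complex) \<in> borel_measurable M"
         "(\<lambda>\<omega>. \<Prod>i\<in>J. indicator (B i) (V i \<omega>) :: complex) \<in> borel_measurable M'"
          by (simp_all add: borel_measurable_prod)
      qed
      have "(\<integral>\<omega>. ?G \<omega> * indicator (B a) (U a \<omega>) \<partial>M) = (\<integral>\<omega>. ?G' \<omega> * indicator (B a) (V a \<omega>) \<partial>M')"
      proof (rule char_unique_weight[where c=c, OF M M' U[OF a(1)] V[OF a(1)]])
        show "(\<integral>\<omega>. cis (v * U a \<omega>) \<partial>M) = (\<integral>\<omega>. cis (v * V a \<omega>) \<partial>M')" for v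
        proof -
          have "(\<Sum>i\<in>I. (if i = a then v else 0) * f i) = v * f a" for f :: "'i \<Rightarrow> real"
            using a fin by (subst sum.remove[of _ a]) (auto intro!: sum.neutral)
          then show ?thesis using ch[of "\<lambda>i. if i = a then v else 0"] by simp
        qed
        show "(\<integral>\<omega>. ?G \<omega> * cis (v * U a \<omega>) \<partial>M) = (\<integral>\<omega>. ?G' \<omega> * cis (v * V a \<omega>) \<partial>M')" for v
        proof -
          have e: "(\<Sum>i\<in>I - insert a J. (u(a := v)) i * f i) = (\<Sum>i\<in>I - insert a J. u i * f i)" for f :: "'i \<Rightarrow> real"
            by (rule sum.cong) auto
          show ?thesis
            using insert.IH[OF a(2), rule_format, of "u(a := v)"] unfolding sp e
            by (simp add: cis_mult[symmetric] mult.assoc mult.commute mult.left_commute)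
        qed
      qed (use nle bnd B a in auto)
      then show "(\<integral>\<omega>. g \<omega> * (\<Prod>i\<in>insert a J. indicator (B i) (U i \<omega>)) * cis (\<Sum>i\<in>I - insert a J. u i * U i \<omega>) \<partial>M)
     = (\<integral>\<omega>. g' \<omega> * (\<Prod>i\<in>insert a J. indicator (B i) (V i \<omega>)) * cis (\<Sum>i\<in>I - insert a J. u i * V i \<omega>) \<partial>M')"
        using insert.hyps by (simp add: mult_ac)
    qed
  qed
  from this[OF fin order_refl] show ?thesis by simp
qed

text \<open>The weight 1 in \<open>char_unique_boxes\<close> gives the probabilities of boxes, and
  boxes generate the product sigma-algebra.\<close>

lemma char_unique_law:
  fixes U :: "'i \<Rightarrow> 'a \<Rightarrow> real" and V :: "'i \<Rightarrow> 'b \<Rightarrow> real"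
  assumes M: "prob_space M" and M': "prob_space M'" and fin: "finite I"
    and U: "\<And>i. i \<in> I \<Longrightarrow> U i \<in> borel_measurable M" and V: "\<And>i. i \<in> I \<Longrightarrow> V i \<in> borel_measurable M'"
    and ch: "\<And>u. (\<integral>\<omega>. cis (\<Sum>i\<in>I. u i * U i \<omega>) \<partial>M) = (\<integral>\<omega>. cis (\<Sum>i\<in>I. u i * V i \<omega>) \<partial>M')"
  shows "distr M (PiM I (\<lambda>_. borel)) (\<lambda>\<omega>. \<lambda>i\<in>I. U i \<omega>) = distr M' (PiM I (\<lambda>_. borel)) (\<lambda>\<omega>. \<lambda>i\<in>I. V i \<omega>)"
proof (rule measure_eqI_PiM_finite[OF fin])
  interpret M: prob_space M by fact
  interpret M': prob_space M' by fact
  have mU[measurable]: "(\<lambda>\<omega>. \<lambda>i\<in>I. U i \<omega>) \<in> measurable M (PiM I (\<lambda>_. borel))"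
    and mV[measurable]: "(\<lambda>\<omega>. \<lambda>i\<in>I. V i \<omega>) \<in> measurable M' (PiM I (\<lambda>_. borel))"
    by (intro measurable_restrict; use U V in simp)+
  show "sets (distr M (PiM I (\<lambda>_. borel)) (\<lambda>\<omega>. \<lambda>i\<in>I. U i \<omega>)) = sets (PiM I (\<lambda>_. borel))" 
    "sets (distr M' (PiM I (\<lambda>_. borel)) (\<lambda>\<omega>. \<lambda>i\<in>I. V i \<omega>)) = sets (PiM I (\<lambda>_. borel))" by simp_all
  fix A :: "'i \<Rightarrow> real set" assume A: "\<And>i. i \<in> I \<Longrightarrow> A i \<in> sets borel"
  have PA[measurable]: "Pi\<^sub>E I A \<in> sets (PiM I (\<lambda>_. borel))" using fin A by (intro sets_PiM_I_finite) auto
  have *: "complex_of_real (measure N (f -` Pi\<^sub>E I A \<inter> space N)) = (\<integral>\<omega>. 1 * (\<Prod>i\<in>I. indicator (A i) (W i \<omega>)) \<partial>N)"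
    if f: "f = (\<lambda>\<omega>. \<lambda>i\<in>I. W i \<omega>)" and m[measurable]: "f \<in> measurable N (PiM I (\<lambda>_. borel))" and "prob_space N" for f N and W :: "'i \<Rightarrow> 'c \<Rightarrow> real"
  proof -
    interpret N: prob_space N by fact
    have "(\<integral>\<omega>. 1 * (\<Prod>i\<in>I. indicator (A i) (W i \<omega>)) \<partial>N) = (\<integral>\<omega>. complex_of_real (indicator (f -` Pi\<^sub>E I A \<inter> space N) \<omega>) \<partial>N)"
      by (intro Bochner_Integration.integral_cong)
         (auto simp: f indicator_def PiE_iff fin prod_zero_iff intro!: prod.neutral)
    also have "\<dots> = complex_of_real (measure N (f -` Pi\<^sub>E I A \<inter> space N))"
      by (subst integral_complex_of_real) (simp add: measurable_sets)
    finally show ?thesis by simp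
  qed
  have "complex_of_real (measure M ((\<lambda>\<omega>. \<lambda>i\<in>I. U i \<omega>) -` Pi\<^sub>E I A \<inter> space M)) = complex_of_real (measure M' ((\<lambda>\<omega>. \<lambda>i\<in>I. V i \<omega>) -` Pi\<^sub>E I A \<inter> space M'))"
    unfolding *[OF refl mU M] *[OF refl mV M']
    by (rule char_unique_boxes[OF M M' fin U V, where c=1]) (use ch A in auto)
  then show "emeasure (distr M (PiM I (\<lambda>_. borel)) (\<lambda>\<omega>. \<lambda>i\<in>I. U i \<omega>)) (Pi\<^sub>E I A) = emeasure (distr M' (PiM I (\<lambda>_. borel)) (\<lambda>\<omega>. \<lambda>i\<in>I. V i \<omega>)) (Pi\<^sub>E I A)"
    by (simp add: emeasure_distr M.emeasure_eq_measure M'.emeasure_eq_measure)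
next
  interpret M: prob_space M by fact
  have mU[measurable]: "(\<lambda>\<omega>. \<lambda>i\<in>I. U i \<omega>) \<in> measurable M (PiM I (\<lambda>_. borel))"
    by (intro measurable_restrict; use U in simp)
  show "range (\<lambda>_::nat. space (PiM I (\<lambda>_. borel :: real measure))) \<subseteq> prod_algebra I (\<lambda>_. borel)"
    using prod_algebraI_finite[OF fin, of "\<lambda>_. UNIV" "\<lambda>_. borel :: real measure"] by (auto simp: space_PiM)
  show "emeasure (distr M (PiM I (\<lambda>_. borel)) (\<lambda>\<omega>. \<lambda>i\<in>I. U i \<omega>)) (space (PiM I (\<lambda>_. borel :: real measure))) \<noteq> \<infinity>" for n :: nat
    by (simp add: emeasure_distr M.emeasure_eq_measure)
qed auto

lemma law_transfer:
  fixes U :: "'i \<Rightarrow> 'a \<Rightarrow> real" and V :: "'i \<Rightarrow> 'b \<Rightarrow> real" and \<phi> :: "('i \<Rightarrow> real) \<Rightarrow> real"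
  assumes law: "distr M (PiM I (\<lambda>_. borel)) (\<lambda>\<omega>. \<lambda>i\<in>I. U i \<omega>) = distr M' (PiM I (\<lambda>_. borel)) (\<lambda>\<omega>. \<lambda>i\<in>I. V i \<omega>)"
    and U: "\<And>i. i \<in> I \<Longrightarrow> U i \<in> borel_measurable M" and V: "\<And>i. i \<in> I \<Longrightarrow> V i \<in> borel_measurable M'"
    and h: "h \<in> borel_measurable (PiM I (\<lambda>_. borel))"
  shows "(\<integral>\<omega>. h (\<lambda>i\<in>I. U i \<omega>) \<partial>M) = (\<integral>\<omega>. h (\<lambda>i\<in>I. V i \<omega>) \<partial>M' :: real)"
proof -
  have mU[measurable]: "(\<lambda>\<omega>. \<lambda>i\<in>I. U i \<omega>) \<in> measurable M (PiM I (\<lambda>_. borel))"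
    and mV[measurable]: "(\<lambda>\<omega>. \<lambda>i\<in>I. V i \<omega>) \<in> measurable M' (PiM I (\<lambda>_. borel))"
    by (intro measurable_restrict; use U V in simp)+
  show ?thesis
    using integral_distr[OF mU h] integral_distr[OF mV h] law by simp
qed

lemma law_transfer_lipschitz:
  fixes U :: "'i \<Rightarrow> 'a \<Rightarrow> real" and V :: "'i \<Rightarrow> 'b \<Rightarrow> real" and \<phi> :: "('i \<Rightarrow> real) \<Rightarrow> real"
  assumes law: "distr M (PiM I (\<lambda>_. borel)) (\<lambda>\<omega>. \<lambda>i\<in>I. U i \<omega>) = distr M' (PiM I (\<lambda>_. borel)) (\<lambda>\<omega>. \<lambda>i\<in>I. V i \<omega>)"
    and fin: "finite I"
    and U: "\<And>i. i \<in> I \<Longrightarrow> U i \<in> borel_measurable M" and V: "\<And>i. i \<in> I \<Longrightarrow> V i \<in> borel_measurable M'"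
    and lip: "\<And>v v'. \<bar>\<phi> v - \<phi> v'\<bar> \<le> C * (\<Sum>a\<in>I. \<bar>v a - v' a\<bar>)"
  shows "(\<integral>\<omega>. \<phi> (\<lambda>a. U a \<omega>) \<partial>M) = (\<integral>\<omega>. \<phi> (\<lambda>a. V a \<omega>) \<partial>M')"
proof -
  \<comment> \<open>Vectors that agree on \<open>I\<close> have equal values, so restricting them
    changes nothing.\<close>
  have r: "\<phi> (restrict v I) = \<phi> v" for v
    using lip[of "restrict v I" v] by simp
  have "(\<lambda>x. \<phi> (\<lambda>a. x a)) \<in> borel_measurable (PiM I (\<lambda>_. borel))"
    by (rule lipschitz_measurable[OF fin _ lip, where U="\<lambda>a x. x a"]) (use measurable_component_singleton in auto)
  from law_transfer[OF law U V this] show ?thesis by (simp add: r del: restrict_apply)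
qed

section \<open>Skorokhod convergence and step functions\<close>

text \<open>Locally uniform convergence. For continuous limits it is the only mode that has to be
  proved, since J1 convergence follows with the identity as time change.\<close>

definition lu_conv :: "nat \<Rightarrow> (nat \<Rightarrow> real \<Rightarrow> nat \<Rightarrow> real) \<Rightarrow> (real \<Rightarrow> nat \<Rightarrow> real) \<Rightarrow> bool" where
  "lu_conv m xs x \<longleftrightarrow> (\<forall>T>0. \<forall>\<epsilon>>0. eventually (\<lambda>k. \<forall>t\<in>{0..T}. \<forall>i<m. \<bar>xs k t i - x t i\<bar> \<le> \<epsilon>) sequentially)"

lemma vdist_le_sum: "vdist m a b \<le> (\<Sum>i<m. \<bar>a i - b i\<bar>)"
  using L2_set_le_sum_abs[of "\<lambda>i. a i - b i" "{..<m}"] by (simp add: vdist_def L2_set_def)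

lemma vdist_le:
  assumes "\<And>i. i < m \<Longrightarrow> \<bar>a i - b i\<bar> \<le> e" shows "vdist m a b \<le> real m * e"
proof -
  have "(\<Sum>i<m. \<bar>a i - b i\<bar>) \<le> (\<Sum>i<m. e)" using assms by (intro sum_mono) auto
  with vdist_le_sum[of m a b] show ?thesis by simp
qed

text \<open>Increments of t - h t lie between 1 - \<eta> and 1 + \<eta> times those of t. The lower
  slope decides the size of the logarithm, because (1 + \<eta>) (1 - \<eta>) \<le> 1.\<close>

lemma SkLambda_minus:
  assumes h: "\<And>s t. 0 \<le> s \<Longrightarrow> 0 \<le> t \<Longrightarrow> \<bar>h s - h t\<bar> \<le> \<eta> * \<bar>s - t\<bar>" and h0: "h 0 = 0" and \<eta>: "0 \<le> \<eta>" "\<eta> < 1"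
  shows "(\<lambda>t. t - h t) \<in> SkLambda"
    and "\<And>s t. 0 \<le> t \<Longrightarrow> t < s \<Longrightarrow> \<bar>ln (((s - h s) - (t - h t)) / (s - t))\<bar> \<le> - ln (1 - \<eta>)"
proof -
  have sl: "(1 - \<eta>) * (s - t) \<le> (s - h s) - (t - h t)" "(s - h s) - (t - h t) \<le> (1 + \<eta>) * (s - t)" if "0 \<le> t" "t \<le> s" for s t
    using h[of s t] that by (auto simp: algebra_simps abs_le_iff)
  show ln: "\<bar>ln (((s - h s) - (t - h t)) / (s - t))\<bar> \<le> - ln (1 - \<eta>)" if "0 \<le> t" "t < s" for s t
  proof -
    let ?q = "((s - h s) - (t - h t)) / (s - t)"
    have q: "1 - \<eta> \<le> ?q" "?q \<le> 1 + \<eta>" using sl[of t s] that by (auto simp: field_simps)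
    have "ln (1 - \<eta>) \<le> ln ?q" using q \<eta> by (subst ln_le_cancel_iff) auto
    moreover have "ln ?q \<le> ln (1 + \<eta>)" using q \<eta> by (subst ln_le_cancel_iff) auto
    moreover have "ln (1 + \<eta>) + ln (1 - \<eta>) \<le> 0"
    proof -
      have "ln (1 + \<eta>) + ln (1 - \<eta>) = ln ((1 + \<eta>) * (1 - \<eta>))" using \<eta> by (simp add: ln_mult)
      also have "\<dots> \<le> ln 1"
      proof (subst ln_le_cancel_iff)
        show "0 < (1 + \<eta>) * (1 - \<eta>)" using \<eta> by (intro mult_pos_pos) auto
        have "(1 + \<eta>) * (1 - \<eta>) = 1 - \<eta> * \<eta>" by (simp add: algebra_simps)
        then show "(1 + \<eta>) * (1 - \<eta>) \<le> 1" using \<eta> by simp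
      qed simp
      finally show ?thesis by simp
    qed
    ultimately show ?thesis by linarith
  qed
  have lip: "\<bar>(s - h s) - (t - h t)\<bar> \<le> 2 * \<bar>s - t\<bar>" if "0 \<le> s" "0 \<le> t" for s t
  proof -
    have "\<eta> * \<bar>s - t\<bar> \<le> 1 * \<bar>s - t\<bar>" using \<eta> by (intro mult_right_mono) auto
    then have "\<bar>h s - h t\<bar> \<le> \<bar>s - t\<bar>" using order_trans[OF h[OF that]] by simp
    moreover have eq: "(s - h s) - (t - h t) = (s - t) - (h s - h t)" by simp
    ultimately show ?thesis unfolding eq using abs_triangle_ineq4[of "s - t" "h s - h t"] by simp
  qed
  have cont: "continuous_on {0..} (\<lambda>t. t - h t)"
    unfolding continuous_on_iff dist_real_def
  proof (intro ballI allI impI)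
    fix x e :: real assume "x \<in> {0..}" "e > 0"
    show "\<exists>d>0. \<forall>x'\<in>{0..}. \<bar>x' - x\<bar> < d \<longrightarrow> \<bar>x' - h x' - (x - h x)\<bar> < e"
    proof (intro exI[of _ "e / 2"] conjI ballI impI)
      fix x' :: real assume "x' \<in> {0..}" "\<bar>x' - x\<bar> < e / 2"
      then show "\<bar>x' - h x' - (x - h x)\<bar> < e" using lip[of x' x] \<open>x \<in> {0..}\<close> by simp
    qed (use \<open>e > 0\<close> in simp)
  qed
  have ge: "(1 - \<eta>) * t \<le> t - h t" if "0 \<le> t" for t using sl[of 0 t] that h0 by simp
  have sm: "strict_mono_on {0..} (\<lambda>t. t - h t)"
  proof (rule strict_mono_onI)
    fix r s :: real assume "r \<in> {0..}" "s \<in> {0..}" "r < s"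
    then have "0 < (1 - \<eta>) * (s - r)" using \<eta> by simp
    also have "\<dots> \<le> (s - h s) - (r - h r)" using sl[of r s] \<open>r < s\<close> \<open>r \<in> _\<close> by simp
    finally show "r - h r < s - h s" by simp
  qed
  have "(\<lambda>t. t - h t) ` {0..} = {0..}"
  proof safe
    fix t :: real assume "t \<ge> 0"
    have "0 \<le> (1 - \<eta>) * t" using \<eta> \<open>t \<ge> 0\<close> by simp
    then show "0 \<le> t - h t" using ge[OF \<open>t \<ge> 0\<close>] by linarith
    have "\<exists>x\<ge>0. x \<le> t / (1 - \<eta>) \<and> x - h x = t"
    proof (rule IVT')
      show "0 - h 0 \<le> t" using h0 \<open>t \<ge> 0\<close> by simp
      show "t \<le> t / (1 - \<eta>) - h (t / (1 - \<eta>))" using ge[of "t / (1 - \<eta>)"] \<open>t \<ge> 0\<close> \<eta> by simp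
      show "0 \<le> t / (1 - \<eta>)" using \<open>t \<ge> 0\<close> \<eta> by simp
      show "continuous_on {0..t / (1 - \<eta>)} (\<lambda>x. x - h x)" by (rule continuous_on_subset[OF cont]) auto
    qed
    then show "t \<in> (\<lambda>t. t - h t) ` {0..}" by force
  qed
  with ln cont sm show "(\<lambda>t. t - h t) \<in> SkLambda" unfolding SkLambda_def by blast
qed

lemma lu_imp_sk:
  assumes "lu_conv m xs x" shows "sk_conv m xs x"
  unfolding sk_conv_def
proof (intro exI[of _ "\<lambda>_ t. t"] conjI allI impI)
  show "(\<lambda>t. t) \<in> SkLambda" using SkLambda_minus(1)[of "\<lambda>_. 0" 0] by simp
  fix \<epsilon> :: real assume "\<epsilon> > 0"
  then show "eventually (\<lambda>k. \<forall>s t. 0 \<le> t \<and> t < s \<longrightarrow> \<bar>ln ((s - t) / (s - t))\<bar> \<le> \<epsilon>) sequentially" by simp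
next
  fix T \<epsilon> :: real assume T: "T > 0" and e: "\<epsilon> > 0"
  then have "\<epsilon> / (real m + 1) > 0" by simp
  with assms T have "eventually (\<lambda>k. \<forall>t\<in>{0..T}. \<forall>i<m. \<bar>xs k t i - x t i\<bar> \<le> \<epsilon> / (real m + 1)) sequentially"
    unfolding lu_conv_def by blast
  then show "eventually (\<lambda>k. \<forall>t\<in>{0..T}. vdist m (xs k t) (x t) \<le> \<epsilon>) sequentially"
  proof eventually_elim
    case (elim k)
    show ?case
    proof
      fix t assume "t \<in> {0..T}"
      then have "vdist m (xs k t) (x t) \<le> real m * (\<epsilon> / (real m + 1))" using elim by (intro vdist_le) auto
      also have "\<dots> \<le> \<epsilon>" using e by (simp add: field_simps)
      finally show "vdist m (xs k t) (x t) \<le> \<epsilon>" .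
    qed
  qed
qed

lemma continuous_Dspace:
  assumes "\<And>i. i < m \<Longrightarrow> continuous_on {0..} (\<lambda>t. x t i)" shows "x \<in> Dspace m"
  unfolding Dspace_def
proof (safe)
  fix i t assume i: "i < m" and t: "t \<ge> (0::real)"
  have c: "((\<lambda>s. x s i) \<longlongrightarrow> x t i) (at t within {0..})" using assms[OF i] t by (auto simp: continuous_on_def)
  show "((\<lambda>s. x s i) \<longlongrightarrow> x t i) (at_right t)" by (rule tendsto_within_subset[OF c]) (use t in auto)
  assume t: "t > 0"
  have "((\<lambda>s. x s i) \<longlongrightarrow> x t i) (at t)"
    using c t by (simp add: at_within_interior[of t "{0..}"])
  then show "\<exists>L. ((\<lambda>s. x s i) \<longlongrightarrow> L) (at_left t)" using filterlim_at_split by blast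
qed

text \<open>Piecewise constancy is expressed by letting the path at t depend only on the set of
  points of \<open>J\<close> up to t. In this form it passes to functionals of the past, such as the
  reflection.\<close>

lemma jump_Dspace:
  fixes J :: "real set"
  assumes fin: "\<And>T. finite {s\<in>J. s \<le> T}" and x: "\<And>s t. 0 \<le> s \<Longrightarrow> 0 \<le> t \<Longrightarrow> {r\<in>J. r \<le> s} = {r\<in>J. r \<le> t} \<Longrightarrow> x s = x t"
  shows "x \<in> Dspace m"
  unfolding Dspace_def
proof (safe)
  fix i t assume i: "i < m" and t: "t \<ge> (0::real)"
  \<comment> \<open>\<open>b\<close> is the next point of \<open>J\<close> after t, or t + 1 if none
    comes up to then.\<close>
  have "\<exists>b>t. \<forall>s\<in>{r\<in>J. r \<le> t + 1} . s > t \<longrightarrow> b \<le> s"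
  proof (cases "{r\<in>J. r \<le> t + 1 \<and> r > t} = {}")
    case True
    then show ?thesis by (intro exI[of _ "t + 1"]) auto
  next
    case False
    have f: "finite {r\<in>J. r \<le> t + 1 \<and> r > t}" by (rule finite_subset[OF _ fin[of "t + 1"]]) auto
    from Min_in[OF f False] Min_le[OF f] show ?thesis by (intro exI[of _ "Min {r\<in>J. r \<le> t + 1 \<and> r > t}"]) auto
  qed
  then obtain b where b: "b > t" "\<forall>s\<in>{r\<in>J. r \<le> t + 1} . s > t \<longrightarrow> b \<le> s" by blast
  have "eventually (\<lambda>s. x s i = x t i) (at_right t)"
    unfolding eventually_at_right_field
  proof (intro exI[of _ "min b (t + 1)"] conjI allI impI)
    fix s assume s: "t < s" "s < min b (t + 1)"
    have "{r\<in>J. r \<le> s} = {r\<in>J. r \<le> t}" using s b by force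
    from x[OF _ _ this] show "x s i = x t i" using s t by simp
  qed (use b in auto)
  then show "((\<lambda>s. x s i) \<longlongrightarrow> x t i) (at_right t)" by (rule tendsto_eventually)
next
  fix i t assume i: "i < m" and t: "t > (0::real)"
  have "\<exists>b<t. \<forall>s\<in>{r\<in>J. r \<le> t} . s < t \<longrightarrow> s \<le> b"
  proof (cases "{r\<in>J. r < t} = {}")
    case True
    then show ?thesis by (intro exI[of _ "t - 1"]) auto
  next
    case False
    have f: "finite {r\<in>J. r < t}" by (rule finite_subset[OF _ fin[of "t"]]) auto
    from Max_in[OF f False] Max_ge[OF f] show ?thesis by (intro exI[of _ "Max {r\<in>J. r < t}"]) auto
  qed
  then obtain b where b: "b < t" "\<forall>s\<in>{r\<in>J. r \<le> t} . s < t \<longrightarrow> s \<le> b" by blast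
  have "eventually (\<lambda>s. x s i = x ((max b 0 + t) / 2) i) (at_left t)"
    unfolding eventually_at_left_field
  proof (intro exI[of _ "max b 0"] conjI allI impI)
    fix s assume s: "max b 0 < s" "s < t"
    have "{r\<in>J. r \<le> s} = {r\<in>J. r \<le> (max b 0 + t) / 2}" using s b t by (force simp: max_def)
    from x[OF _ _ this] show "x s i = x ((max b 0 + t) / 2) i" using s t by simp
  qed (use b t in auto)
  then show "\<exists>L. ((\<lambda>s. x s i) \<longlongrightarrow> L) (at_left t)" by (intro exI tendsto_eventually)
qed

section \<open>Sampling of paths on a grid\<close>

definition gidx :: "nat \<Rightarrow> real \<Rightarrow> nat" where
  "gidx k t = min (nat \<lfloor>real k * t\<rfloor>) (k\<^sup>2)"

text \<open>A path on the grid of mesh 1/k. The cap k^2 in \<open>gidx\<close> freezes it at time k,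
  so that finitely many values determine it while the horizon still grows with k.\<close>

definition stepf :: "nat \<Rightarrow> nat \<Rightarrow> (nat \<times> nat \<Rightarrow> real) \<Rightarrow> real \<Rightarrow> nat \<Rightarrow> real" where
  "stepf m k v t i = (if i < m then v (i, gidx k t) else 0)"

text \<open>The rounding after the sampling reduces a path to finitely many integers, so that an
  arbitrary functional of the result is measurable.\<close>

definition disc :: "nat \<Rightarrow> nat \<Rightarrow> (real \<Rightarrow> nat \<Rightarrow> real) \<Rightarrow> real \<Rightarrow> nat \<Rightarrow> real" where
  "disc m k x = stepf m k (\<lambda>(i, l). real_of_int \<lfloor>real k * x (real l / real k) i\<rfloor> / real k)"

lemma stepf_jump:
  assumes k: "k > 0"
    and *: "{r \<in> (\<lambda>l. real l / real k) ` {1..k\<^sup>2}. r \<le> s} = {r \<in> (\<lambda>l. real l / real k) ` {1..k\<^sup>2}. r \<le> t}"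
  shows "stepf m k v s = stepf m k v t"
proof -
  have "l \<le> gidx k s \<longleftrightarrow> l \<le> gidx k t" for l
  proof -
    have g: "l \<le> gidx k u \<longleftrightarrow> l = 0 \<or> real l / real k \<in> {r \<in> (\<lambda>l. real l / real k) ` {1..k\<^sup>2}. r \<le> u}" for u
    proof (cases "l = 0")
      case False
      have "l \<le> nat \<lfloor>real k * u\<rfloor> \<longleftrightarrow> int l \<le> \<lfloor>real k * u\<rfloor>"
      proof -
        have "l \<le> nat z \<longleftrightarrow> int l \<le> z" for z using False by linarith
        then show ?thesis .
      qed
      also have "\<dots> \<longleftrightarrow> real l \<le> real k * u" by (simp add: le_floor_iff)
      also have "\<dots> \<longleftrightarrow> real l / real k \<le> u" using k by (simp add: field_simps)
      finally have "l \<le> nat \<lfloor>real k * u\<rfloor> \<longleftrightarrow> real l / real k \<le> u" .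
      moreover have "real l / real k \<in> (\<lambda>l. real l / real k) ` {1..k\<^sup>2} \<longleftrightarrow> l \<le> k\<^sup>2"
        using False k by (auto simp: image_iff field_simps)
      ultimately show ?thesis using False by (auto simp: gidx_def)
    qed simp
    show ?thesis unfolding g * ..
  qed
  then have "gidx k s = gidx k t" by (meson le_antisym order_refl)
  then show "stepf m k v s = stepf m k v t" by (simp add: stepf_def fun_eq_iff)
qed

lemma stepf_Dspace: assumes k: "k > 0" shows "stepf m k v \<in> Dspace m'"
proof (rule jump_Dspace[where J="(\<lambda>l. real l / real k) ` {1..k\<^sup>2}"])
  fix s t assume "{r \<in> (\<lambda>l. real l / real k) ` {1..k\<^sup>2}. r \<le> s} = {r \<in> (\<lambda>l. real l / real k) ` {1..k\<^sup>2}. r \<le> t}"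
  then show "stepf m k v s = stepf m k v t" by (rule stepf_jump[OF k])
qed simp

lemma gidx_bounds:
  assumes "k > 0" "0 \<le> t" "t \<le> real k"
  shows "real (gidx k t) / real k \<le> t" "t < real (gidx k t) / real k + 1 / real k" "gidx k t \<le> k\<^sup>2"
proof -
  have "real k * t \<le> real (k\<^sup>2)" using assms by (simp add: power2_eq_square)
  then have "nat \<lfloor>real k * t\<rfloor> \<le> k\<^sup>2" by linarith
  then have g: "gidx k t = nat \<lfloor>real k * t\<rfloor>" by (simp add: gidx_def)
  have "0 \<le> real k * t" using assms by simp
  then have "real (gidx k t) \<le> real k * t" "real k * t < real (gidx k t) + 1" unfolding g by linarith+
  then show "real (gidx k t) / real k \<le> t" "t < real (gidx k t) / real k + 1 / real k"
    using assms by (simp_all add: field_simps)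
  show "gidx k t \<le> k\<^sup>2" by (simp add: gidx_def)
qed

lemma disc_error:
  assumes k: "k > 0" and "i < m"
  shows "\<bar>disc m k x t i - x (real (gidx k t) / real k) i\<bar> \<le> 1 / real k"
proof -
  let ?y = "x (real (gidx k t) / real k) i"
  have "disc m k x t i - ?y = (real_of_int \<lfloor>real k * ?y\<rfloor> - real k * ?y) / real k"
    using assms by (simp add: disc_def stepf_def field_simps)
  also have "\<bar>\<dots>\<bar> = \<bar>real_of_int \<lfloor>real k * ?y\<rfloor> - real k * ?y\<bar> / real k" by simp
  also have "\<dots> \<le> 1 / real k" by (intro divide_right_mono) linarith+
  finally show ?thesis .
qed

lemma disc_lu_conv:
  assumes c: "\<And>i. i < m \<Longrightarrow> continuous_on {0..} (\<lambda>t. x t i)"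
  shows "lu_conv m (\<lambda>k. disc m (Suc k) x) x"
  unfolding lu_conv_def
proof (intro allI impI)
  fix T \<epsilon> :: real assume T: "T > 0" and e: "\<epsilon> > 0"
  have "\<exists>\<delta>>0. \<forall>s\<in>{0..T}. \<forall>t\<in>{0..T}. \<bar>s - t\<bar> < \<delta> \<longrightarrow> \<bar>x s i - x t i\<bar> < \<epsilon> / 2" if "i < m" for i
  proof -
    have "uniformly_continuous_on {0..T} (\<lambda>t. x t i)"
      by (intro compact_uniformly_continuous continuous_on_subset[OF c[OF that]]) auto
    then show ?thesis using e unfolding uniformly_continuous_on_def dist_real_def by (metis half_gt_zero abs_minus_commute)
  qed
  then obtain \<delta> where d: "\<And>i. i < m \<Longrightarrow> \<delta> i > 0" "\<And>i s t. i < m \<Longrightarrow> s\<in>{0..T} \<Longrightarrow> t\<in>{0..T} \<Longrightarrow> \<bar>s - t\<bar> < \<delta> i \<Longrightarrow> \<bar>x s i - x t i\<bar> < \<epsilon> / 2"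
    by metis
  \<comment> \<open>One threshold for both errors: being at most every \<open>\<delta> i\<close> it
    controls the sampling, being at most \<epsilon> / 2 it controls the rounding.\<close>
  define D where "D = Min (insert (\<epsilon> / 2) (\<delta> ` {..<m}))"
  have "D \<le> \<epsilon> / 2" unfolding D_def by (rule Min_le) auto
  moreover have "D \<le> \<delta> i" if "i < m" for i unfolding D_def by (rule Min_le) (use that in auto)
  moreover have "D > 0" unfolding D_def using d(1) e by (subst Min_gr_iff) auto
  ultimately have D: "D > 0" "D \<le> \<epsilon> / 2" "\<And>i. i < m \<Longrightarrow> D \<le> \<delta> i" by blast+
  have "eventually (\<lambda>k. inverse (real (Suc k)) < D) sequentially"
    using LIMSEQ_inverse_real_of_nat D(1) by (rule order_tendstoD)
  moreover have "eventually (\<lambda>k. T \<le> real k) sequentially"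
    by (rule eventually_sequentiallyI[of "nat \<lceil>T\<rceil>"]) linarith
  ultimately show "eventually (\<lambda>k. \<forall>t\<in>{0..T}. \<forall>i<m. \<bar>disc m (Suc k) x t i - x t i\<bar> \<le> \<epsilon>) sequentially"
  proof eventually_elim
    case (elim k)
    show ?case
    proof (intro ballI allI impI)
      fix t i assume t: "t \<in> {0..T}" and i: "i < m"
      let ?s = "real (gidx (Suc k) t) / real (Suc k)"
      have g: "?s \<le> t" "t < ?s + 1 / real (Suc k)" using gidx_bounds[of "Suc k" t] t elim by auto
      have "0 \<le> ?s" by simp
      then have "\<bar>x ?s i - x t i\<bar> < \<epsilon> / 2"
        by (intro d(2) i) (use g t elim D(3)[OF i] in \<open>auto simp: inverse_eq_divide\<close>)
      moreover have "\<bar>disc m (Suc k) x t i - x ?s i\<bar> \<le> 1 / real (Suc k)" by (rule disc_error) (use i in auto)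
      moreover have "1 / real (Suc k) < D" using elim by (simp add: inverse_eq_divide)
      ultimately show "\<bar>disc m (Suc k) x t i - x t i\<bar> \<le> \<epsilon>" using D(2) by linarith
    qed
  qed
qed

text \<open>For each k take a witness for the largest solvable level n \<le> k. A fixed level is
  eventually solvable, hence eventually at most that largest level, and monotonicity in the level
  applies.\<close>

lemma diagonal_choice:
  assumes mono: "\<And>n n' k l. n \<le> n' \<Longrightarrow> P n' k l \<Longrightarrow> P n k l"
    and ex: "\<And>n::nat. eventually (\<lambda>k::nat. \<exists>l. P n k l) sequentially"
  shows "\<exists>l. \<forall>n. eventually (\<lambda>k. P n k (l k)) sequentially"
proof -
  let ?n = "\<lambda>k. GREATEST n. n \<le> k \<and> (\<exists>l. P n k l)"
  let ?l = "\<lambda>k. SOME l. P (?n k) k l"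
  have "eventually (\<lambda>k. P n k (?l k)) sequentially" for n
    using ex[of n] eventually_ge_at_top[of n]
  proof eventually_elim
    case (elim k)
    then have e: "n \<le> k \<and> (\<exists>l. P n k l)" by blast
    have "?n k \<le> k \<and> (\<exists>l. P (?n k) k l)"
      by (rule GreatestI_nat[of _ n k]) (use e in auto)
    then have "P (?n k) k (?l k)" by (meson someI_ex)
    moreover have "n \<le> ?n k" by (rule Greatest_le_nat[where b=k]) (use e in auto)
    ultimately show ?case by (rule mono[rotated])
  qed
  then show ?thesis by (intro exI[of _ ?l]) blast
qed

lemma finite_separated:
  fixes Q :: "real set"
  assumes "finite Q" shows "\<exists>\<delta>>0. \<forall>p\<in>Q. \<forall>q\<in>Q. p \<noteq> q \<longrightarrow> \<delta> \<le> \<bar>p - q\<bar>"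
proof -
  let ?D = "insert 1 ((\<lambda>(p, q). \<bar>p - q\<bar>) ` {(p, q) \<in> Q \<times> Q. p \<noteq> q})"
  have f: "finite ?D" by (rule finite.insertI, rule finite_imageI, rule finite_subset[of _ "Q \<times> Q"]) (use assms in auto)
  have "Min ?D > 0" using f by (subst Min_gr_iff) auto
  moreover have "\<forall>p\<in>Q. \<forall>q\<in>Q. p \<noteq> q \<longrightarrow> Min ?D \<le> \<bar>p - q\<bar>" by (intro ballI impI Min_le[OF f]) auto
  ultimately show ?thesis by blast
qed

text \<open>The time change moves each jump time to the next grid point; its deviation h from the identity
  is extended from the finitely many relevant jump times by McShane's formula.\<close>

lemma jump_time_change:
  fixes J :: "real set"
  assumes fin: "\<And>T. finite {s\<in>J. s \<le> T}" and pos: "J \<subseteq> {0<..}"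
    and x: "\<And>s t. 0 \<le> s \<Longrightarrow> 0 \<le> t \<Longrightarrow> {r\<in>J. r \<le> s} = {r\<in>J. r \<le> t} \<Longrightarrow> x s = x t"
  shows "eventually (\<lambda>k. \<exists>l. l \<in> SkLambda \<and> (\<forall>s t. 0 \<le> t \<and> t < s \<longrightarrow> \<bar>ln ((l s - l t) / (s - t))\<bar> \<le> 1 / real (Suc n)) \<and>
      (\<forall>t\<in>{0..real n}. vdist m (disc m (Suc k) x t) (x (l t)) \<le> real m * (1 / real (Suc k)))) sequentially"
proof -
  \<comment> \<open>The jumps that matter up to time n, with one unit to spare; 0 is added to pin
    down h 0 = 0.\<close>
  define Q where "Q = insert 0 {s\<in>J. s \<le> real n + 1}"
  have finQ: "finite Q" using fin by (simp add: Q_def)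
  \<comment> \<open>Chosen so that the bound of \<open>SkLambda_minus\<close> is exactly 1/(n +
    1).\<close>
  define \<eta> where "\<eta> = 1 - exp (- 1 / real (Suc n))"
  have \<eta>: "0 < \<eta>" "\<eta> < 1" "- ln (1 - \<eta>) = 1 / real (Suc n)" by (simp_all add: \<eta>_def)
  from finite_separated[OF finQ] obtain \<delta> where \<delta>: "\<delta> > 0" "\<And>p q. p \<in> Q \<Longrightarrow> q \<in> Q \<Longrightarrow> p \<noteq> q \<Longrightarrow> \<delta> \<le> \<bar>p - q\<bar>"
    by blast
  \<comment> \<open>With a = 1/(k + 1) this gives a \<le> \<eta> (\<delta> - a): shifts of at most
    a, prescribed at grid points at least \<delta> - a apart, are compatible with the Lipschitz
    constant \<eta>.\<close>
  have "eventually (\<lambda>k. inverse (real (Suc k)) < \<eta> * \<delta> / (1 + \<eta>)) sequentially"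
    using LIMSEQ_inverse_real_of_nat by (rule order_tendstoD) (use \<eta> \<delta> in simp)
  moreover have "eventually (\<lambda>k. real n \<le> real k) sequentially"
    by (rule eventually_sequentiallyI[of n]) simp
  ultimately show ?thesis
  proof eventually_elim
    case (elim k)
    let ?K = "real (Suc k)"
    define c where "c q = real_of_int \<lceil>?K * q\<rceil> / ?K" for q
    have K0: "?K > 0" by simp
    have c: "q \<le> c q" "c q \<le> q + 1 / ?K" for q
    proof -
      have "?K * q \<le> real_of_int \<lceil>?K * q\<rceil>" "real_of_int \<lceil>?K * q\<rceil> \<le> ?K * q + 1" by linarith+
      then show "q \<le> c q" "c q \<le> q + 1 / ?K" unfolding c_def by (simp_all add: field_simps del: of_nat_Suc)
    qed
    define h where "h t = Min ((\<lambda>q. (c q - q) + \<eta> * \<bar>t - c q\<bar>) ` Q)" for t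
    have Q0: "Q \<noteq> {}" by (simp add: Q_def)
    have h_le: "h t \<le> (c q - q) + \<eta> * \<bar>t - c q\<bar>" if "q \<in> Q" for q t
      unfolding h_def by (rule Min_le) (use that finQ in auto)
    have h_att: "\<exists>q\<in>Q. h t = (c q - q) + \<eta> * \<bar>t - c q\<bar>" for t
    proof -
      have "h t \<in> (\<lambda>q. (c q - q) + \<eta> * \<bar>t - c q\<bar>) ` Q" unfolding h_def by (rule Min_in) (use finQ Q0 in auto)
      then show ?thesis by blast
    qed
    have h_nn: "0 \<le> h t" for t using h_att[of t] c(1) \<eta> by force
    have h_lip1: "h s \<le> h t + \<eta> * \<bar>s - t\<bar>" for s t
    proof -
      obtain q where q: "q \<in> Q" "h t = (c q - q) + \<eta> * \<bar>t - c q\<bar>" using h_att by blast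
      have "\<eta> * \<bar>s - c q\<bar> \<le> \<eta> * (\<bar>t - c q\<bar> + \<bar>s - t\<bar>)" using \<eta> by (intro mult_left_mono) auto
      then show ?thesis using h_le[OF q(1), of s] q(2) by (simp add: algebra_simps)
    qed
    have h_lip: "\<bar>h s - h t\<bar> \<le> \<eta> * \<bar>s - t\<bar>" for s t
      using h_lip1[of s t] h_lip1[of t s] by (auto simp: abs_le_iff abs_minus_commute)
    \<comment> \<open>McShane's minimum takes the prescribed value at c p: any other q contributes
      at least \<eta> times the distance of the two grid points, which is no less than the shift of
      p.\<close>
    have hc: "h (c p) = c p - p" if p: "p \<in> Q" for p
    proof (rule antisym)
      show "h (c p) \<le> c p - p" using h_le[OF p, of "c p"] by simp
      obtain q where q: "q \<in> Q" "h (c p) = (c q - q) + \<eta> * \<bar>c p - c q\<bar>" using h_att by blast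
      show "c p - p \<le> h (c p)"
      proof (cases "p = q")
        case False
        have "\<delta> - 1 / ?K \<le> \<bar>c p - c q\<bar>" using \<delta>(2)[OF p q(1) False] c[of p] c[of q] by linarith
        then have "\<eta> * (\<delta> - 1 / ?K) \<le> \<eta> * \<bar>c p - c q\<bar>" using \<eta> by (intro mult_left_mono) auto
        moreover have "1 / ?K \<le> \<eta> * (\<delta> - 1 / ?K)"
        proof -
          have "1 / ?K < \<eta> * \<delta> / (1 + \<eta>)" using elim by (simp add: inverse_eq_divide)
          then have "(1 / ?K) * (1 + \<eta>) < \<eta> * \<delta>" using \<eta> by (subst (asm) pos_less_divide_eq) auto
          moreover have "a * (1 + \<eta>) < \<eta> * \<delta> \<Longrightarrow> a \<le> \<eta> * (\<delta> - a)" for a by (simp add: algebra_simps)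
          ultimately show ?thesis by blast
        qed
        ultimately show ?thesis using q(2) c(2)[of p] c(1)[of q] by linarith
      qed (use q in simp)
    qed
    define l where "l t = t - h t" for t
    have "0 \<in> Q" by (simp add: Q_def)
    then have h0: "h 0 = 0" using hc[of 0] by (simp add: c_def)
    note Sk = SkLambda_minus[of h \<eta>, OF h_lip h0 less_imp_le[OF \<eta>(1)] \<eta>(2), folded l_def]
    have sm: "strict_mono_on {0..} l" using Sk(1) by (simp add: SkLambda_def)
    have "vdist m (disc m (Suc k) x t) (x (l t)) \<le> real m * (1 / ?K)" if t: "t \<in> {0..real n}" for t
    proof (rule vdist_le)
      fix i assume i: "i < m"
      let ?g = "real (gidx (Suc k) t) / ?K"
      have g: "?g \<le> t" "t < ?g + 1 / ?K" using gidx_bounds[of "Suc k" t] t elim by auto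
      \<comment> \<open>The changed time has passed r exactly when the sampled path has; both happen
        at the grid point c r. Jumps after n + 1 are reached by neither.\<close>
      have "r \<le> l t \<longleftrightarrow> r \<le> ?g" if r: "r \<in> J" for r
      proof (cases "r \<le> real n + 1")
        case True
        then have rQ: "r \<in> Q" using r by (simp add: Q_def)
        have lr: "l (c r) = r" using hc[OF rQ] by (simp add: l_def)
        have cr0: "0 \<le> c r" using c(1)[of r] pos r by force
        have "r \<le> l t \<longleftrightarrow> l (c r) \<le> l t" using lr by simp
        also have "\<dots> \<longleftrightarrow> c r \<le> t" using strict_mono_on_less_eq[OF sm, of "c r" t] cr0 t by simp
        also have "\<dots> \<longleftrightarrow> r \<le> ?g"
        proof
          assume "c r \<le> t"
          then have "real_of_int \<lceil>?K * r\<rceil> < real (gidx (Suc k) t) + 1" using g K0 unfolding c_def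
            by (smt (verit) add_divide_distrib divide_strict_right_mono divide_right_mono of_nat_0_le_iff le_less_trans divide_less_cancel)
          then have "\<lceil>?K * r\<rceil> \<le> int (gidx (Suc k) t)" by linarith
          then have "?K * r \<le> real (gidx (Suc k) t)" by linarith
          then show "r \<le> ?g" using K0 by (simp add: field_simps del: of_nat_Suc)
        next
          assume "r \<le> ?g"
          then have "?K * r \<le> real (gidx (Suc k) t)" using K0 by (simp add: field_simps del: of_nat_Suc)
          then have "\<lceil>?K * r\<rceil> \<le> int (gidx (Suc k) t)" by linarith
          then have "real_of_int \<lceil>?K * r\<rceil> \<le> real (gidx (Suc k) t)" by linarith
          then have "c r \<le> ?g" unfolding c_def by (intro divide_right_mono) auto
          then show "c r \<le> t" using g by linarith
        qed
        finally show ?thesis .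
      next
        case False
        then show ?thesis using g t h_nn[of t] by (simp add: l_def)
      qed
      then have "{r\<in>J. r \<le> l t} = {r\<in>J. r \<le> ?g}" by blast
      moreover have "0 \<le> l t" using strict_mono_on_leD[OF sm, of 0 t] t h0 by (simp add: l_def)
      ultimately have "x (l t) = x ?g" by (intro x) auto
      then show "\<bar>disc m (Suc k) x t i - x (l t) i\<bar> \<le> 1 / ?K"
        using disc_error[of "Suc k" i m x t] i by simp
    qed
    moreover have "\<bar>ln ((l s - l t) / (s - t))\<bar> \<le> 1 / real (Suc n)" if "0 \<le> t \<and> t < s" for s t
      using Sk(2)[of t s] that \<eta>(3) unfolding l_def by simp
    ultimately show ?case using Sk(1) by blast
  qed
qed

text \<open>Sampling delays every jump to the next grid point, so for paths with jumps the
  convergence is J1 and in general not locally uniform.\<close>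

lemma disc_sk_conv_jump:
  fixes J :: "real set"
  assumes fin: "\<And>T. finite {s\<in>J. s \<le> T}" and pos: "J \<subseteq> {0<..}"
    and x: "\<And>s t. 0 \<le> s \<Longrightarrow> 0 \<le> t \<Longrightarrow> {r\<in>J. r \<le> s} = {r\<in>J. r \<le> t} \<Longrightarrow> x s = x t"
  shows "sk_conv m (\<lambda>k. disc m (Suc k) x) x"
proof -
  let ?P = "\<lambda>n k l. l \<in> SkLambda \<and> (\<forall>s t. 0 \<le> t \<and> t < s \<longrightarrow> \<bar>ln ((l s - l t) / (s - t))\<bar> \<le> 1 / real (Suc n)) \<and>
      (\<forall>t\<in>{0..real n}. vdist m (disc m (Suc k) x t) (x (l t)) \<le> real m * (1 / real (Suc k)))"
  have "\<exists>l. \<forall>n. eventually (\<lambda>k. ?P n k (l k)) sequentially"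
  proof (rule diagonal_choice)
    show "eventually (\<lambda>k. \<exists>l. ?P n k l) sequentially" for n by (rule jump_time_change[OF fin pos x])
    fix n n' k :: nat and l assume n: "n \<le> n'" and P: "?P n' k l"
    have "1 / real (Suc n') \<le> 1 / real (Suc n)" using n by (intro divide_left_mono) auto
    moreover have "{0..real n} \<subseteq> {0..real n'}" using n by auto
    ultimately show "?P n k l" using P by (meson order_trans subsetD)
  qed
  then obtain l where l: "\<And>n. eventually (\<lambda>k. ?P n k (l k)) sequentially" by blast
  \<comment> \<open>\<open>sk_conv\<close> asks for a time change at every k, including those k for
    which the diagonal choice does not provide one yet; there the identity is substituted.\<close>
  define l' where "l' k = (if l k \<in> SkLambda then l k else (\<lambda>t. t))" for k
  have id: "(\<lambda>t. t) \<in> SkLambda" using SkLambda_minus(1)[of "\<lambda>_. 0" 0] by simp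
  show ?thesis unfolding sk_conv_def
  proof (intro exI[of _ l'] conjI allI impI)
    show "l' k \<in> SkLambda" for k using id by (simp add: l'_def)
    fix \<epsilon> :: real assume e: "\<epsilon> > 0"
    then obtain n where n: "inverse (real (Suc n)) < \<epsilon>" using reals_Archimedean by blast
    show "eventually (\<lambda>k. \<forall>s t. 0 \<le> t \<and> t < s \<longrightarrow> \<bar>ln ((l' k s - l' k t) / (s - t))\<bar> \<le> \<epsilon>) sequentially"
      using l[of n] by eventually_elim (use n in \<open>auto simp: l'_def inverse_eq_divide intro: order_trans[OF _ less_imp_le]\<close>)
  next
    fix T \<epsilon> :: real assume e: "\<epsilon> > 0" and "T > 0"
    have "eventually (\<lambda>k. inverse (real (Suc k)) < \<epsilon> / (real m + 1)) sequentially"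
      using LIMSEQ_inverse_real_of_nat by (rule order_tendstoD) (use e in simp)
    with l[of "nat \<lceil>T\<rceil>"]
    show "eventually (\<lambda>k. \<forall>t\<in>{0..T}. vdist m (disc m (Suc k) x t) (x (l' k t)) \<le> \<epsilon>) sequentially"
    proof eventually_elim
      case (elim k)
      have "real m * (1 / real (Suc k)) \<le> real m * (\<epsilon> / (real m + 1))"
        using elim by (intro mult_left_mono) (auto simp: inverse_eq_divide)
      also have "\<dots> \<le> \<epsilon>" using e by (simp add: field_simps)
      finally have b: "real m * (1 / real (Suc k)) \<le> \<epsilon>" .
      show ?case
      proof
        fix t assume "t \<in> {0..T}"
        then have "t \<in> {0..real (nat \<lceil>T\<rceil>)}" using real_nat_ceiling_ge[of T] by (simp del: real_nat_ceiling_ge add: order_trans) linarith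
        with elim b show "vdist m (disc m (Suc k) x t) (x (l' k t)) \<le> \<epsilon>" unfolding l'_def by force
      qed
    qed
  qed
qed

text \<open>The constant sequence \<open>x\<close> converges to \<open>y\<close>, so a J1-continuous
  functional cannot see negative times or coordinates from m on.\<close>

lemma sk_continuous_cong:
  assumes f: "sk_continuous m f" and x: "x \<in> Dspace m" "y \<in> Dspace m" and eq: "\<And>t i. 0 \<le> t \<Longrightarrow> i < m \<Longrightarrow> x t i = y t i"
  shows "f x = f y"
proof -
  have "lu_conv m (\<lambda>_. x) y" unfolding lu_conv_def using eq by auto
  then have "sk_conv m (\<lambda>_. x) y" by (rule lu_imp_sk)
  then have "(\<lambda>_::nat. f x) \<longlonglongrightarrow> f y" using f[unfolded sk_continuous_def, rule_format, of "\<lambda>_. x" y] x by blast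
  then show ?thesis by (simp add: LIMSEQ_const_iff)
qed

text \<open>The pointwise \<open>lim\<close> of the measurable functions is measurable,
  \<open>h\<close> agrees with it outside a null set, and for the completion this is enough.\<close>

lemma completion_limit:
  fixes q :: "nat \<Rightarrow> 'a \<Rightarrow> real"
  assumes M: "prob_space M" and q[measurable]: "\<And>k. q k \<in> borel_measurable M" and B: "\<And>k \<omega>. \<bar>q k \<omega>\<bar> \<le> B"
    and AEl: "AE \<omega> in M. (\<lambda>k. q k \<omega>) \<longlonglongrightarrow> h \<omega>"
  shows "h \<in> borel_measurable (completion M)" "(\<lambda>k. \<integral>\<omega>. q k \<omega> \<partial>M) \<longlonglongrightarrow> (\<integral>\<omega>. h \<omega> \<partial>completion M)"
proof -
  interpret M: prob_space M by fact
  define g where "g \<omega> = lim (\<lambda>k. q k \<omega>)" for \<omega>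
  have g[measurable]: "g \<in> borel_measurable M" unfolding g_def by measurable
  have AEg: "AE \<omega> in M. h \<omega> = g \<omega>" using AEl by eventually_elim (simp add: g_def limI)
  have cg: "g \<in> borel_measurable (completion M)" by (rule measurable_completion[OF g])
  show mf: "h \<in> borel_measurable (completion M)"
  proof (rule measurableI)
    fix A :: "real set" assume A: "A \<in> sets borel"
    show "h -` A \<inter> space (completion M) \<in> sets (completion M)"
    proof (rule completion.in_sets_AE)
      show "AE \<omega> in completion M. \<omega> \<in> g -` A \<inter> space (completion M) \<longleftrightarrow> \<omega> \<in> h -` A \<inter> space (completion M)"
        using AE_completion[OF AEg] by eventually_elim auto
    qed (use measurable_sets[OF cg A] in auto)
  qed simp
  have "(\<integral>\<omega>. h \<omega> \<partial>completion M) = (\<integral>\<omega>. g \<omega> \<partial>completion M)"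
    by (rule integral_cong_AE[OF mf cg AE_completion[OF AEg]])
  also have "\<dots> = (\<integral>\<omega>. g \<omega> \<partial>M)" by (rule integral_completion[OF g])
  finally have e: "(\<integral>\<omega>. h \<omega> \<partial>completion M) = (\<integral>\<omega>. g \<omega> \<partial>M)" .
  show "(\<lambda>k. \<integral>\<omega>. q k \<omega> \<partial>M) \<longlonglongrightarrow> (\<integral>\<omega>. h \<omega> \<partial>completion M)"
    unfolding e
  proof (rule integral_dominated_convergence[where w="\<lambda>_. B"])
    show "AE \<omega> in M. (\<lambda>k. q k \<omega>) \<longlonglongrightarrow> g \<omega>" using AEl AEg by eventually_elim simp
  qed (use B in auto)
qed

text \<open>On rounded samples \<open>f\<close> is a function of finitely many integers, hence
  measurable; its value on \<open>Z\<close> is the almost sure limit of these values by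
  J1-continuity.\<close>

lemma sk_functional_limit:
  fixes f :: "(real \<Rightarrow> nat \<Rightarrow> real) \<Rightarrow> real" and Z :: "'a \<Rightarrow> real \<Rightarrow> nat \<Rightarrow> real"
  assumes M: "prob_space M" and f: "bounded (range f)" "sk_continuous m f"
    and Z: "\<And>t i. 0 \<le> t \<Longrightarrow> i < m \<Longrightarrow> (\<lambda>\<omega>. Z \<omega> t i) \<in> borel_measurable M"
    and AE: "AE \<omega> in M. Z \<omega> \<in> Dspace m \<and> sk_conv m (\<lambda>k. disc m (Suc k) (Z \<omega>)) (Z \<omega>)"
  shows "(\<lambda>\<omega>. f (disc m (Suc k) (Z \<omega>))) \<in> borel_measurable M"
    and "(\<lambda>\<omega>. f (Z \<omega>)) \<in> borel_measurable (completion M)"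
    and "(\<lambda>k. \<integral>\<omega>. f (disc m (Suc k) (Z \<omega>)) \<partial>M) \<longlonglongrightarrow> (\<integral>\<omega>. f (Z \<omega>) \<partial>completion M)"
proof -
  interpret M: prob_space M by fact
  show me[measurable]: "(\<lambda>\<omega>. f (disc m (Suc k) (Z \<omega>))) \<in> borel_measurable M" for k
  proof -
    let ?I = "{..<m} \<times> {..(Suc k)\<^sup>2}"
    let ?K = "\<lambda>a \<omega>. \<lfloor>real (Suc k) * Z \<omega> (real (snd a) / real (Suc k)) (fst a)\<rfloor>"
    have "(\<lambda>\<omega>. (\<lambda>c. f (stepf m (Suc k) (\<lambda>a. real_of_int (c a) / real (Suc k)))) (\<lambda>a\<in>?I. ?K a \<omega>)) \<in> borel_measurable M"
    proof (rule countable_data_measurable)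
      fix a assume "a \<in> ?I"
      then have [measurable]: "(\<lambda>\<omega>. Z \<omega> (real (snd a) / real (Suc k)) (fst a)) \<in> borel_measurable M"
        by (intro Z) auto
      show "?K a \<in> measurable M (count_space UNIV)" by measurable
    qed auto
    moreover have "stepf m (Suc k) (\<lambda>a. real_of_int ((\<lambda>a\<in>?I. ?K a \<omega>) a) / real (Suc k)) = disc m (Suc k) (Z \<omega>)" for \<omega>
      by (auto simp: fun_eq_iff stepf_def disc_def gidx_def)
    ultimately show ?thesis by simp
  qed
  obtain B where B: "\<And>x. \<bar>f x\<bar> \<le> B" using f(1) by (auto simp: bounded_iff)
  have AEl: "AE \<omega> in M. (\<lambda>k. f (disc m (Suc k) (Z \<omega>))) \<longlonglongrightarrow> f (Z \<omega>)"
    using AE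
  proof eventually_elim
    case (elim \<omega>)
    have "disc m (Suc k) (Z \<omega>) \<in> Dspace m" for k unfolding disc_def by (rule stepf_Dspace) simp
    then show ?case using elim f(2)[unfolded sk_continuous_def, rule_format, of "\<lambda>k. disc m (Suc k) (Z \<omega>)" "Z \<omega>"] by blast
  qed
  from completion_limit[OF M me _ AEl, of B] B
  show "(\<lambda>\<omega>. f (Z \<omega>)) \<in> borel_measurable (completion M)"
    "(\<lambda>k. \<integral>\<omega>. f (disc m (Suc k) (Z \<omega>)) \<partial>M) \<longlonglongrightarrow> (\<integral>\<omega>. f (Z \<omega>) \<partial>completion M)" by auto
qed

section \<open>The one-sided reflection map\<close>

text \<open>The regulator of Skorokhod's one-dimensional reflection problem.\<close>

definition regul1 :: "(real \<Rightarrow> real) \<Rightarrow> real \<Rightarrow> real" where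
  "regul1 y t = (SUP s\<in>{0..t}. max 0 (- y s))"

text \<open>The subdiagonal -1 subtracts the push on coordinate i from coordinate i + 1, so the
  matrix problem is triangular: each regulator solves a one-dimensional problem whose input contains
  the preceding regulator.\<close>

fun regul :: "(real \<Rightarrow> nat \<Rightarrow> real) \<Rightarrow> nat \<Rightarrow> real \<Rightarrow> real" where
  "regul x 0 = regul1 (\<lambda>s. x s 0)"
| "regul x (Suc i) = regul1 (\<lambda>s. x s (Suc i) - regul x i s)"

definition reflmap :: "(real \<Rightarrow> nat \<Rightarrow> real) \<Rightarrow> real \<Rightarrow> nat \<Rightarrow> real" where
  "reflmap x t i = x t i + regul x i t - (if i = 0 then 0 else regul x (i - 1) t)"

text \<open>Boundedness on compact intervals keeps the running suprema meaningful both for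
  continuous paths and for paths with jumps.\<close>

definition bdd_on :: "real \<Rightarrow> (real \<Rightarrow> real) \<Rightarrow> bool" where
  "bdd_on T y \<longleftrightarrow> (\<exists>B. \<forall>s\<in>{0..T}. \<bar>y s\<bar> \<le> B)"

lemma bdd_on_mono: "bdd_on T y \<Longrightarrow> t \<le> T \<Longrightarrow> bdd_on t y"
  unfolding bdd_on_def by force

lemma bdd_on_diff: "bdd_on T y \<Longrightarrow> bdd_on T z \<Longrightarrow> bdd_on T (\<lambda>s. y s - z s)"
proof -
  assume "bdd_on T y" "bdd_on T z"
  then obtain B C where "\<forall>s\<in>{0..T}. \<bar>y s\<bar> \<le> B" "\<forall>s\<in>{0..T}. \<bar>z s\<bar> \<le> C" unfolding bdd_on_def by blast
  then have "\<forall>s\<in>{0..T}. \<bar>y s - z s\<bar> \<le> B + C" by (smt (verit))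
  then show ?thesis unfolding bdd_on_def by blast
qed

lemma continuous_bdd_on: "continuous_on {0..} y \<Longrightarrow> bdd_on T y"
proof -
  assume "continuous_on {0..} y"
  then have "continuous_on {0..T} y" by (rule continuous_on_subset) auto
  then have "compact (y ` {0..T})" by (rule compact_continuous_image) simp
  then have "bounded (y ` {0..T})" by (rule compact_imp_bounded)
  then show ?thesis by (auto simp: bdd_on_def bounded_iff)
qed

lemma bdd_on_bdd_above: "bdd_on t y \<Longrightarrow> bdd_above ((\<lambda>s. max 0 (- y s)) ` {0..t})"
proof -
  assume "bdd_on t y"
  then obtain B where "\<forall>s\<in>{0..t}. \<bar>y s\<bar> \<le> B" by (auto simp: bdd_on_def)
  then show ?thesis by (intro bdd_aboveI[of _ "max 0 B"]) force
qed

lemma regul1_le: "0 \<le> t \<Longrightarrow> 0 \<le> c \<Longrightarrow> (\<And>s. 0 \<le> s \<Longrightarrow> s \<le> t \<Longrightarrow> - y s \<le> c) \<Longrightarrow> regul1 y t \<le> c"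
  unfolding regul1_def by (rule cSUP_least) auto

lemma regul1_ge: "bdd_on t y \<Longrightarrow> 0 \<le> s \<Longrightarrow> s \<le> t \<Longrightarrow> max 0 (- y s) \<le> regul1 y t"
  unfolding regul1_def by (rule cSUP_upper[OF _ bdd_on_bdd_above]) auto

lemma regul1_ge1: "bdd_on t y \<Longrightarrow> 0 \<le> s \<Longrightarrow> s \<le> t \<Longrightarrow> - y s \<le> regul1 y t"
  using regul1_ge[of t y s] by simp

lemma regul1_nonneg: "bdd_on t y \<Longrightarrow> 0 \<le> t \<Longrightarrow> 0 \<le> regul1 y t"
  using regul1_ge[of t y t] by simp

lemma regul1_mono: "bdd_on t y \<Longrightarrow> 0 \<le> s \<Longrightarrow> s \<le> t \<Longrightarrow> regul1 y s \<le> regul1 y t"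
  by (rule regul1_le) (auto intro: regul1_nonneg regul1_ge1)

lemma regul1_bdd_on: "bdd_on t y \<Longrightarrow> bdd_on t (regul1 y)"
proof (cases "0 \<le> t")
  case True
  assume b: "bdd_on t y"
  have "\<bar>regul1 y s\<bar> \<le> regul1 y t" if "s \<in> {0..t}" for s
    using regul1_mono[OF b, of s] regul1_nonneg[OF bdd_on_mono[OF b], of s] that by auto
  then show ?thesis unfolding bdd_on_def by blast
qed (simp add: bdd_on_def)

text \<open>The running supremum is 1-Lipschitz in the uniform norm; \<open>y\<close> inherits its
  bound from \<open>z\<close> by closeness.\<close>

lemma regul1_diff:
  assumes "0 \<le> t" "bdd_on t z" "\<And>s. 0 \<le> s \<Longrightarrow> s \<le> t \<Longrightarrow> \<bar>y s - z s\<bar> \<le> \<epsilon>"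
  shows "\<bar>regul1 y t - regul1 z t\<bar> \<le> \<epsilon>"
proof -
  have e: "0 \<le> \<epsilon>" using assms(3)[of t] assms(1) by linarith
  obtain B where B: "\<forall>s\<in>{0..t}. \<bar>z s\<bar> \<le> B" using assms(2) by (auto simp: bdd_on_def)
  have bdy: "bdd_on t y" unfolding bdd_on_def using B assms(3) by (intro exI[of _ "B + \<epsilon>"]) force
  have "regul1 y t \<le> regul1 z t + \<epsilon>"
  proof (rule regul1_le)
    fix s assume s: "0 \<le> s" "s \<le> t"
    show "- y s \<le> regul1 z t + \<epsilon>" using assms(3)[OF s] regul1_ge1[OF assms(2) s] by linarith
  qed (use assms e regul1_nonneg[of t z] in auto)
  moreover have "regul1 z t \<le> regul1 y t + \<epsilon>"
  proof (rule regul1_le)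
    fix s assume s: "0 \<le> s" "s \<le> t"
    show "- z s \<le> regul1 y t + \<epsilon>" using assms(3)[OF s] regul1_ge1[OF bdy s] by linarith
  qed (use assms e regul1_nonneg[OF bdy] in auto)
  ultimately show ?thesis by linarith
qed

lemma regul_bdd_on: "(\<And>j. j \<le> i \<Longrightarrow> bdd_on T (\<lambda>s. x s j)) \<Longrightarrow> bdd_on T (regul x i)"
  by (induction i) (auto intro!: regul1_bdd_on bdd_on_diff)

text \<open>Every level adds its own input error to the error of the preceding regulator, which
  gives the factor i + 1.\<close>

lemma regul_diff:
  assumes "\<And>j. j \<le> i \<Longrightarrow> bdd_on T (\<lambda>s. z s j)"
    "\<And>s j. 0 \<le> s \<Longrightarrow> s \<le> T \<Longrightarrow> j \<le> i \<Longrightarrow> \<bar>x s j - z s j\<bar> \<le> \<epsilon>" "0 \<le> t" "t \<le> T"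
  shows "\<bar>regul x i t - regul z i t\<bar> \<le> real (Suc i) * \<epsilon>"
  using assms
proof (induction i arbitrary: t)
  case 0
  then show ?case by (auto intro!: regul1_diff intro: bdd_on_mono)
next
  case (Suc i)
  have b: "bdd_on T (regul z i)" by (rule regul_bdd_on) (use Suc.prems in auto)
  show ?case unfolding regul.simps
  proof (rule regul1_diff)
    show "bdd_on t (\<lambda>s. z s (Suc i) - regul z i s)"
      by (rule bdd_on_mono[OF bdd_on_diff[OF _ b]]) (use Suc.prems in auto)
    fix s assume s: "0 \<le> s" "s \<le> t"
    have "\<bar>regul x i s - regul z i s\<bar> \<le> real (Suc i) * \<epsilon>" by (rule Suc.IH) (use Suc.prems s in auto)
    moreover have "\<bar>x s (Suc i) - z s (Suc i)\<bar> \<le> \<epsilon>" using Suc.prems s by auto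
    ultimately show "\<bar>x s (Suc i) - regul x i s - (z s (Suc i) - regul z i s)\<bar> \<le> real (Suc (Suc i)) * \<epsilon>"
      by (simp add: algebra_simps abs_le_iff) 
  qed (use Suc.prems in auto)
qed

text \<open>The factor 2 i + 2 collects 1 for the path, i + 1 for its regulator and i for the
  preceding regulator.\<close>

lemma reflmap_diff:
  assumes "\<And>j. j \<le> i \<Longrightarrow> bdd_on T (\<lambda>s. z s j)"
    "\<And>s j. 0 \<le> s \<Longrightarrow> s \<le> T \<Longrightarrow> j \<le> i \<Longrightarrow> \<bar>x s j - z s j\<bar> \<le> \<epsilon>" "0 \<le> t" "t \<le> T"
  shows "\<bar>reflmap x t i - reflmap z t i\<bar> \<le> (2 * real i + 2) * \<epsilon>"
proof -
  have e: "0 \<le> \<epsilon>" using assms(2)[of t i] assms(3,4) by linarith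
  have "\<bar>regul x i t - regul z i t\<bar> \<le> real (Suc i) * \<epsilon>" by (rule regul_diff[OF assms]) auto
  moreover have "\<bar>(if i = 0 then 0 else regul x (i - 1) t) - (if i = 0 then 0 else regul z (i - 1) t)\<bar> \<le> real i * \<epsilon>"
  proof (cases i)
    case (Suc j)
    have "\<bar>regul x j t - regul z j t\<bar> \<le> real (Suc j) * \<epsilon>" by (rule regul_diff) (use assms Suc in auto)
    then show ?thesis using Suc by simp
  qed simp
  moreover have "\<bar>x t i - z t i\<bar> \<le> \<epsilon>" using assms by auto
  moreover have "(2 * real i + 2) * \<epsilon> = real (Suc i) * \<epsilon> + real i * \<epsilon> + \<epsilon>" by (simp add: algebra_simps)
  ultimately show ?thesis unfolding reflmap_def by linarith
qed

lemma regul1_continuous: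
  assumes c: "continuous_on {0..} y" shows "continuous_on {0..} (regul1 y)"
  unfolding continuous_on_iff dist_real_def
proof (intro ballI allI impI)
  fix t e :: real assume t: "t \<in> {0..}" and e: "e > 0"
  have b: "bdd_on T y" for T by (rule continuous_bdd_on[OF c])
  have "uniformly_continuous_on {0..t + 1} y"
    by (intro compact_uniformly_continuous continuous_on_subset[OF c]) auto
  then obtain \<delta> where \<delta>: "\<delta> > 0" "\<And>r s. r \<in> {0..t + 1} \<Longrightarrow> s \<in> {0..t + 1} \<Longrightarrow> \<bar>r - s\<bar> < \<delta> \<Longrightarrow> \<bar>y r - y s\<bar> < e / 2"
    using e unfolding uniformly_continuous_on_def dist_real_def by (metis half_gt_zero abs_minus_commute)
  \<comment> \<open>Beyond u the supremum can only grow by the oscillation of \<open>y\<close> on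
    [u, v].\<close>
  have key: "\<bar>regul1 y v - regul1 y u\<bar> \<le> e / 2" if uv: "0 \<le> u" "u \<le> v" "v \<le> t + 1" "v - u < \<delta>" for u v
  proof -
    have "regul1 y v \<le> regul1 y u + e / 2"
    proof (rule regul1_le)
      fix s assume s: "0 \<le> s" "s \<le> v"
      show "- y s \<le> regul1 y u + e / 2"
      proof (cases "s \<le> u")
        case True
        then show ?thesis using regul1_ge1[OF b s(1) True] e by linarith
      next
        case False
        have "\<bar>y s - y u\<bar> < e / 2" by (rule \<delta>(2)) (use s False uv in auto)
        then show ?thesis using regul1_ge1[OF b uv(1) order_refl] by linarith
      qed
    qed (use uv e regul1_nonneg[OF b uv(1)] in auto)
    then show ?thesis using regul1_mono[OF b uv(1,2)] by linarith
  qed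
  show "\<exists>d>0. \<forall>x'\<in>{0..}. \<bar>x' - t\<bar> < d \<longrightarrow> \<bar>regul1 y x' - regul1 y t\<bar> < e"
  proof (intro exI[of _ "min \<delta> 1"] conjI ballI impI)
    fix s assume s: "s \<in> {0..}" "\<bar>s - t\<bar> < min \<delta> 1"
    show "\<bar>regul1 y s - regul1 y t\<bar> < e"
    proof (cases "s \<le> t")
      case True
      then have "\<bar>regul1 y t - regul1 y s\<bar> \<le> e / 2" using key[of s t] s t by auto
      then show ?thesis using e by linarith
    next
      case False
      then have "\<bar>regul1 y s - regul1 y t\<bar> \<le> e / 2" using key[of t s] s t by auto
      then show ?thesis using e by linarith
    qed
  qed (use \<delta> in auto)
qed

lemma regul_continuous: "(\<And>j. j \<le> i \<Longrightarrow> continuous_on {0..} (\<lambda>s. x s j)) \<Longrightarrow> continuous_on {0..} (regul x i)"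
  by (induction i) (auto intro!: regul1_continuous continuous_on_diff)

lemma reflmap_continuous: "(\<And>j. j \<le> i \<Longrightarrow> continuous_on {0..} (\<lambda>s. x s j)) \<Longrightarrow> continuous_on {0..} (\<lambda>t. reflmap x t i)"
proof -
  assume c: "\<And>j. j \<le> i \<Longrightarrow> continuous_on {0..} (\<lambda>s. x s j)"
  have r: "continuous_on {0..} (regul x j)" if "j \<le> i" for j by (rule regul_continuous) (use c that in auto)
  show ?thesis unfolding reflmap_def by (cases "i = 0") (use c r in \<open>auto intro!: continuous_on_add continuous_on_diff simp del: regul.simps\<close>)
qed

lemma regul_mono: "(\<And>j. j \<le> i \<Longrightarrow> bdd_on t (\<lambda>s. x s j)) \<Longrightarrow> 0 \<le> s \<Longrightarrow> s \<le> t \<Longrightarrow> regul x i s \<le> regul x i t"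
  by (cases i) (auto intro!: regul1_mono bdd_on_diff regul_bdd_on)

text \<open>Nonnegativity of w and monotonicity of Y make Y dominate the regulator. Conversely,
  suppose that Y t exceeds the level m = \<open>regul1 y t\<close>. After the last time at which Y
  equals m the path w is positive, so dY has no mass there, although Y still grows from m to Y
  t.\<close>

lemma regul1_unique:
  assumes y: "\<And>t. 0 \<le> t \<Longrightarrow> w t = y t + Y t" and w: "\<And>t. 0 \<le> t \<Longrightarrow> 0 \<le> w t"
    and c: "continuous_on {0..} Y" "continuous_on {0..} w" and Y0: "Y 0 = 0" and mono: "mono_on {0..} Y"
    and null: "emeasure (interval_measure (\<lambda>t. Y (max 0 t))) {t. 0 \<le> t \<and> w t > 0} = 0"
    and t: "0 \<le> t"
  shows "Y t = regul1 y t"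
proof (rule antisym)
  have cy: "continuous_on {0..} y"
    using continuous_on_diff[OF c(2,1)] by (rule continuous_on_eq) (use y in auto)
  have b: "bdd_on T y" for T by (rule continuous_bdd_on[OF cy])
  have Ynn: "0 \<le> Y s" if "0 \<le> s" for s using mono_onD[OF mono, of 0 s] that Y0 by simp
  show "regul1 y t \<le> Y t"
  proof (rule regul1_le)
    fix s assume s: "0 \<le> s" "s \<le> t"
    show "- y s \<le> Y t" using y[OF s(1)] w[OF s(1)] mono_onD[OF mono, of s t] s by simp
  qed (use t Ynn in auto)
  show "Y t \<le> regul1 y t"
  proof (rule ccontr)
    let ?m = "regul1 y t"
    assume "\<not> Y t \<le> ?m"
    then have gt: "?m < Y t" by simp
    have m0: "0 \<le> ?m" by (rule regul1_nonneg[OF b t])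
    have cY: "continuous_on {0..t} Y" by (rule continuous_on_subset[OF c(1)]) auto
    let ?S = "{s\<in>{0..t}. Y s = ?m}"
    have "\<exists>s\<ge>0. s \<le> t \<and> Y s = ?m" by (rule IVT'[OF _ _ t cY]) (use Y0 m0 gt in auto)
    then have ne: "?S \<noteq> {}" by auto
    have "closed ?S" using continuous_closed_preimage_constant[OF cY, of ?m] by simp
    moreover have "bounded ?S" by (rule bounded_subset[of "{0..t}"]) auto
    ultimately have cS: "compact ?S" by (simp add: compact_eq_bounded_closed)
    from compact_attains_sup[OF cS ne] obtain s0 where s0: "s0 \<in> ?S" "\<forall>s\<in>?S. s \<le> s0" by blast
    have s0t: "s0 < t" using s0 gt by (cases "s0 = t") auto
    have gtm: "?m < Y s" if s: "s0 < s" "s \<le> t" for s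
    proof (rule ccontr)
      assume "\<not> ?m < Y s"
      moreover have "?m \<le> Y s" using mono_onD[OF mono, of s0 s] s0 s by auto
      ultimately have "Y s = regul1 y t" by linarith
      then have "s \<in> ?S" using s0 s by auto
      then have "s \<le> s0" using s0(2) by blast
      then show False using s by linarith
    qed
    have wp: "w s > 0" if s: "s0 < s" "s \<le> t" for s
    proof -
      have "0 \<le> s" using s s0 by auto
      then show ?thesis using y[of s] gtm[OF s] regul1_ge1[OF b, of s t] s by auto
    qed
    let ?F = "\<lambda>t. Y (max 0 t)"
    have Fm: "?F u \<le> ?F v" if "u \<le> v" for u v using mono_onD[OF mono, of "max 0 u" "max 0 v"] that by auto
    have Fc: "continuous_on UNIV ?F"
      by (rule continuous_on_compose2[OF c(1)]) (auto intro!: continuous_intros)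
    have "emeasure (interval_measure ?F) {s0<..t} = ennreal (?F t - ?F s0)"
      by (rule emeasure_interval_measure_Ioc)
         (use s0t Fm Fc in \<open>auto simp: continuous_on_eq_continuous_within intro: continuous_within_subset\<close>)
    moreover have "?F t - ?F s0 > 0" using gt s0 t by auto
    ultimately have pos: "emeasure (interval_measure ?F) {s0<..t} > 0" by simp
    have sub: "{s0<..t} \<subseteq> {t. 0 \<le> t \<and> w t > 0}" using wp s0 by auto
    have meas: "{t. 0 \<le> t \<and> w t > 0} \<in> sets (interval_measure ?F)"
    proof -
      have "{t\<in>{0..}. 0 < w t} \<in> sets borel"
      proof -
        have "(\<lambda>t. indicator {0..} t *\<^sub>R w t) \<in> borel_measurable borel"
          by (rule borel_measurable_continuous_on_indicator[OF _ c(2)]) simp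
        then have "{t\<in>space borel. 0 < indicator {0..} t *\<^sub>R w t} \<in> sets borel" by measurable
        also have "{t\<in>space borel. 0 < indicator {0..} t *\<^sub>R w t} = {t\<in>{0..}. 0 < w t}" by (auto simp: indicator_def)
        finally show ?thesis .
      qed
      then show ?thesis by simp
    qed
    from emeasure_mono[OF sub meas] pos null show False by simp
  qed
qed

text \<open>The regulator only grows on the zero set: the open set where the reflected path is positive is a
  countable union of rational intervals on which the regulator is constant.\<close>

lemma regul1_complement:
  assumes c: "continuous_on {0..} y"
  shows "emeasure (interval_measure (\<lambda>t. regul1 y (max 0 t))) {t. 0 \<le> t \<and> y t + regul1 y t > 0} = 0"
proof -
  let ?Y = "regul1 y" and ?F = "\<lambda>t. regul1 y (max 0 t)"
  have b: "bdd_on T y" for T by (rule continuous_bdd_on[OF c])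
  have cY: "continuous_on {0..} ?Y" by (rule regul1_continuous[OF c])
  have Fm: "?F u \<le> ?F v" if "u \<le> v" for u v by (rule regul1_mono[OF b]) (use that in auto)
  have Fc: "continuous_on UNIV ?F"
    by (rule continuous_on_compose2[OF cY]) (auto intro!: continuous_intros)
  have Ioc: "emeasure (interval_measure ?F) {u<..v} = ennreal (?F v - ?F u)" if "u \<le> v" for u v
    by (rule emeasure_interval_measure_Ioc)
       (use that Fm Fc in \<open>auto simp: continuous_on_eq_continuous_within intro: continuous_within_subset\<close>)
  \<comment> \<open>If the supremum grew on [u, v], its value at v would be at most - y s for the
    minimiser s of y on that interval, and then y s plus the regulator at s could not be
    positive.\<close>
  have const: "?F v = ?F u" if u: "u < v" and pos: "\<And>s. max 0 u \<le> s \<Longrightarrow> s \<le> v \<Longrightarrow> y s + ?Y s > 0" for u v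
  proof (cases "v \<le> 0")
    case False
    let ?u = "max 0 u"
    have uv: "?u \<le> v" "0 \<le> ?u" using False u by auto
    have "continuous_on {?u..v} (\<lambda>s. - y s)" by (intro continuous_intros continuous_on_subset[OF c]) auto
    from continuous_attains_sup[OF _ _ this] uv obtain s where s: "s \<in> {?u..v}" "\<And>r. r \<in> {?u..v} \<Longrightarrow> - y r \<le> - y s"
      by fastforce
    have "?Y v \<le> ?Y ?u"
    proof (rule ccontr)
      assume n: "\<not> ?Y v \<le> ?Y ?u"
      have "?Y v \<le> max (?Y ?u) (- y s)"
      proof (rule regul1_le)
        fix r assume r: "0 \<le> r" "r \<le> v"
        show "- y r \<le> max (?Y ?u) (- y s)"
        proof (cases "r \<le> ?u")
          case True
          then show ?thesis using regul1_ge1[OF b r(1) True] by linarith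
        next
          case False
          then have "r \<in> {?u..v}" using r by auto
          from s(2)[OF this] show ?thesis by linarith
        qed
      qed (use uv regul1_nonneg[OF b uv(2)] in auto)
      then have "?Y v \<le> - y s" using n by linarith
      moreover have "?Y s \<le> ?Y v" by (rule regul1_mono[OF b]) (use s uv in auto)
      moreover have "y s + ?Y s > 0" by (rule pos) (use s in auto)
      ultimately show False by linarith
    qed
    moreover have "?Y ?u \<le> ?Y v" by (rule regul1_mono[OF b]) (use uv in auto)
    ultimately show ?thesis using uv by auto
  qed (use u in auto)
  \<comment> \<open>Rational endpoints make the cover countable. The left endpoint may be negative,
    because some half-open interval has to contain the time 0.\<close>
  define Q where "Q = {(u, v). u \<in> \<rat> \<and> v \<in> \<rat> \<and> u < v \<and> (\<forall>s. max 0 u \<le> s \<and> s \<le> v \<longrightarrow> y s + ?Y s > 0)}"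
  have cQ: "countable Q"
    by (rule countable_subset[of _ "\<rat> \<times> \<rat>"]) (auto simp: Q_def countable_rat)
  have sub: "{t. 0 \<le> t \<and> y t + ?Y t > 0} \<subseteq> (\<Union>(u, v)\<in>Q. {u<..v})"
  proof safe
    fix t assume t: "0 \<le> t" and pos: "y t + ?Y t > 0"
    have "continuous_on {0..} (\<lambda>s. y s + ?Y s)" by (intro continuous_intros c cY)
    then have "\<exists>\<delta>>0. \<forall>s\<in>{0..}. \<bar>s - t\<bar> < \<delta> \<longrightarrow> \<bar>(y s + ?Y s) - (y t + ?Y t)\<bar> < y t + ?Y t"
      using t pos unfolding continuous_on_iff dist_real_def by fastforce
    then obtain \<delta> where \<delta>: "\<delta> > 0" "\<And>s. 0 \<le> s \<Longrightarrow> \<bar>s - t\<bar> < \<delta> \<Longrightarrow> y s + ?Y s > 0"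
      by (metis abs_less_iff atLeast_iff diff_add_cancel less_add_same_cancel2 minus_diff_eq neg_less_0_iff_less pos add.commute
          diff_less_eq less_diff_eq add_less_same_cancel1)
    obtain u where u: "u \<in> \<rat>" "t - \<delta> < u" "u < t" using Rats_dense_in_real[of "t - \<delta>" t] \<delta> by auto
    obtain v where v: "v \<in> \<rat>" "t < v" "v < t + \<delta>" using Rats_dense_in_real[of t "t + \<delta>"] \<delta> by auto
    have "y s + ?Y s > 0" if "max 0 u \<le> s" "s \<le> v" for s using that u v by (intro \<delta>(2)) auto
    then have "(u, v) \<in> Q" using u v by (auto simp: Q_def)
    then show "t \<in> (\<Union>(u, v)\<in>Q. {u<..v})" by (rule UN_I) (use u v in auto)
  qed
  have "(\<Union>(u, v)\<in>Q. {u<..v}) \<in> null_sets (interval_measure ?F)"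
  proof (rule null_sets_UN'[OF cQ])
    fix p assume "p \<in> Q"
    then obtain u v where p: "p = (u, v)" "u < v" "\<And>s. max 0 u \<le> s \<Longrightarrow> s \<le> v \<Longrightarrow> y s + ?Y s > 0"
      by (auto simp: Q_def)
    show "(case p of (u, v) \<Rightarrow> {u<..v}) \<in> null_sets (interval_measure ?F)"
      using Ioc[of u v] const[OF p(2,3)] p by auto
  qed
  then have "emeasure (interval_measure ?F) (\<Union>(u, v)\<in>Q. {u<..v}) = 0" "(\<Union>(u, v)\<in>Q. {u<..v}) \<in> sets (interval_measure ?F)" by auto
  from emeasure_mono[OF sub this(2)] this(1) show ?thesis by simp
qed

section \<open>Brownian motion\<close>

abbreviation gauss :: "(nat \<Rightarrow> real) measure" where
  "gauss \<equiv> PiM UNIV (\<lambda>_. std_normal_distribution)"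

lemma prob_space_gauss: "prob_space gauss"
  by (rule prob_space_PiM) (rule real_distribution.axioms(1)[OF real_dist_normal_dist])

lemma gauss_coord [measurable]: "(\<lambda>\<omega>. \<omega> n) \<in> borel_measurable gauss"
  using measurable_component_singleton[of n UNIV "\<lambda>_. std_normal_distribution"] by simp

lemma gauss_linear_char:
  fixes c :: "nat \<Rightarrow> real"
  assumes fin: "finite A"
  shows "(\<integral>\<omega>. cis (\<Sum>a\<in>A. c a * \<omega> a) \<partial>gauss) = complex_of_real (exp (- (\<Sum>a\<in>A. (c a)\<^sup>2) / 2))"
proof -
  interpret N: prob_space "std_normal_distribution" by (rule real_distribution.axioms(1)[OF real_dist_normal_dist])
  interpret PP: product_prob_space "\<lambda>_::nat. std_normal_distribution" UNIV by unfold_locales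
  have "(\<integral>\<omega>. cis (\<Sum>a\<in>A. c a * \<omega> a) \<partial>gauss) = (\<integral>\<omega>. (\<Prod>a\<in>A. cis (c a * restrict \<omega> A a)) \<partial>gauss)"
    by (intro Bochner_Integration.integral_cong) (simp_all add: cis_conv_exp exp_sum[OF fin, symmetric] sum_distrib_left cong: prod.cong)
  also have "\<dots> = (\<integral>\<omega>. (\<Prod>a\<in>A. cis (c a * \<omega> a)) \<partial>distr gauss (PiM A (\<lambda>_. std_normal_distribution)) (\<lambda>\<omega>. restrict \<omega> A))"
    by (subst integral_distr) (auto intro!: borel_measurable_prod measurable_restrict_subset measurable_compose[OF _ cis_measurable] borel_measurable_times
      intro: measurable_component_singleton[where M="\<lambda>_. std_normal_distribution", simplified])
  also have "\<dots> = (\<integral>\<omega>. (\<Prod>a\<in>A. cis (c a * \<omega> a)) \<partial>PiM A (\<lambda>_. std_normal_distribution))"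
    by (subst PP.distr_PiM_restrict_finite[OF fin]) auto
  also have "\<dots> = (\<Prod>a\<in>A. \<integral>x. cis (c a * x) \<partial>std_normal_distribution)"
    by (rule PP.product_integral_prod[OF fin]) (rule N.integrable_const_bound[where B=1]; simp)
  also have "\<dots> = (\<Prod>a\<in>A. complex_of_real (exp (- (c a)\<^sup>2 / 2)))"
  proof (rule prod.cong)
    fix a
    show "(\<integral>x. cis (c a * x) \<partial>std_normal_distribution) = complex_of_real (exp (- (c a)\<^sup>2 / 2))"
      using fun_cong[OF char_std_normal_distribution, of "c a"] by (simp add: char_def cis_conv_exp)
  qed simp
  also have "\<dots> = complex_of_real (exp (\<Sum>a\<in>A. - (c a)\<^sup>2 / 2))" by (simp add: exp_sum[OF fin])
  also have "(\<Sum>a\<in>A. - (c a)\<^sup>2 / 2) = - (\<Sum>a\<in>A. (c a)\<^sup>2) / 2" by (simp add: sum_divide_distrib sum_negf)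
  finally show ?thesis .
qed

text \<open>Levy's construction: dinc i m k is the increment of the i-th Brownian motion over the dyadic interval
  from k / 2^m to (k + 1) / 2^m; bisecting an interval splits its increment with the help of a fresh Gaussian.\<close>

definition gauss_index :: "nat \<Rightarrow> nat \<Rightarrow> nat \<Rightarrow> nat" where "gauss_index i m k = prod_encode (i, prod_encode (m, k))"

lemma gauss_index_inj: "gauss_index i m k = gauss_index i' m' k' \<longleftrightarrow> i = i' \<and> m = m' \<and> k = k'" by (simp add: gauss_index_def)

fun dinc :: "nat \<Rightarrow> nat \<Rightarrow> nat \<Rightarrow> (nat \<Rightarrow> real) \<Rightarrow> real" where
  "dinc i 0 k \<omega> = \<omega> (gauss_index i 0 k)"
| "dinc i (Suc m) k \<omega> = dinc i m (k div 2) \<omega> / 2 + (if even k then 1 else -1) * (sqrt ((1 / 2) ^ m) / 2) * \<omega> (gauss_index i (Suc m) (k div 2))"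

lemma dinc_measurable [measurable]: "dinc i m k \<in> borel_measurable gauss"
proof (induction m arbitrary: k)
  case 0
  have "dinc i 0 k = (\<lambda>\<omega>. \<omega> (gauss_index i 0 k))" by (rule ext) simp
  then show ?case by simp
next
  case (Suc m)
  have e: "dinc i (Suc m) k = (\<lambda>\<omega>. dinc i m (k div 2) \<omega> / 2 + (if even k then 1 else -1) * (sqrt ((1 / 2) ^ m) / 2) * \<omega> (gauss_index i (Suc m) (k div 2)))"
    by (rule ext) simp
  show ?case unfolding e by (intro borel_measurable_add borel_measurable_times borel_measurable_divide Suc.IH gauss_coord borel_measurable_const)
qed

lemma dinc_split: "dinc i (Suc m) (2 * k) \<omega> + dinc i (Suc m) (Suc (2 * k)) \<omega> = dinc i m k \<omega>"
  by simp

lemma sum_double: "(\<Sum>k<2 * K. f k) = (\<Sum>k<K. f (2 * k) + f (Suc (2 * k)) :: 'a :: comm_monoid_add)"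
  by (induction K) (simp_all add: add.assoc)

text \<open>The variance is carried along as a sum of squared coefficients over independent
  Gaussians. At level m + 1 each pair of coefficients a, b sends half its sum to the parent
  increment and a multiple of its difference to a fresh Gaussian; since ((a + b)^2 + (a - b)^2) / 4
  = (a^2 + b^2) / 2, the factor \<open>sqrt ((1 / 2) ^ m) / 2\<close> in \<open>dinc\<close> is the
  one that makes the two halves uncorrelated with half the variance. The bound m' \<le> m keeps the
  fresh Gaussians apart from the old ones.\<close>

lemma dinc_linear:
  "\<exists>A c. finite A \<and> A \<subseteq> {gauss_index i m' k |i m' k. m' \<le> m} \<and>
     (\<forall>\<omega>. (\<Sum>i<d. \<Sum>k<K. u i k * dinc i m k \<omega>) = (\<Sum>a\<in>A. c a * \<omega> a)) \<and>
     (\<Sum>a\<in>A. (c a)\<^sup>2) = (\<Sum>i<d. \<Sum>k<K. (u i k)\<^sup>2) / 2 ^ m"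
proof (induction m arbitrary: K u)
  case 0
  let ?g = "\<lambda>(i, k). gauss_index i 0 k"
  let ?A = "?g ` ({..<d} \<times> {..<K})"
  let ?inv = "the_inv_into ({..<d} \<times> {..<K}) ?g"
  have inj: "inj_on ?g ({..<d} \<times> {..<K})" by (auto simp: inj_on_def gauss_index_inj)
  let ?c = "\<lambda>a. case_prod u (?inv a)"
  have inv: "?inv (?g p) = p" if "p \<in> {..<d} \<times> {..<K}" for p by (rule the_inv_into_f_f[OF inj that])
  have s: "(\<Sum>a\<in>?A. F (?c a) a) = (\<Sum>i<d. \<Sum>k<K. F (u i k) (gauss_index i 0 k))" for F :: "real \<Rightarrow> nat \<Rightarrow> real"
    unfolding sum.reindex[OF inj] sum.cartesian_product by (rule sum.cong) (use inv in auto)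
  show ?case
    by (intro exI[of _ ?A] exI[of _ ?c]) (use s[of "\<lambda>c a. c * _ a"] s[of "\<lambda>c a. c\<^sup>2"] in auto)
next
  case (Suc m)
  \<comment> \<open>Coefficients from K on are set to zero, so that the children can be summed in
    pairs whatever the parity of K.\<close>
  define v where "v i k = (if k < K then u i k else 0)" for i k
  define w where "w i k = (v i (2 * k) + v i (Suc (2 * k))) / 2" for i k
  define z where "z i k = (v i (2 * k) - v i (Suc (2 * k))) * (sqrt ((1 / 2) ^ m) / 2)" for i k
  from Suc.IH[of w K] obtain A c where A: "finite A" "A \<subseteq> {gauss_index i m' k |i m' k. m' \<le> m}"
     "\<And>\<omega>. (\<Sum>i<d. \<Sum>k<K. w i k * dinc i m k \<omega>) = (\<Sum>a\<in>A. c a * \<omega> a)"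
     "(\<Sum>a\<in>A. (c a)\<^sup>2) = (\<Sum>i<d. \<Sum>k<K. (w i k)\<^sup>2) / 2 ^ m" by blast
  let ?g = "\<lambda>(i, k). gauss_index i (Suc m) k"
  let ?B = "?g ` ({..<d} \<times> {..<K})"
  let ?inv = "the_inv_into ({..<d} \<times> {..<K}) ?g"
  have inj: "inj_on ?g ({..<d} \<times> {..<K})" by (auto simp: inj_on_def gauss_index_inj)
  have inv: "?inv (?g p) = p" if "p \<in> {..<d} \<times> {..<K}" for p by (rule the_inv_into_f_f[OF inj that])
  have disj: "A \<inter> ?B = {}" using A(2) by (auto simp: gauss_index_inj)
  let ?c = "\<lambda>a. if a \<in> A then c a else case_prod z (?inv a)"
  have s: "(\<Sum>a\<in>A \<union> ?B. F (?c a) a) = (\<Sum>a\<in>A. F (c a) a) + (\<Sum>i<d. \<Sum>k<K. F (z i k) (gauss_index i (Suc m) k))" for F :: "real \<Rightarrow> nat \<Rightarrow> real"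
  proof -
    have "(\<Sum>a\<in>A \<union> ?B. F (?c a) a) = (\<Sum>a\<in>A. F (?c a) a) + (\<Sum>a\<in>?B. F (?c a) a)"
      by (rule sum.union_disjoint) (use A disj in auto)
    also have "(\<Sum>a\<in>A. F (?c a) a) = (\<Sum>a\<in>A. F (c a) a)" by (rule sum.cong) auto
    also have "(\<Sum>a\<in>?B. F (?c a) a) = (\<Sum>a\<in>?B. F (case_prod z (?inv a)) a)" by (rule sum.cong) (use disj in auto)
    also have "\<dots> = (\<Sum>i<d. \<Sum>k<K. F (z i k) (gauss_index i (Suc m) k))"
      unfolding sum.reindex[OF inj] sum.cartesian_product by (rule sum.cong) (use inv in auto)
    finally show ?thesis .
  qed
  have uv: "(\<Sum>k<K. F (u i k) k) = (\<Sum>k<K. F (v i (2 * k)) (2 * k) + F (v i (Suc (2 * k))) (Suc (2 * k)))"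
    if F0: "\<And>k. F 0 k = 0" for F :: "real \<Rightarrow> nat \<Rightarrow> real" and i
  proof -
    have "(\<Sum>k<K. F (u i k) k) = (\<Sum>k<2 * K. F (v i k) k)"
      by (rule sum.mono_neutral_cong_left) (auto simp: v_def F0)
    then show ?thesis by (simp only: sum_double)
  qed
  have lin: "(\<Sum>i<d. \<Sum>k<K. u i k * dinc i (Suc m) k \<omega>) = (\<Sum>a\<in>A \<union> ?B. ?c a * \<omega> a)" for \<omega>
  proof -
    have "(\<Sum>k<K. u i k * dinc i (Suc m) k \<omega>) = (\<Sum>k<K. w i k * dinc i m k \<omega> + z i k * \<omega> (gauss_index i (Suc m) k))" for i
      unfolding uv[of "\<lambda>c k. c * dinc i (Suc m) k \<omega>", OF mult_zero_left]
      by (rule sum.cong) (auto simp: w_def z_def algebra_simps add_divide_distrib diff_divide_distrib)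
    then show ?thesis unfolding s[of "\<lambda>c a. c * \<omega> a"] A(3)[symmetric] by (simp add: sum.distrib)
  qed
  have sq: "(\<Sum>a\<in>A \<union> ?B. (?c a)\<^sup>2) = (\<Sum>i<d. \<Sum>k<K. (u i k)\<^sup>2) / 2 ^ Suc m"
  proof -
    have e: "(w i k)\<^sup>2 / 2 ^ m + (z i k)\<^sup>2 = ((v i (2 * k))\<^sup>2 + (v i (Suc (2 * k)))\<^sup>2) / 2 ^ Suc m" for i k
    proof -
      have "(sqrt ((1 / 2) ^ m))\<^sup>2 = 1 / 2 ^ m" by (simp add: power_one_over)
      then have "(z i k)\<^sup>2 = (v i (2 * k) - v i (Suc (2 * k)))\<^sup>2 / 4 / 2 ^ m"
        by (simp only: z_def power_mult_distrib power_divide) simp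
      then show ?thesis by (simp add: w_def power2_eq_square field_simps)
    qed
    have "(\<Sum>k<K. (u i k)\<^sup>2) / 2 ^ Suc m = (\<Sum>k<K. (w i k)\<^sup>2 / 2 ^ m + (z i k)\<^sup>2)" for i
      unfolding uv[of "\<lambda>c k. c\<^sup>2", OF zero_power2] e by (simp add: sum_divide_distrib)
    then have "(\<Sum>i<d. \<Sum>k<K. (u i k)\<^sup>2) / 2 ^ Suc m = (\<Sum>i<d. \<Sum>k<K. (w i k)\<^sup>2 / 2 ^ m + (z i k)\<^sup>2)"
      by (simp only: sum_divide_distrib)
    then show ?thesis unfolding s[of "\<lambda>c a. c\<^sup>2"] A(4) by (simp add: sum.distrib sum_divide_distrib)
  qed
  have "A \<subseteq> {gauss_index i m' k |i m' k. m' \<le> Suc m}" using A(2) le_SucI by blast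
  then have "A \<union> ?B \<subseteq> {gauss_index i m' k |i m' k. m' \<le> Suc m}" by auto
  then show ?case
    by (intro exI[of _ "A \<union> ?B"] exI[of _ ?c] conjI allI lin sq) (use A(1) in auto)
qed

lemma dinc_char:
  "(\<integral>\<omega>. cis (\<Sum>i<d. \<Sum>k<K. u i k * dinc i m k \<omega>) \<partial>gauss) = complex_of_real (exp (- ((\<Sum>i<d. \<Sum>k<K. (u i k)\<^sup>2) / 2 ^ m) / 2))"
proof -
  from dinc_linear[where d=d and m=m and K=K and u=u] obtain A c where A: "finite A"
     "\<And>\<omega>. (\<Sum>i<d. \<Sum>k<K. u i k * dinc i m k \<omega>) = (\<Sum>a\<in>A. c a * \<omega> a)"
     "(\<Sum>a\<in>A. (c a)\<^sup>2) = (\<Sum>i<d. \<Sum>k<K. (u i k)\<^sup>2) / 2 ^ m" by blast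
  show ?thesis unfolding A(2) gauss_linear_char[OF A(1)] A(3) ..
qed

lemma dinc_law: "distr gauss borel (dinc i m k) = distr std_normal_distribution borel (\<lambda>x. sqrt ((1 / 2) ^ m) * x)"
proof -
  interpret G: prob_space gauss by (rule prob_space_gauss)
  interpret N: prob_space "std_normal_distribution" by (rule real_distribution.axioms(1)[OF real_dist_normal_dist])
  show ?thesis
  proof (rule Levy_uniqueness)
    show "real_distribution (distr gauss borel (dinc i m k))" by (rule G.real_distribution_distr) simp
    show "real_distribution (distr std_normal_distribution borel (\<lambda>x. sqrt ((1 / 2) ^ m) * x))"
      by (rule N.real_distribution_distr) simp
    show "char (distr gauss borel (dinc i m k)) = char (distr std_normal_distribution borel (\<lambda>x. sqrt ((1 / 2) ^ m) * x))"
    proof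
      fix t
      let ?u = "\<lambda>i' k'. if i' = i \<and> k' = k then t else (0::real)"
      have s1: "(\<Sum>i'<Suc i. \<Sum>k'<Suc k. ?u i' k' * F i' k') = t * F i k" for F
      proof -
        have "(\<Sum>i'<Suc i. \<Sum>k'<Suc k. ?u i' k' * F i' k') = (\<Sum>i'<Suc i. if i' = i then t * F i k else 0)"
          by (rule sum.cong) (auto simp: if_distrib[where f="\<lambda>x. x * _"] sum.delta cong: if_cong)
        then show ?thesis by (simp add: sum.delta)
      qed
      have s2: "(\<Sum>i'<Suc i. \<Sum>k'<Suc k. (?u i' k')\<^sup>2) = t\<^sup>2"
        using s1[of "?u"] by (simp add: power2_eq_square)
      have "char (distr gauss borel (dinc i m k)) t = (\<integral>\<omega>. cis (t * dinc i m k \<omega>) \<partial>gauss)"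
        unfolding char_def by (subst integral_distr) (auto simp: cis_conv_exp)
      also have "\<dots> = complex_of_real (exp (- (t\<^sup>2 / 2 ^ m) / 2))"
        using dinc_char[where u="?u" and K="Suc k" and m=m and d="Suc i"] unfolding s1 s2 .
      also have "\<dots> = char std_normal_distribution (sqrt ((1 / 2) ^ m) * t)"
        unfolding char_std_normal_distribution by (simp add: power_mult_distrib power_one_over)
      also have "\<dots> = char (distr std_normal_distribution borel (\<lambda>x. sqrt ((1 / 2) ^ m) * x)) t"
        unfolding char_def by (subst integral_distr) (auto simp: mult_ac)
      finally show "char (distr gauss borel (dinc i m k)) t = char (distr std_normal_distribution borel (\<lambda>x. sqrt ((1 / 2) ^ m) * x)) t" .
    qed
  qed
qed

lemma dinc_fourth: "(\<integral>\<omega>. (dinc i m k \<omega>) ^ 4 \<partial>gauss) = 3 / 4 ^ m" "integrable gauss (\<lambda>\<omega>. (dinc i m k \<omega>) ^ 4)"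
proof -
  have s4: "(sqrt ((1 / 2) ^ m)) ^ 4 = (1 / 4 :: real) ^ m"
  proof -
    have "(sqrt ((1 / 2) ^ m)) ^ 4 = ((sqrt ((1 / 2) ^ m))\<^sup>2)\<^sup>2" by (simp only: power2_eq_square power4_eq_xxxx mult.assoc)
    also have "\<dots> = ((1 / 2 :: real) ^ m)\<^sup>2" by (subst real_sqrt_pow2) auto
    also have "\<dots> = (1 / 4) ^ m" by (simp add: power2_eq_square power_mult_distrib[symmetric])
    finally show ?thesis .
  qed
  have "(\<integral>\<omega>. (dinc i m k \<omega>) ^ 4 \<partial>gauss) = (\<integral>x. x ^ 4 \<partial>distr gauss borel (dinc i m k))"
    by (subst integral_distr) auto
  also have "\<dots> = (\<integral>x. (sqrt ((1 / 2) ^ m) * x) ^ 4 \<partial>std_normal_distribution)"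
    unfolding dinc_law by (subst integral_distr) auto
  also have "\<dots> = (1 / 4) ^ m * (\<integral>x. x ^ (2 * 2) \<partial>std_normal_distribution)"
    unfolding power_mult_distrib s4 by simp
  also have "\<dots> = 3 / 4 ^ m"
    unfolding std_normal_distribution_even_moments(1) by (simp add: fact_numeral power_one_over)
  finally show "(\<integral>\<omega>. (dinc i m k \<omega>) ^ 4 \<partial>gauss) = 3 / 4 ^ m" .
  have "integrable std_normal_distribution (\<lambda>x. (sqrt ((1 / 2) ^ m) * x) ^ 4)"
    unfolding power_mult_distrib by (intro integrable_mult_right integrable_std_normal_distribution_moment)
  then have "integrable (distr gauss borel (dinc i m k)) (\<lambda>x. x ^ 4)"
    unfolding dinc_law by (subst integrable_distr_eq) auto
  then show "integrable gauss (\<lambda>\<omega>. (dinc i m k \<omega>) ^ 4)"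
    by (subst (asm) integrable_distr_eq) auto
qed

definition dpath :: "nat \<Rightarrow> nat \<Rightarrow> real \<Rightarrow> (nat \<Rightarrow> real) \<Rightarrow> real" where
  "dpath i m t \<omega> = (\<Sum>k<nat \<lfloor>2 ^ m * t\<rfloor>. dinc i m k \<omega>)"

text \<open>The rate 9/10 can be any number r with 1/2 < r^4 < 1: the fourth moment of a dyadic increment of level m is
  3/4^m and there are about 2^m of them per unit of time.\<close>

definition bmgood :: "(nat \<Rightarrow> real) set" where
  "bmgood = {\<omega>\<in>space gauss. \<forall>i. \<forall>T::nat. eventually (\<lambda>m. \<forall>k<T * 2 ^ m. \<bar>dinc i m k \<omega>\<bar> \<le> (9 / 10) ^ m) sequentially}"

text \<open>The value 0 outside \<open>bmgood\<close> makes every path continuous and not only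
  almost every one, so pathwise arguments about \<open>bm\<close> have no exceptional set.\<close>

definition bm :: "real \<Rightarrow> (nat \<Rightarrow> real) \<Rightarrow> nat \<Rightarrow> real" where
  "bm t \<omega> i = (if \<omega> \<in> bmgood then lim (\<lambda>m. dpath i m t \<omega>) else 0)"

lemma dpath_measurable [measurable]: "dpath i m t \<in> borel_measurable gauss"
proof -
  have "dpath i m t = (\<lambda>\<omega>. \<Sum>k<nat \<lfloor>2 ^ m * t\<rfloor>. dinc i m k \<omega>)" by (rule ext) (simp add: dpath_def)
  then show ?thesis by simp
qed

lemma bmgood_measurable [measurable]: "bmgood \<in> sets gauss"
  unfolding bmgood_def eventually_sequentially by measurable

lemma bm_measurable [measurable]: "(\<lambda>\<omega>. bm t \<omega> i) \<in> borel_measurable gauss"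
  unfolding bm_def by measurable

text \<open>Markov's inequality for the fourth moment: (1/4) / (9/10)^4 = 2500/6561, and the 2^m
  intervals per unit of time turn this into 5000/6561 < 1, which is summable, so Borel-Cantelli
  applies.\<close>

lemma AE_bmgood: "AE \<omega> in gauss. \<omega> \<in> bmgood"
proof -
  interpret G: prob_space gauss by (rule prob_space_gauss)
  have "AE \<omega> in gauss. eventually (\<lambda>m. \<omega> \<in> space gauss - {\<omega>\<in>space gauss. \<exists>k<T * 2 ^ m. \<bar>dinc i m k \<omega>\<bar> > (9 / 10) ^ m}) sequentially" for i T
  proof (rule borel_cantelli_AE1)
    let ?A = "\<lambda>m. {\<omega>\<in>space gauss. \<exists>k<T * 2 ^ m. \<bar>dinc i m k \<omega>\<bar> > (9 / 10) ^ m}"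
    show meas: "?A m \<in> sets gauss" for m by measurable
    show "emeasure gauss (?A m) < \<infinity>" for m by (simp add: G.emeasure_eq_measure)
    have one: "measure gauss {\<omega>\<in>space gauss. \<bar>dinc i m k \<omega>\<bar> > (9 / 10) ^ m} \<le> 3 * (2500 / 6561) ^ m" for m k
    proof -
      have "measure gauss {\<omega>\<in>space gauss. \<bar>dinc i m k \<omega>\<bar> > (9 / 10) ^ m} \<le> measure gauss {\<omega>\<in>space gauss. (dinc i m k \<omega>) ^ 4 \<ge> ((9 / 10) ^ m) ^ 4}"
      proof (rule G.finite_measure_mono)
        show "{\<omega>\<in>space gauss. \<bar>dinc i m k \<omega>\<bar> > (9 / 10) ^ m} \<subseteq> {\<omega>\<in>space gauss. (dinc i m k \<omega>) ^ 4 \<ge> ((9 / 10) ^ m) ^ 4}"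
        proof safe
          fix \<omega> assume "\<bar>dinc i m k \<omega>\<bar> > (9 / 10) ^ m"
          then have "((9 / 10) ^ m) ^ 4 \<le> \<bar>dinc i m k \<omega>\<bar> ^ 4" by (intro power_mono) auto
          then show "((9 / 10) ^ m) ^ 4 \<le> dinc i m k \<omega> ^ 4" by (simp add: power_even_abs)
        qed
      qed measurable
      also have "\<dots> \<le> (\<integral>\<omega>. (dinc i m k \<omega>) ^ 4 \<partial>gauss) / ((9 / 10) ^ m) ^ 4"
        by (rule integral_Markov_inequality_measure[where A="{}"]) (auto simp: dinc_fourth)
      also have "\<dots> = 3 * (2500 / 6561) ^ m"
      proof -
        have "((9 / 10 :: real) ^ m) ^ 4 = (6561 / 10000) ^ m" by (simp only: power_mult[symmetric] mult.commute[of m]) (simp add: power_mult power_divide)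
        moreover have "(10000 :: real) ^ m = 4 ^ m * 2500 ^ m" by (simp add: power_mult_distrib[symmetric])
        ultimately show ?thesis unfolding dinc_fourth by (simp add: power_divide)
      qed
      finally show ?thesis .
    qed
    have bound: "measure gauss (?A m) \<le> real T * 3 * (5000 / 6561) ^ m" for m
    proof -
      have e: "?A m = (\<Union>k<T * 2 ^ m. {\<omega>\<in>space gauss. \<bar>dinc i m k \<omega>\<bar> > (9 / 10) ^ m})" by auto
      have "measure gauss (?A m) \<le> (\<Sum>k<T * 2 ^ m. measure gauss {\<omega>\<in>space gauss. \<bar>dinc i m k \<omega>\<bar> > (9 / 10) ^ m})"
        unfolding e by (rule G.finite_measure_subadditive_finite) auto
      also have "\<dots> \<le> (\<Sum>k<T * 2 ^ m. 3 * (2500 / 6561) ^ m)" by (rule sum_mono) (rule one)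
      also have "\<dots> = real T * 3 * (2 ^ m * (2500 / 6561) ^ m)" by simp
      also have "2 ^ m * (2500 / 6561 :: real) ^ m = (5000 / 6561) ^ m" by (simp add: power_mult_distrib[symmetric])
      finally show ?thesis .
    qed
    show "summable (\<lambda>m. measure gauss (?A m))"
      by (rule summable_comparison_test[where g="\<lambda>m. real T * 3 * (5000 / 6561) ^ m"])
         (use bound in \<open>auto intro!: summable_mult summable_geometric\<close>)
  qed
  then have "AE \<omega> in gauss. \<forall>i. \<forall>T. eventually (\<lambda>m. \<omega> \<in> space gauss - {\<omega>\<in>space gauss. \<exists>k<T * 2 ^ m. \<bar>dinc i m k \<omega>\<bar> > (9 / 10) ^ m}) sequentially"
    by (simp add: AE_all_countable)
  then show ?thesis
    using AE_space
  proof eventually_elim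
    case (elim \<omega>)
    show ?case unfolding bmgood_def
    proof (safe)
      fix i T show "eventually (\<lambda>m. \<forall>k<T * 2 ^ m. \<bar>dinc i m k \<omega>\<bar> \<le> (9 / 10) ^ m) sequentially"
        using elim(1)[rule_format, of T i] by eventually_elim (auto simp: not_less, meson not_le)
    qed (use elim in auto)
  qed
qed

text \<open>At a fixed time consecutive levels differ by at most one increment of the finer level,
  and at times closer than 2^-m the path of level m differs by at most one increment. The factor 10
  = 1 / (1 - 9/10) bounds the geometric series.\<close>

lemma dpath_good:
  assumes \<omega>: "\<omega> \<in> bmgood"
  shows "\<exists>M. \<forall>m\<ge>M. (\<forall>t. 0 \<le> t \<longrightarrow> t \<le> real T \<longrightarrow> \<bar>bm t \<omega> i - dpath i m t \<omega>\<bar> \<le> 10 * (9 / 10) ^ m) \<and>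
      (\<forall>s t. 0 \<le> s \<longrightarrow> s \<le> t \<longrightarrow> t \<le> real T \<longrightarrow> t - s < 1 / 2 ^ m \<longrightarrow> \<bar>dpath i m t \<omega> - dpath i m s \<omega>\<bar> \<le> (9 / 10) ^ m)"
    and "0 \<le> t \<Longrightarrow> (\<lambda>m. dpath i m t \<omega>) \<longlonglongrightarrow> bm t \<omega> i"
proof -
  have A: "\<exists>M. \<forall>m\<ge>M. (\<forall>t. 0 \<le> t \<longrightarrow> t \<le> real T \<longrightarrow> (\<lambda>m. dpath i m t \<omega>) \<longlonglongrightarrow> bm t \<omega> i \<and> \<bar>bm t \<omega> i - dpath i m t \<omega>\<bar> \<le> 10 * (9 / 10) ^ m) \<and>
      (\<forall>s t. 0 \<le> s \<longrightarrow> s \<le> t \<longrightarrow> t \<le> real T \<longrightarrow> t - s < 1 / 2 ^ m \<longrightarrow> \<bar>dpath i m t \<omega> - dpath i m s \<omega>\<bar> \<le> (9 / 10) ^ m)" for T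
  proof -
    have "eventually (\<lambda>m. \<forall>k<T * 2 ^ m. \<bar>dinc i m k \<omega>\<bar> \<le> (9 / 10) ^ m) sequentially"
      using \<omega> by (simp add: bmgood_def)
    then obtain M where M: "\<And>m k. m \<ge> M \<Longrightarrow> k < T * 2 ^ m \<Longrightarrow> \<bar>dinc i m k \<omega>\<bar> \<le> (9 / 10) ^ m"
      unfolding eventually_sequentially by blast
    have step: "\<bar>dpath i (Suc m) t \<omega> - dpath i m t \<omega>\<bar> \<le> (9 / 10) ^ Suc m" if m: "m \<ge> M" and t: "0 \<le> t" "t \<le> real T" for m t
    proof -
      define n where "n = nat \<lfloor>2 ^ m * t\<rfloor>"
      define n' where "n' = nat \<lfloor>2 ^ Suc m * t\<rfloor>"
      have "0 \<le> 2 ^ m * t" using t by simp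
      then have n: "real n \<le> 2 ^ m * t" "2 ^ m * t < real n + 1" unfolding n_def by linarith+
      have "0 \<le> 2 ^ Suc m * t" using t by simp
      then have n': "real n' \<le> 2 ^ Suc m * t" "2 ^ Suc m * t < real n' + 1" unfolding n'_def by linarith+
      \<comment> \<open>In the odd case the finer path has one more increment, the left half of the
        parent interval that contains t.\<close>
      have cases: "n' = 2 * n \<or> n' = Suc (2 * n)" using n n' by simp linarith
      have d2: "(\<Sum>k<2 * n. dinc i (Suc m) k \<omega>) = (\<Sum>k<n. dinc i m k \<omega>)"
        unfolding sum_double dinc_split ..
      show ?thesis
      proof (cases "n' = 2 * n")
        case True
        then show ?thesis using d2 unfolding dpath_def n_def[symmetric] n'_def[symmetric] by (simp del: dinc.simps)
      next
        case False
        with cases have e: "n' = Suc (2 * n)" by simp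
        have "real n' \<le> 2 ^ Suc m * real T" by (rule order_trans[OF n'(1) mult_left_mono[OF t(2)]]) simp
        then have "real n' \<le> real (T * 2 ^ Suc m)" by (simp add: mult.commute)
        then have "2 * n < T * 2 ^ Suc m" using e by (simp only: of_nat_le_iff)
        then have "\<bar>dinc i (Suc m) (2 * n) \<omega>\<bar> \<le> (9 / 10) ^ Suc m" using m by (intro M) auto
        moreover have "dpath i (Suc m) t \<omega> - dpath i m t \<omega> = dinc i (Suc m) (2 * n) \<omega>"
          unfolding dpath_def n_def[symmetric] n'_def[symmetric] e using d2 by (simp del: dinc.simps power_Suc)
        ultimately show ?thesis by (simp del: dinc.simps)
      qed
    qed
    have tele: "\<bar>dpath i (m + p) t \<omega> - dpath i m t \<omega>\<bar> \<le> 10 * ((9 / 10) ^ m - (9 / 10) ^ (m + p))"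
      if "m \<ge> M" "0 \<le> t" "t \<le> real T" for m t p
    proof (induction p)
      case (Suc p)
      have "\<bar>dpath i (Suc (m + p)) t \<omega> - dpath i (m + p) t \<omega>\<bar> \<le> (9 / 10) ^ Suc (m + p)" by (rule step) (use that in auto)
      moreover have "(9 / 10 :: real) ^ Suc (m + p) \<le> 10 * ((9 / 10) ^ (m + p) - (9 / 10) ^ Suc (m + p))" by simp
      moreover have "\<bar>dpath i (Suc (m + p)) t \<omega> - dpath i m t \<omega>\<bar> \<le> \<bar>dpath i (Suc (m + p)) t \<omega> - dpath i (m + p) t \<omega>\<bar> + \<bar>dpath i (m + p) t \<omega> - dpath i m t \<omega>\<bar>"
        using abs_triangle_ineq[of "dpath i (Suc (m + p)) t \<omega> - dpath i (m + p) t \<omega>" "dpath i (m + p) t \<omega> - dpath i m t \<omega>"] by simp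
      ultimately show ?case using Suc.IH unfolding add_Suc_right right_diff_distrib by linarith
    qed simp
    have lim: "(\<lambda>m. dpath i m t \<omega>) \<longlonglongrightarrow> bm t \<omega> i" if t: "0 \<le> t" "t \<le> real T" for t
    proof -
      have "Cauchy (\<lambda>m. dpath i m t \<omega>)"
      proof (rule metric_CauchyI)
        fix e :: real assume e: "e > 0"
        have "(\<lambda>m. 10 * (9 / 10 :: real) ^ m) \<longlonglongrightarrow> 0" by (intro tendsto_mult_right_zero LIMSEQ_power_zero) simp
        then have "eventually (\<lambda>m. 10 * (9 / 10 :: real) ^ m < e / 2) sequentially" by (rule order_tendstoD) (use e in simp)
        then obtain N where N: "\<And>m. m \<ge> N \<Longrightarrow> 10 * (9 / 10 :: real) ^ m < e / 2" unfolding eventually_sequentially by blast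
        let ?N = "max M N"
        have "\<bar>dpath i m t \<omega> - dpath i ?N t \<omega>\<bar> < e / 2" if m: "m \<ge> ?N" for m
        proof -
          have "\<bar>dpath i (?N + (m - ?N)) t \<omega> - dpath i ?N t \<omega>\<bar> \<le> 10 * ((9 / 10) ^ ?N - (9 / 10) ^ (?N + (m - ?N)))"
            by (rule tele) (use t in auto)
          also have "\<dots> \<le> 10 * (9 / 10) ^ ?N" by simp
          also have "\<dots> < e / 2" by (rule N) simp
          finally show ?thesis using m by simp
        qed
        then have "dist (dpath i m t \<omega>) (dpath i n t \<omega>) < e" if "m \<ge> ?N" "n \<ge> ?N" for m n
          unfolding dist_real_def using that by (smt (verit) field_sum_of_halves)
        then show "\<exists>M. \<forall>m\<ge>M. \<forall>n\<ge>M. dist (dpath i m t \<omega>) (dpath i n t \<omega>) < e" by blast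
      qed
      then have "convergent (\<lambda>m. dpath i m t \<omega>)" by (rule Cauchy_convergent)
      then show ?thesis using \<omega> by (simp add: bm_def convergent_LIMSEQ_iff)
    qed
    have app: "\<bar>bm t \<omega> i - dpath i m t \<omega>\<bar> \<le> 10 * (9 / 10) ^ m" if "m \<ge> M" and t: "0 \<le> t" "t \<le> real T" for m t
    proof (rule LIMSEQ_le_const2)
      show "(\<lambda>p. \<bar>dpath i (p + m) t \<omega> - dpath i m t \<omega>\<bar>) \<longlonglongrightarrow> \<bar>bm t \<omega> i - dpath i m t \<omega>\<bar>"
        by (intro tendsto_rabs tendsto_diff tendsto_const LIMSEQ_ignore_initial_segment lim t)
      show "\<exists>N. \<forall>p\<ge>N. \<bar>dpath i (p + m) t \<omega> - dpath i m t \<omega>\<bar> \<le> 10 * (9 / 10) ^ m"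
      proof (intro exI allI impI)
        fix p
        have "\<bar>dpath i (m + p) t \<omega> - dpath i m t \<omega>\<bar> \<le> 10 * ((9 / 10) ^ m - (9 / 10) ^ (m + p))" by (rule tele) (use that in auto)
        also have "\<dots> \<le> 10 * (9 / 10) ^ m" by simp
        finally show "\<bar>dpath i (p + m) t \<omega> - dpath i m t \<omega>\<bar> \<le> 10 * (9 / 10) ^ m" by (simp add: add.commute)
      qed
    qed
    have osc: "\<bar>dpath i m t \<omega> - dpath i m s \<omega>\<bar> \<le> (9 / 10) ^ m"
      if m: "m \<ge> M" and st: "0 \<le> s" "s \<le> t" "t \<le> real T" "t - s < 1 / 2 ^ m" for m s t
    proof -
      define n where "n = nat \<lfloor>2 ^ m * s\<rfloor>"
      define n' where "n' = nat \<lfloor>2 ^ m * t\<rfloor>"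
      have "0 \<le> 2 ^ m * s" "0 \<le> 2 ^ m * t" using st by simp_all
      then have n: "real n \<le> 2 ^ m * s" "2 ^ m * s < real n + 1" "real n' \<le> 2 ^ m * t" "2 ^ m * t < real n' + 1"
        unfolding n_def n'_def by linarith+
      have le: "2 ^ m * s \<le> 2 ^ m * t" using st by simp
      have lt: "2 ^ m * t < 2 ^ m * s + 1" using st by (simp add: field_simps)
      have cases: "n' = n \<or> n' = Suc n" using n le lt by linarith
      show ?thesis
      proof (cases "n' = n")
        case True
        then show ?thesis by (simp add: dpath_def n_def[symmetric] n'_def[symmetric])
      next
        case False
        with cases have e: "n' = Suc n" by simp
        have "real n' \<le> 2 ^ m * real T" by (rule order_trans[OF n(3) mult_left_mono[OF st(3)]]) simp
        then have "real n' \<le> real (T * 2 ^ m)" by (simp add: mult.commute)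
        then have "n < T * 2 ^ m" using e by (simp only: of_nat_le_iff)
        then have "\<bar>dinc i m n \<omega>\<bar> \<le> (9 / 10) ^ m" using m by (intro M) auto
        then show ?thesis unfolding dpath_def n_def[symmetric] n'_def[symmetric] e by simp
      qed
    qed
    show ?thesis using lim app osc by blast
  qed
  show "\<exists>M. \<forall>m\<ge>M. (\<forall>t. 0 \<le> t \<longrightarrow> t \<le> real T \<longrightarrow> \<bar>bm t \<omega> i - dpath i m t \<omega>\<bar> \<le> 10 * (9 / 10) ^ m) \<and>
      (\<forall>s t. 0 \<le> s \<longrightarrow> s \<le> t \<longrightarrow> t \<le> real T \<longrightarrow> t - s < 1 / 2 ^ m \<longrightarrow> \<bar>dpath i m t \<omega> - dpath i m s \<omega>\<bar> \<le> (9 / 10) ^ m)"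
    using A[of T] by blast
  show "(\<lambda>m. dpath i m t \<omega>) \<longlonglongrightarrow> bm t \<omega> i" if "0 \<le> t"
    using A[of "nat \<lceil>t\<rceil>"] real_nat_ceiling_ge[of t] that by blast
qed

lemma bm_continuous: "continuous_on {0..} (\<lambda>t. bm t \<omega> i)"
proof (cases "\<omega> \<in> bmgood")
  case True
  show ?thesis unfolding continuous_on_iff dist_real_def
  proof (intro ballI allI impI)
    fix t e :: real assume t: "t \<in> {0..}" and e: "e > 0"
    define T where "T = nat \<lceil>t + 1\<rceil>"
    have T: "t + 1 \<le> real T" unfolding T_def by (rule real_nat_ceiling_ge)
    from dpath_good(1)[OF True, of T i] obtain M where
      M1: "\<And>m t. m \<ge> M \<Longrightarrow> 0 \<le> t \<Longrightarrow> t \<le> real T \<Longrightarrow> \<bar>bm t \<omega> i - dpath i m t \<omega>\<bar> \<le> 10 * (9 / 10) ^ m" and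
      M2: "\<And>m s t. m \<ge> M \<Longrightarrow> 0 \<le> s \<Longrightarrow> s \<le> t \<Longrightarrow> t \<le> real T \<Longrightarrow> t - s < 1 / 2 ^ m \<Longrightarrow> \<bar>dpath i m t \<omega> - dpath i m s \<omega>\<bar> \<le> (9 / 10) ^ m"
      by blast
    \<comment> \<open>21 = 10 + 10 + 1: two approximation errors and one oscillation.\<close>
    have "(\<lambda>m. 21 * (9 / 10 :: real) ^ m) \<longlonglongrightarrow> 0" by (intro tendsto_mult_right_zero LIMSEQ_power_zero) simp
    then have "eventually (\<lambda>m. 21 * (9 / 10 :: real) ^ m < e) sequentially" by (rule order_tendstoD) (use e in simp)
    then obtain N where N: "\<And>m. m \<ge> N \<Longrightarrow> 21 * (9 / 10 :: real) ^ m < e" unfolding eventually_sequentially by blast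
    define m where "m = max M N"
    have m: "m \<ge> M" "21 * (9 / 10 :: real) ^ m < e" using N[of m] by (auto simp: m_def)
    have key: "\<bar>bm v \<omega> i - bm u \<omega> i\<bar> < e" if "0 \<le> u" "u \<le> v" "v \<le> t + 1" "v - u < 1 / 2 ^ m" for u v
    proof -
      have "\<bar>bm v \<omega> i - dpath i m v \<omega>\<bar> \<le> 10 * (9 / 10) ^ m" "\<bar>bm u \<omega> i - dpath i m u \<omega>\<bar> \<le> 10 * (9 / 10) ^ m"
        by (rule M1; use that m T in linarith)+
      moreover have "\<bar>dpath i m v \<omega> - dpath i m u \<omega>\<bar> \<le> (9 / 10) ^ m" by (rule M2) (use that m T in linarith)+
      ultimately show ?thesis using m(2) by linarith
    qed
    show "\<exists>d>0. \<forall>x'\<in>{0..}. \<bar>x' - t\<bar> < d \<longrightarrow> \<bar>bm x' \<omega> i - bm t \<omega> i\<bar> < e"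
    proof (intro exI[of _ "min 1 (1 / 2 ^ m)"] conjI ballI impI)
      fix s assume s: "s \<in> {0..}" "\<bar>s - t\<bar> < min 1 (1 / 2 ^ m)"
      have s': "\<bar>s - t\<bar> < 1" "\<bar>s - t\<bar> < 1 / 2 ^ m" using s(2)[unfolded min_less_iff_conj] by blast+
      show "\<bar>bm s \<omega> i - bm t \<omega> i\<bar> < e"
      proof (cases "s \<le> t")
        case True
        then have "\<bar>bm t \<omega> i - bm s \<omega> i\<bar> < e" using s t by (intro key) auto
        then show ?thesis by linarith
      next
        case False
        then show ?thesis by (intro key) (use s(1) s' t in auto)
      qed
    qed simp
  qed
qed (simp add: bm_def)

lemma bm_0: "bm 0 \<omega> i = 0"
  by (simp add: bm_def dpath_def limI)

text \<open>The covariance is that of independent Brownian motions at times rounded down to the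
  dyadic grid. The finite index set is arbitrary and may repeat times and coordinates, so that later
  proofs can mix past values and increments in one sum.\<close>

lemma dpath_char:
  fixes c :: "'a \<Rightarrow> real"
  assumes fin: "finite A"
  shows "(\<integral>\<omega>. cis (\<Sum>a\<in>A. c a * dpath (\<iota> a) m (\<tau> a) \<omega>) \<partial>gauss) =
     complex_of_real (exp (- (\<Sum>a\<in>A. \<Sum>b\<in>A. if \<iota> a = \<iota> b then c a * c b * (real (min (nat \<lfloor>2 ^ m * \<tau> a\<rfloor>) (nat \<lfloor>2 ^ m * \<tau> b\<rfloor>)) / 2 ^ m) else 0) / 2))"
proof -
  define n where "n a = nat \<lfloor>2 ^ m * \<tau> a\<rfloor>" for a
  obtain d where d: "\<And>a. a \<in> A \<Longrightarrow> \<iota> a < d"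
    using finite_nat_set_iff_bounded[of "\<iota> ` A"] fin by auto
  obtain K where K: "\<And>a. a \<in> A \<Longrightarrow> n a < K"
    using finite_nat_set_iff_bounded[of "n ` A"] fin by auto
  define e where "e i k a = (if \<iota> a = i \<and> k < n a then c a else 0)" for i k a
  define u where "u i k = (\<Sum>a\<in>A. e i k a)" for i k
  have lin: "(\<Sum>a\<in>A. c a * dpath (\<iota> a) m (\<tau> a) \<omega>) = (\<Sum>i<d. \<Sum>k<K. u i k * dinc i m k \<omega>)" for \<omega>
  proof -
    have "c a * dpath (\<iota> a) m (\<tau> a) \<omega> = (\<Sum>i<d. \<Sum>k<K. e i k a * dinc i m k \<omega>)" if a: "a \<in> A" for a
    proof -
      have "(\<Sum>i<d. \<Sum>k<K. e i k a * dinc i m k \<omega>) = (\<Sum>k<K. e (\<iota> a) k a * dinc (\<iota> a) m k \<omega>)"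
        by (subst sum.remove[of _ "\<iota> a"]) (use d[OF a] in \<open>auto simp: e_def intro!: sum.neutral\<close>)
      also have "\<dots> = (\<Sum>k<n a. c a * dinc (\<iota> a) m k \<omega>)"
        by (rule sum.mono_neutral_cong_right) (use K[OF a] in \<open>auto simp: e_def\<close>)
      finally show ?thesis by (simp add: dpath_def n_def sum_distrib_left)
    qed
    then have "(\<Sum>a\<in>A. c a * dpath (\<iota> a) m (\<tau> a) \<omega>) = (\<Sum>a\<in>A. \<Sum>i<d. \<Sum>k<K. e i k a * dinc i m k \<omega>)" by simp
    also have "\<dots> = (\<Sum>i<d. \<Sum>a\<in>A. \<Sum>k<K. e i k a * dinc i m k \<omega>)" by (rule sum.swap)
    also have "\<dots> = (\<Sum>i<d. \<Sum>k<K. \<Sum>a\<in>A. e i k a * dinc i m k \<omega>)" by (intro sum.cong sum.swap refl)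
    finally show ?thesis by (simp add: u_def sum_distrib_right)
  qed
  have sq: "(\<Sum>i<d. \<Sum>k<K. (u i k)\<^sup>2) = (\<Sum>a\<in>A. \<Sum>b\<in>A. if \<iota> a = \<iota> b then c a * c b * real (min (n a) (n b)) else 0)"
  proof -
    have "(\<Sum>i<d. \<Sum>k<K. (u i k)\<^sup>2) = (\<Sum>i<d. \<Sum>k<K. \<Sum>a\<in>A. \<Sum>b\<in>A. e i k a * e i k b)"
      by (simp add: u_def power2_eq_square sum_product)
    also have "\<dots> = (\<Sum>i<d. \<Sum>a\<in>A. \<Sum>k<K. \<Sum>b\<in>A. e i k a * e i k b)" by (intro sum.cong sum.swap refl)
    also have "\<dots> = (\<Sum>i<d. \<Sum>a\<in>A. \<Sum>b\<in>A. \<Sum>k<K. e i k a * e i k b)" by (intro sum.cong sum.swap refl)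
    also have "\<dots> = (\<Sum>a\<in>A. \<Sum>i<d. \<Sum>b\<in>A. \<Sum>k<K. e i k a * e i k b)" by (rule sum.swap)
    also have "\<dots> = (\<Sum>a\<in>A. \<Sum>b\<in>A. \<Sum>i<d. \<Sum>k<K. e i k a * e i k b)" by (intro sum.cong sum.swap refl)
    also have "\<dots> = (\<Sum>a\<in>A. \<Sum>b\<in>A. if \<iota> a = \<iota> b then c a * c b * real (min (n a) (n b)) else 0)"
    proof (intro sum.cong refl)
      fix a b assume ab: "a \<in> A" "b \<in> A"
      have "(\<Sum>i<d. \<Sum>k<K. e i k a * e i k b) = (\<Sum>k<K. e (\<iota> a) k a * e (\<iota> a) k b)"
        by (subst sum.remove[of _ "\<iota> a"]) (use d[OF ab(1)] in \<open>auto simp: e_def intro!: sum.neutral\<close>)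
      also have "\<dots> = (if \<iota> a = \<iota> b then (\<Sum>k<min (n a) (n b). c a * c b) else 0)"
      proof (cases "\<iota> a = \<iota> b")
        case True
        have "(\<Sum>k<K. e (\<iota> a) k a * e (\<iota> a) k b) = (\<Sum>k<min (n a) (n b). c a * c b)"
          by (rule sum.mono_neutral_cong_right) (use K[OF ab(1)] True in \<open>auto simp: e_def\<close>)
        then show ?thesis using True by simp
      qed (simp add: e_def)
      finally show "(\<Sum>i<d. \<Sum>k<K. e i k a * e i k b) = (if \<iota> a = \<iota> b then c a * c b * real (min (n a) (n b)) else 0)" by simp
    qed
    finally show ?thesis .
  qed
  have "(\<Sum>i<d. \<Sum>k<K. (u i k)\<^sup>2) / 2 ^ m = (\<Sum>a\<in>A. \<Sum>b\<in>A. if \<iota> a = \<iota> b then c a * c b * (real (min (n a) (n b)) / 2 ^ m) else 0)"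
    unfolding sq sum_divide_distrib by (intro sum.cong refl) auto
  then show ?thesis unfolding lin dinc_char n_def by simp
qed

lemma bm_char:
  fixes c :: "'a \<Rightarrow> real"
  assumes fin: "finite A" and \<tau>: "\<And>a. a \<in> A \<Longrightarrow> 0 \<le> \<tau> a"
  shows "(\<integral>\<omega>. cis (\<Sum>a\<in>A. c a * bm (\<tau> a) \<omega> (\<iota> a)) \<partial>gauss) =
     complex_of_real (exp (- (\<Sum>a\<in>A. \<Sum>b\<in>A. if \<iota> a = \<iota> b then c a * c b * min (\<tau> a) (\<tau> b) else 0) / 2))"
proof (rule LIMSEQ_unique)
  interpret G: prob_space gauss by (rule prob_space_gauss)
  let ?L = "\<lambda>m. \<integral>\<omega>. cis (\<Sum>a\<in>A. c a * dpath (\<iota> a) m (\<tau> a) \<omega>) \<partial>gauss"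
  show "?L \<longlonglongrightarrow> (\<integral>\<omega>. cis (\<Sum>a\<in>A. c a * bm (\<tau> a) \<omega> (\<iota> a)) \<partial>gauss)"
  proof (rule integral_dominated_convergence[where w="\<lambda>_. 1"])
    show "AE \<omega> in gauss. (\<lambda>m. cis (\<Sum>a\<in>A. c a * dpath (\<iota> a) m (\<tau> a) \<omega>)) \<longlonglongrightarrow> cis (\<Sum>a\<in>A. c a * bm (\<tau> a) \<omega> (\<iota> a))"
      using AE_bmgood
      by eventually_elim (auto intro!: tendsto_cis tendsto_sum tendsto_mult_left dpath_good(2) \<tau>)
  qed auto
  have fl: "(\<lambda>m. real (nat \<lfloor>2 ^ m * t\<rfloor>) / 2 ^ m) \<longlonglongrightarrow> t" if t: "0 \<le> t" for t :: real
  proof (rule tendsto_sandwich)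
    have b: "real (nat \<lfloor>2 ^ m * t\<rfloor>) \<le> 2 ^ m * t" "2 ^ m * t - 1 \<le> real (nat \<lfloor>2 ^ m * t\<rfloor>)" for m
    proof -
      have "0 \<le> 2 ^ m * t" using t by simp
      then show "real (nat \<lfloor>2 ^ m * t\<rfloor>) \<le> 2 ^ m * t" "2 ^ m * t - 1 \<le> real (nat \<lfloor>2 ^ m * t\<rfloor>)" by linarith+
    qed
    show "eventually (\<lambda>m. real (nat \<lfloor>2 ^ m * t\<rfloor>) / 2 ^ m \<le> t) sequentially"
      using b(1) by (auto simp: divide_le_eq mult.commute)
    show "eventually (\<lambda>m. t - (1 / 2) ^ m \<le> real (nat \<lfloor>2 ^ m * t\<rfloor>) / 2 ^ m) sequentially"
    proof (intro always_eventually allI)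
      fix m
      have "t - (1 / 2) ^ m = (2 ^ m * t - 1) / 2 ^ m" by (simp add: field_simps power_one_over)
      also have "\<dots> \<le> real (nat \<lfloor>2 ^ m * t\<rfloor>) / 2 ^ m" by (intro divide_right_mono b) auto
      finally show "t - (1 / 2) ^ m \<le> real (nat \<lfloor>2 ^ m * t\<rfloor>) / 2 ^ m" .
    qed
    have "(\<lambda>m. t - (1 / 2 :: real) ^ m) \<longlonglongrightarrow> t - 0" by (intro tendsto_intros LIMSEQ_power_zero) simp
    then show "(\<lambda>m. t - (1 / 2 :: real) ^ m) \<longlonglongrightarrow> t" by simp
  qed simp
  have mn: "real (min p q) / 2 ^ m = min (real p / 2 ^ m) (real q / 2 ^ m)" for p q m
    by (simp add: min_def divide_le_cancel)
  show "?L \<longlonglongrightarrow> complex_of_real (exp (- (\<Sum>a\<in>A. \<Sum>b\<in>A. if \<iota> a = \<iota> b then c a * c b * min (\<tau> a) (\<tau> b) else 0) / 2))"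
    unfolding dpath_char[OF fin] mn
  proof (intro tendsto_of_real tendsto_exp tendsto_divide tendsto_minus tendsto_sum tendsto_const)
    fix a b assume "a \<in> A" "b \<in> A"
    then have "(\<lambda>m. c a * c b * min (real (nat \<lfloor>2 ^ m * \<tau> a\<rfloor>) / 2 ^ m) (real (nat \<lfloor>2 ^ m * \<tau> b\<rfloor>) / 2 ^ m)) \<longlonglongrightarrow> c a * c b * min (\<tau> a) (\<tau> b)"
      by (intro tendsto_mult_left tendsto_min fl \<tau>)
    then show "(\<lambda>m. if \<iota> a = \<iota> b then c a * c b * min (real (nat \<lfloor>2 ^ m * \<tau> a\<rfloor>) / 2 ^ m) (real (nat \<lfloor>2 ^ m * \<tau> b\<rfloor>) / 2 ^ m) else 0)
       \<longlonglongrightarrow> (if \<iota> a = \<iota> b then c a * c b * min (\<tau> a) (\<tau> b) else 0)" by simp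
  qed simp
qed

section \<open>Reflection of paths with jumps; measurability of the reflection\<close>

lemma regul1_jump:
  assumes y: "\<And>s t. 0 \<le> s \<Longrightarrow> 0 \<le> t \<Longrightarrow> {r\<in>J. r \<le> s} = {r\<in>J. r \<le> t} \<Longrightarrow> y s = y t"
    and st: "0 \<le> s" "0 \<le> t" "{r\<in>J. r \<le> s} = {r\<in>J. r \<le> t}"
  shows "regul1 y s = regul1 y t"
proof -
  \<comment> \<open>A time in (a, b] has the same jumps behind it as a, so the longer interval
    contributes no new values.\<close>
  have *: "(\<lambda>r. max 0 (- y r)) ` {0..a} = (\<lambda>r. max 0 (- y r)) ` {0..b}"
    if ab: "0 \<le> a" "a \<le> b" "{r\<in>J. r \<le> a} = {r\<in>J. r \<le> b}" for a b
  proof (intro antisym subsetI)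
    fix z assume "z \<in> (\<lambda>r. max 0 (- y r)) ` {0..b}"
    then obtain r where r: "0 \<le> r" "r \<le> b" "z = max 0 (- y r)" by auto
    show "z \<in> (\<lambda>r. max 0 (- y r)) ` {0..a}"
    proof (cases "r \<le> a")
      case False
      have "{q\<in>J. q \<le> r} = {q\<in>J. q \<le> a}" using ab r False by (auto intro: order_trans)
      then have "y r = y a" using y[of r a] r ab by simp
      then show ?thesis using r ab by auto
    qed (use r in auto)
  qed (use ab in auto)
  show ?thesis
  proof (cases "s \<le> t")
    case True
    then show ?thesis using *[of s t] st by (simp add: regul1_def)
  next
    case False
    then show ?thesis using *[of t s] st by (simp add: regul1_def)
  qed
qed

lemma regul_jump:
  assumes x: "\<And>s t. 0 \<le> s \<Longrightarrow> 0 \<le> t \<Longrightarrow> {r\<in>J. r \<le> s} = {r\<in>J. r \<le> t} \<Longrightarrow> x s = x t"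
  shows "0 \<le> s \<Longrightarrow> 0 \<le> t \<Longrightarrow> {r\<in>J. r \<le> s} = {r\<in>J. r \<le> t} \<Longrightarrow> regul x i s = regul x i t"
proof (induction i arbitrary: s t)
  case 0
  have e: "x s 0 = x t 0" if "0 \<le> s" "0 \<le> t" "{r\<in>J. r \<le> s} = {r\<in>J. r \<le> t}" for s t
    using x[OF that] by simp
  show ?case unfolding regul.simps by (rule regul1_jump[OF e 0])
next
  case (Suc i)
  have e: "x s (Suc i) - regul x i s = x t (Suc i) - regul x i t"
    if "0 \<le> s" "0 \<le> t" "{r\<in>J. r \<le> s} = {r\<in>J. r \<le> t}" for s t
    using Suc.IH[OF that] x[OF that] by simp
  show ?case unfolding regul.simps by (rule regul1_jump[OF e Suc.prems])
qed

lemma reflmap_jump: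
  assumes x: "\<And>s t. 0 \<le> s \<Longrightarrow> 0 \<le> t \<Longrightarrow> {r\<in>J. r \<le> s} = {r\<in>J. r \<le> t} \<Longrightarrow> x s = x t"
    and st: "0 \<le> s" "0 \<le> t" "{r\<in>J. r \<le> s} = {r\<in>J. r \<le> t}"
  shows "reflmap x s = reflmap x t"
proof
  fix i
  have "regul x j s = regul x j t" for j by (rule regul_jump[OF x st])
  then show "reflmap x s i = reflmap x t i" by (simp add: reflmap_def x[OF st])
qed

lemma reflmap_lu_conv:
  assumes lu: "lu_conv m xs x" and b: "\<And>T i. i < m \<Longrightarrow> bdd_on T (\<lambda>s. x s i)"
  shows "lu_conv m (\<lambda>k. reflmap (xs k)) (reflmap x)"
  unfolding lu_conv_def
proof (intro allI impI)
  fix T \<epsilon> :: real assume T: "T > 0" and e: "\<epsilon> > 0"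
  let ?e = "\<epsilon> / (2 * real m + 2)"
  have e': "?e > 0" using e by simp
  have "eventually (\<lambda>k. \<forall>t\<in>{0..T}. \<forall>i<m. \<bar>xs k t i - x t i\<bar> \<le> ?e) sequentially"
    using lu T e' unfolding lu_conv_def by blast
  then show "eventually (\<lambda>k. \<forall>t\<in>{0..T}. \<forall>i<m. \<bar>reflmap (xs k) t i - reflmap x t i\<bar> \<le> \<epsilon>) sequentially"
  proof eventually_elim
    case (elim k)
    show ?case
    proof (intro ballI allI impI)
      fix t i assume t: "t \<in> {0..T}" and i: "i < m"
      have "\<bar>reflmap (xs k) t i - reflmap x t i\<bar> \<le> (2 * real i + 2) * ?e"
        by (rule reflmap_diff[where T=T]) (use b elim t i in auto)
      also have "\<dots> \<le> (2 * real m + 2) * ?e" using i e' by (intro mult_right_mono) auto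
      also have "\<dots> = \<epsilon>" by (simp add: field_simps add_pos_nonneg)
      finally show "\<bar>reflmap (xs k) t i - reflmap x t i\<bar> \<le> \<epsilon>" .
    qed
  qed
qed

lemma reflmap_stepf_Dspace:
  assumes k: "k > 0" shows "reflmap (stepf m k v) \<in> Dspace m'"
proof (rule jump_Dspace)
  let ?J = "(\<lambda>l. real l / real k) ` {1..k\<^sup>2}"
  show "finite {s\<in>?J. s \<le> T}" for T by simp
  fix s t :: real assume "0 \<le> s" "0 \<le> t" "{r\<in>?J. r \<le> s} = {r\<in>?J. r \<le> t}"
  then show "reflmap (stepf m k v) s = reflmap (stepf m k v) t"
    by (rule reflmap_jump[rotated]) (rule stepf_jump[OF k])
qed

text \<open>Right continuity is what counting paths and Brownian paths share, and it is enough to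
  reduce a running supremum to countably many times.\<close>

definition rcont :: "(real \<Rightarrow> real) \<Rightarrow> bool" where
  "rcont y \<longleftrightarrow> (\<forall>t\<ge>0. \<forall>e>0. \<exists>\<delta>>0. \<forall>s. t \<le> s \<longrightarrow> s < t + \<delta> \<longrightarrow> \<bar>y s - y t\<bar> < e)"

lemma continuous_rcont: "continuous_on {0..} y \<Longrightarrow> rcont y"
  unfolding rcont_def continuous_on_iff dist_real_def
proof (intro allI impI)
  fix t e :: real assume c: "\<forall>x\<in>{0..}. \<forall>e>0. \<exists>d>0. \<forall>x'\<in>{0..}. \<bar>x' - x\<bar> < d \<longrightarrow> \<bar>y x' - y x\<bar> < e" and t: "0 \<le> t" "0 < e"
  then obtain d where "d > 0" "\<And>s. 0 \<le> s \<Longrightarrow> \<bar>s - t\<bar> < d \<Longrightarrow> \<bar>y s - y t\<bar> < e" by (metis atLeast_iff)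
  then show "\<exists>\<delta>>0. \<forall>s. t \<le> s \<longrightarrow> s < t + \<delta> \<longrightarrow> \<bar>y s - y t\<bar> < e" using t by (intro exI[of _ d]) auto
qed

lemma rcont_diff: assumes "rcont y" "rcont z" shows "rcont (\<lambda>s. y s - z s)"
  unfolding rcont_def
proof (intro allI impI)
  fix t e :: real assume t: "0 \<le> t" "0 < e"
  then have "e / 2 > 0" by simp
  with assms t obtain d1 d2 where d: "d1 > 0" "d2 > 0" "\<And>s. t \<le> s \<Longrightarrow> s < t + d1 \<Longrightarrow> \<bar>y s - y t\<bar> < e / 2"
     "\<And>s. t \<le> s \<Longrightarrow> s < t + d2 \<Longrightarrow> \<bar>z s - z t\<bar> < e / 2" unfolding rcont_def by metis
  show "\<exists>\<delta>>0. \<forall>s. t \<le> s \<longrightarrow> s < t + \<delta> \<longrightarrow> \<bar>y s - z s - (y t - z t)\<bar> < e"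
  proof (intro exI[of _ "min d1 d2"] conjI allI impI)
    fix s assume "t \<le> s" "s < t + min d1 d2"
    then have "\<bar>y s - y t\<bar> < e / 2" "\<bar>z s - z t\<bar> < e / 2" using d(3,4) by auto
    then show "\<bar>y s - z s - (y t - z t)\<bar> < e" by linarith
  qed (use d in auto)
qed

lemma regul1_rcont:
  assumes b: "\<And>T. bdd_on T y" and r: "rcont y" shows "rcont (regul1 y)"
  unfolding rcont_def
proof (intro allI impI)
  fix t e :: real assume t: "0 \<le> t" "0 < e"
  then have "e / 2 > 0" by simp
  then obtain \<delta> where \<delta>: "\<delta> > 0" "\<And>s. t \<le> s \<Longrightarrow> s < t + \<delta> \<Longrightarrow> \<bar>y s - y t\<bar> < e / 2"
    using r t unfolding rcont_def by metis
  show "\<exists>\<delta>>0. \<forall>s. t \<le> s \<longrightarrow> s < t + \<delta> \<longrightarrow> \<bar>regul1 y s - regul1 y t\<bar> < e"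
  proof (intro exI[of _ \<delta>] conjI allI impI)
    fix s assume s: "t \<le> s" "s < t + \<delta>"
    have "regul1 y s \<le> regul1 y t + e / 2"
    proof (rule regul1_le)
      fix q assume q: "0 \<le> q" "q \<le> s"
      show "- y q \<le> regul1 y t + e / 2"
      proof (cases "q \<le> t")
        case True
        then show ?thesis using regul1_ge1[OF b q(1) True] t by linarith
      next
        case False
        then have "\<bar>y q - y t\<bar> < e / 2" using \<delta>(2)[of q] q s by auto
        then show ?thesis using regul1_ge1[OF b t(1) order_refl] by linarith
      qed
    qed (use t s regul1_nonneg[OF b t(1)] in auto)
    then show "\<bar>regul1 y s - regul1 y t\<bar> < e" using regul1_mono[OF b t(1) s(1)] t by linarith
  qed (rule \<delta>)
qed

text \<open>The times are rational fractions q of t instead of rational times: q = 1 then captures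
  the endpoint t, which right continuity cannot approach from inside [0, t].\<close>

lemma regul1_rational:
  assumes b: "bdd_on t y" and r: "rcont y" and t: "0 \<le> t"
  shows "regul1 y t = (SUP q\<in>\<rat> \<inter> {0..1}. max 0 (- y (q * t)))"
proof -
  have qt: "q * t \<in> {0..t}" if "q \<in> \<rat> \<inter> {0..1}" for q
    using that t by (auto simp: mult_left_le_one_le)
  have bd: "bdd_above ((\<lambda>q. max 0 (- y (q * t))) ` (\<rat> \<inter> {0..1}))"
    by (rule bdd_above_mono[OF bdd_on_bdd_above[OF b]]) (use qt in auto)
  let ?S = "SUP q\<in>\<rat> \<inter> {0..1}. max 0 (- y (q * t))"
  have up: "max 0 (- y (q * t)) \<le> ?S" if "q \<in> \<rat> \<inter> {0..1}" for q by (rule cSUP_upper[OF that bd])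
  show ?thesis
  proof (rule antisym)
    show "?S \<le> regul1 y t"
      by (rule cSUP_least) (use regul1_ge[OF b] qt in \<open>auto intro!: exI[of _ "0::real"]\<close>)
    show "regul1 y t \<le> ?S"
    proof (rule regul1_le[OF t])
      show "0 \<le> ?S" using up[of 0] by auto
      fix s assume s: "0 \<le> s" "s \<le> t"
      show "- y s \<le> ?S"
      proof (cases "s = t")
        case True
        then show ?thesis using up[of 1] by auto
      next
        case False
        then have st: "s < t" using s by simp
        show ?thesis
        proof (rule field_le_epsilon)
          fix e :: real assume "e > 0"
          then obtain \<delta> where \<delta>: "\<delta> > 0" "\<And>u. s \<le> u \<Longrightarrow> u < s + \<delta> \<Longrightarrow> \<bar>y u - y s\<bar> < e"
            using r s unfolding rcont_def by metis
          have "s / t < min 1 ((s + \<delta>) / t)" using st s \<delta>(1) by (simp add: divide_strict_right_mono)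
          then obtain q where q: "q \<in> \<rat>" "s / t < q" "q < min 1 ((s + \<delta>) / t)" using Rats_dense_in_real by blast
          have t0: "0 < t" using st s by simp
          have "s < q * t" "q * t < s + \<delta>" using q t0 by (simp_all add: field_simps)
          then have "\<bar>y (q * t) - y s\<bar> < e" by (intro \<delta>(2)) auto
          moreover have "0 \<le> s / t" using s t0 by simp
          then have "q \<in> \<rat> \<inter> {0..1}" using q by auto
          from up[OF this] have "- y (q * t) \<le> ?S" by simp
          ultimately show "- y s \<le> ?S + e" by linarith
        qed
      qed
    qed
  qed
qed

lemma regul_rcont:
  assumes "\<And>j T. j \<le> i \<Longrightarrow> bdd_on T (\<lambda>s. x s j)" "\<And>j. j \<le> i \<Longrightarrow> rcont (\<lambda>s. x s j)"
  shows "rcont (regul x i)"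
  using assms
proof (induction i)
  case 0
  then show ?case by (auto intro!: regul1_rcont)
next
  case (Suc i)
  have "rcont (regul x i)" by (rule Suc.IH) (use Suc.prems in auto)
  moreover have "bdd_on T (regul x i)" for T by (rule regul_bdd_on) (use Suc.prems in auto)
  ultimately show ?case unfolding regul.simps using Suc.prems by (intro regul1_rcont rcont_diff bdd_on_diff) auto
qed

text \<open>Measurability of the input is requested only up to time t. With the sigma-algebra at
  time t in the place of \<open>M\<close> the lemma therefore gives adaptedness.\<close>

lemma regul_measurable:
  fixes x :: "'a \<Rightarrow> real \<Rightarrow> nat \<Rightarrow> real"
  assumes b: "\<And>\<omega> j T. j \<le> i \<Longrightarrow> bdd_on T (\<lambda>s. x \<omega> s j)" and r: "\<And>\<omega> j. j \<le> i \<Longrightarrow> rcont (\<lambda>s. x \<omega> s j)"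
    and m: "\<And>s j. 0 \<le> s \<Longrightarrow> s \<le> t \<Longrightarrow> j \<le> i \<Longrightarrow> (\<lambda>\<omega>. x \<omega> s j) \<in> borel_measurable M"
    and t: "0 \<le> t"
  shows "(\<lambda>\<omega>. regul (x \<omega>) i t) \<in> borel_measurable M"
proof -
  have one: "(\<lambda>\<omega>. regul1 (y \<omega>) t) \<in> borel_measurable M"
    if b: "\<And>\<omega> T. bdd_on T (y \<omega>)" and r: "\<And>\<omega>. rcont (y \<omega>)" and m: "\<And>s. 0 \<le> s \<Longrightarrow> s \<le> t \<Longrightarrow> (\<lambda>\<omega>. y \<omega> s) \<in> borel_measurable M"
      and t: "0 \<le> t" for y t
  proof -
    have qt: "0 \<le> q * t" "q * t \<le> t" if "q \<in> \<rat> \<inter> {0..1}" for q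
      using that t by (auto simp: mult_left_le_one_le)
    have bd: "bdd_above ((\<lambda>q. max 0 (- y \<omega> (q * t))) ` (\<rat> \<inter> {0..1}))" for \<omega>
      by (rule bdd_above_mono[OF bdd_on_bdd_above[OF b[of t \<omega>]]]) (use qt in auto)
    show ?thesis
      unfolding regul1_rational[OF b r t]
    proof (rule borel_measurable_cSUP)
      show "countable (\<rat> \<inter> {0..1::real})" by (rule countable_subset[OF _ countable_rat]) auto
      fix q :: real assume "q \<in> \<rat> \<inter> {0..1}"
      from m[OF qt[OF this]] show "(\<lambda>\<omega>. max 0 (- y \<omega> (q * t))) \<in> borel_measurable M" by measurable
    qed (rule bd)
  qed
  show ?thesis using b r m t
  proof (induction i arbitrary: t)
    case 0
    then show ?case by (auto intro!: one)
  next
    case (Suc i)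
    have "rcont (regul (x \<omega>) i)" for \<omega> by (rule regul_rcont) (use Suc.prems in auto)
    moreover have "bdd_on T (regul (x \<omega>) i)" for T \<omega> by (rule regul_bdd_on) (use Suc.prems in auto)
    moreover have "(\<lambda>\<omega>. regul (x \<omega>) i s) \<in> borel_measurable M" if "0 \<le> s" "s \<le> t" for s
      by (rule Suc.IH) (use Suc.prems that in auto)
    ultimately show ?case unfolding regul.simps
      using Suc.prems by (intro one rcont_diff bdd_on_diff borel_measurable_diff) auto
  qed
qed

lemma reflmap_measurable:
  fixes x :: "'a \<Rightarrow> real \<Rightarrow> nat \<Rightarrow> real"
  assumes b: "\<And>\<omega> j T. j \<le> i \<Longrightarrow> bdd_on T (\<lambda>s. x \<omega> s j)" and r: "\<And>\<omega> j. j \<le> i \<Longrightarrow> rcont (\<lambda>s. x \<omega> s j)"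
    and m: "\<And>s j. 0 \<le> s \<Longrightarrow> s \<le> t \<Longrightarrow> j \<le> i \<Longrightarrow> (\<lambda>\<omega>. x \<omega> s j) \<in> borel_measurable M"
    and t: "0 \<le> t"
  shows "(\<lambda>\<omega>. reflmap (x \<omega>) t i) \<in> borel_measurable M"
proof -
  have R: "(\<lambda>\<omega>. regul (x \<omega>) j t) \<in> borel_measurable M" if "j \<le> i" for j
    by (rule regul_measurable[where x=x]) (use that b r m t in auto)
  have [measurable]: "(\<lambda>\<omega>. if i = 0 then 0 else regul (x \<omega>) (i - 1) t) \<in> borel_measurable M"
    using R[of "i - 1"] by (cases "i = 0") auto
  have [measurable]: "(\<lambda>\<omega>. x \<omega> t i) \<in> borel_measurable M" using m[of t i] t by auto
  have [measurable]: "(\<lambda>\<omega>. regul (x \<omega>) i t) \<in> borel_measurable M" by (rule R) simp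
  show ?thesis unfolding reflmap_def by measurable
qed

section \<open>The driving Brownian motion and its filtration\<close>

definition bmX :: "real \<Rightarrow> (nat \<Rightarrow> real) \<Rightarrow> nat \<Rightarrow> real" where
  "bmX t \<omega> i = bm t \<omega> i - bm t \<omega> (Suc i)"

text \<open>Finite-dimensional cylinders are closed under intersection, as the Dynkin argument for
  the generated filtration requires.\<close>

definition bm_cyl :: "nat \<Rightarrow> real \<Rightarrow> (nat \<Rightarrow> real) set set" where
  "bm_cyl d s = {{\<omega>\<in>space gauss. \<forall>j\<in>J. bm (fst j) \<omega> (snd j) \<in> B j} |J B.
     finite J \<and> J \<subseteq> {0..s} \<times> {..<d} \<and> (\<forall>j\<in>J. B j \<in> sets borel)}"

definition bm_filt :: "nat \<Rightarrow> real \<Rightarrow> (nat \<Rightarrow> real) set set" where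
  "bm_filt d s = sigma_sets (space gauss) (bm_cyl d s)"

lemma bm_cyl_sets: "bm_cyl d s \<subseteq> sets gauss"
proof
  fix A assume "A \<in> bm_cyl d s"
  then obtain J B where A: "A = {\<omega>\<in>space gauss. \<forall>j\<in>J. bm (fst j) \<omega> (snd j) \<in> B j}"
    "finite J" "\<And>j. j \<in> J \<Longrightarrow> B j \<in> sets borel" unfolding bm_cyl_def by blast
  show "A \<in> sets gauss" unfolding A(1)
  proof (rule sets.sets_Collect_finite_All[OF _ A(2)])
    fix j assume "j \<in> J"
    from A(3)[OF this] show "{\<omega>\<in>space gauss. bm (fst j) \<omega> (snd j) \<in> B j} \<in> sets gauss" by measurable
  qed
qed

lemma bm_cyl_Pow: "bm_cyl d s \<subseteq> Pow (space gauss)"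
  using bm_cyl_sets sets.sets_into_space by blast

lemma bm_cyl_Int_stable: "Int_stable (bm_cyl d s)"
  unfolding Int_stable_def
proof (intro ballI)
  fix A A' assume "A \<in> bm_cyl d s" "A' \<in> bm_cyl d s"
  then obtain J B J' B' where
    A: "A = {\<omega>\<in>space gauss. \<forall>j\<in>J. bm (fst j) \<omega> (snd j) \<in> B j}" "finite J" "J \<subseteq> {0..s} \<times> {..<d}" "\<forall>j\<in>J. B j \<in> sets borel" and
    A': "A' = {\<omega>\<in>space gauss. \<forall>j\<in>J'. bm (fst j) \<omega> (snd j) \<in> B' j}" "finite J'" "J' \<subseteq> {0..s} \<times> {..<d}" "\<forall>j\<in>J'. B' j \<in> sets borel"
    unfolding bm_cyl_def by blast
  let ?B = "\<lambda>j. (if j \<in> J then B j else UNIV) \<inter> (if j \<in> J' then B' j else UNIV)"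
  have iff: "x \<in> ?B j \<longleftrightarrow> (j \<in> J \<longrightarrow> x \<in> B j) \<and> (j \<in> J' \<longrightarrow> x \<in> B' j)" for x j by auto
  have "A \<inter> A' = {\<omega>\<in>space gauss. \<forall>j\<in>J \<union> J'. bm (fst j) \<omega> (snd j) \<in> ?B j}" unfolding A(1) A'(1) iff by blast
  moreover have "\<forall>j\<in>J \<union> J'. ?B j \<in> sets borel" using A(4) A'(4) by auto
  ultimately show "A \<inter> A' \<in> bm_cyl d s"
    unfolding bm_cyl_def using A(2,3) A'(2,3) by (intro CollectI exI[of _ "J \<union> J'"] exI[of _ ?B]) auto
qed

lemma bm_filt_sets: "bm_filt d s \<subseteq> sets gauss"
  unfolding bm_filt_def by (rule sets.sigma_sets_subset) (rule bm_cyl_sets)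

lemma bm_filt_filtration: "is_filtration gauss (bm_filt d)"
  unfolding is_filtration_def
proof (intro conjI allI impI)
  fix t show "sigma_algebra (space gauss) (bm_filt d t)"
    unfolding bm_filt_def by (rule sigma_algebra_sigma_sets) (use bm_cyl_sets sets.sets_into_space in blast)
  show "bm_filt d t \<subseteq> sets gauss" by (rule bm_filt_sets)
next
  fix s t :: real assume "s \<le> t"
  then have "{0..s} \<times> {..<d} \<subseteq> {0..t} \<times> {..<d}" by auto
  then have "bm_cyl d s \<subseteq> bm_cyl d t" unfolding bm_cyl_def by (smt (verit) Collect_mono subset_trans)
  then show "bm_filt d s \<subseteq> bm_filt d t" unfolding bm_filt_def by (rule sigma_sets_mono')
qed

abbreviation filtM :: "nat \<Rightarrow> real \<Rightarrow> (nat \<Rightarrow> real) measure" where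
  "filtM d s \<equiv> sigma (space gauss) (bm_cyl d s)"

lemma sets_filtM: "sets (filtM d s) = bm_filt d s"
  unfolding bm_filt_def using bm_cyl_sets sets.sets_into_space by (subst sets_measure_of) blast+

lemma space_filtM: "space (filtM d s) = space gauss"
  using bm_cyl_sets sets.sets_into_space by (subst space_measure_of) blast+

lemma bm_filt_bm:
  assumes "0 \<le> u" "u \<le> s" "i < d"
  shows "(\<lambda>\<omega>. bm u \<omega> i) \<in> borel_measurable (filtM d s)"
proof (rule measurableI)
  fix B :: "real set" assume B: "B \<in> sets borel"
  have "(\<lambda>\<omega>. bm u \<omega> i) -` B \<inter> space (filtM d s) = {\<omega>\<in>space gauss. \<forall>j\<in>{(u, i)}. bm (fst j) \<omega> (snd j) \<in> B}"
    unfolding space_filtM by auto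
  also have "\<dots> \<in> bm_cyl d s"
    unfolding bm_cyl_def using assms B by (intro CollectI exI[of _ "{(u, i)}"] exI[of _ "\<lambda>_. B"]) auto
  finally show "(\<lambda>\<omega>. bm u \<omega> i) -` B \<inter> space (filtM d s) \<in> sets (filtM d s)"
    unfolding sets_filtM bm_filt_def by (rule sigma_sets.Basic)
qed simp

text \<open>A value at a time u \<le> s has the same covariance min(u, t) = min(u, s) = u with both
  endpoints of the increment, so all cross terms cancel and the characteristic function
  factorises.\<close>

lemma bm_increment_char:
  fixes v :: "real \<times> nat \<Rightarrow> real"
  assumes J: "finite J" "J \<subseteq> {0..s} \<times> UNIV" and st: "0 \<le> s" "s \<le> t"
  shows "(\<integral>\<omega>. cis (\<Sum>p<d. w p * (bm t \<omega> p - bm s \<omega> p)) * cis (\<Sum>j\<in>J. v j * bm (fst j) \<omega> (snd j)) \<partial>gauss) =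
     complex_of_real (exp (- (t - s) / 2 * (\<Sum>p<d. (w p)\<^sup>2))) * (\<integral>\<omega>. cis (\<Sum>j\<in>J. v j * bm (fst j) \<omega> (snd j)) \<partial>gauss)"
proof -
  \<comment> \<open>The right summand of the index type holds the endpoints of the increments:
    \<open>True\<close> stands for time t with coefficient w, \<open>False\<close> for time s with
    coefficient - w.\<close>
  let ?P = "{..<d} \<times> (UNIV :: bool set)"
  let ?A = "J <+> ?P"
  let ?c = "\<lambda>a. case a of Inl j \<Rightarrow> v j | Inr (p, b) \<Rightarrow> if b then w p else - w p"
  let ?\<iota> = "\<lambda>a. case a of Inl j \<Rightarrow> snd j | Inr (p, b) \<Rightarrow> p"
  let ?\<tau> = "\<lambda>a. case a of Inl j \<Rightarrow> fst j | Inr (p, b) \<Rightarrow> if b then t else s"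
  let ?V = "\<lambda>a b. if ?\<iota> a = ?\<iota> b then ?c a * ?c b * min (?\<tau> a) (?\<tau> b) else 0"
  have fP: "finite ?P" by simp
  have s2: "(\<Sum>q\<in>?P. F q) = (\<Sum>p<d. F (p, True) + F (p, False))" for F :: "nat \<times> bool \<Rightarrow> real"
  proof -
    have "(\<Sum>q\<in>?P. F q) = (\<Sum>p<d. \<Sum>b\<in>UNIV. F (p, b))" by (simp add: sum.cartesian_product)
    then show ?thesis by (simp add: UNIV_bool add.commute)
  qed
  have plus: "(\<Sum>a\<in>?A. F a) = (\<Sum>j\<in>J. F (Inl j)) + (\<Sum>q\<in>?P. F (Inr q))" for F :: "real \<times> nat + nat \<times> bool \<Rightarrow> real"
    by (simp add: sum.Plus[OF J(1) fP] comp_def)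
  have lin: "(\<Sum>p<d. w p * (bm t \<omega> p - bm s \<omega> p)) + (\<Sum>j\<in>J. v j * bm (fst j) \<omega> (snd j)) = (\<Sum>a\<in>?A. ?c a * bm (?\<tau> a) \<omega> (?\<iota> a))" for \<omega>
    unfolding plus s2 by (simp add: right_diff_distrib sum_subtractf)
  have zero1: "(\<Sum>q\<in>?P. ?V (Inl j) (Inr q)) = 0" if "j \<in> J" for j
  proof -
    have "fst j \<le> s" using J that by auto
    then show ?thesis unfolding s2 using st by (intro sum.neutral) (auto simp: min_absorb1)
  qed
  have zero2: "(\<Sum>q\<in>?P. ?V (Inr q) (Inl j)) = 0" if "j \<in> J" for j
  proof -
    have "?V a b = ?V b a" for a b by (simp add: mult.commute min.commute)
    then show ?thesis using zero1[OF that] by presburger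
  qed
  have PP: "(\<Sum>q\<in>?P. \<Sum>r\<in>?P. ?V (Inr q) (Inr r)) = (t - s) * (\<Sum>p<d. (w p)\<^sup>2)"
  proof -
    have "(\<Sum>q\<in>?P. \<Sum>r\<in>?P. ?V (Inr q) (Inr r)) = (\<Sum>p<d. \<Sum>p'<d. if p = p' then (t - s) * (w p)\<^sup>2 else 0)"
    proof -
      have "(\<Sum>q\<in>?P. \<Sum>r\<in>?P. ?V (Inr q) (Inr r)) = (\<Sum>p<d. \<Sum>p'<d. (?V (Inr (p, True)) (Inr (p', True)) + ?V (Inr (p, True)) (Inr (p', False)))
          + (?V (Inr (p, False)) (Inr (p', True)) + ?V (Inr (p, False)) (Inr (p', False))))"
        unfolding s2 by (simp only: sum.distrib)
      also have "\<dots> = (\<Sum>p<d. \<Sum>p'<d. if p = p' then (t - s) * (w p)\<^sup>2 else 0)"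
        by (intro sum.cong HOL.refl) (use st in \<open>auto simp: min_absorb1 min_absorb2 algebra_simps power2_eq_square\<close>)
      finally show ?thesis .
    qed
    also have "\<dots> = (\<Sum>p<d. (t - s) * (w p)\<^sup>2)" by (simp add: sum.delta)
    finally show ?thesis by (simp add: sum_distrib_left)
  qed
  have var: "(\<Sum>a\<in>?A. \<Sum>b\<in>?A. ?V a b) = (\<Sum>j\<in>J. \<Sum>k\<in>J. ?V (Inl j) (Inl k)) + (t - s) * (\<Sum>p<d. (w p)\<^sup>2)"
  proof -
    have "(\<Sum>a\<in>?A. \<Sum>b\<in>?A. ?V a b) = (\<Sum>a\<in>?A. (\<Sum>k\<in>J. ?V a (Inl k)) + (\<Sum>r\<in>?P. ?V a (Inr r)))"
    proof (rule sum.cong[OF HOL.refl])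
      fix a show "(\<Sum>b\<in>?A. ?V a b) = (\<Sum>k\<in>J. ?V a (Inl k)) + (\<Sum>r\<in>?P. ?V a (Inr r))"
        by (rule plus)
    qed
    also have "\<dots> = (\<Sum>j\<in>J. (\<Sum>k\<in>J. ?V (Inl j) (Inl k)) + (\<Sum>r\<in>?P. ?V (Inl j) (Inr r))) + (\<Sum>q\<in>?P. (\<Sum>k\<in>J. ?V (Inr q) (Inl k)) + (\<Sum>r\<in>?P. ?V (Inr q) (Inr r)))"
      by (rule plus)
    also have "\<dots> = (\<Sum>j\<in>J. \<Sum>k\<in>J. ?V (Inl j) (Inl k)) + (\<Sum>j\<in>J. \<Sum>r\<in>?P. ?V (Inl j) (Inr r)) + ((\<Sum>q\<in>?P. \<Sum>k\<in>J. ?V (Inr q) (Inl k)) + (\<Sum>q\<in>?P. \<Sum>r\<in>?P. ?V (Inr q) (Inr r)))"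
      by (simp only: sum.distrib)
    also have "(\<Sum>j\<in>J. \<Sum>r\<in>?P. ?V (Inl j) (Inr r)) = 0" by (rule sum.neutral) (use zero1 in blast)
    also have "(\<Sum>q\<in>?P. \<Sum>k\<in>J. ?V (Inr q) (Inl k)) = (\<Sum>k\<in>J. \<Sum>q\<in>?P. ?V (Inr q) (Inl k))" by (rule sum.swap)
    also have "\<dots> = 0" by (rule sum.neutral) (use zero2 in blast)
    finally show ?thesis unfolding PP by simp
  qed
  have "(\<integral>\<omega>. cis (\<Sum>p<d. w p * (bm t \<omega> p - bm s \<omega> p)) * cis (\<Sum>j\<in>J. v j * bm (fst j) \<omega> (snd j)) \<partial>gauss) =
     complex_of_real (exp (- (\<Sum>a\<in>?A. \<Sum>b\<in>?A. ?V a b) / 2))"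
    unfolding cis_mult lin by (rule bm_char) (use J st in \<open>auto split: if_splits\<close>)
  also have "\<dots> = complex_of_real (exp (- (t - s) / 2 * (\<Sum>p<d. (w p)\<^sup>2))) * complex_of_real (exp (- (\<Sum>j\<in>J. \<Sum>k\<in>J. ?V (Inl j) (Inl k)) / 2))"
    unfolding var by (simp add: exp_add[symmetric] of_real_mult[symmetric] del: of_real_mult) (simp add: field_simps)
  also have "complex_of_real (exp (- (\<Sum>j\<in>J. \<Sum>k\<in>J. ?V (Inl j) (Inl k)) / 2)) = (\<integral>\<omega>. cis (\<Sum>j\<in>J. v j * bm (fst j) \<omega> (snd j)) \<partial>gauss)"
  proof -
    have "0 \<le> fst j" if "j \<in> J" for j using J that by auto
    from bm_char[where \<tau>=fst and c=v and \<iota>=snd, OF J(1) this] show ?thesis unfolding sum.case by (rule sym)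
  qed
  finally show ?thesis .
qed

text \<open>On cylinders the previous factorisation is turned into a statement about events by
  uniqueness of weighted characteristic functions; complements and disjoint unions extend it to the
  generated sigma-algebra.\<close>

lemma bm_increment_indep:
  assumes st: "0 \<le> s" "s \<le> t" and A: "A \<in> bm_filt d s"
  shows "(\<integral>\<omega>. indicator A \<omega> * cis (\<Sum>p<d. w p * (bm t \<omega> p - bm s \<omega> p)) \<partial>gauss) =
     complex_of_real (measure gauss A) * complex_of_real (exp (- (t - s) / 2 * (\<Sum>p<d. (w p)\<^sup>2)))"
proof -
  interpret G: prob_space gauss by (rule prob_space_gauss)
  let ?D = "\<lambda>\<omega>. cis (\<Sum>p<d. w p * (bm t \<omega> p - bm s \<omega> p))"
  let ?\<phi> = "complex_of_real (exp (- (t - s) / 2 * (\<Sum>p<d. (w p)\<^sup>2)))"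
  have D[measurable]: "?D \<in> borel_measurable gauss" by measurable
  have iD: "integrable gauss (\<lambda>\<omega>. indicator A \<omega> * ?D \<omega>)" if "A \<in> sets gauss" for A
    by (rule prob_integrable_bounded[OF prob_space_gauss, where c=1]) (use that in \<open>auto simp: indicator_def\<close>)
  have tot: "(\<integral>\<omega>. ?D \<omega> \<partial>gauss) = ?\<phi>"
    using bm_increment_char[where J="{}" and s=s and t=t and d=d and w=w] st by (simp add: G.prob_space)
  have n1: "norm ?\<phi> \<le> 1" using st by (simp add: sum_nonneg mult_nonpos_nonneg)
  show ?thesis using A unfolding bm_filt_def
  proof (induction rule: sigma_sets_induct_disjoint[OF bm_cyl_Int_stable bm_cyl_Pow, consumes 1, case_names basic empty compl union])
    case (basic A)
    then obtain J B where A: "A = {\<omega>\<in>space gauss. \<forall>j\<in>J. bm (fst j) \<omega> (snd j) \<in> B j}"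
      "finite J" "J \<subseteq> {0..s} \<times> {..<d}" "\<And>j. j \<in> J \<Longrightarrow> B j \<in> sets borel" unfolding bm_cyl_def by blast
    have ind: "(\<Prod>j\<in>J. indicator (B j) (bm (fst j) \<omega> (snd j))) = (indicator A \<omega> :: complex)" if "\<omega> \<in> space gauss" for \<omega>
      using that A(2) unfolding A(1) by (auto simp: indicator_def prod_zero_iff intro!: prod.neutral)
    \<comment> \<open>The past values have the same weighted transform under the random weight
      \<open>?D\<close> and under the constant weight \<open>?\<phi>\<close>.\<close>
    have "(\<integral>\<omega>. ?D \<omega> * (\<Prod>j\<in>J. indicator (B j) (bm (fst j) \<omega> (snd j))) \<partial>gauss) = (\<integral>\<omega>. ?\<phi> * (\<Prod>j\<in>J. indicator (B j) (bm (fst j) \<omega> (snd j))) \<partial>gauss)"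
    proof (rule char_unique_boxes[OF prob_space_gauss prob_space_gauss A(2), where c=1])
      fix u show "(\<integral>\<omega>. ?D \<omega> * cis (\<Sum>j\<in>J. u j * bm (fst j) \<omega> (snd j)) \<partial>gauss) = (\<integral>\<omega>. ?\<phi> * cis (\<Sum>j\<in>J. u j * bm (fst j) \<omega> (snd j)) \<partial>gauss)"
        using bm_increment_char[OF A(2) _ st, where d=d and w=w and v=u] A(3) by auto
    qed (use A(4) n1 in auto)
    then have "(\<integral>\<omega>. indicator A \<omega> * ?D \<omega> \<partial>gauss) = ?\<phi> * (\<integral>\<omega>. indicator A \<omega> \<partial>gauss)"
      by (simp add: ind mult.commute cong: Bochner_Integration.integral_cong)
    also have "(\<integral>\<omega>. indicator A \<omega> \<partial>gauss) = complex_of_real (\<integral>\<omega>. indicator A \<omega> \<partial>gauss)"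
      by (subst integral_complex_of_real[symmetric]) (simp add: of_real_indicator)
    also have "\<dots> = complex_of_real (measure gauss A)"
    proof -
      have "A \<in> sets gauss" using basic bm_cyl_sets by blast
      then show ?thesis by (simp add: sets.Int_space_eq2)
    qed
    finally show ?case by (simp add: mult.commute)
  next
    case empty
    show ?case by simp
  next
    case (compl A)
    have As: "A \<in> sets gauss" using compl(1) bm_filt_sets[of d s] unfolding bm_filt_def by blast
    have "(\<integral>\<omega>. indicator (space gauss - A) \<omega> * ?D \<omega> \<partial>gauss) = (\<integral>\<omega>. ?D \<omega> - indicator A \<omega> * ?D \<omega> \<partial>gauss)"
      by (rule Bochner_Integration.integral_cong) (auto simp: indicator_def)
    also have "\<dots> = ?\<phi> - complex_of_real (measure gauss A) * ?\<phi>"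
      using compl.IH tot iD[OF As] prob_integrable_bounded[OF prob_space_gauss D, of 1]
      by (subst Bochner_Integration.integral_diff) auto
    also have "\<dots> = complex_of_real (measure gauss (space gauss - A)) * ?\<phi>"
    proof -
      have c: "complex_of_real (measure gauss (space gauss - A)) = 1 - complex_of_real (measure gauss A)"
        using G.prob_compl[OF As] by simp
      show ?thesis unfolding c by (simp only: left_diff_distrib mult_1)
    qed
    finally show ?case .
  next
    case (union A)
    have As: "A i \<in> sets gauss" for i using union(2) bm_filt_sets[of d s] unfolding bm_filt_def by blast
    have "(\<integral>\<omega>. indicator (\<Union>i. A i) \<omega> * ?D \<omega> \<partial>gauss) = (\<Sum>i. \<integral>\<omega>. indicator (A i) \<omega> * ?D \<omega> \<partial>gauss)"
    proof -
      have e: "indicator B \<omega> * z = indicator B \<omega> *\<^sub>R z" for B and \<omega> :: "nat \<Rightarrow> real" and z :: complex by (simp add: indicator_def)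
      show ?thesis unfolding e set_lebesgue_integral_def[symmetric]
      proof (rule lebesgue_integral_countable_add)
        show "A i \<inter> A j = {}" if "i \<noteq> j" for i j using union(1) that by (auto simp: disjoint_family_on_def)
        show "set_integrable gauss (\<Union>i. A i) ?D" unfolding set_integrable_def e[symmetric] by (rule iD) (use As in auto)
      qed (rule As)
    qed
    also have "\<dots> = (\<Sum>i. complex_of_real (measure gauss (A i)) * ?\<phi>)" using union.IH by simp
    also have "\<dots> = complex_of_real (measure gauss (\<Union>i. A i)) * ?\<phi>"
    proof (rule sums_unique[symmetric], rule sums_mult2, rule sums_of_real)
      show "(\<lambda>i. measure gauss (A i)) sums measure gauss (\<Union>i. A i)"
        by (rule G.finite_measure_UNION) (use As union(1) in auto)
    qed
    finally show ?case .
  qed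
qed

text \<open>For an event \<open>A\<close> of the smaller sigma-algebra, the weights
  \<open>indicator A\<close> and \<open>prob A\<close> give the same transforms of \<open>D\<close>,
  hence the same integrals of indicators of \<open>D\<close>. This is independence in terms of
  events.\<close>

lemma indep_from_char:
  fixes Z D :: "'a \<Rightarrow> real"
  assumes M: "prob_space M" and sp: "space N = space M" and sub: "sets N \<subseteq> sets M"
    and D[measurable]: "D \<in> borel_measurable M" and Z: "Z \<in> borel_measurable N"
    and ch: "\<And>A v. A \<in> sets N \<Longrightarrow> (\<integral>\<omega>. indicator A \<omega> * cis (v * D \<omega>) \<partial>M) = complex_of_real (measure M A) * \<phi> v"
  shows "prob_space.indep_var M borel Z borel D"
proof -
  interpret prob_space M by fact
  have Zm[measurable]: "Z \<in> borel_measurable M"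
    using Z sp sub by (auto simp: measurable_def)
  have tot: "(\<integral>\<omega>. cis (v * D \<omega>) \<partial>M) = \<phi> v" for v
  proof -
    have "space M \<in> sets N" using sp sets.top[of N] by simp
    from ch[OF this, of v] have "(\<integral>\<omega>. indicator (space M) \<omega> * cis (v * D \<omega>) \<partial>M) = \<phi> v" by (simp add: prob_space)
    then show ?thesis by (simp cong: Bochner_Integration.integral_cong)
  qed
  have ind: "prob (A \<inter> (D -` B \<inter> space M)) = prob A * prob (D -` B \<inter> space M)" if A: "A \<in> sets N" and B[measurable]: "B \<in> sets borel" for A B
  proof -
    have [measurable]: "A \<in> sets M" using A sub by auto
    have "(\<integral>\<omega>. indicator A \<omega> * indicator B (D \<omega>) \<partial>M) = (\<integral>\<omega>. complex_of_real (prob A) * indicator B (D \<omega>) \<partial>M)"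
    proof (rule char_unique_weight[OF M M, where c=1])
      show "(\<integral>\<omega>. indicator A \<omega> * cis (v * D \<omega>) \<partial>M) = (\<integral>\<omega>. complex_of_real (prob A) * cis (v * D \<omega>) \<partial>M)" for v
        using ch[OF A, of v] tot[of v] by simp
    qed (auto simp: indicator_def)
    moreover have "(\<integral>\<omega>. indicator A \<omega> * indicator B (D \<omega>) \<partial>M) = complex_of_real (prob (A \<inter> (D -` B \<inter> space M)))"
    proof -
      have "(\<integral>\<omega>. indicator A \<omega> * indicator B (D \<omega>) \<partial>M) = (\<integral>\<omega>. complex_of_real (indicator (A \<inter> (D -` B \<inter> space M)) \<omega>) \<partial>M)"
        by (rule Bochner_Integration.integral_cong) (auto simp: indicator_def)
      also have "\<dots> = complex_of_real (\<integral>\<omega>. indicator (A \<inter> (D -` B \<inter> space M)) \<omega> \<partial>M)" by (rule integral_complex_of_real)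
      finally show ?thesis by (simp add: sets.Int_space_eq2)
    qed
    moreover have "(\<integral>\<omega>. complex_of_real (prob A) * indicator B (D \<omega>) \<partial>M) = complex_of_real (prob A * prob (D -` B \<inter> space M))"
    proof -
      have "(\<integral>\<omega>. complex_of_real (prob A) * indicator B (D \<omega>) \<partial>M) = (\<integral>\<omega>. complex_of_real (prob A * indicator (D -` B \<inter> space M) \<omega>) \<partial>M)"
        by (rule Bochner_Integration.integral_cong) (auto simp: indicator_def)
      also have "\<dots> = complex_of_real (\<integral>\<omega>. prob A * indicator (D -` B \<inter> space M) \<omega> \<partial>M)" by (rule integral_complex_of_real)
      finally show ?thesis by simp
    qed
    ultimately show ?thesis by (metis of_real_eq_iff)
  qed
  let ?A = "{Z -` A \<inter> space M |A. A \<in> sets borel}" and ?B = "{D -` A \<inter> space M |A. A \<in> sets borel}"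
  have "indep_set (sigma_sets (space M) ?A) (sigma_sets (space M) ?B)"
  proof (rule indep_set_sigma_sets)
    show "indep_set ?A ?B"
    proof (rule indep_setI)
      fix a b assume "a \<in> ?A" "b \<in> ?B"
      then obtain A B where ab: "a = Z -` A \<inter> space M" "A \<in> sets borel" "b = D -` B \<inter> space M" "B \<in> sets borel" by blast
      have "a \<in> sets N" using measurable_sets[OF Z ab(2)] ab(1) sp by simp
      from ind[OF this ab(4)] show "prob (a \<inter> b) = prob a * prob b" using ab(3) by simp
    qed auto
    have "Int_stable {V -` A \<inter> space M |A. A \<in> sets borel}" for V :: "'a \<Rightarrow> real"
      unfolding Int_stable_def
    proof (intro ballI)
      fix a b assume "a \<in> {V -` A \<inter> space M |A. A \<in> sets borel}" "b \<in> {V -` A \<inter> space M |A. A \<in> sets borel}"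
      then obtain A B where "a = V -` A \<inter> space M" "b = V -` B \<inter> space M" "A \<in> sets borel" "B \<in> sets borel" by blast
      then have "a \<inter> b = V -` (A \<inter> B) \<inter> space M" "A \<inter> B \<in> sets borel" by auto
      then show "a \<inter> b \<in> {V -` A \<inter> space M |A. A \<in> sets borel}" by blast
    qed
    then show "Int_stable ?A" "Int_stable ?B" by blast+
  qed
  then show ?thesis unfolding indep_var_eq by simp
qed

section \<open>Uniqueness in law of the SRBM\<close>

definition qform :: "nat \<Rightarrow> (nat \<Rightarrow> nat \<Rightarrow> real) \<Rightarrow> (nat \<Rightarrow> real) \<Rightarrow> real" where
  "qform m \<Gamma> u = (\<Sum>i<m. \<Sum>j<m. u i * \<Gamma> i j * u j)"

lemma qform_scale: "qform m \<Gamma> (\<lambda>i. v * u i) = v\<^sup>2 * qform m \<Gamma> u"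
  unfolding qform_def sum_distrib_left by (intro sum.cong refl) (simp add: power2_eq_square)

lemma adapted_measurable:
  assumes "sigma_algebra (space M) (F s)" "F t \<subseteq> F s" "adapted M F m V" "0 \<le> t" "i < m"
  shows "(\<lambda>\<omega>. V t \<omega> i) \<in> borel_measurable (sigma (space M) (F s))"
proof (rule measurableI)
  interpret sigma_algebra "space M" "F s" by fact
  fix B :: "real set" assume "B \<in> sets borel"
  then have "{\<omega>\<in>space M. V t \<omega> i \<in> B} \<in> F s" using assms(2-5) unfolding adapted_def by blast
  moreover have "(\<lambda>\<omega>. V t \<omega> i) -` B \<inter> space M = {\<omega>\<in>space M. V t \<omega> i \<in> B}" by auto
  ultimately show "(\<lambda>\<omega>. V t \<omega> i) -` B \<inter> space (sigma (space M) (F s)) \<in> sets (sigma (space M) (F s))"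
    by (simp add: sets_measure_of_eq space_measure_of_conv)
qed simp

lemma adapted_borel_measurable:
  assumes "is_filtration M F" "adapted M F m V" "0 \<le> t" "i < m"
  shows "(\<lambda>\<omega>. V t \<omega> i) \<in> borel_measurable M"
proof (rule measurableI)
  fix B :: "real set" assume "B \<in> sets borel"
  then have "{\<omega>\<in>space M. V t \<omega> i \<in> B} \<in> F t" using assms(2-4) unfolding adapted_def by blast
  moreover have "(\<lambda>\<omega>. V t \<omega> i) -` B \<inter> space M = {\<omega>\<in>space M. V t \<omega> i \<in> B}" by auto
  moreover have "F t \<subseteq> sets M" using assms(1) by (simp add: is_filtration_def)
  ultimately show "(\<lambda>\<omega>. V t \<omega> i) -` B \<inter> space M \<in> sets M" by auto
qed simp

text \<open>The last increment is independent of the earlier ones, which are measurable at its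
  starting time; the condition in \<open>brownian\<close> is exactly of the form that
  \<open>indep_from_char\<close> takes. Induction then gives the product, so the law of the grid
  increments depends on \<Gamma> only.\<close>

lemma brownian_increments_char:
  assumes M: "prob_space M" and F: "is_filtration M F" and X: "brownian M F m (\<lambda>_. 0) \<Gamma> \<nu> X" and h: "h > 0"
  shows "(\<integral>\<omega>. cis (\<Sum>l<L. \<Sum>i<m. u l i * (X (real (Suc l) * h) \<omega> i - X (real l * h) \<omega> i)) \<partial>M)
    = complex_of_real (\<Prod>l<L. exp (- h / 2 * qform m \<Gamma> (u l)))"
proof (induction L)
  interpret prob_space M by fact
  case 0
  show ?case by (simp add: prob_space)
next
  interpret prob_space M by fact
  case (Suc L)
  let ?s = "real L * h" and ?t = "real (Suc L) * h"
  let ?N = "sigma (space M) (F ?s)"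
  have ad: "adapted M F m X" using X by (simp add: brownian_def)
  have sa: "sigma_algebra (space M) (F ?s)" and sub: "F ?s \<subseteq> sets M" and mono: "\<And>r. r \<le> ?s \<Longrightarrow> F r \<subseteq> F ?s"
    using F by (auto simp: is_filtration_def)
  interpret sa: sigma_algebra "space M" "F ?s" by fact
  have setsN: "sets ?N = F ?s" by simp
  have spN: "space ?N = space M" by (simp add: space_measure_of_conv)
  define D where "D \<omega> = (\<Sum>i<m. u L i * (X ?t \<omega> i - X ?s \<omega> i))" for \<omega>
  define Z where "Z \<omega> = (\<Sum>l<L. \<Sum>i<m. u l i * (X (real (Suc l) * h) \<omega> i - X (real l * h) \<omega> i))" for \<omega>
  have Xm: "(\<lambda>\<omega>. X t \<omega> i) \<in> borel_measurable M" if "0 \<le> t" "i < m" for t i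
    by (rule adapted_borel_measurable[OF F ad that])
  have Dm[measurable]: "D \<in> borel_measurable M"
    unfolding D_def using h by (intro borel_measurable_sum borel_measurable_times borel_measurable_diff Xm) auto
  have ZN: "Z \<in> borel_measurable ?N"
    unfolding Z_def
  proof (intro borel_measurable_sum borel_measurable_times borel_measurable_diff borel_measurable_const)
    fix l i assume "l \<in> {..<L}" "i \<in> {..<m}"
    then have l: "real (Suc l) * h \<le> ?s" "real l * h \<le> ?s" "i < m" using h by (auto intro!: mult_right_mono)
    show "(\<lambda>\<omega>. X (real (Suc l) * h) \<omega> i) \<in> borel_measurable ?N" "(\<lambda>\<omega>. X (real l * h) \<omega> i) \<in> borel_measurable ?N"
      by (rule adapted_measurable[OF sa mono ad]; use l h in simp)+
  qed
  have Zm[measurable]: "Z \<in> borel_measurable M" using ZN sub spN setsN by (auto simp: measurable_def)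
  have def: "(\<integral>\<omega>. indicator A \<omega> * cis (v * D \<omega>) \<partial>M) = complex_of_real (measure M A) * complex_of_real (exp (- h / 2 * (v\<^sup>2 * qform m \<Gamma> (u L))))"
    if "A \<in> sets ?N" for A v
  proof -
    have pre: "0 \<le> ?s \<and> ?s \<le> ?t \<and> A \<in> F ?s" using that setsN h by simp
    have D: "\<forall>s t u A. 0 \<le> s \<and> s \<le> t \<and> A \<in> F s \<longrightarrow>
        (\<integral>\<omega>. indicator A \<omega> * cis (\<Sum>i<m. u i * (X t \<omega> i - X s \<omega> i)) \<partial>M) =
        complex_of_real (measure M A) * cis ((t - s) * (\<Sum>i<m. u i * 0)) *
        complex_of_real (exp (- (t - s) / 2 * (\<Sum>i<m. \<Sum>j<m. u i * \<Gamma> i j * u j)))"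
      by (rule conjunct1[OF conjunct2[OF conjunct2[OF conjunct2[OF X[unfolded brownian_def]]]]])
    have "(\<integral>\<omega>. indicator A \<omega> * cis (\<Sum>i<m. (v * u L i) * (X ?t \<omega> i - X ?s \<omega> i)) \<partial>M) =
        complex_of_real (measure M A) * cis ((?t - ?s) * (\<Sum>i<m. (v * u L i) * 0)) *
        complex_of_real (exp (- (?t - ?s) / 2 * qform m \<Gamma> (\<lambda>i. v * u L i)))"
      unfolding qform_def by (rule mp[OF spec[OF spec[OF spec[OF spec[OF D, of ?s], of ?t], of "\<lambda>i. v * u L i"], of A] pre])
    moreover have e: "?t - ?s = h" by (simp add: algebra_simps)
    ultimately show ?thesis unfolding qform_scale e by (simp add: D_def sum_distrib_left mult.assoc del: of_nat_Suc)
  qed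
  have ind: "indep_var borel Z borel D"
    by (rule indep_from_char[OF M spN _ Dm ZN def]) (use sub setsN in auto)
  have "indep_var borel (cis \<circ> Z) borel (cis \<circ> D)" by (rule indep_var_compose[OF ind]) auto
  then have "(\<integral>\<omega>. cis (Z \<omega>) * cis (D \<omega>) \<partial>M) = (\<integral>\<omega>. cis (Z \<omega>) \<partial>M) * (\<integral>\<omega>. cis (D \<omega>) \<partial>M)"
    unfolding comp_def by (intro indep_var_lebesgue_integral prob_integrable_bounded[OF M, where c=1]) auto
  also have "(\<integral>\<omega>. cis (D \<omega>) \<partial>M) = complex_of_real (exp (- h / 2 * qform m \<Gamma> (u L)))"
  proof -
    have "space M \<in> sets ?N" using sets.top[of ?N] spN by simp
    from def[OF this, of 1] have "(\<integral>\<omega>. indicator (space M) \<omega> * cis (D \<omega>) \<partial>M) = complex_of_real (exp (- h / 2 * qform m \<Gamma> (u L)))"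
      by (simp add: prob_space)
    then show ?thesis by (simp cong: Bochner_Integration.integral_cong)
  qed
  finally show ?case using Suc unfolding cis_mult by (simp add: Z_def D_def)
qed

lemma brownian_increments_law:
  assumes M: "prob_space M" and F: "is_filtration M F" and X: "brownian M F m (\<lambda>_. 0) \<Gamma> \<nu> X"
    and M': "prob_space M'" and F': "is_filtration M' F'" and X': "brownian M' F' m (\<lambda>_. 0) \<Gamma> \<nu>' X'" and h: "h > 0"
  shows "distr M (PiM ({..<m} \<times> {..<L}) (\<lambda>_. borel)) (\<lambda>\<omega>. \<lambda>a\<in>{..<m} \<times> {..<L}. X (real (Suc (snd a)) * h) \<omega> (fst a) - X (real (snd a) * h) \<omega> (fst a))
    = distr M' (PiM ({..<m} \<times> {..<L}) (\<lambda>_. borel)) (\<lambda>\<omega>. \<lambda>a\<in>{..<m} \<times> {..<L}. X' (real (Suc (snd a)) * h) \<omega> (fst a) - X' (real (snd a) * h) \<omega> (fst a))"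
proof (rule char_unique_law[OF M M'])
  have ad: "adapted M F m X" and ad': "adapted M' F' m X'" using X X' by (simp_all add: brownian_def)
  fix a assume "a \<in> {..<m} \<times> {..<L}"
  then show "(\<lambda>\<omega>. X (real (Suc (snd a)) * h) \<omega> (fst a) - X (real (snd a) * h) \<omega> (fst a)) \<in> borel_measurable M"
    "(\<lambda>\<omega>. X' (real (Suc (snd a)) * h) \<omega> (fst a) - X' (real (snd a) * h) \<omega> (fst a)) \<in> borel_measurable M'"
    using h by (auto intro!: borel_measurable_diff adapted_borel_measurable[OF F ad] adapted_borel_measurable[OF F' ad'])
next
  fix u :: "nat \<times> nat \<Rightarrow> real"
  have e: "(\<Sum>a\<in>{..<m} \<times> {..<L}. u a * W a) = (\<Sum>l<L. \<Sum>i<m. u (i, l) * W (i, l))" for W :: "nat \<times> nat \<Rightarrow> real"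
  proof -
    have "(\<Sum>a\<in>{..<m} \<times> {..<L}. u a * W a) = (\<Sum>i<m. \<Sum>l<L. u (i, l) * W (i, l))" by (simp add: sum.cartesian_product)
    then show ?thesis by (simp add: sum.swap[of _ "{..<m}"])
  qed
  show "(\<integral>\<omega>. cis (\<Sum>a\<in>{..<m} \<times> {..<L}. u a * (X (real (Suc (snd a)) * h) \<omega> (fst a) - X (real (snd a) * h) \<omega> (fst a))) \<partial>M)
    = (\<integral>\<omega>. cis (\<Sum>a\<in>{..<m} \<times> {..<L}. u a * (X' (real (Suc (snd a)) * h) \<omega> (fst a) - X' (real (snd a) * h) \<omega> (fst a))) \<partial>M')"
    unfolding e fst_conv snd_conv
    using brownian_increments_char[OF M F X h, of "\<lambda>l i. u (i, l)" L] brownian_increments_char[OF M' F' X' h, of "\<lambda>l i. u (i, l)" L]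
    by simp
qed simp

abbreviation delta0 :: "nat \<Rightarrow> (nat \<Rightarrow> real) measure" where
  "delta0 m \<equiv> return (PiM {..<m} (\<lambda>_. borel)) (\<lambda>i\<in>{..<m}. 0)"

lemma delta0_AE:
  assumes M: "prob_space M" and F: "is_filtration M F" and ad: "adapted M F m X"
    and d: "distr M (PiM {..<m} (\<lambda>_. borel)) (\<lambda>\<omega>. restrict (X 0 \<omega>) {..<m}) = delta0 m"
  shows "AE \<omega> in M. \<forall>i<m. X 0 \<omega> i = 0"
proof -
  have m: "(\<lambda>\<omega>. restrict (X 0 \<omega>) {..<m}) \<in> measurable M (PiM {..<m} (\<lambda>_. borel))"
    by (rule measurable_restrict) (use adapted_borel_measurable[OF F ad] in auto)
  have "AE x in delta0 m. x i = 0" if i: "i < m" for i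
  proof (subst AE_return)
    show "(\<lambda>i\<in>{..<m}. 0) \<in> space (PiM {..<m} (\<lambda>_. borel :: real measure))" by (simp add: space_PiM)
    have [measurable]: "(\<lambda>x. x i) \<in> borel_measurable (PiM {..<m} (\<lambda>_. borel :: real measure))"
      by (rule measurable_component_singleton) (use i in simp)
    show "Measurable.pred (PiM {..<m} (\<lambda>_. borel :: real measure)) (\<lambda>x. x i = 0)" by measurable
  qed (use i in auto)
  then have "AE x in distr M (PiM {..<m} (\<lambda>_. borel)) (\<lambda>\<omega>. restrict (X 0 \<omega>) {..<m}). \<forall>i\<in>{..<m}. x i = 0"
    unfolding d by (subst AE_ball_countable) auto
  from AE_distrD[OF m this] show ?thesis by eventually_elim auto
qed

lemma tridiag_R:
  assumes i: "i < m"
  shows "(\<Sum>j<m. tridiag m (-1) 1 0 i j * Y j) = Y i - (if i = 0 then 0 else Y (i - 1))"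
proof -
  have "(\<Sum>j<m. tridiag m (-1) 1 0 i j * Y j) = (\<Sum>j<m. (if j = i then Y i else 0) - (if Suc j = i then Y j else 0))"
    by (rule sum.cong) (use i in \<open>auto simp: tridiag_def\<close>)
  also have "\<dots> = Y i - (\<Sum>j<m. if Suc j = i then Y j else 0)" using i by (simp add: sum_subtractf)
  also have "(\<Sum>j<m. if Suc j = i then Y j else 0) = (if i = 0 then 0 else Y (i - 1))"
  proof (cases i)
    case (Suc k)
    have "(\<Sum>j<m. if Suc j = i then Y j else 0) = (\<Sum>j<m. if j = k then Y k else 0)" by (rule sum.cong) (auto simp: Suc)
    then show ?thesis using i Suc by simp
  qed simp
  finally show ?thesis .
qed

text \<open>By induction on the coordinate: once the preceding regulator is known, coordinate i + 1
  is a one-dimensional reflection problem with input X (i + 1) - Y i, and its solution is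
  unique.\<close>

lemma srbm_is_reflmap:
  assumes S: "srbm M F m (\<lambda>_. 0) \<Gamma> (tridiag m (-1) 1 0) \<nu> W X Y"
  shows "AE \<omega> in M. \<forall>i<m. continuous_on {0..} (\<lambda>t. X t \<omega> i) \<and> continuous_on {0..} (\<lambda>t. W t \<omega> i)
     \<and> (\<forall>t\<ge>0. W t \<omega> i = reflmap (\<lambda>s. X s \<omega>) t i)"
proof -
  have B: "brownian M F m (\<lambda>_. 0) \<Gamma> \<nu> X" using S by (simp add: srbm_def)
  have "AE \<omega> in M. \<forall>i<m. continuous_on {0..} (\<lambda>t. X t \<omega> i)" using B by (simp add: brownian_def)
  moreover have "AE \<omega> in M.
        (\<forall>t\<ge>0. \<forall>i<m. W t \<omega> i = X t \<omega> i + (\<Sum>j<m. tridiag m (-1) 1 0 i j * Y t \<omega> j)) \<and>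
        (\<forall>i<m. continuous_on {0..} (\<lambda>t. W t \<omega> i)) \<and>
        (\<forall>t\<ge>0. \<forall>i<m. W t \<omega> i \<ge> 0) \<and>
        (\<forall>i<m. Y 0 \<omega> i = 0 \<and> continuous_on {0..} (\<lambda>t. Y t \<omega> i) \<and> mono_on {0..} (\<lambda>t. Y t \<omega> i) \<and>
           emeasure (interval_measure (\<lambda>t. Y (max 0 t) \<omega> i)) {t. 0 \<le> t \<and> W t \<omega> i > 0} = 0)"
    using S by (simp add: srbm_def)
  ultimately show ?thesis
  proof eventually_elim
    case (elim \<omega>)
    note R = tridiag_R
    have W: "W t \<omega> i = X t \<omega> i + (Y t \<omega> i - (if i = 0 then 0 else Y t \<omega> (i - 1)))" if "i < m" "0 \<le> t" for i t
      using elim that R[OF that(1), of "Y t \<omega>"] by auto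
    have nn: "0 \<le> W t \<omega> i" if "i < m" "0 \<le> t" for i t using elim that by blast
    have cW: "continuous_on {0..} (\<lambda>t. W t \<omega> i)" if "i < m" for i using elim that by blast
    have pY: "continuous_on {0..} (\<lambda>t. Y t \<omega> i)" "Y 0 \<omega> i = 0" "mono_on {0..} (\<lambda>t. Y t \<omega> i)"
      "emeasure (interval_measure (\<lambda>t. Y (max 0 t) \<omega> i)) {t. 0 \<le> t \<and> W t \<omega> i > 0} = 0" if "i < m" for i
      using elim that by blast+
    have Y: "\<forall>t\<ge>0. Y t \<omega> i = regul (\<lambda>s. X s \<omega>) i t" if "i < m" for i
      using that
    proof (induction i)
      case 0
      show ?case unfolding regul.simps
      proof (intro allI impI)
        fix t :: real assume t: "t \<ge> 0"
        show "Y t \<omega> 0 = regul1 (\<lambda>s. X s \<omega> 0) t"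
        proof (rule regul1_unique[OF _ nn pY(1) cW pY(2) pY(3) pY(4) t])
          show "W t \<omega> 0 = X t \<omega> 0 + Y t \<omega> 0" if "0 \<le> t" for t using W[OF 0 that] by simp
        qed (use 0 in auto)
      qed
    next
      case (Suc i)
      then have IH: "\<forall>t\<ge>0. Y t \<omega> i = regul (\<lambda>s. X s \<omega>) i t" by simp
      show ?case unfolding regul.simps
      proof (intro allI impI)
        fix t :: real assume t: "t \<ge> 0"
        show "Y t \<omega> (Suc i) = regul1 (\<lambda>s. X s \<omega> (Suc i) - regul (\<lambda>s. X s \<omega>) i s) t"
        proof (rule regul1_unique[OF _ nn pY(1) cW pY(2) pY(3) pY(4) t])
          show "W t \<omega> (Suc i) = X t \<omega> (Suc i) - regul (\<lambda>s. X s \<omega>) i t + Y t \<omega> (Suc i)" if "0 \<le> t" for t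
            using W[OF Suc.prems that] IH that by simp
        qed (use Suc.prems in auto)
      qed
    qed
    have "W t \<omega> i = reflmap (\<lambda>s. X s \<omega>) t i" if i: "i < m" and t: "0 \<le> t" for i t
    proof -
      have "Y t \<omega> i = regul (\<lambda>s. X s \<omega>) i t" "Y t \<omega> (i - 1) = regul (\<lambda>s. X s \<omega>) (i - 1) t"
        using Y[of i] Y[of "i - 1"] i t by auto
      then show ?thesis unfolding reflmap_def W[OF i t] by simp
    qed
    then show ?case using elim by blast
  qed
qed

text \<open>The functional of the reflected, sampled and rounded path, written in terms of grid
  increments, because these are what \<open>brownian_increments_law\<close> compares.\<close>

definition qfun :: "nat \<Rightarrow> ((real \<Rightarrow> nat \<Rightarrow> real) \<Rightarrow> real) \<Rightarrow> nat \<Rightarrow> (nat \<times> nat \<Rightarrow> real) \<Rightarrow> real" where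
  "qfun m f k v = f (reflmap (stepf m k (\<lambda>(i, l). real_of_int \<lfloor>real k * (\<Sum>l'<l. v (i, l'))\<rfloor> / real k)))"

lemma qfun_measurable: "qfun m f k \<in> borel_measurable (PiM ({..<m} \<times> {..<k\<^sup>2}) (\<lambda>_. borel))"
proof -
  \<comment> \<open>k^2 increments determine k^2 + 1 grid values, hence the closed range in
    \<open>?J\<close>.\<close>
  let ?I = "{..<m} \<times> {..<k\<^sup>2}" and ?J = "{..<m} \<times> {..k\<^sup>2}"
  let ?K = "\<lambda>a v. \<lfloor>real k * (\<Sum>l'<snd a. v (fst a, l'))\<rfloor>"
  have "(\<lambda>v. (\<lambda>c. f (reflmap (stepf m k (\<lambda>a. real_of_int (c a) / real k)))) (\<lambda>a\<in>?J. ?K a v)) \<in> borel_measurable (PiM ?I (\<lambda>_. borel))"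
  proof (rule countable_data_measurable)
    fix a assume a: "a \<in> ?J"
    have [measurable]: "(\<lambda>v. \<Sum>l'<snd a. v (fst a, l')) \<in> borel_measurable (PiM ?I (\<lambda>_. borel :: real measure))"
      by (intro borel_measurable_sum measurable_component_singleton) (use a in auto)
    show "?K a \<in> measurable (PiM ?I (\<lambda>_. borel)) (count_space UNIV)" by measurable
  qed auto
  moreover have "stepf m k (\<lambda>a. real_of_int ((\<lambda>a\<in>?J. ?K a v) a) / real k) = stepf m k (\<lambda>(i, l). real_of_int \<lfloor>real k * (\<Sum>l'<l. v (i, l'))\<rfloor> / real k)" for v
    by (auto simp: fun_eq_iff stepf_def gidx_def)
  ultimately show ?thesis by (simp add: qfun_def[abs_def])
qed

text \<open>As X starts at 0, sums of increments return its grid values. The expectation of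
  \<open>f\<close> at \<open>W\<close> is thus a limit of expectations that only involve finitely
  many increments of \<open>X\<close>.\<close>

lemma srbm_functional_limit:
  assumes S: "srbm M F m (\<lambda>_. 0) \<Gamma> (tridiag m (-1) 1 0) (delta0 m) W X Y"
    and f: "bounded (range f)" "sk_continuous m f"
  shows "(\<lambda>k. \<integral>\<omega>. qfun m f (Suc k) (\<lambda>a\<in>{..<m} \<times> {..<(Suc k)\<^sup>2}. X (real (Suc (snd a)) * (1 / real (Suc k))) \<omega> (fst a) - X (real (snd a) * (1 / real (Suc k))) \<omega> (fst a)) \<partial>M)
     \<longlonglongrightarrow> (\<integral>\<omega>. f (\<lambda>t. W t \<omega>) \<partial>completion M)"
proof -
  have M: "prob_space M" and F: "is_filtration M F" and adW: "adapted M F m W" and B: "brownian M F m (\<lambda>_. 0) \<Gamma> (delta0 m) X"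
    using S by (auto simp: srbm_def)
  have ad: "adapted M F m X" and d: "distr M (PiM {..<m} (\<lambda>_. borel)) (\<lambda>\<omega>. restrict (X 0 \<omega>) {..<m}) = delta0 m"
    using B by (auto simp: brownian_def)
  obtain C where C: "\<And>x. \<bar>f x\<bar> \<le> C" using f(1) by (auto simp: bounded_iff)
  let ?\<Delta> = "\<lambda>k \<omega> a. X (real (Suc (snd a)) * (1 / real (Suc k))) \<omega> (fst a) - X (real (snd a) * (1 / real (Suc k))) \<omega> (fst a)"
  show ?thesis
  proof (rule completion_limit(2)[OF M, where B=C])
  fix k
  show "(\<lambda>\<omega>. qfun m f (Suc k) (\<lambda>a\<in>{..<m} \<times> {..<(Suc k)\<^sup>2}. ?\<Delta> k \<omega> a)) \<in> borel_measurable M"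
    by (rule measurable_compose[OF _ qfun_measurable], rule measurable_restrict)
       (auto intro!: borel_measurable_diff adapted_borel_measurable[OF F ad])
  show "\<bar>qfun m f (Suc k) (\<lambda>a\<in>{..<m} \<times> {..<(Suc k)\<^sup>2}. ?\<Delta> k \<omega> a)\<bar> \<le> C" for \<omega>
    unfolding qfun_def by (rule C)
  show "AE \<omega> in M. (\<lambda>k. qfun m f (Suc k) (\<lambda>a\<in>{..<m} \<times> {..<(Suc k)\<^sup>2}. ?\<Delta> k \<omega> a)) \<longlonglongrightarrow> f (\<lambda>t. W t \<omega>)"
    using srbm_is_reflmap[OF S] delta0_AE[OF M F ad d]
  proof eventually_elim
    case (elim \<omega>)
    let ?x = "\<lambda>s. X s \<omega>"
    have q: "qfun m f (Suc k) (\<lambda>a\<in>{..<m} \<times> {..<(Suc k)\<^sup>2}. ?\<Delta> k \<omega> a) = f (reflmap (disc m (Suc k) ?x))" for k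
    proof -
      have "(\<Sum>l'<l. (\<lambda>a\<in>{..<m} \<times> {..<(Suc k)\<^sup>2}. ?\<Delta> k \<omega> a) (i, l')) = X (real l / real (Suc k)) \<omega> i" if il: "i < m" "l \<le> (Suc k)\<^sup>2" for i l
      proof -
        have "(\<Sum>l'<l. (\<lambda>a\<in>{..<m} \<times> {..<(Suc k)\<^sup>2}. ?\<Delta> k \<omega> a) (i, l'))
           = (\<Sum>l'<l. X (real (Suc l') * (1 / real (Suc k))) \<omega> i - X (real l' * (1 / real (Suc k))) \<omega> i)"
          by (rule sum.cong) (use il in auto)
        also have "\<dots> = X (real l * (1 / real (Suc k))) \<omega> i - X (real 0 * (1 / real (Suc k))) \<omega> i"
          by (rule sum_lessThan_telescope)
        finally show ?thesis using elim il by simp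
      qed
      then have "stepf m (Suc k) (\<lambda>(i, l). real_of_int \<lfloor>real (Suc k) * (\<Sum>l'<l. (\<lambda>a\<in>{..<m} \<times> {..<(Suc k)\<^sup>2}. ?\<Delta> k \<omega> a) (i, l'))\<rfloor> / real (Suc k)) = disc m (Suc k) ?x"
        by (auto simp: fun_eq_iff stepf_def disc_def gidx_def simp del: of_nat_Suc restrict_apply)
      then show ?thesis by (simp only: qfun_def)
    qed
    have cx: "continuous_on {0..} (\<lambda>s. ?x s i)" if "i < m" for i using elim that by blast
    have "lu_conv m (\<lambda>k. disc m (Suc k) ?x) ?x" by (rule disc_lu_conv) (rule cx)
    then have "lu_conv m (\<lambda>k. reflmap (disc m (Suc k) ?x)) (reflmap ?x)"
      by (rule reflmap_lu_conv) (rule continuous_bdd_on[OF cx])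
    then have sk: "sk_conv m (\<lambda>k. reflmap (disc m (Suc k) ?x)) (reflmap ?x)" by (rule lu_imp_sk)
    have D: "reflmap ?x \<in> Dspace m" by (rule continuous_Dspace, rule reflmap_continuous) (use cx in auto)
    have DW: "(\<lambda>t. W t \<omega>) \<in> Dspace m" by (rule continuous_Dspace) (use elim in auto)
    have "reflmap (disc m (Suc k) ?x) \<in> Dspace m" for k unfolding disc_def by (rule reflmap_stepf_Dspace) simp
    then have "(\<lambda>k. f (reflmap (disc m (Suc k) ?x))) \<longlonglongrightarrow> f (reflmap ?x)"
      using f(2)[unfolded sk_continuous_def, rule_format, of "\<lambda>k. reflmap (disc m (Suc k) ?x)" "reflmap ?x"] D sk by blast
    \<comment> \<open>\<open>W\<close> and the reflected path agree only at times t \<ge> 0 and in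
      coordinates i < m.\<close>
    moreover have "f (\<lambda>t. W t \<omega>) = f (reflmap ?x)"
      by (rule sk_continuous_cong[OF f(2) DW D]) (use elim in auto)
    ultimately show ?case unfolding q by simp
  qed
  qed
qed

text \<open>The approximating expectations are equal for every k, although the two processes live on
  different spaces with different filtrations.\<close>

lemma srbm_law_unique:
  assumes S: "srbm M F m (\<lambda>_. 0) \<Gamma> (tridiag m (-1) 1 0) (delta0 m) W X Y"
    and S': "srbm M' F' m (\<lambda>_. 0) \<Gamma> (tridiag m (-1) 1 0) (delta0 m) W' X' Y'"
    and f: "bounded (range f)" "sk_continuous m f"
  shows "(\<integral>\<omega>. f (\<lambda>t. W t \<omega>) \<partial>completion M) = (\<integral>\<omega>. f (\<lambda>t. W' t \<omega>) \<partial>completion M')"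
proof (rule LIMSEQ_unique[OF srbm_functional_limit[OF S f]])
  have M: "prob_space M" and F: "is_filtration M F" and B: "brownian M F m (\<lambda>_. 0) \<Gamma> (delta0 m) X"
    using S by (auto simp: srbm_def)
  have M': "prob_space M'" and F': "is_filtration M' F'" and B': "brownian M' F' m (\<lambda>_. 0) \<Gamma> (delta0 m) X'"
    using S' by (auto simp: srbm_def)
  have ad: "adapted M F m X" and ad': "adapted M' F' m X'" using B B' by (auto simp: brownian_def)
  show "(\<lambda>k. \<integral>\<omega>. qfun m f (Suc k) (\<lambda>a\<in>{..<m} \<times> {..<(Suc k)\<^sup>2}. X (real (Suc (snd a)) * (1 / real (Suc k))) \<omega> (fst a) - X (real (snd a) * (1 / real (Suc k))) \<omega> (fst a)) \<partial>M)
     \<longlonglongrightarrow> (\<integral>\<omega>. f (\<lambda>t. W' t \<omega>) \<partial>completion M')"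
  proof -
    have "(\<integral>\<omega>. qfun m f (Suc k) (\<lambda>a\<in>{..<m} \<times> {..<(Suc k)\<^sup>2}. X (real (Suc (snd a)) * (1 / real (Suc k))) \<omega> (fst a) - X (real (snd a) * (1 / real (Suc k))) \<omega> (fst a)) \<partial>M)
      = (\<integral>\<omega>. qfun m f (Suc k) (\<lambda>a\<in>{..<m} \<times> {..<(Suc k)\<^sup>2}. X' (real (Suc (snd a)) * (1 / real (Suc k))) \<omega> (fst a) - X' (real (snd a) * (1 / real (Suc k))) \<omega> (fst a)) \<partial>M')" for k
    proof (rule law_transfer[OF brownian_increments_law[OF M F B M' F' B'] _ _ qfun_measurable])
      show "0 < 1 / real (Suc k)" by simp
    qed (auto intro!: borel_measurable_diff adapted_borel_measurable[OF F ad] adapted_borel_measurable[OF F' ad'])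
    then show ?thesis using srbm_functional_limit[OF S' f] by simp
  qed
qed

section \<open>Moments of the Brownian motion and the covariance of its differences\<close>

lemma bm_law:
  assumes t: "0 \<le> t"
  shows "distr gauss borel (\<lambda>\<omega>. bm t \<omega> p) = distr std_normal_distribution borel (\<lambda>x. sqrt t * x)"
proof -
  interpret G: prob_space gauss by (rule prob_space_gauss)
  interpret N: prob_space "std_normal_distribution" by (rule real_distribution.axioms(1)[OF real_dist_normal_dist])
  show ?thesis
  proof (rule Levy_uniqueness)
    show "real_distribution (distr gauss borel (\<lambda>\<omega>. bm t \<omega> p))" by (rule G.real_distribution_distr) simp
    show "real_distribution (distr std_normal_distribution borel (\<lambda>x. sqrt t * x))" by (rule N.real_distribution_distr) simp
    show "char (distr gauss borel (\<lambda>\<omega>. bm t \<omega> p)) = char (distr std_normal_distribution borel (\<lambda>x. sqrt t * x))"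
    proof
      fix v
      have "char (distr gauss borel (\<lambda>\<omega>. bm t \<omega> p)) v = (\<integral>\<omega>. cis (v * bm t \<omega> p) \<partial>gauss)"
        unfolding char_def by (subst integral_distr) (auto simp: cis_conv_exp)
      also have "\<dots> = complex_of_real (exp (- (v\<^sup>2 * t) / 2))"
        using bm_char[of "{()}" "\<lambda>_. t" "\<lambda>_. v" "\<lambda>_. p"] t by (simp add: power2_eq_square)
      also have "\<dots> = char std_normal_distribution (sqrt t * v)"
        unfolding char_std_normal_distribution using t by (simp add: power_mult_distrib mult.commute)
      also have "\<dots> = char (distr std_normal_distribution borel (\<lambda>x. sqrt t * x)) v"
        unfolding char_def by (subst integral_distr) (auto simp: mult_ac)
      finally show "char (distr gauss borel (\<lambda>\<omega>. bm t \<omega> p)) v = char (distr std_normal_distribution borel (\<lambda>x. sqrt t * x)) v" .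
    qed
  qed
qed

lemma bm_integrable: assumes t: "0 \<le> t" shows "integrable gauss (\<lambda>\<omega>. bm t \<omega> p)"
proof -
  have "integrable std_normal_distribution (\<lambda>x. x ^ 1)" by (rule integrable_std_normal_distribution_moment)
  then have "integrable std_normal_distribution (\<lambda>x. sqrt t * x)" by simp
  then have "integrable (distr gauss borel (\<lambda>\<omega>. bm t \<omega> p)) (\<lambda>x. x)"
    unfolding bm_law[OF t] by (subst integrable_distr_eq) auto
  then show ?thesis by (subst (asm) integrable_distr_eq) auto
qed

lemma bm_mean: assumes t: "0 \<le> t" shows "(\<integral>\<omega>. bm t \<omega> p \<partial>gauss) = 0"
proof -
  have "(\<integral>\<omega>. bm t \<omega> p \<partial>gauss) = (\<integral>x. x \<partial>distr gauss borel (\<lambda>\<omega>. bm t \<omega> p))" by (subst integral_distr) auto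
  also have "\<dots> = (\<integral>x. sqrt t * x \<partial>std_normal_distribution)" unfolding bm_law[OF t] by (subst integral_distr) auto
  also have "\<dots> = 0" using integral_std_normal_distribution_moment_odd[of 1] by simp
  finally show ?thesis .
qed

lemma bm_increment_mean:
  assumes st: "0 \<le> s" "s \<le> t" and A: "A \<in> bm_filt d s" and p: "p < d"
  shows "(\<integral>\<omega>. indicator A \<omega> * (bm t \<omega> p - bm s \<omega> p) \<partial>gauss) = 0"
proof -
  interpret G: prob_space gauss by (rule prob_space_gauss)
  have As: "A \<in> sets gauss" using A bm_filt_sets by blast
  have ind: "G.indep_var borel (indicator A :: _ \<Rightarrow> real) borel (\<lambda>\<omega>. bm t \<omega> p - bm s \<omega> p)"
  proof (rule indep_from_char[OF prob_space_gauss space_filtM[of d s]])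
    show "sets (filtM d s) \<subseteq> sets gauss" unfolding sets_filtM by (rule bm_filt_sets)
    show "indicator A \<in> borel_measurable (filtM d s)" by (rule borel_measurable_indicator) (simp only: sets_filtM A)
    fix B v assume B: "B \<in> sets (filtM d s)"
    have e: "(\<Sum>q<d. (if q = p then v else 0) * (bm t \<omega> q - bm s \<omega> q)) = v * (bm t \<omega> p - bm s \<omega> p)" for \<omega>
      using p by (subst sum.remove[of _ p]) (auto intro!: sum.neutral)
    show "(\<integral>\<omega>. indicator B \<omega> * cis (v * (bm t \<omega> p - bm s \<omega> p)) \<partial>gauss) = complex_of_real (measure gauss B) * complex_of_real (exp (- (t - s) / 2 * (\<Sum>q<d. (if q = p then v else 0)\<^sup>2)))"
      using bm_increment_indep[OF st B[unfolded sets_filtM], of "\<lambda>q. if q = p then v else 0"] unfolding e .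
  qed simp
  have "(\<integral>\<omega>. indicator A \<omega> * (bm t \<omega> p - bm s \<omega> p) \<partial>gauss) = (\<integral>\<omega>. indicator A \<omega> \<partial>gauss) * (\<integral>\<omega>. bm t \<omega> p - bm s \<omega> p \<partial>gauss)"
  proof (rule G.indep_var_lebesgue_integral[OF ind])
    show "integrable gauss (indicator A :: _ \<Rightarrow> real)"
      by (rule prob_integrable_bounded[OF prob_space_gauss, where c=1]) (use As in \<open>auto simp: indicator_def\<close>)
    show "integrable gauss (\<lambda>\<omega>. bm t \<omega> p - bm s \<omega> p)" using st by (intro Bochner_Integration.integrable_diff bm_integrable) auto
  qed
  also have "(\<integral>\<omega>. bm t \<omega> p - bm s \<omega> p \<partial>gauss) = 0"
    using st by (subst Bochner_Integration.integral_diff) (auto simp: bm_mean intro!: bm_integrable)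
  finally show ?thesis by simp
qed

text \<open>On the left are the coefficients u p - u (p - 1) with which the p-th of m + 1
  independent motions enters a combination of their m consecutive differences. The square of the
  last coefficient is the boundary term (u (m - 1))^2 of the induction.\<close>

lemma tridiag_qform:
  "(\<Sum>p<Suc m. ((if p < m then u p else 0) - (if p = 0 then 0 else u (p - 1)))\<^sup>2) = qform m (tridiag m (-1) 2 (-1)) u"
proof -
  define T where "T i j = (if i = j then 2 else if i = Suc j \<or> j = Suc i then -1 else (0::real))" for i j :: nat
  define a where "a p = (u p - (if p = 0 then 0 else u (p - 1)))\<^sup>2" for p
  have q: "qform m (tridiag m (-1) 2 (-1)) u = (\<Sum>i<m. \<Sum>j<m. u i * T i j * u j)"
    unfolding qform_def by (intro sum.cong refl) (auto simp: tridiag_def T_def)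
  have l: "(\<Sum>p<Suc m. ((if p < m then u p else 0) - (if p = 0 then 0 else u (p - 1)))\<^sup>2) = (\<Sum>p<m. a p) + (if m = 0 then 0 else (u (m - 1))\<^sup>2)"
    by (simp add: a_def)
  have row: "(\<Sum>j<m. u m * T m j * u j) = (if m = 0 then 0 else - u m * u (m - 1))" for m
  proof (cases m)
    case (Suc k)
    have "(\<Sum>j<m. u m * T m j * u j) = (\<Sum>j<m. if j = k then - u m * u k else 0)" by (rule sum.cong) (auto simp: T_def Suc)
    then show ?thesis using Suc by simp
  qed simp
  have col: "(\<Sum>i<m. u i * T i m * u m) = (\<Sum>j<m. u m * T m j * u j)" for m
    by (rule sum.cong) (auto simp: T_def)
  have "(\<Sum>i<m. \<Sum>j<m. u i * T i j * u j) = (\<Sum>p<m. a p) + (if m = 0 then 0 else (u (m - 1))\<^sup>2)"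
  proof (induction m)
    case (Suc m)
    have "(\<Sum>i<Suc m. \<Sum>j<Suc m. u i * T i j * u j) = (\<Sum>i<m. \<Sum>j<m. u i * T i j * u j) + (\<Sum>i<m. u i * T i m * u m) + (\<Sum>j<m. u m * T m j * u j) + u m * T m m * u m"
      by (simp add: sum.distrib)
    also have "\<dots> = (\<Sum>p<m. a p) + (if m = 0 then 0 else (u (m - 1))\<^sup>2) + 2 * (if m = 0 then 0 else - u m * u (m - 1)) + 2 * (u m)\<^sup>2"
      unfolding Suc.IH col row by (simp add: T_def power2_eq_square)
    also have "\<dots> = (\<Sum>p<Suc m. a p) + (u m)\<^sup>2" by (cases "m = 0") (simp_all add: a_def power2_eq_square algebra_simps)
    finally show ?case by simp
  qed simp
  then show ?thesis unfolding q l by simp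
qed

section \<open>Existence of the SRBM\<close>

definition bmY :: "real \<Rightarrow> (nat \<Rightarrow> real) \<Rightarrow> nat \<Rightarrow> real" where
  "bmY t \<omega> i = regul (\<lambda>s. bmX s \<omega>) i t"

definition bmW :: "real \<Rightarrow> (nat \<Rightarrow> real) \<Rightarrow> nat \<Rightarrow> real" where
  "bmW t \<omega> i = reflmap (\<lambda>s. bmX s \<omega>) t i"

lemma bmX_continuous: "continuous_on {0..} (\<lambda>t. bmX t \<omega> i)"
  unfolding bmX_def by (intro continuous_intros bm_continuous)

lemma adaptedI:
  assumes "\<And>t i. 0 \<le> t \<Longrightarrow> i < m \<Longrightarrow> (\<lambda>\<omega>. V t \<omega> i) \<in> borel_measurable (filtM d t)"
  shows "adapted gauss (bm_filt d) m V"
  unfolding adapted_def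
proof (intro allI impI ballI)
  fix t :: real and i and B :: "real set" assume t: "0 \<le> t" "i < m" "B \<in> sets borel"
  have "(\<lambda>\<omega>. V t \<omega> i) -` B \<inter> space (filtM d t) \<in> sets (filtM d t)"
    by (rule measurable_sets[OF assms[OF t(1,2)] t(3)])
  moreover have "(\<lambda>\<omega>. V t \<omega> i) -` B \<inter> space (filtM d t) = {\<omega>\<in>space gauss. V t \<omega> i \<in> B}" unfolding space_filtM by auto
  ultimately show "{\<omega>\<in>space gauss. V t \<omega> i \<in> B} \<in> bm_filt d t" by (simp only: sets_filtM)
qed

text \<open>The filtration is generated by the m + 1 underlying motions. It is at least as fine as
  that of the differences, and their increments are still independent of its past.\<close>

lemma bmX_brownian:
  "brownian gauss (bm_filt (Suc m)) m (\<lambda>_. 0) (tridiag m (-1) 2 (-1)) (delta0 m) bmX"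
  unfolding brownian_def
proof (intro conjI allI impI)
  interpret G: prob_space gauss by (rule prob_space_gauss)
  show "adapted gauss (bm_filt (Suc m)) m bmX"
    by (rule adaptedI) (auto simp: bmX_def[abs_def] intro!: borel_measurable_diff bm_filt_bm)
  show "AE \<omega> in gauss. \<forall>i<m. continuous_on {0..} (\<lambda>t. bmX t \<omega> i)" by (simp add: bmX_continuous)
  show "distr gauss (PiM {..<m} (\<lambda>_. borel)) (\<lambda>\<omega>. restrict (bmX 0 \<omega>) {..<m}) = delta0 m"
  proof -
    have "(\<lambda>\<omega>. restrict (bmX 0 \<omega>) {..<m}) = (\<lambda>\<omega>. \<lambda>i\<in>{..<m}. 0)" by (auto simp: fun_eq_iff bmX_def bm_0)
    then show ?thesis by (simp only:) (rule G.distr_const, simp add: space_PiM)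
  qed
next
  fix s t :: real and u :: "nat \<Rightarrow> real" and A
  assume h: "0 \<le> s \<and> s \<le> t \<and> A \<in> bm_filt (Suc m) s"
  \<comment> \<open>Summation by parts moves the combination of differences to the underlying
    motions.\<close>
  define w where "w p = (if p < m then u p else 0) - (if p = 0 then 0 else u (p - 1))" for p
  have lin: "(\<Sum>i<m. u i * (bmX t \<omega> i - bmX s \<omega> i)) = (\<Sum>p<Suc m. w p * (bm t \<omega> p - bm s \<omega> p))" for \<omega>
  proof -
    let ?b = "\<lambda>p. bm t \<omega> p - bm s \<omega> p"
    have "(\<Sum>p<Suc m. w p * ?b p) = (\<Sum>p<Suc m. (if p < m then u p else 0) * ?b p) - (\<Sum>p<Suc m. (if p = 0 then 0 else u (p - 1)) * ?b p)"
      by (simp only: w_def left_diff_distrib sum_subtractf)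
    also have "(\<Sum>p<Suc m. (if p < m then u p else 0) * ?b p) = (\<Sum>p<m. u p * ?b p)" by simp
    also have "(\<Sum>p<Suc m. (if p = 0 then 0 else u (p - 1)) * ?b p) = (\<Sum>p<m. u p * ?b (Suc p))"
      by (subst sum.lessThan_Suc_shift) simp
    finally show ?thesis by (simp add: bmX_def sum_subtractf[symmetric] algebra_simps)
  qed
  have sq: "(\<Sum>p<Suc m. (w p)\<^sup>2) = (\<Sum>i<m. \<Sum>j<m. u i * tridiag m (-1) 2 (-1) i j * u j)"
    using tridiag_qform[of m u] by (simp only: w_def qform_def)
  show "(\<integral>\<omega>. indicator A \<omega> * cis (\<Sum>i<m. u i * (bmX t \<omega> i - bmX s \<omega> i)) \<partial>gauss) =
        complex_of_real (measure gauss A) * cis ((t - s) * (\<Sum>i<m. u i * 0)) *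
        complex_of_real (exp (- (t - s) / 2 * (\<Sum>i<m. \<Sum>j<m. u i * tridiag m (-1) 2 (-1) i j * u j)))"
    unfolding lin using bm_increment_indep[of s t A "Suc m" w] h by (simp add: sq del: sum.lessThan_Suc)
next
  fix i t assume "i < m" "0 \<le> (t::real)"
  then show "integrable gauss (\<lambda>\<omega>. bmX t \<omega> i - bmX 0 \<omega> i - 0 * t)"
    by (simp add: bmX_def bm_0 bm_integrable)
next
  fix i and s t :: real and A assume i: "i < m" and h: "0 \<le> s \<and> s \<le> t \<and> A \<in> bm_filt (Suc m) s"
  have As: "A \<in> sets gauss" using h bm_filt_sets by blast
  have int: "integrable gauss (\<lambda>\<omega>. indicator A \<omega> * bm r \<omega> p)" if "0 \<le> r" for r p
    using integrable_mult_indicator[OF As bm_integrable[OF that, of p]] by simp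
  have z: "(\<integral>\<omega>. indicator A \<omega> * bm t \<omega> p \<partial>gauss) = (\<integral>\<omega>. indicator A \<omega> * bm s \<omega> p \<partial>gauss)" if "p < Suc m" for p
    using bm_increment_mean[of s t A "Suc m" p] h that int by (simp add: right_diff_distrib)
  show "(\<integral>\<omega>. indicator A \<omega> * (bmX t \<omega> i - bmX 0 \<omega> i - 0 * t) \<partial>gauss) = (\<integral>\<omega>. indicator A \<omega> * (bmX s \<omega> i - bmX 0 \<omega> i - 0 * s) \<partial>gauss)"
    using z[of i] z[of "Suc i"] i h int by (simp add: bmX_def bm_0 right_diff_distrib)
qed

lemma srbm_exists:
  "srbm gauss (bm_filt (Suc m)) m (\<lambda>_. 0) (tridiag m (-1) 2 (-1)) (tridiag m (-1) 1 0) (delta0 m) bmW bmX bmY"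
  unfolding srbm_def
proof (intro conjI)
  have b: "bdd_on T (\<lambda>s. bmX s \<omega> j)" and r: "rcont (\<lambda>s. bmX s \<omega> j)" for T \<omega> j
    by (rule continuous_bdd_on[OF bmX_continuous], rule continuous_rcont[OF bmX_continuous])
  have cR: "continuous_on {0..} (regul (\<lambda>s. bmX s \<omega>) i)" for \<omega> i by (rule regul_continuous) (rule bmX_continuous)
  have Xf: "(\<lambda>\<omega>. bmX s \<omega> j) \<in> borel_measurable (filtM (Suc m) t)" if "0 \<le> s" "s \<le> t" "j < m" for s t j
    unfolding bmX_def using that by (intro borel_measurable_diff bm_filt_bm) auto
  show "prob_space gauss" by (rule prob_space_gauss)
  show "is_filtration gauss (bm_filt (Suc m))" by (rule bm_filt_filtration)
  show "adapted gauss (bm_filt (Suc m)) m bmW"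
    by (rule adaptedI, unfold bmW_def, rule reflmap_measurable) (use b r Xf in auto)
  show "adapted gauss (bm_filt (Suc m)) m bmY"
    by (rule adaptedI, unfold bmY_def, rule regul_measurable) (use b r Xf in auto)
  show "brownian gauss (bm_filt (Suc m)) m (\<lambda>_. 0) (tridiag m (-1) 2 (-1)) (delta0 m) bmX" by (rule bmX_brownian)
  have R: "(\<Sum>j<m. tridiag m (-1) 1 0 i j * Y j) = Y i - (if i = 0 then 0 else Y (i - 1))" if i: "i < m" for i and Y :: "nat \<Rightarrow> real"
    by (rule tridiag_R[OF i])
  \<comment> \<open>Separating the input of the one-dimensional problem, for the first and for the
    later coordinates at once, lets the facts on \<open>regul1\<close> apply to every coordinate in
    the same way.\<close>
  have sp: "bmW t \<omega> i = (case i of 0 \<Rightarrow> bmX t \<omega> 0 | Suc j \<Rightarrow> bmX t \<omega> i - bmY t \<omega> j) + bmY t \<omega> i" for t \<omega> i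
    by (simp add: bmW_def bmY_def reflmap_def split: nat.split)
  have bY: "bmY t \<omega> i = regul1 (\<lambda>t. case i of 0 \<Rightarrow> bmX t \<omega> 0 | Suc j \<Rightarrow> bmX t \<omega> i - bmY t \<omega> j) t" for t \<omega> i
    by (cases i) (simp_all add: bmY_def)
  have cd: "continuous_on {0..} (\<lambda>t. case i of 0 \<Rightarrow> bmX t \<omega> 0 | Suc j \<Rightarrow> bmX t \<omega> i - bmY t \<omega> j)" for \<omega> i
    unfolding bmY_def by (cases i) (auto intro!: continuous_intros bmX_continuous cR simp del: regul.simps)
  show "AE \<omega> in gauss.
        (\<forall>t\<ge>0. \<forall>i<m. bmW t \<omega> i = bmX t \<omega> i + (\<Sum>j<m. tridiag m (-1) 1 0 i j * bmY t \<omega> j)) \<and>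
        (\<forall>i<m. continuous_on {0..} (\<lambda>t. bmW t \<omega> i)) \<and>
        (\<forall>t\<ge>0. \<forall>i<m. bmW t \<omega> i \<ge> 0) \<and>
        (\<forall>i<m. bmY 0 \<omega> i = 0 \<and> continuous_on {0..} (\<lambda>t. bmY t \<omega> i) \<and> mono_on {0..} (\<lambda>t. bmY t \<omega> i) \<and>
           emeasure (interval_measure (\<lambda>t. bmY (max 0 t) \<omega> i)) {t. 0 \<le> t \<and> bmW t \<omega> i > 0} = 0)"
  proof (rule AE_I2, intro conjI allI impI)
    fix \<omega> :: "nat \<Rightarrow> real" and t :: real and i :: nat
    assume i: "i < m"
    show "continuous_on {0..} (\<lambda>t. bmW t \<omega> i)" unfolding bmW_def by (rule reflmap_continuous) (rule bmX_continuous)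
    show "continuous_on {0..} (\<lambda>t. bmY t \<omega> i)" unfolding bmY_def by (rule cR)
    show "mono_on {0..} (\<lambda>t. bmY t \<omega> i)"
      unfolding bmY_def by (rule mono_onI, rule regul_mono) (use b in auto)
    show "bmY 0 \<omega> i = 0"
    proof -
      have "bmY 0 \<omega> i = 0" for i
      proof (induction i)
        case 0
        then show ?case by (simp add: bmY_def regul1_def bmX_def bm_0)
      next
        case (Suc i)
        then show ?case by (simp add: bmY_def regul1_def bmX_def bm_0)
      qed
      then show ?thesis .
    qed
    show "emeasure (interval_measure (\<lambda>t. bmY (max 0 t) \<omega> i)) {t. 0 \<le> t \<and> bmW t \<omega> i > 0} = 0"
      using regul1_complement[OF cd[of \<omega> i]] unfolding bY[symmetric] sp[symmetric] by simp
    assume t: "0 \<le> t"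
    show "bmW t \<omega> i = bmX t \<omega> i + (\<Sum>j<m. tridiag m (-1) 1 0 i j * bmY t \<omega> j)"
      unfolding R[OF i] by (simp add: bmW_def bmY_def reflmap_def)
    show "bmW t \<omega> i \<ge> 0"
      unfolding sp bY[of t \<omega> i] using regul1_ge1[OF continuous_bdd_on[OF cd[of \<omega> i], of t] t order_refl] by simp
  qed
qed

section \<open>Brownian scaling of the reflection map\<close>

lemma regul1_cong: "(\<And>s. 0 \<le> s \<Longrightarrow> s \<le> t \<Longrightarrow> y s = z s) \<Longrightarrow> regul1 y t = regul1 z t"
  unfolding regul1_def by (rule SUP_cong) auto

text \<open>The change of time maps [0, t] onto [0, n t], and a positive factor passes through the
  supremum.\<close>

lemma regul1_scale:
  assumes b: "bdd_on (n * t) y" and a: "a > 0" and n: "n > 0" and t: "0 \<le> t"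
  shows "regul1 (\<lambda>s. a * y (n * s)) t = a * regul1 y (n * t)"
proof (rule antisym)
  have nt: "0 \<le> n * t" using n t by simp
  have b': "bdd_on t (\<lambda>s. a * y (n * s))"
  proof -
    obtain B where B: "\<forall>s\<in>{0..n * t}. \<bar>y s\<bar> \<le> B" using b unfolding bdd_on_def by blast
    have "\<bar>a * y (n * s)\<bar> \<le> a * B" if "s \<in> {0..t}" for s
      using B[rule_format, of "n * s"] that a n by (simp add: abs_mult)
    then show ?thesis unfolding bdd_on_def by blast
  qed
  show "regul1 (\<lambda>s. a * y (n * s)) t \<le> a * regul1 y (n * t)"
  proof (rule regul1_le[OF t])
    show "0 \<le> a * regul1 y (n * t)" using regul1_nonneg[OF b nt] a by simp
    fix s assume s: "0 \<le> s" "s \<le> t"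
    have "- y (n * s) \<le> regul1 y (n * t)" by (rule regul1_ge1[OF b]) (use s n in auto)
    then have "a * (- y (n * s)) \<le> a * regul1 y (n * t)" using a by (intro mult_left_mono) auto
    then show "- (a * y (n * s)) \<le> a * regul1 y (n * t)" by simp
  qed
  have "regul1 y (n * t) \<le> (1 / a) * regul1 (\<lambda>s. a * y (n * s)) t"
  proof (rule regul1_le[OF nt])
    show "0 \<le> (1 / a) * regul1 (\<lambda>s. a * y (n * s)) t" using regul1_nonneg[OF b' t] a by simp
    fix s assume s: "0 \<le> s" "s \<le> n * t"
    have "- (a * y (n * (s / n))) \<le> regul1 (\<lambda>s. a * y (n * s)) t"
      by (rule regul1_ge1[OF b', of "s / n"]) (use s n in \<open>auto simp: field_simps\<close>)
    then show "- y s \<le> (1 / a) * regul1 (\<lambda>s. a * y (n * s)) t" using a n by (simp add: field_simps)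
  qed
  then show "a * regul1 y (n * t) \<le> regul1 (\<lambda>s. a * y (n * s)) t" using a by (simp add: field_simps)
qed

lemma regul_scale:
  assumes "\<And>j. j \<le> i \<Longrightarrow> bdd_on (n * t) (\<lambda>s. x s j)" and a: "a > 0" and n: "n > 0" and "0 \<le> t"
  shows "regul (\<lambda>s j. a * x (n * s) j) i t = a * regul x i (n * t)"
  using assms(1,4)
proof (induction i arbitrary: t)
  case 0
  then show ?case using regul1_scale[of n t "\<lambda>s. x s 0" a] a n by simp
next
  case (Suc i)
  have b: "bdd_on (n * t) (regul x i)" by (rule regul_bdd_on) (use Suc.prems in auto)
  have "regul (\<lambda>s j. a * x (n * s) j) (Suc i) t = regul1 (\<lambda>s. a * (x (n * s) (Suc i) - regul x i (n * s))) t"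
    unfolding regul.simps
  proof (rule regul1_cong)
    fix s assume s: "0 \<le> s" "s \<le> t"
    have "regul (\<lambda>s j. a * x (n * s) j) i s = a * regul x i (n * s)"
    proof (rule Suc.IH)
      show "bdd_on (n * s) (\<lambda>s. x s j)" if "j \<le> i" for j
        by (rule bdd_on_mono[OF Suc.prems(1)]) (use that s n in auto)
    qed (rule s)
    then show "a * x (n * s) (Suc i) - regul (\<lambda>s j. a * x (n * s) j) i s = a * (x (n * s) (Suc i) - regul x i (n * s))"
      by (simp add: right_diff_distrib)
  qed
  also have "\<dots> = a * regul1 (\<lambda>s. x s (Suc i) - regul x i s) (n * t)"
    by (rule regul1_scale[OF bdd_on_diff[OF _ b] a n]) (use Suc.prems in auto)
  finally show ?case by simp
qed

lemma reflmap_scale: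
  assumes "\<And>j. j \<le> i \<Longrightarrow> bdd_on (n * t) (\<lambda>s. x s j)" and a: "a > 0" and n: "n > 0" and "0 \<le> t"
  shows "reflmap (\<lambda>s j. a * x (n * s) j) t i = a * reflmap x (n * t) i"
  unfolding reflmap_def using regul_scale[OF assms] regul_scale[of "i - 1" n t x a] assms
  by (auto simp: algebra_simps)

section \<open>Gaps as a reflection of the clock processes\<close>

definition ringers :: "(nat \<Rightarrow> nat \<Rightarrow> real) \<Rightarrow> nat \<Rightarrow> real set" where
  "ringers E i = range (ring_time E i)"

definition rings :: "nat \<Rightarrow> (nat \<Rightarrow> nat \<Rightarrow> real) \<Rightarrow> real set" where
  "rings d E = (\<Union>i<d. ringers E i)"

text \<open>The almost sure event for all pathwise arguments. Unbounded ring times leave finitely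
  many rings before any time; for an infinite set \<open>sorted_list_of_set\<close> and
  \<open>card\<close> would return their default values. The absence of ties makes the order of
  simultaneous jumps irrelevant.\<close>

definition generic :: "nat \<Rightarrow> (nat \<Rightarrow> nat \<Rightarrow> real) \<Rightarrow> bool" where
  "generic d E \<longleftrightarrow> (\<forall>i<d. \<forall>k. 0 < E i k) \<and> (\<forall>i<d. \<forall>T::nat. \<exists>k. real T < ring_time E i k) \<and>
     (\<forall>i<d. \<forall>j<d. \<forall>k l. ring_time E i k = ring_time E j l \<longrightarrow> i = j)"

definition cnt :: "(nat \<Rightarrow> nat \<Rightarrow> real) \<Rightarrow> nat \<Rightarrow> real \<Rightarrow> nat" where
  "cnt E i t = card {k. ring_time E i k \<le> t}"

text \<open>The sequence of jumping particles is indexed by a set of ring times, so that inductions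
  can add the latest ring.\<close>

definition evlist :: "nat \<Rightarrow> (nat \<Rightarrow> nat \<Rightarrow> real) \<Rightarrow> real set \<Rightarrow> nat list" where
  "evlist d E A = concat (map (\<lambda>s. filter (\<lambda>i. s \<in> ringers E i) [0..<d]) (sorted_list_of_set A))"

lemma pt_config_evlist: "pt_config d x0 E t = fold push (evlist d E {s\<in>rings d E. s \<le> t}) x0"
proof -
  have "{s. s \<le> t \<and> (\<exists>i<d. \<exists>k. s = ring_time E i k)} = {s\<in>rings d E. s \<le> t}" by (auto simp: rings_def ringers_def)
  moreover have "(\<lambda>s. filter (\<lambda>i. \<exists>k. s = ring_time E i k) [0..<d]) = (\<lambda>s. filter (\<lambda>i. s \<in> ringers E i) [0..<d])"
    by (intro ext filter_cong) (auto simp: ringers_def)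
  ultimately show ?thesis by (simp only: pt_config_def evlist_def)
qed

lemma ring_time_Suc: "ring_time E i (Suc k) = ring_time E i k + E i (Suc k)"
  by (simp add: ring_time_def)

lemma ring_time_strict_mono: "generic d E \<Longrightarrow> i < d \<Longrightarrow> strict_mono (ring_time E i)"
  unfolding strict_mono_Suc_iff by (auto simp: ring_time_Suc generic_def)

lemma ring_time_pos: "generic d E \<Longrightarrow> i < d \<Longrightarrow> 0 < ring_time E i k"
  by (induction k) (auto simp: ring_time_def generic_def add_pos_pos)

lemma ring_index_finite:
  assumes g: "generic d E" and i: "i < d" shows "finite {k. ring_time E i k \<le> t}"
proof -
  obtain K where K: "real (nat \<lceil>t\<rceil>) < ring_time E i K" using g i unfolding generic_def by blast
  have "{k. ring_time E i k \<le> t} \<subseteq> {..<K}"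
  proof safe
    fix k assume "ring_time E i k \<le> t"
    then have "ring_time E i k < ring_time E i K" using K real_nat_ceiling_ge[of t] by linarith
    then show "k < K" using ring_time_strict_mono[OF g i] by (simp add: strict_mono_less)
  qed
  then show ?thesis by (rule finite_subset) simp
qed

lemma rings_finite:
  assumes g: "generic d E" shows "finite {s\<in>rings d E. s \<le> t}"
proof -
  have "{s\<in>rings d E. s \<le> t} = (\<Union>i<d. ring_time E i ` {k. ring_time E i k \<le> t})" by (auto simp: rings_def ringers_def)
  then show ?thesis using ring_index_finite[OF g] by auto
qed

lemma rings_pos: "generic d E \<Longrightarrow> rings d E \<subseteq> {0<..}"
  using ring_time_pos by (auto simp: rings_def ringers_def)

text \<open>Without ties a new latest ring appends exactly one particle.\<close>

lemma evlist_insert: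
  assumes g: "generic d E" and A: "finite A" "\<forall>a\<in>A. a < \<tau>" and e: "e < d" "\<tau> \<in> ringers E e"
  shows "evlist d E (insert \<tau> A) = evlist d E A @ [e]"
proof -
  have "sorted_list_of_set (insert \<tau> A) = sorted_list_of_set A @ [\<tau>]"
  proof (rule sorted_distinct_set_unique)
    have f: "finite (insert \<tau> A)" using A by simp
    show "sorted (sorted_list_of_set A @ [\<tau>])" using A by (auto simp: sorted_append less_imp_le)
    show "distinct (sorted_list_of_set A @ [\<tau>])" using A by auto
    show "sorted (sorted_list_of_set (insert \<tau> A))" "distinct (sorted_list_of_set (insert \<tau> A))"
      by (rule sorted_sorted_list_of_set distinct_sorted_list_of_set)+
    show "set (sorted_list_of_set (insert \<tau> A)) = set (sorted_list_of_set A @ [\<tau>])"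
      by (simp only: set_sorted_list_of_set[OF f] set_append set_sorted_list_of_set[OF A(1)]) auto
  qed
  moreover have "filter (\<lambda>i. \<tau> \<in> ringers E i) [0..<d] = [e]"
  proof (rule sorted_distinct_set_unique)
    have u: "i = e" if "i < d" "\<tau> \<in> ringers E i" for i
    proof -
      note h = that
      obtain k where "\<tau> = ring_time E i k" using h(2) by (auto simp: ringers_def)
      moreover obtain l where "\<tau> = ring_time E e l" using e(2) by (auto simp: ringers_def)
      ultimately show ?thesis using g h(1) e(1) unfolding generic_def by metis
    qed
    show "set (filter (\<lambda>i. \<tau> \<in> ringers E i) [0..<d]) = set [e]" using e by (auto dest: u)
    show "sorted (filter (\<lambda>i. \<tau> \<in> ringers E i) [0..<d])" by (rule sorted_wrt_filter) simp
    show "distinct (filter (\<lambda>i. \<tau> \<in> ringers E i) [0..<d])" by simp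
  qed simp_all
  ultimately show ?thesis by (simp add: evlist_def)
qed

definition pcount :: "(nat \<Rightarrow> nat \<Rightarrow> real) \<Rightarrow> nat \<Rightarrow> real set \<Rightarrow> nat" where
  "pcount E i A = card (A \<inter> ringers E i)"

lemma pcount_insert:
  assumes g: "generic d E" and A: "finite A" "\<forall>a\<in>A. a < \<tau>" and e: "e < d" "\<tau> \<in> ringers E e" and i: "i < d"
  shows "pcount E i (insert \<tau> A) = pcount E i A + (if i = e then 1 else 0)"
proof -
  have "\<tau> \<notin> A" using A by auto
  moreover have "\<tau> \<in> ringers E i \<longleftrightarrow> i = e"
  proof
    assume "\<tau> \<in> ringers E i"
    then obtain k where "\<tau> = ring_time E i k" by (auto simp: ringers_def)
    moreover obtain l where "\<tau> = ring_time E e l" using e(2) by (auto simp: ringers_def)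
    ultimately show "i = e" using g i e(1) unfolding generic_def by metis
  qed (use e in auto)
  ultimately show ?thesis using A by (auto simp: pcount_def Int_insert_left)
qed

lemma pcount_cnt:
  assumes g: "generic d E" and i: "i < d"
  shows "pcount E i {s\<in>rings d E. s \<le> t} = cnt E i t"
proof -
  have "{s\<in>rings d E. s \<le> t} \<inter> ringers E i = ring_time E i ` {k. ring_time E i k \<le> t}"
    using i by (auto simp: rings_def ringers_def)
  moreover have "inj_on (ring_time E i) {k. ring_time E i k \<le> t}"
    using ring_time_strict_mono[OF g i] by (meson strict_mono_imp_inj_on inj_on_subset subset_UNIV)
  ultimately show ?thesis by (simp add: pcount_def cnt_def card_image)
qed

text \<open>pushV is the number of times particle i + 1 was pushed; pushU is the number of pushes that would be forced
  by the position of particle i alone.\<close>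

definition cfg :: "nat \<Rightarrow> (nat \<Rightarrow> int) \<Rightarrow> (nat \<Rightarrow> nat \<Rightarrow> real) \<Rightarrow> real set \<Rightarrow> nat \<Rightarrow> int" where
  "cfg d x0 E A = fold push (evlist d E A) x0"

definition pushV :: "nat \<Rightarrow> (nat \<Rightarrow> int) \<Rightarrow> (nat \<Rightarrow> nat \<Rightarrow> real) \<Rightarrow> nat \<Rightarrow> real set \<Rightarrow> int" where
  "pushV d x0 E i A = cfg d x0 E A (Suc i) - x0 (Suc i) - int (pcount E (Suc i) A)"

definition pushU :: "nat \<Rightarrow> (nat \<Rightarrow> int) \<Rightarrow> (nat \<Rightarrow> nat \<Rightarrow> real) \<Rightarrow> nat \<Rightarrow> real set \<Rightarrow> int" where
  "pushU d x0 E i A = cfg d x0 E A i + 1 - x0 (Suc i) - int (pcount E (Suc i) A)"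

lemma push_below: "j < e \<Longrightarrow> push e x j = x j"
  by (induction j) auto

lemma cfg_insert:
  assumes "generic d E" "finite A" "\<forall>a\<in>A. a < \<tau>" "e < d" "\<tau> \<in> ringers E e"
  shows "cfg d x0 E (insert \<tau> A) = push e (cfg d x0 E A)"
  unfolding cfg_def evlist_insert[OF assms] by simp

text \<open>A ring to the right of particle i + 1 changes neither side. A ring of particle i + 1
  itself moves the particle and its own count together, so only \<open>pushU\<close> drops. A ring
  at or to the left of particle i is the maximum in \<open>push\<close>. The hypothesis on U and V
  is the strict order of the two particles.\<close>

lemma push_step:
  assumes g: "generic d E" and A: "finite A" "\<forall>a\<in>A. a < \<tau>" and e: "e < d" "\<tau> \<in> ringers E e" and i: "Suc i < d"
    and UV: "pushU d x0 E i A \<le> pushV d x0 E i A"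
  shows "pushV d x0 E i (insert \<tau> A) = max (pushV d x0 E i A) (pushU d x0 E i (insert \<tau> A))"
proof -
  note c = cfg_insert[OF g A e] and p = pcount_insert[OF g A e i]
  consider "Suc i < e" | "Suc i = e" | "e < Suc i" by linarith
  then show ?thesis
  proof cases
    case 1
    then show ?thesis using UV push_below[of i e] by (simp add: pushV_def pushU_def c p)
  next
    case 2
    then have e2: "e = Suc i" by simp
    show ?thesis using UV push_below[of i e] by (simp add: pushV_def pushU_def c p e2)
  next
    case 3
    then show ?thesis by (simp add: pushV_def pushU_def c p max_def)
  qed
qed

text \<open>The number of pushes is the running maximum of 0 and \<open>pushU\<close>. Stated as an
  upper bound that is attained, it can be proved by adding the latest ring and compared afterwards
  with a supremum over a real interval. The initial order of the particles makes
  \<open>pushU\<close> at most 0 before the first ring.\<close>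

lemma push_characterization:
  assumes g: "generic d E" and i: "Suc i < d" and x0: "x0 i < x0 (Suc i)"
    and A: "finite A" "A \<subseteq> rings d E"
  shows "0 \<le> pushV d x0 E i A \<and> (\<forall>r. pushU d x0 E i {a\<in>A. a \<le> r} \<le> pushV d x0 E i A) \<and>
     (pushV d x0 E i A = 0 \<or> (\<exists>r\<in>A. pushV d x0 E i A = pushU d x0 E i {a\<in>A. a \<le> r}))"
  using A
proof (induction A rule: finite_linorder_max_induct)
  case empty
  then show ?case using x0 by (simp add: pushV_def pushU_def cfg_def evlist_def pcount_def)
next
  case (insert \<tau> A)
  obtain e where e: "e < d" "\<tau> \<in> ringers E e" using insert.prems by (auto simp: rings_def)
  have IH: "0 \<le> pushV d x0 E i A" "\<And>r. pushU d x0 E i {a\<in>A. a \<le> r} \<le> pushV d x0 E i A"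
     "pushV d x0 E i A = 0 \<or> (\<exists>r\<in>A. pushV d x0 E i A = pushU d x0 E i {a\<in>A. a \<le> r})"
    using insert by auto
  have AA: "{a\<in>A. a \<le> \<tau>} = A" using insert.hyps by auto
  have V: "pushV d x0 E i (insert \<tau> A) = max (pushV d x0 E i A) (pushU d x0 E i (insert \<tau> A))"
    by (rule push_step[OF g insert.hyps e i]) (use IH(2)[of \<tau>] AA in simp)
  have seg1: "{a\<in>insert \<tau> A. a \<le> r} = insert \<tau> A" if "\<tau> \<le> r" for r using insert.hyps that by force
  have seg2: "{a\<in>insert \<tau> A. a \<le> r} = {a\<in>A. a \<le> r}" if "r < \<tau>" for r using that by auto
  show ?case
  proof (intro conjI allI)
    show "0 \<le> pushV d x0 E i (insert \<tau> A)" using V IH(1) by simp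
    fix r show "pushU d x0 E i {a\<in>insert \<tau> A. a \<le> r} \<le> pushV d x0 E i (insert \<tau> A)"
    proof (cases "\<tau> \<le> r")
      case True
      then show ?thesis using V unfolding seg1[OF True] by simp
    next
      case False
      then have "r < \<tau>" by simp
      then show ?thesis using V IH(2)[of r] unfolding seg2[OF \<open>r < \<tau>\<close>] by simp
    qed
  next
    show "pushV d x0 E i (insert \<tau> A) = 0 \<or> (\<exists>r\<in>insert \<tau> A. pushV d x0 E i (insert \<tau> A) = pushU d x0 E i {a\<in>insert \<tau> A. a \<le> r})"
    proof (cases "pushV d x0 E i A \<le> pushU d x0 E i (insert \<tau> A)")
      case True
      then have "pushV d x0 E i (insert \<tau> A) = pushU d x0 E i {a\<in>insert \<tau> A. a \<le> \<tau>}" using V unfolding seg1[OF order_refl] by simp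
      then show ?thesis by blast
    next
      case False
      then have VV: "pushV d x0 E i (insert \<tau> A) = pushV d x0 E i A" using V by simp
      from IH(3) show ?thesis
      proof
        assume "\<exists>r\<in>A. pushV d x0 E i A = pushU d x0 E i {a\<in>A. a \<le> r}"
        then obtain r where r: "r \<in> A" "pushV d x0 E i A = pushU d x0 E i {a\<in>A. a \<le> r}" by blast
        then have "r < \<tau>" using insert.hyps by auto
        then have "pushV d x0 E i (insert \<tau> A) = pushU d x0 E i {a\<in>insert \<tau> A. a \<le> r}"
          unfolding seg2[OF \<open>r < \<tau>\<close>] using r VV by simp
        then show ?thesis using r(1) by blast
      qed (use VV in simp)
    qed
  qed
qed

text \<open>The gaps as they would evolve if clocks never pushed anybody: the input of the
  reflection.\<close>

definition netpath :: "(nat \<Rightarrow> int) \<Rightarrow> (nat \<Rightarrow> nat \<Rightarrow> real) \<Rightarrow> real \<Rightarrow> nat \<Rightarrow> real" where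
  "netpath x0 E t i = real_of_int (x0 (Suc i) - x0 i - 1) + real (cnt E (Suc i) t) - real (cnt E i t)"

lemma cfg_0:
  assumes g: "generic d E" and d: "0 < d" and A: "finite A" "A \<subseteq> rings d E"
  shows "cfg d x0 E A 0 = x0 0 + int (pcount E 0 A)"
  using A
proof (induction A rule: finite_linorder_max_induct)
  case empty
  then show ?case by (simp add: cfg_def evlist_def pcount_def)
next
  case (insert \<tau> A)
  obtain e where e: "e < d" "\<tau> \<in> ringers E e" using insert.prems by (auto simp: rings_def)
  show ?case using insert pcount_insert[OF g insert.hyps e d] by (simp add: cfg_insert[OF g insert.hyps e])
qed

text \<open>A particle is at its initial position plus its own rings plus the pushes received. Hence
  the negative of \<open>pushU\<close> for gap i + 1 is \<open>netpath\<close> minus the pushes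
  counted at gap i, which is the recursion of \<open>regul\<close>. The supremum over all times is
  attained at a ring or is 0.\<close>

lemma pushV_regul:
  assumes g: "generic d E" and x0: "\<And>i. Suc i < d \<Longrightarrow> x0 i < x0 (Suc i)"
  shows "Suc i < d \<Longrightarrow> 0 \<le> t \<Longrightarrow> real_of_int (pushV d x0 E i {s\<in>rings d E. s \<le> t}) = regul (netpath x0 E) i t"
proof (induction i arbitrary: t)
  let ?A = "\<lambda>t. {s\<in>rings d E. s \<le> t}"
  have main: "real_of_int (pushV d x0 E i (?A t)) = regul1 y t"
    if i: "Suc i < d" and t: "0 \<le> t" and y: "\<And>s. 0 \<le> s \<Longrightarrow> s \<le> t \<Longrightarrow> y s = - real_of_int (pushU d x0 E i (?A s))" for i t y
  proof -
    have seg: "{a\<in>?A t. a \<le> r} = ?A r" if "r \<le> t" for r using that by auto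
    note ch = push_characterization[OF g i x0[OF i] rings_finite[OF g, of t], OF Collect_restrict]
    have le: "max 0 (- y s) \<le> real_of_int (pushV d x0 E i (?A t))" if s: "0 \<le> s" "s \<le> t" for s
    proof -
      have "pushU d x0 E i {a\<in>?A t. a \<le> s} \<le> pushV d x0 E i (?A t)" using ch by blast
      then have "pushU d x0 E i (?A s) \<le> pushV d x0 E i (?A t)" unfolding seg[OF s(2)] .
      then show ?thesis using ch y[OF s] by simp
    qed
    have bd: "bdd_above ((\<lambda>s. max 0 (- y s)) ` {0..t})" by (rule bdd_aboveI2[OF le]) auto
    show ?thesis unfolding regul1_def
    proof (rule antisym)
      show "(SUP s\<in>{0..t}. max 0 (- y s)) \<le> real_of_int (pushV d x0 E i (?A t))"
        by (rule cSUP_least) (use t le in auto)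
      from ch consider "pushV d x0 E i (?A t) = 0" | r where "r \<in> ?A t" "pushV d x0 E i (?A t) = pushU d x0 E i {a\<in>?A t. a \<le> r}" by blast
      then show "real_of_int (pushV d x0 E i (?A t)) \<le> (SUP s\<in>{0..t}. max 0 (- y s))"
      proof cases
        case 1
        have "0 \<le> max 0 (- y 0)" by simp
        also have "\<dots> \<le> (SUP s\<in>{0..t}. max 0 (- y s))" by (rule cSUP_upper[OF _ bd]) (use t in simp)
        finally show ?thesis using 1 by simp
      next
        case 2
        then have r: "0 \<le> r" "r \<le> t" using rings_pos[OF g] by auto
        have "real_of_int (pushV d x0 E i (?A t)) = - y r" unfolding 2(2) seg[OF r(2)] using y[OF r] by simp
        also have "\<dots> \<le> max 0 (- y r)" by simp
        also have "\<dots> \<le> (SUP s\<in>{0..t}. max 0 (- y s))" by (rule cSUP_upper[OF _ bd]) (use r in simp)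
        finally show ?thesis .
      qed
    qed
  qed
  {
    case 0
    show ?case unfolding regul.simps
    proof (rule main)
      fix s :: real assume "0 \<le> s"
      have "0 < d" using 0 by simp
      then show "netpath x0 E s 0 = - real_of_int (pushU d x0 E 0 (?A s))"
        using cfg_0[OF g _ rings_finite[OF g, of s] Collect_restrict, of x0] pcount_cnt[OF g, of 0 s] pcount_cnt[OF g, of "Suc 0" s] 0
        by (simp add: netpath_def pushU_def)
    qed (use 0 in auto)
  next
    case (Suc i)
    show ?case unfolding regul.simps
    proof (rule main)
      fix s :: real assume s: "0 \<le> s"
      have "real_of_int (pushV d x0 E i (?A s)) = regul (netpath x0 E) i s" by (rule Suc.IH) (use Suc.prems s in auto)
      then show "netpath x0 E s (Suc i) - regul (netpath x0 E) i s = - real_of_int (pushU d x0 E (Suc i) (?A s))"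
        using pcount_cnt[OF g, of "Suc i" s] pcount_cnt[OF g, of "Suc (Suc i)" s] Suc.prems
        by (simp add: netpath_def pushU_def pushV_def)
    qed (use Suc.prems in auto)
  }
qed

text \<open>Pushes of particle i + 1 widen gap i, pushes of particle i narrow it, as the two nonzero
  entries in a row of the reflection matrix say.\<close>

lemma gaps_reflmap:
  assumes g: "generic d E" and x0: "\<And>i. Suc i < d \<Longrightarrow> x0 i < x0 (Suc i)" and t: "0 \<le> t" and i: "i < d - 1"
  shows "gaps d (pt_config d x0 E t) i = reflmap (netpath x0 E) t i"
proof -
  let ?A = "{s\<in>rings d E. s \<le> t}"
  have c: "pt_config d x0 E t = cfg d x0 E ?A" by (simp add: pt_config_evlist cfg_def)
  have i': "Suc i < d" using i by simp
  have V: "real_of_int (cfg d x0 E ?A (Suc i)) = real_of_int (x0 (Suc i)) + real (cnt E (Suc i) t) + regul (netpath x0 E) i t"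
  proof -
    have "real_of_int (pushV d x0 E i ?A) = regul (netpath x0 E) i t"
      by (rule pushV_regul) (use g x0 i' t in auto)
    then show ?thesis using pcount_cnt[OF g i', of t] by (simp add: pushV_def)
  qed
  have W: "real_of_int (cfg d x0 E ?A i) = real_of_int (x0 i) + real (cnt E i t) + (if i = 0 then 0 else regul (netpath x0 E) (i - 1) t)"
  proof (cases i)
    case 0
    then show ?thesis using cfg_0[OF g _ rings_finite[OF g, of t] Collect_restrict, of x0] pcount_cnt[OF g, of 0 t] i' by simp
  next
    case (Suc j)
    have "real_of_int (pushV d x0 E j ?A) = regul (netpath x0 E) j t"
      by (rule pushV_regul) (use g x0 i' Suc t in auto)
    then show ?thesis using Suc pcount_cnt[OF g, of i t] i' by (simp add: pushV_def)
  qed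
  show ?thesis using i V W by (simp add: gaps_def c reflmap_def netpath_def)
qed

section \<open>Rescaled gap paths\<close>

definition psum :: "(nat \<Rightarrow> nat \<Rightarrow> real) \<Rightarrow> nat \<Rightarrow> nat \<Rightarrow> real" where
  "psum e i m = (\<Sum>k<m. e i k)"

definition walk :: "(nat \<Rightarrow> nat \<Rightarrow> real) \<Rightarrow> nat \<Rightarrow> real \<Rightarrow> nat \<Rightarrow> real" where
  "walk e n t i = (psum e i (nat \<lfloor>real n * t\<rfloor>) - real (nat \<lfloor>real n * t\<rfloor>)) / sqrt (real n)"

lemma ring_time_psum: "ring_time e i k = psum e i (Suc k)"
  by (simp add: ring_time_def psum_def lessThan_Suc_atMost)

lemma psum_mono: "generic d e \<Longrightarrow> i < d \<Longrightarrow> k \<le> l \<Longrightarrow> psum e i k \<le> psum e i l"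
  unfolding psum_def by (rule sum_mono2) (auto simp: generic_def intro: less_imp_le)

text \<open>The indices of the rings up to t form an initial segment, so the count is the index at
  which the partial sums cross t.\<close>

lemma cnt_bounds:
  assumes g: "generic d e" and i: "i < d" and t: "0 \<le> t"
  shows "psum e i (cnt e i t) \<le> t" "t < psum e i (Suc (cnt e i t))"
proof -
  let ?S = "{k. ring_time e i k \<le> t}"
  have fin: "finite ?S" by (rule ring_index_finite[OF g i])
  have down: "k \<in> ?S" if "l \<in> ?S" "k \<le> l" for k l
    using that strict_mono_mono[OF ring_time_strict_mono[OF g i]] by (auto dest: monoD intro: order_trans)
  have "?S = {..<card ?S}"
  proof (cases "?S = {}")
    case False
    have "?S = {..Max ?S}" using down Max_in[OF fin False] Max_ge[OF fin] by blast
    then have "card ?S = Suc (Max ?S)" by (metis card_atMost)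
    then show ?thesis using \<open>?S = {..Max ?S}\<close> by (simp only: lessThan_Suc_atMost)
  qed (metis card.empty lessThan_0)
  then have S: "ring_time e i k \<le> t \<longleftrightarrow> k < cnt e i t" for k unfolding cnt_def by blast
  show "t < psum e i (Suc (cnt e i t))" using S[of "cnt e i t"] by (simp add: ring_time_psum)
  show "psum e i (cnt e i t) \<le> t"
  proof (cases "cnt e i t")
    case 0
    then show ?thesis using t by (simp add: psum_def)
  next
    case (Suc k)
    then show ?thesis using S[of k] by (simp add: ring_time_psum)
  qed
qed

text \<open>The counting process is the inverse of the partial sums, so its fluctuations converge to the negative of
  the limit of the fluctuations of the partial sums.\<close>

lemma cnt_fluctuation:
  fixes nn :: "nat \<Rightarrow> nat"
  assumes nn: "filterlim nn at_top sequentially" and g: "\<And>j. generic d (e j)" and i: "i < d"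
    and c: "continuous_on {0..} (\<lambda>t. b t i)"
    and conv: "\<forall>T>0. \<forall>\<epsilon>>0. eventually (\<lambda>j. \<forall>t\<in>{0..T}. \<bar>walk (e j) (nn j) t i - b t i\<bar> \<le> \<epsilon>) sequentially"
    and T: "0 < T" and \<epsilon>: "0 < (\<epsilon>::real)"
  shows "eventually (\<lambda>j. \<forall>t\<in>{0..T}. \<bar>(real (cnt (e j) i (real (nn j) * t)) - real (nn j) * t) / sqrt (real (nn j)) + b t i\<bar> \<le> \<epsilon>) sequentially"
proof -
  \<comment> \<open>The walks are evaluated at m/n and (m + 1)/n, where m is the count at time n t;
    these arguments are shown below to stay under T + 2.\<close>
  obtain B where B: "\<And>s. s \<in> {0..T + 2} \<Longrightarrow> \<bar>b s i\<bar> \<le> B"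
    using continuous_bdd_on[OF c, of "T + 2"] unfolding bdd_on_def by blast
  have B0: "0 \<le> B" using B[of 0] T by force
  have "uniformly_continuous_on {0..T + 2} (\<lambda>t. b t i)"
    by (intro compact_uniformly_continuous continuous_on_subset[OF c]) auto
  then obtain \<delta> where \<delta>: "\<delta> > 0" "\<And>r s. r \<in> {0..T + 2} \<Longrightarrow> s \<in> {0..T + 2} \<Longrightarrow> \<bar>r - s\<bar> < \<delta> \<Longrightarrow> \<bar>b r i - b s i\<bar> < \<epsilon> / 4"
    using \<epsilon> unfolding uniformly_continuous_on_def dist_real_def by (metis abs_minus_commute divide_pos_pos zero_less_numeral)
  have sq: "filterlim (\<lambda>j. sqrt (real (nn j))) at_top sequentially"
    by (intro filterlim_compose[OF sqrt_at_top] filterlim_compose[OF filterlim_real_sequentially nn])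
  have ev1: "eventually (\<lambda>j. \<forall>t\<in>{0..T + 2}. \<bar>walk (e j) (nn j) t i - b t i\<bar> \<le> min 1 (\<epsilon> / 4)) sequentially"
    by (rule conv[rule_format]) (use T \<epsilon> in auto)
  \<comment> \<open>The three thresholds: 4 / \<epsilon> for the overshoot of one unit, 2 (B + 3) /
    \<delta> for the distance between t and m/n or (m + 1)/n, and B + 4 to exclude counts above n (T
    + 1).\<close>
  have ev2: "eventually (\<lambda>j. sqrt (real (nn j)) \<ge> max (max (4 / \<epsilon>) (2 * (B + 3) / \<delta>)) (B + 4)) sequentially"
    using sq unfolding filterlim_at_top by blast
  show ?thesis using ev1 ev2
  proof eventually_elim
    case (elim j)
    define n where "n = real (nn j)"
    define r where "r = sqrt n"
    have r1: "4 / \<epsilon> \<le> r" "2 * (B + 3) / \<delta> \<le> r" "B + 4 \<le> r" using elim(2) by (auto simp: n_def r_def)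
    have r0: "r \<ge> 4" "r > 0" using r1 B0 by auto
    have n: "n = r * r" using r0 by (simp add: r_def n_def)
    have n1: "n \<ge> 4 * r" unfolding n using r0 by simp
    have n0: "n > 0" using n1 r0 by linarith
    have rle: "r \<le> n" using n1 r0 by linarith
    have v: "walk (e j) (nn j) s i \<le> b s i + \<epsilon> / 4" "walk (e j) (nn j) s i \<ge> b s i - \<epsilon> / 4" "\<bar>walk (e j) (nn j) s i\<bar> \<le> B + 1"
      if "s \<in> {0..T + 2}" for s using elim(1)[rule_format, OF that] B[OF that] by linarith+
    have ps: "psum (e j) i q = real q + r * walk (e j) (nn j) (real q / n) i" for q
    proof -
      have "real (nn j) * (real q / n) = real q" using n0 by (simp add: n_def)
      then show ?thesis using r0 by (simp add: walk_def r_def n_def)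
    qed
    show ?case
    proof
      fix t assume t: "t \<in> {0..T}"
      define m where "m = cnt (e j) i (n * t)"
      have nt: "0 \<le> n * t" using t n0 by simp
      note cb = cnt_bounds[OF g[of j] i nt, folded m_def]
      \<comment> \<open>A larger count would put the partial sum near index n (T + 1) below n T, a
        deviation of order n, while the walk only allows one of order sqrt n.\<close>
      have m_le: "real m \<le> n * (T + 1)"
      proof (rule ccontr)
        assume "\<not> real m \<le> n * (T + 1)"
        define q where "q = nat \<lfloor>n * (T + 1)\<rfloor>"
        have "0 \<le> n * (T + 1)" using n0 T by simp
        then have q: "real q \<le> n * (T + 1)" "n * (T + 1) < real q + 1" unfolding q_def by linarith+
        have "q \<le> m" using \<open>\<not> real m \<le> _\<close> q by linarith
        then have "psum (e j) i q \<le> n * t" using psum_mono[OF g i] cb(1) order_trans by blast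
        moreover have "real q / n \<in> {0..T + 2}" using q n0 T by (auto simp: field_simps)
        then have "\<bar>walk (e j) (nn j) (real q / n) i\<bar> \<le> B + 1" by (rule v(3))
        then have "- (B + 1) \<le> walk (e j) (nn j) (real q / n) i" by linarith
        then have "r * (- (B + 1)) \<le> r * walk (e j) (nn j) (real q / n) i" using r0 by (intro mult_left_mono) auto
        ultimately have "real q - r * (B + 1) \<le> n * t" unfolding ps by (simp add: algebra_simps)
        moreover have "n * t \<le> n * T" using t n0 by simp
        ultimately have "n - 1 < r * (B + 1)" using q(2) by (simp add: algebra_simps)
        moreover have "r * (B + 4) \<le> n" unfolding n using r0 r1(3) by (intro mult_left_mono) auto
        ultimately show False using r0 by (simp add: algebra_simps)
      qed
      have mn: "real m / n \<in> {0..T + 2}" "real (Suc m) / n \<in> {0..T + 2}"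
        using m_le n0 T n1 r0 by (auto simp: field_simps)
      \<comment> \<open>The negative fluctuation of the count. It lies between the walk at m/n and
        the walk at (m + 1)/n plus 1/r, both close to b t i.\<close>
      define y where "y = (n * t - real m) / r"
      have ry: "n * t - real m = r * y" using r0 by (simp add: y_def)
      have "r * walk (e j) (nn j) (real m / n) i \<le> r * y" using cb(1) unfolding ps using ry by linarith
      then have lo: "walk (e j) (nn j) (real m / n) i \<le> y" using r0 by simp
      have "r * y < 1 + r * walk (e j) (nn j) (real (Suc m) / n) i" using cb(2) unfolding ps using ry by simp
      then have "r * y < r * (1 / r + walk (e j) (nn j) (real (Suc m) / n) i)" using r0 by (simp add: algebra_simps)
      then have hi: "y < 1 / r + walk (e j) (nn j) (real (Suc m) / n) i" using r0 by simp
      have r14: "1 / r \<le> \<epsilon> / 4" using r1(1) r0 \<epsilon> by (simp add: field_simps)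
      have r11: "1 / r \<le> 1" using r0 by simp
      have yb: "\<bar>y\<bar> \<le> B + 2" using lo hi v(3)[OF mn(1)] v(3)[OF mn(2)] r11 by linarith
      have tm: "t - real m / n = y / r" using n0 r0 ry by (simp add: field_simps n)
      have tm': "t - real (Suc m) / n = y / r - 1 / n" using tm by (simp add: add_divide_distrib)
      have yr: "\<bar>y / r\<bar> \<le> (B + 2) / r" using yb r0 by (simp add: divide_right_mono)
      have "1 / n \<le> 1 / r" using rle r0 by (simp add: frac_le)
      moreover have "(B + 3) / r < \<delta>"
      proof -
        have "2 * (B + 3) \<le> r * \<delta>" using r1(2) \<delta>(1) by (simp add: pos_divide_le_eq)
        moreover have "B + 3 < 2 * (B + 3)" using B0 by simp
        ultimately have "B + 3 < r * \<delta>" by (rule less_le_trans[rotated])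
        then show ?thesis using r0 by (simp add: pos_divide_less_eq mult.commute)
      qed
      moreover have "(B + 3) / r = (B + 2) / r + 1 / r" by (simp add: add_divide_distrib[symmetric])
      ultimately have close: "\<bar>t - real m / n\<bar> < \<delta>" "\<bar>t - real (Suc m) / n\<bar> < \<delta>"
        using yr tm tm' r0 n0 by (smt (verit) divide_nonneg_nonneg zero_le_one)+
      have tT: "t \<in> {0..T + 2}" using t by auto
      have "\<bar>b t i - b (real m / n) i\<bar> < \<epsilon> / 4" "\<bar>b t i - b (real (Suc m) / n) i\<bar> < \<epsilon> / 4"
        by (rule \<delta>(2)[OF tT mn(1) close(1)], rule \<delta>(2)[OF tT mn(2) close(2)])
      then have "\<bar>- y + b t i\<bar> \<le> \<epsilon>"
        using lo hi v(2)[OF mn(1)] v(1)[OF mn(2)] r14 \<epsilon> by linarith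
      moreover have "(real m - n * t) / r = - y" by (simp add: y_def minus_divide_left)
      ultimately show "\<bar>(real (cnt (e j) i (real (nn j) * t)) - real (nn j) * t) / sqrt (real (nn j)) + b t i\<bar> \<le> \<epsilon>"
        by (simp add: m_def n_def r_def)
    qed
  qed
qed

lemma netpath_bdd: assumes g: "generic d E" and i: "Suc i < d" shows "bdd_on T (\<lambda>s. netpath x0 E s i)"
proof -
  have mono: "cnt E j s \<le> cnt E j T" if "s \<le> T" "j < d" for s j
    unfolding cnt_def by (rule card_mono[OF ring_index_finite[OF g that(2)]]) (use that in auto)
  have "\<bar>netpath x0 E s i\<bar> \<le> \<bar>real_of_int (x0 (Suc i) - x0 i - 1)\<bar> + real (cnt E (Suc i) T) + real (cnt E i T)" if "s \<in> {0..T}" for s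
    using mono[of s i] mono[of s "Suc i"] that i unfolding netpath_def by (simp add: abs_le_iff) linarith
  then show ?thesis unfolding bdd_on_def by blast
qed

definition zpath :: "nat \<Rightarrow> (nat \<Rightarrow> int) \<Rightarrow> nat \<Rightarrow> (nat \<Rightarrow> nat \<Rightarrow> real) \<Rightarrow> real \<Rightarrow> nat \<Rightarrow> real" where
  "zpath d x0 n E t = (\<lambda>i. gaps d (pt_config d x0 E (real n * t)) i / sqrt (real n))"

lemma zpath_reflmap:
  assumes g: "generic d E" and x0: "\<And>i. Suc i < d \<Longrightarrow> x0 i < x0 (Suc i)" and t: "0 \<le> t" and i: "i < d - 1" and n: "0 < n"
  shows "zpath d x0 n E t i = reflmap (\<lambda>s j. 1 / sqrt (real n) * netpath x0 E (real n * s) j) t i"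
proof -
  have "reflmap (\<lambda>s j. 1 / sqrt (real n) * netpath x0 E (real n * s) j) t i = 1 / sqrt (real n) * reflmap (netpath x0 E) (real n * t) i"
    by (rule reflmap_scale) (use netpath_bdd[OF g] i n t in auto)
  moreover have "gaps d (pt_config d x0 E (real n * t)) i = reflmap (netpath x0 E) (real n * t) i"
    by (rule gaps_reflmap) (use g x0 i t in auto)
  ultimately show ?thesis by (simp add: zpath_def)
qed

lemma zpath_jump:
  assumes "{r\<in>(\<lambda>s. s / real n) ` rings d E. r \<le> s} = {r\<in>(\<lambda>s. s / real n) ` rings d E. r \<le> t}" and n: "0 < n"
  shows "zpath d x0 n E s = zpath d x0 n E t"
proof -
  have e: "{r\<in>rings d E. r \<le> real n * u} = {r. r / real n \<in> {r\<in>(\<lambda>s. s / real n) ` rings d E. r \<le> u}}" for u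
    using n by (auto simp: image_iff field_simps)
  show ?thesis unfolding zpath_def pt_config_evlist e assms(1) ..
qed

lemma zpath_J_finite:
  assumes g: "generic d E" and n: "0 < n"
  shows "finite {s\<in>(\<lambda>s. s / real n) ` rings d E. s \<le> T}" "(\<lambda>s. s / real n) ` rings d E \<subseteq> {0<..}"
proof -
  have "{s\<in>(\<lambda>s. s / real n) ` rings d E. s \<le> T} = (\<lambda>s. s / real n) ` {s\<in>rings d E. s \<le> real n * T}"
    using n by (auto simp: field_simps)
  then show "finite {s\<in>(\<lambda>s. s / real n) ` rings d E. s \<le> T}" using rings_finite[OF g] by simp
  show "(\<lambda>s. s / real n) ` rings d E \<subseteq> {0<..}" using rings_pos[OF g] n by auto
qed

lemma zpath_Dspace: "generic d E \<Longrightarrow> 0 < n \<Longrightarrow> zpath d x0 n E \<in> Dspace m"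
  by (rule jump_Dspace[OF zpath_J_finite(1) zpath_jump])

lemma zpath_disc: "generic d E \<Longrightarrow> 0 < n \<Longrightarrow> sk_conv m (\<lambda>k. disc m (Suc k) (zpath d x0 n E)) (zpath d x0 n E)"
  by (rule disc_sk_conv_jump[OF zpath_J_finite zpath_jump])

text \<open>A deterministic statement along arbitrary scales and clock realisations, since it is
  applied to sequences extracted in an argument by contradiction. The counts fluctuate like - b, so
  the differences of consecutive counts give b i - b (i + 1), in this order.\<close>

lemma zpath_lu_conv:
  fixes nn :: "nat \<Rightarrow> nat"
  assumes nn: "filterlim nn at_top sequentially" and pos: "\<And>j. 0 < nn j" and g: "\<And>j. generic d (e j)"
    and x0: "\<And>i. Suc i < d \<Longrightarrow> x0 i < x0 (Suc i)"
    and c: "\<And>i. i < d \<Longrightarrow> continuous_on {0..} (\<lambda>t. b t i)"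
    and conv: "\<And>T \<epsilon> i. 0 < T \<Longrightarrow> 0 < \<epsilon> \<Longrightarrow> i < d \<Longrightarrow> eventually (\<lambda>j. \<forall>t\<in>{0..T}. \<bar>walk (e j) (nn j) t i - b t i\<bar> \<le> \<epsilon>) sequentially"
  shows "lu_conv (d - 1) (\<lambda>j. zpath d x0 (nn j) (e j)) (reflmap (\<lambda>t i. b t i - b t (Suc i)))"
proof -
  let ?x = "\<lambda>j s i. 1 / sqrt (real (nn j)) * netpath x0 (e j) (real (nn j) * s) i"
  let ?y = "\<lambda>t i. b t i - b t (Suc i)"
  have one: "eventually (\<lambda>j. \<forall>t\<in>{0..T}. \<bar>?x j t i - ?y t i\<bar> \<le> \<epsilon>) sequentially"
    if T: "T > 0" and e: "\<epsilon> > 0" and i: "i < d - 1" for T \<epsilon> i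
  proof -
    have i': "i < d" "Suc i < d" using i by auto
    have conv1: "\<forall>T>0. \<forall>\<epsilon>>0. eventually (\<lambda>j. \<forall>t\<in>{0..T}. \<bar>walk (e j) (nn j) t i - b t i\<bar> \<le> \<epsilon>) sequentially"
      and conv2: "\<forall>T>0. \<forall>\<epsilon>>0. eventually (\<lambda>j. \<forall>t\<in>{0..T}. \<bar>walk (e j) (nn j) t (Suc i) - b t (Suc i)\<bar> \<le> \<epsilon>) sequentially"
      using conv i' by blast+
    \<comment> \<open>One third for the initial gap, which vanishes after rescaling, and one for
      each of the two counts.\<close>
    have e3: "\<epsilon> / 3 > 0" using e by simp
    have sq: "filterlim (\<lambda>j. sqrt (real (nn j))) at_top sequentially"
      by (intro filterlim_compose[OF sqrt_at_top] filterlim_compose[OF filterlim_real_sequentially nn])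
    define G where "G = \<bar>real_of_int (x0 (Suc i) - x0 i - 1)\<bar>"
    have "eventually (\<lambda>j. sqrt (real (nn j)) \<ge> 3 * G / \<epsilon>) sequentially" using sq by (simp add: filterlim_at_top)
    moreover note cnt_fluctuation[where nn=nn and e=e and b=b and i=i and d=d, OF nn g i'(1) c[OF i'(1)] conv1 T e3]
    moreover note cnt_fluctuation[where nn=nn and e=e and b=b and i="Suc i" and d=d, OF nn g i'(2) c[OF i'(2)] conv2 T e3]
    ultimately show ?thesis
    proof eventually_elim
      case (elim j)
      show ?case
      proof
        fix t assume t: "t \<in> {0..T}"
        let ?r = "sqrt (real (nn j))" and ?nt = "real (nn j) * t"
        have r0: "?r > 0" using pos[of j] by simp
        have "?x j t i = real_of_int (x0 (Suc i) - x0 i - 1) / ?r + (real (cnt (e j) (Suc i) ?nt) - ?nt) / ?r - (real (cnt (e j) i ?nt) - ?nt) / ?r"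
          by (simp add: netpath_def diff_divide_distrib add_divide_distrib)
        moreover have "\<bar>real_of_int (x0 (Suc i) - x0 i - 1) / ?r\<bar> \<le> \<epsilon> / 3"
        proof -
          have "\<bar>real_of_int (x0 (Suc i) - x0 i - 1) / ?r\<bar> = G / ?r" using r0 unfolding G_def abs_divide by simp
          also have "\<dots> \<le> \<epsilon> / 3" using elim(1) r0 e by (simp add: field_simps)
          finally show ?thesis .
        qed
        moreover have "\<bar>(real (cnt (e j) i ?nt) - ?nt) / ?r + b t i\<bar> \<le> \<epsilon> / 3"
          "\<bar>(real (cnt (e j) (Suc i) ?nt) - ?nt) / ?r + b t (Suc i)\<bar> \<le> \<epsilon> / 3" using elim t by blast+
        ultimately show "\<bar>?x j t i - ?y t i\<bar> \<le> \<epsilon>" by linarith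
      qed
    qed
  qed
  have "lu_conv (d - 1) ?x ?y"
    unfolding lu_conv_def
  proof (intro allI impI)
    fix T \<epsilon> :: real assume "T > 0" "\<epsilon> > 0"
    then have "eventually (\<lambda>j. \<forall>i\<in>{..<d - 1}. \<forall>t\<in>{0..T}. \<bar>?x j t i - ?y t i\<bar> \<le> \<epsilon>) sequentially"
      using one by (intro eventually_ball_finite) auto
    then show "eventually (\<lambda>j. \<forall>t\<in>{0..T}. \<forall>i<d - 1. \<bar>?x j t i - ?y t i\<bar> \<le> \<epsilon>) sequentially"
      by eventually_elim auto
  qed
  then have lu: "lu_conv (d - 1) (\<lambda>j. reflmap (?x j)) (reflmap ?y)"
    by (rule reflmap_lu_conv) (auto intro!: continuous_bdd_on continuous_on_diff c)
  have eq: "zpath d x0 (nn j) (e j) t i = reflmap (?x j) t i" if "0 \<le> t" "i < d - 1" for j t i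
    by (rule zpath_reflmap) (use g x0 that pos in auto)
  show ?thesis unfolding lu_conv_def
  proof (intro allI impI)
    fix T \<epsilon> :: real assume "T > 0" "\<epsilon> > 0"
    then have "eventually (\<lambda>j. \<forall>t\<in>{0..T}. \<forall>i<d - 1. \<bar>reflmap (?x j) t i - reflmap ?y t i\<bar> \<le> \<epsilon>) sequentially"
      using lu unfolding lu_conv_def by blast
    then show "eventually (\<lambda>j. \<forall>t\<in>{0..T}. \<forall>i<d - 1. \<bar>zpath d x0 (nn j) (e j) t i - reflmap ?y t i\<bar> \<le> \<epsilon>) sequentially"
    proof eventually_elim
      case (elim j)
      show ?case
      proof (intro ballI allI impI)
        fix t i assume ti: "t \<in> {0..T}" "i < d - 1"
        have "\<bar>reflmap (?x j) t i - reflmap ?y t i\<bar> \<le> \<epsilon>" using elim ti by blast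
        then show "\<bar>zpath d x0 (nn j) (e j) t i - reflmap ?y t i\<bar> \<le> \<epsilon>" using eq[of t i j] ti by simp
      qed
    qed
  qed
qed

section \<open>Exponential waiting times\<close>

locale exp_clocks = prob_space P for P :: "'a measure" +
  fixes d :: nat and E :: "nat \<Rightarrow> nat \<Rightarrow> 'a \<Rightarrow> real"
  assumes d_pos: "0 < d"
    and E_exp: "\<And>i k. i < d \<Longrightarrow> distributed P lborel (E i k) (exponential_density 1)"
    and E_indep: "indep_vars (\<lambda>_. borel) (\<lambda>(i, k). E i k) ({..<d} \<times> UNIV)"
begin

abbreviation Ew :: "'a \<Rightarrow> nat \<Rightarrow> nat \<Rightarrow> real" where "Ew \<omega> \<equiv> (\<lambda>i k. E i k \<omega>)"

definition bsum :: "nat \<Rightarrow> nat \<Rightarrow> nat \<Rightarrow> 'a \<Rightarrow> real" where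
  "bsum i a b \<omega> = (\<Sum>k\<in>{a..<b}. E i k \<omega> - 1)"

lemma E_measurable: "i < d \<Longrightarrow> E i k \<in> borel_measurable P"
  using distributed_measurable[OF E_exp, of i k] by simp

lemma bsum_measurable: "i < d \<Longrightarrow> bsum i a b \<in> borel_measurable P"
  unfolding bsum_def by (intro borel_measurable_sum borel_measurable_diff E_measurable) auto

lemma E_row_indep: assumes "i < d" shows "indep_vars (\<lambda>_. borel) (\<lambda>k. E i k) A"
proof -
  have "indep_vars (\<lambda>k. PiM {(i, k)} (\<lambda>_. borel)) (\<lambda>k \<omega>. restrict (\<lambda>p. (case p of (i, k) \<Rightarrow> E i k) \<omega>) {(i, k)}) A"
    by (rule indep_vars_restrict[OF E_indep]) (use assms in \<open>auto simp: disjoint_family_on_def\<close>)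
  from indep_vars_compose2[OF this, of "\<lambda>k f. f (i, k)" "\<lambda>_. borel"] show ?thesis by simp
qed

lemma bsum_erlang:
  assumes i: "i < d" and ab: "a < b"
  shows "distributed P lborel (\<lambda>\<omega>. \<Sum>k\<in>{a..<b}. E i k \<omega>) (erlang_density (b - a - 1) 1)"
  using exponential_distributed_sum[of "{a..<b}" 1 "\<lambda>k. E i k"] E_exp[OF i] E_row_indep[OF i] ab by simp

lemma bsum_eq: "bsum i a b \<omega> = (\<Sum>k\<in>{a..<b}. E i k \<omega>) - real (b - a)"
  by (simp add: bsum_def sum_subtractf)

text \<open>The sums are shifted Erlang variables, whose law depends on the number of terms only. A
  block of any clock can thus be represented by the beginning of clock 0.\<close>

lemma bsum_law:
  assumes i: "i < d" and i': "i' < d" and ab: "b - a = b' - a'"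
  shows "distr P borel (bsum i a b) = distr P borel (bsum i' a' b')"
proof (cases "a < b")
  case True
  have gen: "distr P borel (bsum i a b) = distr (density lborel (erlang_density (b - a - 1) 1)) borel (\<lambda>x. x - real (b - a))"
    if "i < d" "a < b" for i a b
  proof -
    have m: "(\<lambda>\<omega>. \<Sum>k\<in>{a..<b}. E i k \<omega>) \<in> measurable P lborel"
      using E_measurable[OF that(1)] by simp
    have "distr P borel (bsum i a b) = distr (distr P lborel (\<lambda>\<omega>. \<Sum>k\<in>{a..<b}. E i k \<omega>)) borel (\<lambda>x. x - real (b - a))"
      by (subst distr_distr[OF _ m]) (auto simp: comp_def bsum_eq[abs_def] fun_eq_iff intro!: distr_cong)
    then show ?thesis using distributed_distr_eq_density[OF bsum_erlang[OF that]] by simp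
  qed
  have "a' < b'" using True ab by linarith
  from gen[OF i True] gen[OF i' this] ab show ?thesis by simp
next
  case False
  then have "bsum i a b = (\<lambda>_. 0)" "bsum i' a' b' = (\<lambda>_. 0)" using ab by (auto simp: bsum_def fun_eq_iff)
  then show ?thesis by simp
qed

text \<open>The raw moments of the Erlang law are rising factorials of n = b - a. They give the
  fourth central moment 3 n^2 + 6 n, which is at most 9 n^2 because n \<ge> 1 for a nonempty
  block.\<close>

lemma bsum_moments:
  assumes i: "i < d"
  shows "(\<integral>\<omega>. (bsum i a b \<omega>)\<^sup>2 \<partial>P) = real (b - a)" "integrable P (\<lambda>\<omega>. (bsum i a b \<omega>)\<^sup>2)"
    "(\<integral>\<omega>. (bsum i a b \<omega>) ^ 4 \<partial>P) \<le> 9 * (real (b - a))\<^sup>2" "integrable P (\<lambda>\<omega>. (bsum i a b \<omega>) ^ 4)"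
proof -
  have "(\<integral>\<omega>. (bsum i a b \<omega>)\<^sup>2 \<partial>P) = real (b - a) \<and> integrable P (\<lambda>\<omega>. (bsum i a b \<omega>)\<^sup>2) \<and>
    (\<integral>\<omega>. (bsum i a b \<omega>) ^ 4 \<partial>P) \<le> 9 * (real (b - a))\<^sup>2 \<and> integrable P (\<lambda>\<omega>. (bsum i a b \<omega>) ^ 4)"
  proof (cases "a < b")
    case True
    define X where "X \<omega> = (\<Sum>k\<in>{a..<b}. E i k \<omega>)" for \<omega>
    define n where "n = real (b - a)"
    have n1: "n \<ge> 1" using True by (simp add: n_def)
    have D: "distributed P lborel X (erlang_density (b - a - 1) 1)" unfolding X_def by (rule bsum_erlang[OF i True])
    have int[simp]: "integrable P (\<lambda>\<omega>. X \<omega> ^ p)" for p by (rule erlang_ith_moment_integrable[OF _ D]) simp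
    have mom: "expectation (\<lambda>\<omega>. X \<omega> ^ p) = fact (b - a - 1 + p) / fact (b - a - 1)" for p
      using erlang_ith_moment[OF _ D, of p] by simp
    obtain k where k: "b - a = Suc k" using True by (metis Suc_diff_Suc)
    have nk: "n = real k + 1" by (simp add: n_def k)
    have m: "expectation (\<lambda>\<omega>. X \<omega> ^ 1) = n" "expectation (\<lambda>\<omega>. X \<omega> ^ 2) = n * (n + 1)"
      "expectation (\<lambda>\<omega>. X \<omega> ^ 3) = n * (n + 1) * (n + 2)" "expectation (\<lambda>\<omega>. X \<omega> ^ 4) = n * (n + 1) * (n + 2) * (n + 3)"
      unfolding mom k nk by (simp_all add: numeral_eq_Suc field_simps)
    have X: "bsum i a b \<omega> = X \<omega> - n" for \<omega> by (simp add: bsum_eq X_def n_def)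
    have e2: "(bsum i a b \<omega>)\<^sup>2 = X \<omega> ^ 2 - 2 * n * X \<omega> ^ 1 + n\<^sup>2" for \<omega> unfolding X by (simp add: power2_eq_square algebra_simps)
    have e4: "(bsum i a b \<omega>) ^ 4 = X \<omega> ^ 4 - 4 * n * X \<omega> ^ 3 + 6 * n\<^sup>2 * X \<omega> ^ 2 - 4 * n ^ 3 * X \<omega> ^ 1 + n ^ 4" for \<omega>
      unfolding X by (simp add: power2_eq_square power3_eq_cube power4_eq_xxxx algebra_simps)
    have i1: "integrable P (\<lambda>\<omega>. (bsum i a b \<omega>)\<^sup>2)" unfolding e2
      by (intro Bochner_Integration.integrable_add Bochner_Integration.integrable_diff integrable_mult_right int integrable_const)
    have i2: "integrable P (\<lambda>\<omega>. (bsum i a b \<omega>) ^ 4)" unfolding e4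
      by (intro Bochner_Integration.integrable_add Bochner_Integration.integrable_diff integrable_mult_right int integrable_const)
    have v2: "(\<integral>\<omega>. (bsum i a b \<omega>)\<^sup>2 \<partial>P) = n"
    proof -
      have "(\<integral>\<omega>. (bsum i a b \<omega>)\<^sup>2 \<partial>P) = expectation (\<lambda>\<omega>. X \<omega> ^ 2) - 2 * n * expectation (\<lambda>\<omega>. X \<omega> ^ 1) + n\<^sup>2"
        unfolding e2 by (simp only: Bochner_Integration.integral_add Bochner_Integration.integral_diff Bochner_Integration.integrable_diff int integrable_mult_right integrable_const integral_mult_right_zero lebesgue_integral_const prob_space scaleR_one)
      then show ?thesis unfolding m by (simp add: power2_eq_square algebra_simps)
    qed
    have "(\<integral>\<omega>. (bsum i a b \<omega>) ^ 4 \<partial>P) = expectation (\<lambda>\<omega>. X \<omega> ^ 4) - 4 * n * expectation (\<lambda>\<omega>. X \<omega> ^ 3) + 6 * n\<^sup>2 * expectation (\<lambda>\<omega>. X \<omega> ^ 2) - 4 * n ^ 3 * expectation (\<lambda>\<omega>. X \<omega> ^ 1) + n ^ 4"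
      unfolding e4 by (simp only: Bochner_Integration.integral_add Bochner_Integration.integral_diff Bochner_Integration.integrable_diff Bochner_Integration.integrable_add int integrable_mult_right integrable_const integral_mult_right_zero lebesgue_integral_const prob_space scaleR_one)
    also have "\<dots> = 3 * n\<^sup>2 + 6 * n" unfolding m by (simp add: power2_eq_square power3_eq_cube power4_eq_xxxx algebra_simps)
    also have "\<dots> \<le> 9 * n\<^sup>2" using n1 by (simp add: power2_eq_square)
    finally show ?thesis using v2 i1 i2 by (simp add: n_def)
  next
    case False
    then have "bsum i a b = (\<lambda>_. 0)" by (auto simp: bsum_def fun_eq_iff)
    then show ?thesis using False by simp
  qed
  then show "(\<integral>\<omega>. (bsum i a b \<omega>)\<^sup>2 \<partial>P) = real (b - a)" "integrable P (\<lambda>\<omega>. (bsum i a b \<omega>)\<^sup>2)"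
    "(\<integral>\<omega>. (bsum i a b \<omega>) ^ 4 \<partial>P) \<le> 9 * (real (b - a))\<^sup>2" "integrable P (\<lambda>\<omega>. (bsum i a b \<omega>) ^ 4)" by blast+
qed

lemma bsum_split: "a \<le> b \<Longrightarrow> b \<le> c \<Longrightarrow> bsum i a c \<omega> = bsum i a b \<omega> + bsum i b c \<omega>"
  unfolding bsum_def by (simp add: sum.atLeastLessThan_concat)

lemma bsum_tail2:
  assumes i: "i < d" and lam: "lam > 0"
  shows "prob {\<omega>\<in>space P. \<bar>bsum i a b \<omega>\<bar> \<ge> lam} \<le> real (b - a) / lam\<^sup>2"
proof -
  have "{\<omega>\<in>space P. \<bar>bsum i a b \<omega>\<bar> \<ge> lam} = {\<omega>\<in>space P. (bsum i a b \<omega>)\<^sup>2 \<ge> lam\<^sup>2}"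
    using lam by (auto simp: abs_le_square_iff[symmetric])
  also have "prob \<dots> \<le> (\<integral>\<omega>. (bsum i a b \<omega>)\<^sup>2 \<partial>P) / lam\<^sup>2"
    by (rule integral_Markov_inequality_measure[where A="{}"]) (use bsum_moments[OF i] lam in auto)
  finally show ?thesis using bsum_moments(1)[OF i] by simp
qed

lemma bsum_tail4:
  assumes i: "i < d" and lam: "lam > 0"
  shows "prob {\<omega>\<in>space P. \<bar>bsum i a b \<omega>\<bar> \<ge> lam} \<le> 9 * (real (b - a))\<^sup>2 / lam ^ 4"
proof -
  have "{\<omega>\<in>space P. \<bar>bsum i a b \<omega>\<bar> \<ge> lam} = {\<omega>\<in>space P. (bsum i a b \<omega>) ^ 4 \<ge> lam ^ 4}"
  proof -
    have "lam \<le> \<bar>x\<bar> \<longleftrightarrow> lam ^ 4 \<le> x ^ 4" for x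
      using power_mono_iff[of lam "\<bar>x\<bar>" 4] lam by (simp add: power_even_abs)
    then show ?thesis by simp
  qed
  also have "prob \<dots> \<le> (\<integral>\<omega>. (bsum i a b \<omega>) ^ 4 \<partial>P) / lam ^ 4"
    by (rule integral_Markov_inequality_measure[where A="{}"]) (use bsum_moments[OF i] lam in auto)
  also have "\<dots> \<le> 9 * (real (b - a))\<^sup>2 / lam ^ 4" using bsum_moments(3)[OF i] lam by (intro divide_right_mono) auto
  finally show ?thesis .
qed

text \<open>Ottaviani's inequality. Split by the first index q at which 2 lam is exceeded: the rest
  of the sum is independent of that event and, by Chebyshev, smaller than lam with probability at
  least 1/2; then the whole sum exceeds lam. The factor 18 is 2 times the 9 of the fourth-moment
  tail bound.\<close>

lemma bsum_max:
  assumes i: "i < d" and lam: "lam > 0" and m: "2 * real m \<le> lam\<^sup>2"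
  shows "prob {\<omega>\<in>space P. \<exists>q\<le>m. \<bar>bsum i a (a + q) \<omega>\<bar> \<ge> 2 * lam} \<le> 18 * (real m)\<^sup>2 / lam ^ 4"
proof -
  note [measurable] = bsum_measurable[OF i]
  define A where "A q = {\<omega>\<in>space P. (\<forall>r<q. \<bar>bsum i a (a + r) \<omega>\<bar> < 2 * lam) \<and> \<bar>bsum i a (a + q) \<omega>\<bar> \<ge> 2 * lam}" for q
  define C where "C q = {\<omega>\<in>space P. \<bar>bsum i (a + q) (a + m) \<omega>\<bar> < lam}" for q
  have Am[measurable]: "A q \<in> sets P" for q unfolding A_def by measurable
  have Cm[measurable]: "C q \<in> sets P" for q unfolding C_def by measurable
  have C12: "1 / 2 \<le> prob (C q)" for q
  proof -
    have "prob {\<omega>\<in>space P. \<bar>bsum i (a + q) (a + m) \<omega>\<bar> \<ge> lam} \<le> real (a + m - (a + q)) / lam\<^sup>2" by (rule bsum_tail2[OF i lam])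
    also have "\<dots> \<le> real m / lam\<^sup>2" by (intro divide_right_mono) auto
    also have "\<dots> \<le> 1 / 2" using m lam by (simp add: field_simps)
    finally have "prob {\<omega>\<in>space P. \<bar>bsum i (a + q) (a + m) \<omega>\<bar> \<ge> lam} \<le> 1 / 2" .
    moreover have "C q = space P - {\<omega>\<in>space P. \<bar>bsum i (a + q) (a + m) \<omega>\<bar> \<ge> lam}" unfolding C_def by auto
    ultimately show ?thesis by (simp add: prob_compl)
  qed
  have ind: "prob (A q \<inter> C q) = prob (A q) * prob (C q)" if "q \<le> m" for q
  proof -
    let ?I = "{i} \<times> {a..<a + q}" and ?J = "{i} \<times> {a + q..<a + m}"
    let ?X = "\<lambda>(i, k). E i k"
    have iv: "indep_var (PiM ?I (\<lambda>_. borel)) (\<lambda>\<omega>. restrict (\<lambda>p. ?X p \<omega>) ?I) (PiM ?J (\<lambda>_. borel)) (\<lambda>\<omega>. restrict (\<lambda>p. ?X p \<omega>) ?J)"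
      by (rule indep_var_restrict[OF E_indep]) (use i in auto)
    let ?s = "\<lambda>l u v. \<Sum>k\<in>{l..<u}. v (i, k) - (1::real)"
    have [measurable]: "?s a (a + r) \<in> borel_measurable (PiM ?I (\<lambda>_. borel))" if "r \<le> q" for r
      by (intro borel_measurable_sum borel_measurable_diff measurable_component_singleton) (use that in auto)
    have [measurable]: "?s (a + q) (a + m) \<in> borel_measurable (PiM ?J (\<lambda>_. borel))"
      by (intro borel_measurable_sum borel_measurable_diff measurable_component_singleton) auto
    define SA where "SA = {v\<in>space (PiM ?I (\<lambda>_. borel)). (\<forall>r\<in>{..<q}. \<bar>?s a (a + r) v\<bar> < 2 * lam) \<and> \<bar>?s a (a + q) v\<bar> \<ge> 2 * lam}"
    define SC where "SC = {v\<in>space (PiM ?J (\<lambda>_. borel)). \<bar>?s (a + q) (a + m) v\<bar> < lam}"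
    have SA: "SA \<in> sets (PiM ?I (\<lambda>_. borel))" unfolding SA_def
    proof (intro sets.sets_Collect_conj sets.sets_Collect_finite_All)
      fix r assume "r \<in> {..<q}"
      then have [measurable]: "?s a (a + r) \<in> borel_measurable (PiM ?I (\<lambda>_. borel))" by simp
      show "{v\<in>space (PiM ?I (\<lambda>_. borel)). \<bar>?s a (a + r) v\<bar> < 2 * lam} \<in> sets (PiM ?I (\<lambda>_. borel))" by measurable
    next
      show "{v\<in>space (PiM ?I (\<lambda>_. borel)). \<bar>?s a (a + q) v\<bar> \<ge> 2 * lam} \<in> sets (PiM ?I (\<lambda>_. borel))" by measurable
    qed simp
    have SC: "SC \<in> sets (PiM ?J (\<lambda>_. borel))" unfolding SC_def by measurable
    have rA: "?s a (a + r) (restrict (\<lambda>p. ?X p \<omega>) ?I) = bsum i a (a + r) \<omega>" if "r \<le> q" for r \<omega>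
      unfolding bsum_def by (rule sum.cong) (use that in auto)
    have rC: "?s (a + q) (a + m) (restrict (\<lambda>p. ?X p \<omega>) ?J) = bsum i (a + q) (a + m) \<omega>" for \<omega>
      unfolding bsum_def by (rule sum.cong) auto
    have sp: "restrict (\<lambda>p. ?X p \<omega>) K \<in> space (PiM K (\<lambda>_. borel))" for K \<omega> by (simp add: space_PiM)
    have eA: "(\<lambda>\<omega>. restrict (\<lambda>p. ?X p \<omega>) ?I) -` SA \<inter> space P = A q"
      unfolding SA_def A_def using sp[of _ ?I] rA by (auto simp: less_imp_le simp del: restrict_apply)
    have eC: "(\<lambda>\<omega>. restrict (\<lambda>p. ?X p \<omega>) ?J) -` SC \<inter> space P = C q"
      unfolding SC_def C_def using sp[of _ ?J] rC by (auto simp del: restrict_apply)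
    have "(\<lambda>\<omega>. (restrict (\<lambda>p. ?X p \<omega>) ?I, restrict (\<lambda>p. ?X p \<omega>) ?J)) -` (SA \<times> SC) \<inter> space P = A q \<inter> C q"
      using eA eC by auto
    then show ?thesis using indep_varD[OF iv SA SC] unfolding eA eC by simp
  qed
  have un: "{\<omega>\<in>space P. \<exists>q\<le>m. \<bar>bsum i a (a + q) \<omega>\<bar> \<ge> 2 * lam} = (\<Union>q\<in>{..m}. A q)"
  proof safe
    fix \<omega> q assume \<omega>: "\<omega> \<in> space P" and q: "q \<le> m" "2 * lam \<le> \<bar>bsum i a (a + q) \<omega>\<bar>"
    define q0 where "q0 = (LEAST q. 2 * lam \<le> \<bar>bsum i a (a + q) \<omega>\<bar>)"
    have "2 * lam \<le> \<bar>bsum i a (a + q0) \<omega>\<bar>" unfolding q0_def by (rule LeastI[of _ q]) (rule q)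
    moreover have "q0 \<le> q" unfolding q0_def by (rule Least_le) (rule q)
    moreover have "\<bar>bsum i a (a + r) \<omega>\<bar> < 2 * lam" if "r < q0" for r
      using not_less_Least[of r "\<lambda>q. 2 * lam \<le> \<bar>bsum i a (a + q) \<omega>\<bar>"] that unfolding q0_def by auto
    ultimately have "\<omega> \<in> A q0" "q0 \<in> {..m}" using \<omega> q by (auto simp: A_def)
    then show "\<omega> \<in> (\<Union>q\<in>{..m}. A q)" by blast
  qed (auto simp: A_def)
  have disj: "disjoint_family_on A {..m}"
    unfolding disjoint_family_on_def
  proof (intro ballI impI)
    fix q r :: nat assume "q \<noteq> r"
    then consider "q < r" | "r < q" by linarith
    then show "A q \<inter> A r = {}" by cases (auto simp: A_def not_less[symmetric])
  qed
  have "prob (\<Union>q\<in>{..m}. A q) = (\<Sum>q\<le>m. prob (A q))" by (rule finite_measure_finite_Union) (use disj in auto)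
  also have "\<dots> \<le> (\<Sum>q\<le>m. 2 * prob (A q \<inter> C q))"
  proof (rule sum_mono)
    fix q assume "q \<in> {..m}"
    then have "prob (A q) * (1 / 2) \<le> prob (A q \<inter> C q)" unfolding ind[OF atMost_iff[THEN iffD1, OF \<open>q \<in> {..m}\<close>]]
      using C12 by (intro mult_left_mono) auto
    then show "prob (A q) \<le> 2 * prob (A q \<inter> C q)" by simp
  qed
  also have "\<dots> = 2 * prob (\<Union>q\<in>{..m}. A q \<inter> C q)"
  proof -
    have "disjoint_family_on (\<lambda>q. A q \<inter> C q) {..m}" using disj unfolding disjoint_family_on_def by blast
    then have "prob (\<Union>q\<in>{..m}. A q \<inter> C q) = (\<Sum>q\<le>m. prob (A q \<inter> C q))" by (intro finite_measure_finite_Union) auto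
    then show ?thesis by (simp add: sum_distrib_left)
  qed
  also have "\<dots> \<le> 2 * prob {\<omega>\<in>space P. \<bar>bsum i a (a + m) \<omega>\<bar> \<ge> lam}"
  proof (intro mult_left_mono finite_measure_mono subsetI)
    fix \<omega> assume "\<omega> \<in> (\<Union>q\<in>{..m}. A q \<inter> C q)"
    then obtain q where q: "q \<le> m" "\<omega> \<in> A q" "\<omega> \<in> C q" by auto
    have "bsum i a (a + m) \<omega> = bsum i a (a + q) \<omega> + bsum i (a + q) (a + m) \<omega>" by (rule bsum_split) (use q in auto)
    then show "\<omega> \<in> {\<omega>\<in>space P. \<bar>bsum i a (a + m) \<omega>\<bar> \<ge> lam}" using q by (auto simp: A_def C_def)
  qed auto
  also have "\<dots> \<le> 2 * (9 * (real (a + m - a))\<^sup>2 / lam ^ 4)" by (intro mult_left_mono bsum_tail4[OF i lam]) auto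
  finally show ?thesis unfolding un by simp
qed

end

section \<open>Grid increments of the standard Brownian motion and auxiliary facts\<close>

lemma bm_brownian:
  "brownian gauss (bm_filt d) d (\<lambda>_. 0) (\<lambda>i j. if i = j then 1 else 0)
     (distr gauss (PiM {..<d} (\<lambda>_. borel)) (\<lambda>\<omega>. restrict (bm 0 \<omega>) {..<d})) bm"
  unfolding brownian_def
proof (intro conjI allI impI HOL.refl)
  show "adapted gauss (bm_filt d) d bm" by (rule adaptedI) (auto intro!: bm_filt_bm)
  show "AE \<omega> in gauss. \<forall>i<d. continuous_on {0..} (\<lambda>t. bm t \<omega> i)" by (simp add: bm_continuous)
next
  fix s t :: real and u :: "nat \<Rightarrow> real" and A
  assume h: "0 \<le> s \<and> s \<le> t \<and> A \<in> bm_filt d s"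
  have q: "(\<Sum>i<d. \<Sum>j<d. u i * (if i = j then 1 else 0) * u j) = (\<Sum>p<d. (u p)\<^sup>2)"
  proof (rule sum.cong[OF HOL.refl])
    fix i assume "i \<in> {..<d}"
    then show "(\<Sum>j<d. u i * (if i = j then 1 else 0) * u j) = (u i)\<^sup>2"
      by (subst sum.remove[of _ i]) (auto simp: power2_eq_square intro!: sum.neutral)
  qed
  show "(\<integral>\<omega>. indicator A \<omega> * cis (\<Sum>i<d. u i * (bm t \<omega> i - bm s \<omega> i)) \<partial>gauss) =
        complex_of_real (measure gauss A) * cis ((t - s) * (\<Sum>i<d. u i * 0)) *
        complex_of_real (exp (- (t - s) / 2 * (\<Sum>i<d. \<Sum>j<d. u i * (if i = j then 1 else 0) * u j)))"
    unfolding q using bm_increment_indep[of s t A d u] h by simp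
next
  fix i t assume "i < d" "0 \<le> (t::real)"
  then show "integrable gauss (\<lambda>\<omega>. bm t \<omega> i - bm 0 \<omega> i - 0 * t)" by (simp add: bm_0 bm_integrable)
next
  fix i and s t :: real and A assume i: "i < d" and h: "0 \<le> s \<and> s \<le> t \<and> A \<in> bm_filt d s"
  have As: "A \<in> sets gauss" using h bm_filt_sets by blast
  have int: "integrable gauss (\<lambda>\<omega>. indicator A \<omega> * bm r \<omega> p)" if "0 \<le> r" for r p
    using integrable_mult_indicator[OF As bm_integrable[OF that, of p]] by simp
  show "(\<integral>\<omega>. indicator A \<omega> * (bm t \<omega> i - bm 0 \<omega> i - 0 * t) \<partial>gauss) = (\<integral>\<omega>. indicator A \<omega> * (bm s \<omega> i - bm 0 \<omega> i - 0 * s) \<partial>gauss)"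
    using bm_increment_mean[of s t A d i] h int i by (simp add: right_diff_distrib bm_0)
qed

lemma bm_grid_char:
  assumes h: "h > 0"
  shows "(\<integral>\<omega>. cis (\<Sum>a\<in>{..<d} \<times> {..<L}. u a * (bm (real (Suc (snd a)) * h) \<omega> (fst a) - bm (real (snd a) * h) \<omega> (fst a))) \<partial>gauss)
    = (\<Prod>a\<in>{..<d} \<times> {..<L}. complex_of_real (exp (- h / 2 * (u a)\<^sup>2)))"
proof -
  have e: "(\<Sum>a\<in>{..<d} \<times> {..<L}. W a) = (\<Sum>l<L. \<Sum>i<d. W (i, l))" for W :: "nat \<times> nat \<Rightarrow> real"
  proof -
    have "(\<Sum>a\<in>{..<d} \<times> {..<L}. W a) = (\<Sum>i<d. \<Sum>l<L. W (i, l))" by (simp add: sum.cartesian_product)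
    then show ?thesis by (simp add: sum.swap[of _ "{..<d}"])
  qed
  have q: "qform d (\<lambda>i j. if i = j then 1 else 0) w = (\<Sum>i<d. (w i)\<^sup>2)" for w
    unfolding qform_def
  proof (rule sum.cong[OF HOL.refl])
    fix i assume "i \<in> {..<d}"
    then show "(\<Sum>j<d. w i * (if i = j then 1 else 0) * w j) = (w i)\<^sup>2"
      by (subst sum.remove[of _ i]) (auto simp: power2_eq_square intro!: sum.neutral)
  qed
  have "(\<integral>\<omega>. cis (\<Sum>a\<in>{..<d} \<times> {..<L}. u a * (bm (real (Suc (snd a)) * h) \<omega> (fst a) - bm (real (snd a) * h) \<omega> (fst a))) \<partial>gauss)
    = complex_of_real (\<Prod>l<L. exp (- h / 2 * (\<Sum>i<d. (u (i, l))\<^sup>2)))"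
    unfolding e fst_conv snd_conv
    using brownian_increments_char[OF prob_space_gauss bm_filt_filtration[of d] bm_brownian[of d] h, where u="\<lambda>l i. u (i, l)" and L=L]
    unfolding q .
  also have "(\<Prod>l<L. exp (- h / 2 * (\<Sum>i<d. (u (i, l))\<^sup>2))) = exp (\<Sum>a\<in>{..<d} \<times> {..<L}. - h / 2 * (u a)\<^sup>2)"
    unfolding e by (simp add: exp_sum sum_distrib_left)
  also have "\<dots> = (\<Prod>a\<in>{..<d} \<times> {..<L}. exp (- h / 2 * (u a)\<^sup>2))" by (rule exp_sum) simp
  finally show ?thesis by (simp only: of_real_prod)
qed

lemma div_sum_ge: "(a::nat) div K + b div K \<le> (a + b) div K"
proof (cases "K = 0")
  case False
  have "(a div K + b div K) * K \<le> a + b" by (simp add: add_mult_distrib add_mono)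
  then show ?thesis using False by (simp add: less_eq_div_iff_mult_less_eq)
qed simp

lemma div_ratio:
  assumes K: "0 < (K::nat)"
  shows "(\<lambda>n. real (n * q div K) / real n) \<longlonglongrightarrow> real q / real K"
proof -
  have b: "\<bar>real (n * q div K) / real n - real q / real K\<bar> \<le> inverse (real n)" if n: "n > 0" for n
  proof -
    have "real (n * q div K) \<le> real (n * q) / real K" "real (n * q) / real K - 1 \<le> real (n * q div K)"
      using floor_divide_of_nat_eq[where 'a=real, of "n * q" K] by linarith+
    then have "real (n * q div K) / real n \<le> (real (n * q) / real K) / real n" "(real (n * q) / real K - 1) / real n \<le> real (n * q div K) / real n"
      by (intro divide_right_mono; simp)+
    moreover have "(real (n * q) / real K) / real n = real q / real K" using n by simp
    moreover have "(real (n * q) / real K - 1) / real n = real q / real K - inverse (real n)"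
      using n by (simp add: diff_divide_distrib inverse_eq_divide)
    ultimately show ?thesis using n by (simp add: abs_le_iff)
  qed
  have "(\<lambda>n. real (n * q div K) / real n - real q / real K) \<longlonglongrightarrow> 0"
  proof (rule Lim_null_comparison[OF _ lim_inverse_n])
    show "eventually (\<lambda>n. norm (real (n * q div K) / real n - real q / real K) \<le> inverse (real n)) sequentially"
      using eventually_gt_at_top[of "0::nat"] by eventually_elim (use b in simp)
  qed
  then show ?thesis by (simp add: LIM_zero_iff)
qed

text \<open>By Fubini the diagonal has measure zero under the joint law, as the second marginal has
  no atoms.\<close>

lemma (in prob_space) indep_density_neq:
  fixes X Y :: "'a \<Rightarrow> real"
  assumes iv: "indep_var borel X borel Y" and Y: "distributed M lborel Y f"
  shows "AE \<omega> in M. X \<omega> \<noteq> Y \<omega>"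
proof -
  have [measurable]: "X \<in> borel_measurable M" "Y \<in> borel_measurable M"
    using indep_var_rv1[OF iv] indep_var_rv2[OF iv] by auto
  have D: "distr M borel X \<Otimes>\<^sub>M distr M borel Y = distr M (borel \<Otimes>\<^sub>M borel) (\<lambda>\<omega>. (X \<omega>, Y \<omega>))"
    using iv by (simp only: indep_var_distribution_eq)
  let ?D = "{p\<in>space (borel \<Otimes>\<^sub>M borel). fst p = (snd p :: real)}"
  have Dm: "?D \<in> sets (borel \<Otimes>\<^sub>M borel)" by measurable
  interpret Y: prob_space "distr M borel Y" by (rule prob_space_distr) simp
  have dY: "distr M borel Y = density lborel f"
    using distributed_distr_eq_density[OF Y] by (metis distr_cong sets_lborel)
  have [measurable]: "f \<in> borel_measurable lborel" using distributed_borel_measurable[OF Y] by simp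
  have pt: "emeasure (distr M borel Y) {x} = 0" for x
  proof -
    have "emeasure (distr M borel Y) {x} = (\<integral>\<^sup>+y. f y * indicator {x} y \<partial>lborel)"
      unfolding dY by (subst emeasure_density) auto
    also have "\<dots> = (\<integral>\<^sup>+y. 0 \<partial>(lborel :: real measure))"
    proof (rule nn_integral_cong_AE)
      have "AE y in lborel. y \<noteq> x" by (rule AE_lborel_singleton)
      then show "AE y in lborel. f y * indicator {x} y = 0" by eventually_elim (simp add: indicator_def)
    qed
    finally show ?thesis by simp
  qed
  have "emeasure (distr M (borel \<Otimes>\<^sub>M borel) (\<lambda>\<omega>. (X \<omega>, Y \<omega>))) ?D = 0"
  proof -
    have sD: "?D \<in> sets (distr M borel X \<Otimes>\<^sub>M distr M borel Y)" using Dm by (simp cong: sets_pair_measure_cong)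
    have "Pair x -` ?D = {x}" for x :: real by (auto simp: space_pair_measure)
    then show ?thesis unfolding D[symmetric] Y.emeasure_pair_measure_alt[OF sD] by (simp add: pt)
  qed
  also have "emeasure (distr M (borel \<Otimes>\<^sub>M borel) (\<lambda>\<omega>. (X \<omega>, Y \<omega>))) ?D = emeasure M {\<omega>\<in>space M. X \<omega> = Y \<omega>}"
    by (subst emeasure_distr[OF _ Dm]) (auto intro!: arg_cong[where f="emeasure M"] simp: space_pair_measure)
  finally have "prob {\<omega>\<in>space M. X \<omega> = Y \<omega>} = 0" by (simp add: measure_def)
  then show "AE \<omega> in M. X \<omega> \<noteq> Y \<omega>" by (subst (asm) prob_Collect_eq_0) auto
qed

context exp_clocks
begin

section \<open>Almost sure genericity of the clocks\<close>

lemma AE_pos: assumes i: "i < d" shows "AE \<omega> in P. 0 < E i k \<omega>"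
proof -
  have [measurable]: "E i k \<in> borel_measurable P" by (rule E_measurable[OF i])
  have "prob {\<omega>\<in>space P. 0 < E i k \<omega>} = 1"
    using exponential_distributedD_gt[OF E_exp[OF i], of 0] by simp
  then show ?thesis by (subst (asm) prob_Collect_eq_1) auto
qed

lemma ring_time_bsum: "ring_time (Ew \<omega>) i k = bsum i 0 (Suc k) \<omega> + real (Suc k)"
  by (simp add: ring_time_def bsum_eq atLeast0LessThan lessThan_Suc_atMost)

lemma ring_time_measurable: "i < d \<Longrightarrow> (\<lambda>\<omega>. ring_time (Ew \<omega>) i k) \<in> borel_measurable P"
  unfolding ring_time_bsum using bsum_measurable by simp

text \<open>For n = k + 1 \<ge> 2 T, a ring time of index k below T needs a centred sum of at most -
  n / 2, which has probability at most 4 / n by Chebyshev.\<close>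

lemma AE_div: assumes i: "i < d" shows "AE \<omega> in P. \<exists>k. real T < ring_time (Ew \<omega>) i k"
proof -
  note [measurable] = ring_time_measurable[OF i]
  let ?N = "{\<omega>\<in>space P. \<forall>k. ring_time (Ew \<omega>) i k \<le> real T}"
  have Nm: "?N \<in> sets P" by measurable
  have le: "prob ?N \<le> 4 * inverse (real (Suc k))" if k: "2 * T \<le> Suc k" and k1: "0 < k" for k
  proof -
    let ?n = "real (Suc k)"
    have "real (2 * T) \<le> ?n" using k by (simp only: of_nat_le_iff)
    then have Tn: "real T \<le> ?n / 2" by simp
    have "prob ?N \<le> prob {\<omega>\<in>space P. \<bar>bsum i 0 (Suc k) \<omega>\<bar> \<ge> ?n / 2}"
    proof (rule finite_measure_mono)
      show "?N \<subseteq> {\<omega>\<in>space P. \<bar>bsum i 0 (Suc k) \<omega>\<bar> \<ge> ?n / 2}"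
      proof safe
        fix \<omega> assume "\<forall>k. ring_time (Ew \<omega>) i k \<le> real T"
        then have "bsum i 0 (Suc k) \<omega> + ?n \<le> ?n / 2" using Tn unfolding ring_time_bsum by (meson order_trans)
        moreover have "b + n \<le> n / 2 \<Longrightarrow> n / 2 \<le> \<bar>b\<bar>" for b n :: real by linarith
        ultimately show "?n / 2 \<le> \<bar>bsum i 0 (Suc k) \<omega>\<bar>" by blast
      qed
    qed (use bsum_measurable[OF i] in measurable)
    also have "\<dots> \<le> real (Suc k - 0) / (?n / 2)\<^sup>2" by (rule bsum_tail2[OF i]) simp
    also have "\<dots> = 4 * inverse ?n"
    proof -
      have "n / (n / 2)\<^sup>2 = 4 * inverse n" if "n > 0" for n :: real using that by (simp add: power2_eq_square field_simps)
      from this[of ?n] show ?thesis by simp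
    qed
    finally show ?thesis .
  qed
  have "(\<lambda>k. 4 * inverse (real (Suc k))) \<longlonglongrightarrow> 4 * 0" by (intro tendsto_mult tendsto_const LIMSEQ_inverse_real_of_nat)
  then have "prob ?N \<le> 4 * 0"
    by (rule LIMSEQ_le_const) (use le in \<open>auto intro!: exI[of _ "2 * T + 1"]\<close>)
  then have "prob ?N = 0" using measure_nonneg[of P ?N] by linarith
  then have "AE \<omega> in P. \<not> (\<forall>k. ring_time (Ew \<omega>) i k \<le> real T)" by (subst (asm) prob_Collect_eq_0[OF Nm])
  then show ?thesis by eventually_elim (auto simp: not_le)
qed

lemma AE_distinct:
  assumes i: "i < d" and j: "j < d" and ij: "i \<noteq> j"
  shows "AE \<omega> in P. ring_time (Ew \<omega>) i k \<noteq> ring_time (Ew \<omega>) j l"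
proof -
  let ?I = "{i} \<times> {0..<Suc k}" and ?J = "{j} \<times> {0..<Suc l}"
  let ?X = "\<lambda>\<omega>. \<Sum>k\<in>{0..<Suc k}. E i k \<omega>" and ?Y = "\<lambda>\<omega>. \<Sum>k\<in>{0..<Suc l}. E j k \<omega>"
  have iv: "indep_var (PiM ?I (\<lambda>_. borel)) (\<lambda>\<omega>. restrict (\<lambda>p. (case p of (i, k) \<Rightarrow> E i k) \<omega>) ?I) (PiM ?J (\<lambda>_. borel)) (\<lambda>\<omega>. restrict (\<lambda>p. (case p of (i, k) \<Rightarrow> E i k) \<omega>) ?J)"
    by (rule indep_var_restrict[OF E_indep]) (use i j ij in auto)
  have m1: "(\<lambda>f. \<Sum>k\<in>{0..<Suc k}. f (i, k)) \<in> borel_measurable (PiM ?I (\<lambda>_. borel :: real measure))"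
    by (intro borel_measurable_sum measurable_component_singleton) auto
  have m2: "(\<lambda>f. \<Sum>k\<in>{0..<Suc l}. f (j, k)) \<in> borel_measurable (PiM ?J (\<lambda>_. borel :: real measure))"
    by (intro borel_measurable_sum measurable_component_singleton) auto
  have "indep_var borel ?X borel ?Y"
  proof -
    have "(\<Sum>k\<in>{0..<Suc k}. restrict (\<lambda>p. (case p of (i, k) \<Rightarrow> E i k) \<omega>) ?I (i, k)) = ?X \<omega>" for \<omega> by (rule sum.cong) auto
    moreover have "(\<Sum>k\<in>{0..<Suc l}. restrict (\<lambda>p. (case p of (i, k) \<Rightarrow> E i k) \<omega>) ?J (j, k)) = ?Y \<omega>" for \<omega> by (rule sum.cong) auto
    ultimately show ?thesis using indep_var_compose[OF iv m1 m2] by (simp add: comp_def del: sum.op_ivl_Suc restrict_apply)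
  qed
  then have "AE \<omega> in P. ?X \<omega> \<noteq> ?Y \<omega>" by (rule indep_density_neq[OF _ bsum_erlang[OF j]]) simp
  then show ?thesis by (simp add: ring_time_def atLeast0LessThan lessThan_Suc_atMost)
qed

lemma AE_generic: "AE \<omega> in P. generic d (Ew \<omega>)"
proof -
  have "AE \<omega> in P. \<forall>i\<in>{..<d}. \<forall>k. 0 < E i k \<omega>"
    by (simp add: AE_ball_countable AE_all_countable AE_pos)
  moreover have "AE \<omega> in P. \<forall>i\<in>{..<d}. \<forall>T::nat. \<exists>k. real T < ring_time (Ew \<omega>) i k"
    by (simp add: AE_ball_countable AE_all_countable AE_div)
  moreover have "AE \<omega> in P. \<forall>i\<in>{..<d}. \<forall>j\<in>{..<d}. \<forall>k l. i \<noteq> j \<longrightarrow> ring_time (Ew \<omega>) i k \<noteq> ring_time (Ew \<omega>) j l"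
    using AE_distinct by (simp add: AE_ball_countable AE_all_countable)
  ultimately show ?thesis
    unfolding generic_def by eventually_elim (meson lessThan_iff)
qed

section \<open>Convergence of the grid increments\<close>

lemma clt_coupling:
  "\<exists>(\<Omega> :: real measure) Yn Y. prob_space \<Omega> \<and> (\<forall>n. Yn n \<in> borel_measurable \<Omega>) \<and> Y \<in> borel_measurable \<Omega> \<and>
     (\<forall>n::nat. distr \<Omega> borel (Yn n) = distr P borel (\<lambda>\<omega>. bsum 0 0 n \<omega> / sqrt (real n))) \<and>
     distr \<Omega> borel Y = std_normal_distribution \<and> (\<forall>x\<in>space \<Omega>. (\<lambda>n. Yn n x) \<longlonglongrightarrow> Y x)"
proof -
  let ?\<mu> = "\<lambda>n. distr P borel (\<lambda>\<omega>. bsum 0 0 n \<omega> / sqrt (real n))"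
  have [measurable]: "bsum 0 0 n \<in> borel_measurable P" for n by (rule bsum_measurable[OF d_pos])
  have e: "(\<Sum>k<n. E 0 k \<omega> - 1) / sqrt (real n * 1\<^sup>2) = bsum 0 0 n \<omega> / sqrt (real n)" for n \<omega>
    by (simp add: bsum_def atLeast0LessThan)
  have "weak_conv_m (\<lambda>n. distr P borel (\<lambda>\<omega>. (\<Sum>k<n. E 0 k \<omega> - 1) / sqrt (real n * 1\<^sup>2))) std_normal_distribution"
  proof (rule central_limit_theorem[where \<mu>="density lborel (exponential_density 1)"])
    show "indep_vars (\<lambda>_. borel) (E 0) UNIV" using E_row_indep[OF d_pos, of UNIV] .
    show "expectation (E 0 n) = 1" for n using exponential_distributed_expectation[OF _ E_exp[OF d_pos]] by simp
    show "integrable P (\<lambda>x. (E 0 n x)\<^sup>2)" for n by (rule erlang_ith_moment_integrable[OF _ E_exp[OF d_pos]]) simp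
    show "variance (E 0 n) = 1\<^sup>2" for n using exponential_distributed_variance[OF _ E_exp[OF d_pos]] by simp
    show "distr P borel (E 0 n) = density lborel (exponential_density 1)" for n
      using distributed_distr_eq_density[OF E_exp[OF d_pos, of n]] by (simp add: distr_cong[OF HOL.refl sets_lborel[symmetric]])
  qed simp
  then have wc: "weak_conv_m ?\<mu> std_normal_distribution" unfolding e .
  have rd: "real_distribution (?\<mu> n)" for n by (rule real_distribution_distr) simp
  \<comment> \<open>Skorohod's representation replaces weak convergence by pointwise convergence of
    copies on one space, on which dominated convergence works for nonlinear functionals.\<close>
  from Skorohod[OF rd real_dist_normal_dist wc] obtain \<Omega> :: "real measure" and Yn Y where
    "prob_space \<Omega>" "\<forall>n. Yn n \<in> measurable \<Omega> borel" "\<forall>n. distr \<Omega> borel (Yn n) = ?\<mu> n"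
    "Y \<in> measurable \<Omega> lborel" "distr \<Omega> borel Y = std_normal_distribution" "\<forall>x\<in>space \<Omega>. (\<lambda>n. Yn n x) \<longlonglongrightarrow> Y x" by blast
  then show ?thesis by (intro exI[of _ \<Omega>] exI[of _ Yn] exI[of _ Y]) simp
qed

text \<open>The contribution of grid cell number \<open>snd a\<close>, of length 1/K on the rescaled
  time axis; cell boundaries are rounded down to whole numbers of waiting times.\<close>

definition blk :: "nat \<Rightarrow> nat \<Rightarrow> nat \<times> nat \<Rightarrow> 'a \<Rightarrow> real" where
  "blk K n a \<omega> = bsum (fst a) (n * snd a div K) (n * Suc (snd a) div K) \<omega> / sqrt (real n)"

lemma blk_measurable: "fst a < d \<Longrightarrow> blk K n a \<in> borel_measurable P"
  unfolding blk_def using bsum_measurable by simp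

lemma blk_indep:
  assumes K: "0 < K"
  shows "indep_vars (\<lambda>_. borel) (blk K n) ({..<d} \<times> UNIV)"
proof -
  let ?K = "\<lambda>a. {fst a} \<times> {n * snd a div K..<n * Suc (snd a) div K}"
  have mono: "n * p div K \<le> n * q div K" if "p \<le> q" for p q by (intro div_le_mono mult_le_mono2 that)
  have "indep_vars (\<lambda>a. PiM (?K a) (\<lambda>_. borel)) (\<lambda>a \<omega>. restrict (\<lambda>p. (case p of (i, k) \<Rightarrow> E i k) \<omega>) (?K a)) ({..<d} \<times> UNIV)"
  proof (rule indep_vars_restrict[OF E_indep])
    show "disjoint_family_on ?K ({..<d} \<times> UNIV)"
      unfolding disjoint_family_on_def
    proof (intro ballI impI)
      fix a b :: "nat \<times> nat" assume "a \<noteq> b"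
      then consider "fst a \<noteq> fst b" | "snd a < snd b" | "snd b < snd a" by (metis linorder_neqE_nat prod_eqI)
      then show "?K a \<inter> ?K b = {}"
      proof cases
        case 2
        then show ?thesis using mono[of "Suc (snd a)" "snd b"] by auto
      next
        case 3
        then show ?thesis using mono[of "Suc (snd b)" "snd a"] by auto
      qed auto
    qed
  qed auto
  from indep_vars_compose2[OF this, of "\<lambda>a f. (\<Sum>k\<in>{n * snd a div K..<n * Suc (snd a) div K}. f (fst a, k) - 1) / sqrt (real n)" "\<lambda>_. borel"]
  have "indep_vars (\<lambda>_. borel) (\<lambda>a \<omega>. (\<Sum>k\<in>{n * snd a div K..<n * Suc (snd a) div K}. restrict (\<lambda>p. (case p of (i, k) \<Rightarrow> E i k) \<omega>) (?K a) (fst a, k) - 1) / sqrt (real n)) ({..<d} \<times> UNIV)"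
    by (force intro!: borel_measurable_divide borel_measurable_sum borel_measurable_diff measurable_component_singleton)
  moreover have "(\<Sum>k\<in>{n * snd a div K..<n * Suc (snd a) div K}. restrict (\<lambda>p. (case p of (i, k) \<Rightarrow> E i k) \<omega>) (?K a) (fst a, k) - 1) = bsum (fst a) (n * snd a div K) (n * Suc (snd a) div K) \<omega>" for a \<omega>
    unfolding bsum_def by (rule sum.cong) auto
  ultimately show ?thesis unfolding blk_def[abs_def] by simp
qed

end

context exp_clocks
begin

text \<open>Blocks of different clocks or cells are independent, so a product of coupling spaces
  carries a copy of all of them. A block with m terms is sqrt(m / n) times a normalised sum; m / n
  tends to 1/K and m to infinity, so the copies converge pointwise to independent Gaussians of
  variance 1/K.\<close>

lemma blk_fdd:
  assumes K: "0 < K" and L: "0 < L"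
    and lip: "\<And>v v'. \<bar>\<phi> v - \<phi> v'\<bar> \<le> C * (\<Sum>a\<in>{..<d} \<times> {..<L}. \<bar>v a - v' a\<bar>)" and B: "\<And>v. \<bar>\<phi> v\<bar> \<le> B"
  shows "(\<lambda>n. \<integral>\<omega>. \<phi> (\<lambda>a. blk K n a \<omega>) \<partial>P) \<longlonglongrightarrow>
     (\<integral>\<omega>. \<phi> (\<lambda>a. bm (real (Suc (snd a)) * (1 / real K)) \<omega> (fst a) - bm (real (snd a) * (1 / real K)) \<omega> (fst a)) \<partial>gauss)"
proof -
  let ?I = "{..<d} \<times> {..<L}"
  have finI: "finite ?I" and neI: "?I \<noteq> {}" using d_pos L by auto
  obtain \<Omega> :: "real measure" and Yn Y where Om: "prob_space \<Omega>" and Yn[measurable]: "\<And>n. Yn n \<in> borel_measurable \<Omega>"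
    and Y[measurable]: "Y \<in> borel_measurable \<Omega>"
    and lawn: "\<And>n::nat. distr \<Omega> borel (Yn n) = distr P borel (\<lambda>\<omega>. bsum 0 0 n \<omega> / sqrt (real n))"
    and law: "distr \<Omega> borel Y = std_normal_distribution" and lim: "\<And>x. x \<in> space \<Omega> \<Longrightarrow> (\<lambda>n. Yn n x) \<longlonglongrightarrow> Y x"
    using clt_coupling by blast
  \<comment> \<open>One copy of the coupling space for each pair of a clock and a cell.\<close>
  let ?O = "PiM ?I (\<lambda>_. \<Omega>)"
  interpret Om: prob_space \<Omega> by (rule Om)
  have PO: "prob_space ?O" by (rule prob_space_PiM) (rule Om)
  interpret O: prob_space ?O by (rule PO)
  have comp[measurable]: "(\<lambda>\<eta>. \<eta> a) \<in> measurable ?O \<Omega>" if "a \<in> ?I" for a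
    by (rule measurable_component_singleton[OF that])
  have compd: "distr ?O \<Omega> (\<lambda>\<eta>. \<eta> a) = \<Omega>" if "a \<in> ?I" for a
    by (rule distr_PiM_component[where M="\<lambda>_. \<Omega>"]) (use Om that in auto)
  have ci: "O.indep_vars (\<lambda>_. \<Omega>) (\<lambda>a \<eta>. \<eta> a) ?I"
  proof (subst O.indep_vars_iff_distr_eq_PiM'[OF neI comp])
    have "distr ?O ?O (\<lambda>\<eta>. \<lambda>a\<in>?I. \<eta> a) = distr ?O ?O (\<lambda>\<eta>. \<eta>)"
      by (rule distr_cong) (auto simp: space_PiM PiE_restrict)
    also have "\<dots> = ?O" by (rule distr_id)
    also have "?O = PiM ?I (\<lambda>a. distr ?O \<Omega> (\<lambda>\<eta>. \<eta> a))" by (rule PiM_cong) (use compd in auto)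
    finally show "distr ?O ?O (\<lambda>\<eta>. \<lambda>a\<in>?I. \<eta> a) = PiM ?I (\<lambda>a. distr ?O \<Omega> (\<lambda>\<eta>. \<eta> a))" .
  qed simp
  have marg: "distr ?O borel (\<lambda>\<eta>. g (\<eta> a)) = distr \<Omega> borel g" if "a \<in> ?I" "g \<in> borel_measurable \<Omega>" for a and g :: "real \<Rightarrow> real"
    using distr_distr[OF that(2) comp[OF that(1)]] unfolding compd[OF that(1)] by (simp add: comp_def)
  define m where "m n a = n * Suc (snd a) div K - n * snd a div K" for n and a :: "nat \<times> nat"
  define V where "V n a \<eta> = sqrt (real (m n a) / real n) * Yn (m n a) (\<eta> a)" for n a and \<eta> :: "nat \<times> nat \<Rightarrow> real"
  have Vm[measurable]: "V n a \<in> borel_measurable ?O" if "a \<in> ?I" for n a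
    unfolding V_def using measurable_compose[OF comp[OF that] Yn] by simp
  have Vmarg: "distr ?O borel (V n a) = distr P borel (blk K n a)" if a: "a \<in> ?I" for n a
  proof -
    let ?c = "sqrt (real (m n a) / real n)"
    have i: "fst a < d" using a by auto
    note [measurable] = bsum_measurable[OF d_pos] bsum_measurable[OF i]
    have "distr ?O borel (V n a) = distr \<Omega> borel (\<lambda>x. ?c * Yn (m n a) x)"
      unfolding V_def by (rule marg[OF a]) simp
    also have "\<dots> = distr (distr \<Omega> borel (Yn (m n a))) borel (\<lambda>x. ?c * x)" by (subst distr_distr) (auto simp: comp_def)
    also have "\<dots> = distr P borel (\<lambda>\<omega>. ?c * (bsum 0 0 (m n a) \<omega> / sqrt (real (m n a))))"
      unfolding lawn by (subst distr_distr) (auto simp: comp_def)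
    also have "(\<lambda>\<omega>. ?c * (bsum 0 0 (m n a) \<omega> / sqrt (real (m n a)))) = (\<lambda>\<omega>. bsum 0 0 (m n a) \<omega> / sqrt (real n))"
    \<comment> \<open>For an empty block both sides are 0, the quotient by sqrt 0 included.\<close>
    proof (cases "m n a = 0")
      case True
      then show ?thesis by (simp add: bsum_def)
    qed (auto simp: real_sqrt_divide)
    also have "distr P borel \<dots> = distr (distr P borel (bsum 0 0 (m n a))) borel (\<lambda>x. x / sqrt (real n))"
      by (subst distr_distr) (auto simp: comp_def)
    also have "distr P borel (bsum 0 0 (m n a)) = distr P borel (bsum (fst a) (n * snd a div K) (n * Suc (snd a) div K))"
      by (rule bsum_law[OF d_pos i]) (simp add: m_def)
    also have "distr \<dots> borel (\<lambda>x. x / sqrt (real n)) = distr P borel (blk K n a)"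
      by (subst distr_distr) (auto simp: comp_def blk_def[abs_def])
    finally show ?thesis .
  qed
  have lawV: "distr P (PiM ?I (\<lambda>_. borel)) (\<lambda>\<omega>. \<lambda>a\<in>?I. blk K n a \<omega>) = distr ?O (PiM ?I (\<lambda>_. borel)) (\<lambda>\<eta>. \<lambda>a\<in>?I. V n a \<eta>)" for n
  proof -
    have "indep_vars (\<lambda>_. borel) (blk K n) ?I" by (rule indep_vars_subset[OF blk_indep[OF K]]) auto
    then have 1: "distr P (PiM ?I (\<lambda>_. borel)) (\<lambda>\<omega>. \<lambda>a\<in>?I. blk K n a \<omega>) = PiM ?I (\<lambda>a. distr P borel (blk K n a))"
      by (subst (asm) indep_vars_iff_distr_eq_PiM'[OF neI]) (auto intro: blk_measurable)
    have "O.indep_vars (\<lambda>_. borel) (V n) ?I"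
      unfolding V_def by (rule O.indep_vars_compose2[OF ci]) simp
    then have 2: "distr ?O (PiM ?I (\<lambda>_. borel)) (\<lambda>\<eta>. \<lambda>a\<in>?I. V n a \<eta>) = PiM ?I (\<lambda>a. distr ?O borel (V n a))"
      by (subst (asm) O.indep_vars_iff_distr_eq_PiM'[OF neI]) (auto intro: Vm)
    show ?thesis unfolding 1 2 by (rule PiM_cong) (use Vmarg in auto)
  qed
  have eqV: "(\<integral>\<omega>. \<phi> (\<lambda>a. blk K n a \<omega>) \<partial>P) = (\<integral>\<eta>. \<phi> (\<lambda>a. V n a \<eta>) \<partial>?O)" for n
    by (rule law_transfer_lipschitz[OF lawV finI _ _ lip]) (auto intro: blk_measurable Vm)
  define s where "s = sqrt (1 / real K)"
  define W where "W a \<eta> = s * Y (\<eta> a)" for a and \<eta> :: "nat \<times> nat \<Rightarrow> real"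
  have Wm[measurable]: "W a \<in> borel_measurable ?O" if "a \<in> ?I" for a
    unfolding W_def using measurable_compose[OF comp[OF that] Y] by simp
  have mr: "(\<lambda>n. real (m n a) / real n) \<longlonglongrightarrow> 1 / real K" for a
  proof -
    have "real (m n a) / real n = real (n * Suc (snd a) div K) / real n - real (n * snd a div K) / real n" for n
      unfolding m_def by (subst of_nat_diff) (auto intro!: div_le_mono simp: diff_divide_distrib)
    moreover have "(\<lambda>n. real (n * Suc (snd a) div K) / real n - real (n * snd a div K) / real n) \<longlonglongrightarrow> real (Suc (snd a)) / real K - real (snd a) / real K"
      by (intro tendsto_diff div_ratio K)
    moreover have "real (Suc (snd a)) / real K - real (snd a) / real K = 1 / real K" by (simp add: diff_divide_distrib[symmetric])
    ultimately show ?thesis by simp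
  qed
  have mtop: "filterlim (\<lambda>n. m n a) at_top sequentially" for a
  proof (rule filterlim_at_top_mono[OF filterlim_at_top_div_const_nat[OF K]])
    have "n div K \<le> m n a" for n using div_sum_ge[of "n * snd a" K n] by (simp add: m_def add.commute)
    then show "eventually (\<lambda>n. n div K \<le> m n a) sequentially" by simp
  qed
  have VW: "(\<lambda>n. V n a \<eta>) \<longlonglongrightarrow> W a \<eta>" if a: "a \<in> ?I" and \<eta>: "\<eta> \<in> space ?O" for a \<eta>
  proof -
    have "\<eta> a \<in> space \<Omega>" using a \<eta> by (auto simp: space_PiM)
    from filterlim_compose[OF lim[OF this] mtop[of a]] show ?thesis
      unfolding V_def W_def s_def by (intro tendsto_mult tendsto_real_sqrt mr)
  qed
  have \<phi>lim: "(\<lambda>n. \<phi> (\<lambda>a. V n a \<eta>)) \<longlonglongrightarrow> \<phi> (\<lambda>a. W a \<eta>)" if \<eta>: "\<eta> \<in> space ?O" for \<eta>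
  proof -
    have "(\<lambda>n. C * (\<Sum>a\<in>?I. \<bar>V n a \<eta> - W a \<eta>\<bar>)) \<longlonglongrightarrow> C * (\<Sum>a\<in>?I. 0)"
      by (intro tendsto_mult tendsto_const tendsto_sum tendsto_rabs_zero LIM_zero VW \<eta>)
    then have "(\<lambda>n. \<phi> (\<lambda>a. V n a \<eta>) - \<phi> (\<lambda>a. W a \<eta>)) \<longlonglongrightarrow> 0"
      by (intro Lim_null_comparison[where g="\<lambda>n. C * (\<Sum>a\<in>?I. \<bar>V n a \<eta> - W a \<eta>\<bar>)" and f="\<lambda>n. \<phi> (\<lambda>a. V n a \<eta>) - \<phi> (\<lambda>a. W a \<eta>)"])
         (use lip in simp_all)
    then show ?thesis by (simp add: LIM_zero_iff)
  qed
  have conv: "(\<lambda>n. \<integral>\<eta>. \<phi> (\<lambda>a. V n a \<eta>) \<partial>?O) \<longlonglongrightarrow> (\<integral>\<eta>. \<phi> (\<lambda>a. W a \<eta>) \<partial>?O)"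
  proof (rule integral_dominated_convergence[where w="\<lambda>_. B"])
    show "(\<lambda>\<eta>. \<phi> (\<lambda>a. W a \<eta>)) \<in> borel_measurable ?O" by (rule lipschitz_measurable[OF finI Wm lip])
    show "(\<lambda>\<eta>. \<phi> (\<lambda>a. V n a \<eta>)) \<in> borel_measurable ?O" for n by (rule lipschitz_measurable[OF finI Vm lip])
  qed (use \<phi>lim B in auto)
  have Wchar: "(\<integral>\<eta>. cis (\<Sum>a\<in>?I. u a * W a \<eta>) \<partial>?O) = (\<Prod>a\<in>?I. complex_of_real (exp (- (1 / real K) / 2 * (u a)\<^sup>2)))" for u
  proof -
    have "O.indep_vars (\<lambda>_. borel) (\<lambda>a \<eta>. cis (u a * W a \<eta>)) ?I"
      unfolding W_def by (rule O.indep_vars_compose2[OF ci]) simp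
    then have "(\<integral>\<eta>. (\<Prod>a\<in>?I. cis (u a * W a \<eta>)) \<partial>?O) = (\<Prod>a\<in>?I. \<integral>\<eta>. cis (u a * W a \<eta>) \<partial>?O)"
      by (rule O.indep_vars_lebesgue_integral[OF finI]) (rule prob_integrable_bounded[OF PO, where c=1]; simp)
    moreover have "(\<Prod>a\<in>?I. cis (u a * W a \<eta>)) = cis (\<Sum>a\<in>?I. u a * W a \<eta>)" for \<eta>
      by (simp add: cis_conv_exp exp_sum[OF finI, symmetric] sum_distrib_left)
    moreover have "(\<integral>\<eta>. cis (u a * W a \<eta>) \<partial>?O) = complex_of_real (exp (- (1 / real K) / 2 * (u a)\<^sup>2))" if a: "a \<in> ?I" for a
    proof -
      have "(\<integral>\<eta>. cis (u a * W a \<eta>) \<partial>?O) = (\<integral>x. cis (u a * (s * x)) \<partial>distr ?O borel (\<lambda>\<eta>. Y (\<eta> a)))"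
        unfolding W_def using measurable_compose[OF comp[OF a] Y] by (subst integral_distr) auto
      also have "\<dots> = (\<integral>x. cis ((u a * s) * x) \<partial>std_normal_distribution)"
        unfolding marg[OF a Y] law by (simp add: mult.assoc)
      also have "\<dots> = complex_of_real (exp (- (u a * s)\<^sup>2 / 2))"
        using fun_cong[OF char_std_normal_distribution, of "u a * s"] by (simp add: char_def cis_conv_exp)
      also have "- (u a * s)\<^sup>2 / 2 = - (1 / real K) / 2 * (u a)\<^sup>2" by (simp add: power_mult_distrib s_def)
      finally show ?thesis .
    qed
    ultimately show ?thesis by simp
  qed
  let ?D = "\<lambda>a \<omega>. bm (real (Suc (snd a)) * (1 / real K)) \<omega> (fst a) - bm (real (snd a) * (1 / real K)) \<omega> (fst a)"
  have lawW: "distr ?O (PiM ?I (\<lambda>_. borel)) (\<lambda>\<eta>. \<lambda>a\<in>?I. W a \<eta>) = distr gauss (PiM ?I (\<lambda>_. borel)) (\<lambda>\<omega>. \<lambda>a\<in>?I. ?D a \<omega>)"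
    by (rule char_unique_law[OF PO prob_space_gauss finI Wm]) (use Wchar bm_grid_char[of "1 / real K"] K in auto)
  have "(\<integral>\<eta>. \<phi> (\<lambda>a. W a \<eta>) \<partial>?O) = (\<integral>\<omega>. \<phi> (\<lambda>a. ?D a \<omega>) \<partial>gauss)"
    by (rule law_transfer_lipschitz[OF lawW finI Wm _ lip]) auto
  then show ?thesis using conv unfolding eqV by simp
qed

text \<open>A measurable event of full measure inside the generic realisations. Nonemptiness is
  needed later for the infimum over its elements.\<close>

lemma generic_set: "\<exists>G\<in>sets P. (AE \<omega> in P. \<omega> \<in> G) \<and> (\<forall>\<omega>\<in>G. generic d (Ew \<omega>)) \<and> G \<noteq> {}"
proof -
  obtain N where N: "{\<omega>\<in>space P. \<not> generic d (Ew \<omega>)} \<subseteq> N" "emeasure P N = 0" "N \<in> sets P"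
    using AE_E[OF AE_generic] by blast
  have "AE \<omega> in P. \<omega> \<notin> N" by (rule AE_not_in) (use N in auto)
  then have AE: "AE \<omega> in P. \<omega> \<in> space P - N" using AE_space by eventually_elim auto
  have "space P - N \<noteq> {}"
  proof
    assume "space P - N = {}"
    then have "AE \<omega> in P. \<omega> \<in> {}" using AE by metis
    then show False by simp
  qed
  then show ?thesis using N AE by (intro bexI[of _ "space P - N"]) auto
qed

section \<open>Measurability of functionals of the rescaled gap path\<close>

lemma cnt_measurable:
  assumes G: "G \<in> sets P" "\<And>\<omega>. \<omega> \<in> G \<Longrightarrow> generic d (Ew \<omega>)" and i: "i < d"
  shows "(\<lambda>\<omega>. if \<omega> \<in> G then real (cnt (Ew \<omega>) i s) else 0) \<in> borel_measurable P"
proof (rule borel_measurable_LIMSEQ_real)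
  note [measurable] = ring_time_measurable[OF i] G(1)
  let ?u = "\<lambda>M \<omega>. if \<omega> \<in> G then \<Sum>k<M. if ring_time (Ew \<omega>) i k \<le> s then 1 else (0::real) else 0"
  show "?u M \<in> borel_measurable P" for M by measurable
  fix \<omega>
  show "(\<lambda>M. ?u M \<omega>) \<longlonglongrightarrow> (if \<omega> \<in> G then real (cnt (Ew \<omega>) i s) else 0)"
  proof (cases "\<omega> \<in> G")
    case True
    let ?S = "{k. ring_time (Ew \<omega>) i k \<le> s}"
    have fin: "finite ?S" by (rule ring_index_finite[OF G(2)[OF True] i])
    from fin[unfolded finite_nat_set_iff_bounded] obtain M0 where M0: "\<And>k. k \<in> ?S \<Longrightarrow> k < M0" by metis
    have "(\<Sum>k<M. if ring_time (Ew \<omega>) i k \<le> s then 1 else (0::real)) = real (cnt (Ew \<omega>) i s)" if "M \<ge> M0" for M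
    proof -
      have "(\<Sum>k<M. if ring_time (Ew \<omega>) i k \<le> s then 1 else (0::real)) = (\<Sum>k\<in>?S. 1)"
      proof (rule sum.mono_neutral_cong_right)
        show "?S \<subseteq> {..<M}"
        proof
          fix k assume "k \<in> ?S"
          from M0[OF this] show "k \<in> {..<M}" using that by simp
        qed
      qed simp_all
      then show ?thesis by (simp add: cnt_def)
    qed
    then have "eventually (\<lambda>M. ?u M \<omega> = real (cnt (Ew \<omega>) i s)) sequentially"
      using True by (intro eventually_sequentiallyI[of M0]) auto
    then show ?thesis using True by (simp add: tendsto_eventually)
  qed simp
qed

text \<open>The gap path is measurable at fixed times because it is the reflection of counting
  processes; sampling and rounding then give measurability of \<open>f\<close> along it for the
  completed measure.\<close>

lemma zpath_functional_measurable:
  assumes x0: "\<And>i. Suc i < d \<Longrightarrow> x0 i < x0 (Suc i)" and n: "0 < n"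
    and f: "bounded (range f)" "sk_continuous (d - 1) f"
  shows "(\<lambda>\<omega>. f (zpath d x0 n (Ew \<omega>))) \<in> borel_measurable (completion P)"
proof -
  obtain G where G: "G \<in> sets P" "AE \<omega> in P. \<omega> \<in> G" "\<And>\<omega>. \<omega> \<in> G \<Longrightarrow> generic d (Ew \<omega>)" using generic_set by blast
  have P: "prob_space P" by (rule prob_space_axioms)
  \<comment> \<open>Set to zero off \<open>G\<close>, so that the pathwise hypotheses of
    \<open>reflmap_measurable\<close> hold at every point of the space.\<close>
  define x' where "x' \<omega> s j = (if \<omega> \<in> G then 1 / sqrt (real n) * netpath x0 (Ew \<omega>) (real n * s) j else 0)" for \<omega> s j
  define Z' where "Z' \<omega> t i = (if \<omega> \<in> G then zpath d x0 n (Ew \<omega>) t i else 0)" for \<omega> t i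
  have Zm: "(\<lambda>\<omega>. Z' \<omega> t i) \<in> borel_measurable P" if t: "0 \<le> t" and i: "i < d - 1" for t i
  proof -
    have e: "Z' \<omega> t i = (if \<omega> \<in> G then reflmap (x' \<omega>) t i else 0)" for \<omega>
    proof (cases "\<omega> \<in> G")
      case True
      then have "x' \<omega> = (\<lambda>s j. 1 / sqrt (real n) * netpath x0 (Ew \<omega>) (real n * s) j)" by (auto simp: x'_def fun_eq_iff)
      moreover have "zpath d x0 n (Ew \<omega>) t i = reflmap (\<lambda>s j. 1 / sqrt (real n) * netpath x0 (Ew \<omega>) (real n * s) j) t i"
        by (rule zpath_reflmap) (use G(3)[OF True] x0 t i n in auto)
      ultimately show ?thesis using True by (simp add: Z'_def)
    qed (simp add: Z'_def)
    have "(\<lambda>\<omega>. reflmap (x' \<omega>) t i) \<in> borel_measurable P"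
    proof (rule reflmap_measurable[OF _ _ _ t])
      fix \<omega> j T assume j: "j \<le> i"
      then have j': "Suc j < d" using i by simp
      show "bdd_on T (\<lambda>s. x' \<omega> s j)"
      proof (cases "\<omega> \<in> G")
        case True
        obtain B where B: "\<forall>s\<in>{0..real n * T}. \<bar>netpath x0 (Ew \<omega>) s j\<bar> \<le> B"
          using netpath_bdd[OF G(3)[OF True] j', of "real n * T" x0] unfolding bdd_on_def by blast
        have "\<bar>x' \<omega> s j\<bar> \<le> 1 / sqrt (real n) * B" if "s \<in> {0..T}" for s
        proof -
          have "\<bar>netpath x0 (Ew \<omega>) (real n * s) j\<bar> \<le> B" using B that n by (auto intro!: mult_left_mono)
          then have "1 / sqrt (real n) * \<bar>netpath x0 (Ew \<omega>) (real n * s) j\<bar> \<le> 1 / sqrt (real n) * B" by (intro mult_left_mono) auto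
          then show ?thesis using True by (simp add: x'_def abs_mult)
        qed
        then show ?thesis unfolding bdd_on_def by blast
      qed (auto simp: x'_def bdd_on_def)
      show "rcont (\<lambda>s. x' \<omega> s j)"
      proof (cases "\<omega> \<in> G")
        case True
        note g = G(3)[OF True]
        let ?J = "(\<lambda>s. s / real n) ` rings d (Ew \<omega>)"
        have dep: "x' \<omega> s j = x' \<omega> t j" if "{r\<in>?J. r \<le> s} = {r\<in>?J. r \<le> t}" for s t
        proof -
          have e: "{r\<in>rings d (Ew \<omega>). r \<le> real n * u} = {r. r / real n \<in> {r\<in>?J. r \<le> u}}" for u
            using n by (auto simp: image_iff field_simps)
          have "cnt (Ew \<omega>) k (real n * s) = cnt (Ew \<omega>) k (real n * t)" if "k < d" for k
            unfolding pcount_cnt[OF g that, symmetric] e \<open>{r\<in>?J. r \<le> s} = {r\<in>?J. r \<le> t}\<close> ..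
          then show ?thesis using j' by (simp add: x'_def netpath_def)
        qed
        \<comment> \<open>A single coordinate is packed into a path with a dummy index, so that
          right continuity can be read off from \<open>jump_Dspace\<close>.\<close>
        have "(\<lambda>s i. x' \<omega> s j) \<in> Dspace 1"
        proof (rule jump_Dspace[OF zpath_J_finite(1)[OF g n]])
          fix s t assume "{r\<in>?J. r \<le> s} = {r\<in>?J. r \<le> t}"
          from dep[OF this] show "(\<lambda>i. x' \<omega> s j) = (\<lambda>i. x' \<omega> t j)" by simp
        qed
        then have "((\<lambda>s. x' \<omega> s j) \<longlongrightarrow> x' \<omega> t j) (at_right t)" if "0 \<le> t" for t using that by (auto simp: Dspace_def)
        then show ?thesis unfolding rcont_def
        proof (intro allI impI)
          fix t e :: real assume t: "0 \<le> t" "0 < e" and *: "\<And>t. 0 \<le> t \<Longrightarrow> ((\<lambda>s. x' \<omega> s j) \<longlongrightarrow> x' \<omega> t j) (at_right t)"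
          from tendstoD[OF *[OF t(1)] t(2)] obtain b where b: "b > t" "\<And>s. t < s \<Longrightarrow> s < b \<Longrightarrow> dist (x' \<omega> s j) (x' \<omega> t j) < e"
            unfolding eventually_at_right_field by blast
          show "\<exists>\<delta>>0. \<forall>s. t \<le> s \<longrightarrow> s < t + \<delta> \<longrightarrow> \<bar>x' \<omega> s j - x' \<omega> t j\<bar> < e"
          proof (intro exI[of _ "b - t"] conjI allI impI)
            fix s assume "t \<le> s" "s < t + (b - t)"
            then show "\<bar>x' \<omega> s j - x' \<omega> t j\<bar> < e" using b(2)[of s] t by (cases "s = t") (auto simp: dist_real_def)
          qed (use b in simp)
        qed
      qed (auto simp: x'_def rcont_def intro!: exI[of _ 1])
    next
      fix s j assume s: "0 \<le> s" "s \<le> t" "j \<le> i"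
      then have j: "j < d" "Suc j < d" using i by auto
      have e: "x' \<omega> s j = 1 / sqrt (real n) * ((if \<omega> \<in> G then real_of_int (x0 (Suc j) - x0 j - 1) else 0)
          + (if \<omega> \<in> G then real (cnt (Ew \<omega>) (Suc j) (real n * s)) else 0) - (if \<omega> \<in> G then real (cnt (Ew \<omega>) j (real n * s)) else 0))" for \<omega>
        by (simp add: x'_def netpath_def)
      note [measurable] = G(1) cnt_measurable[OF G(1,3) j(1)] cnt_measurable[OF G(1,3) j(2)]
      show "(\<lambda>\<omega>. x' \<omega> s j) \<in> borel_measurable P" unfolding e by measurable
    qed
    then show ?thesis unfolding e using G(1) by measurable
  qed
  have Zp: "Z' \<omega> \<in> Dspace (d - 1) \<and> sk_conv (d - 1) (\<lambda>k. disc (d - 1) (Suc k) (Z' \<omega>)) (Z' \<omega>)" for \<omega>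
  proof (cases "\<omega> \<in> G")
    case True
    then have "Z' \<omega> = zpath d x0 n (Ew \<omega>)" by (auto simp: Z'_def fun_eq_iff)
    then show ?thesis using zpath_Dspace[OF G(3)[OF True] n] zpath_disc[OF G(3)[OF True] n] by simp
  next
    case False
    then have "Z' \<omega> = (\<lambda>_ _. 0)" by (auto simp: Z'_def fun_eq_iff)
    then show ?thesis by (auto intro!: continuous_Dspace lu_imp_sk disc_lu_conv)
  qed
  obtain B where B: "\<And>x. \<bar>f x\<bar> \<le> B" using f(1) by (auto simp: bounded_iff)
  show ?thesis
  proof (rule completion_limit(1)[OF P, where q="\<lambda>k \<omega>. f (disc (d - 1) (Suc k) (Z' \<omega>))" and B=B])
    show "(\<lambda>\<omega>. f (disc (d - 1) (Suc k) (Z' \<omega>))) \<in> borel_measurable P" for k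
      by (rule sk_functional_limit(1)[OF P f Zm]) (use Zp in auto)
    show "AE \<omega> in P. (\<lambda>k. f (disc (d - 1) (Suc k) (Z' \<omega>))) \<longlonglongrightarrow> f (zpath d x0 n (Ew \<omega>))"
      using G(2)
    proof eventually_elim
      case (elim \<omega>)
      then have e: "Z' \<omega> = zpath d x0 n (Ew \<omega>)" by (auto simp: Z'_def fun_eq_iff)
      have "disc (d - 1) (Suc k) (Z' \<omega>) \<in> Dspace (d - 1)" for k unfolding disc_def by (rule stepf_Dspace) simp
      then show ?case
        using f(2)[unfolded sk_continuous_def, rule_format, of "\<lambda>k. disc (d - 1) (Suc k) (Z' \<omega>)" "Z' \<omega>"] Zp[of \<omega>] unfolding e by blast
    qed
  qed (rule B)
qed

end

section \<open>Convergence in distribution\<close>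

text \<open>Truncation at 1 keeps the supremum finite for arbitrary paths and bounds the cost of an
  exceptional event by 1.\<close>

definition pdist :: "nat \<Rightarrow> nat \<Rightarrow> (real \<Rightarrow> nat \<Rightarrow> real) \<Rightarrow> (real \<Rightarrow> nat \<Rightarrow> real) \<Rightarrow> real" where
  "pdist d j a b = (SUP p\<in>{0..real j} \<times> {..<d}. min 1 \<bar>a (fst p) (snd p) - b (fst p) (snd p)\<bar>)"

lemma pdist_bdd: "bdd_above ((\<lambda>p. min 1 \<bar>a (fst p) (snd p) - b (fst p) (snd p)\<bar>) ` ({0..real j} \<times> {..<d}))"
  for a b :: "real \<Rightarrow> nat \<Rightarrow> real"
  by (intro bdd_aboveI[where M=1]) auto

lemma pdist_upper: "0 \<le> t \<Longrightarrow> t \<le> real j \<Longrightarrow> i < d \<Longrightarrow> min 1 \<bar>a t i - b t i\<bar> \<le> pdist d j a b"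
  unfolding pdist_def by (rule cSUP_upper2[OF pdist_bdd, where x="(t, i)"]) auto

lemma pdist_least:
  assumes "0 < d" "\<And>t i. 0 \<le> t \<Longrightarrow> t \<le> real j \<Longrightarrow> i < d \<Longrightarrow> min 1 \<bar>a t i - b t i\<bar> \<le> e"
  shows "pdist d j a b \<le> e"
  unfolding pdist_def
proof (rule cSUP_least)
  have "(0, 0) \<in> {0..real j} \<times> {..<d}" using assms(1) by simp
  then show "{0..real j} \<times> {..<d} \<noteq> {}" by blast
qed (use assms(2) in auto)

lemma pdist_nonneg: "0 < d \<Longrightarrow> 0 \<le> pdist d j a b"
  using pdist_upper[of 0 j 0 d a b] by (simp add: min_def split: if_splits)

lemma pdist_commute: "pdist d j a b = pdist d j b a"
  unfolding pdist_def by (simp add: abs_minus_commute)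

lemma pdist_self: "0 < d \<Longrightarrow> pdist d j a a = 0"
  by (rule antisym[OF pdist_least pdist_nonneg]) auto

lemma pdist_triangle: assumes "0 < d" shows "pdist d j a c \<le> pdist d j a b + pdist d j b c"
proof (rule pdist_least[OF assms])
  fix t i assume t: "0 \<le> t" "t \<le> real j" "i < d"
  have "min 1 \<bar>a t i - c t i\<bar> \<le> min 1 \<bar>a t i - b t i\<bar> + min 1 \<bar>b t i - c t i\<bar>"
  proof -
    have "min 1 z \<le> min 1 x + min 1 y" if "z \<le> x + y" "0 \<le> x" "0 \<le> y" for x y z :: real
      using that by (auto simp: min_def)
    then show ?thesis using abs_triangle_ineq[of "a t i - b t i" "b t i - c t i"] by simp
  qed
  then show "min 1 \<bar>a t i - c t i\<bar> \<le> pdist d j a b + pdist d j b c"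
    using pdist_upper[OF t, of a b] pdist_upper[OF t, of b c] by linarith
qed

text \<open>The greatest minorant of the truncated functional h along the walks w that is j-Lipschitz for the
  uniform distance up to time j. It is defined for every path, so no measurability of h enters, and it can
  be compared with its value at the limiting path.\<close>

definition lip_env :: "nat \<Rightarrow> real \<Rightarrow> ('p \<Rightarrow> real) \<Rightarrow> ('p \<Rightarrow> real \<Rightarrow> nat \<Rightarrow> real) \<Rightarrow> 'p set \<Rightarrow> nat \<Rightarrow> (real \<Rightarrow> nat \<Rightarrow> real) \<Rightarrow> real" where
  "lip_env d B h w I j b = (INF p\<in>I. min B (h p + real j * pdist d j (w p) b))"

context
  fixes d :: nat and B :: real and h :: "'p \<Rightarrow> real" and w :: "'p \<Rightarrow> real \<Rightarrow> nat \<Rightarrow> real" and I :: "'p set"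
  assumes d: "0 < d" and h: "\<And>p. \<bar>h p\<bar> \<le> B" and I: "I \<noteq> {}"
begin

lemma env_term_ge: "- B \<le> min B (h p + real j * pdist d j (w p) b)"
proof -
  have "0 \<le> real j * pdist d j (w p) b" using pdist_nonneg[OF d] by simp
  then show ?thesis using h[of p] by (simp add: min_def abs_le_iff)
qed

lemma env_term_bdd: "bdd_below ((\<lambda>p. min B (h p + real j * pdist d j (w p) b)) ` I)"
  by (rule bdd_belowI[where m="- B"]) (use env_term_ge in auto)

lemma env_lower: "p \<in> I \<Longrightarrow> lip_env d B h w I j b \<le> min B (h p + real j * pdist d j (w p) b)"
  unfolding lip_env_def by (rule cINF_lower[OF env_term_bdd])

lemma env_le: "p \<in> I \<Longrightarrow> lip_env d B h w I j (w p) \<le> h p"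
  using env_lower[of p j "w p"] by (simp add: pdist_self[OF d])

lemma env_bounded: "\<bar>lip_env d B h w I j b\<bar> \<le> B"
proof -
  obtain p where "p \<in> I" using I by blast
  from env_lower[OF this, of j b] have "lip_env d B h w I j b \<le> B" by simp
  moreover have "- B \<le> lip_env d B h w I j b" unfolding lip_env_def by (rule cINF_greatest[OF I env_term_ge])
  ultimately show ?thesis by simp
qed

lemma env_lipschitz: "lip_env d B h w I j b \<le> lip_env d B h w I j b' + real j * pdist d j b b'"
proof -
  have "lip_env d B h w I j b - real j * pdist d j b b' \<le> lip_env d B h w I j b'"
    unfolding lip_env_def[of d B h w I j b']
  proof (rule cINF_greatest[OF I])
    fix p assume p: "p \<in> I"
    have "real j * pdist d j (w p) b \<le> real j * (pdist d j (w p) b' + pdist d j b' b)"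
      by (intro mult_left_mono pdist_triangle[OF d]) simp
    moreover have "0 \<le> real j * pdist d j b b'" using pdist_nonneg[OF d] by simp
    ultimately have "min B (h p + real j * pdist d j (w p) b) \<le> min B (h p + real j * pdist d j (w p) b') + real j * pdist d j b b'"
      unfolding pdist_commute[of d j b' b] by (simp add: min_def distrib_left)
    then show "lip_env d B h w I j b - real j * pdist d j b b' \<le> min B (h p + real j * pdist d j (w p) b')"
      using env_lower[OF p, of j b] by linarith
  qed
  then show ?thesis by simp
qed

lemma env_abs_diff: "\<bar>lip_env d B h w I j b - lip_env d B h w I j b'\<bar> \<le> real j * pdist d j b b'"
  using env_lipschitz[of j b b'] env_lipschitz[of j b' b] unfolding pdist_commute[of d j b' b] by (simp add: abs_le_iff)

end

section \<open>Step paths built from grid increments\<close>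

definition gpath :: "nat \<Rightarrow> (nat \<times> nat \<Rightarrow> real) \<Rightarrow> real \<Rightarrow> nat \<Rightarrow> real" where
  "gpath K v t i = (\<Sum>l<nat \<lfloor>real K * t\<rfloor>. v (i, l))"

lemma nat_floor_mult_le: assumes "0 \<le> t" "t \<le> real j" shows "nat \<lfloor>real K * t\<rfloor> \<le> j * K"
proof -
  have "real K * t \<le> real (j * K)" using mult_left_mono[OF assms(2), of "real K"] by (simp add: mult.commute)
  then have "\<lfloor>real K * t\<rfloor> \<le> int (j * K)" by (metis floor_mono floor_of_nat)
  then show ?thesis by (simp only: nat_le_iff)
qed

text \<open>Up to time j only the first j K cells enter. The additional cell keeps the index set
  nonempty for j = 0, as \<open>blk_fdd\<close> requires.\<close>

lemma gpath_lipschitz: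
  assumes "0 < d"
  shows "pdist d j (gpath K v) (gpath K v') \<le> (\<Sum>a\<in>{..<d} \<times> {..<j * K + 1}. \<bar>v a - v' a\<bar>)"
proof (rule pdist_least[OF assms])
  fix t i assume t: "0 \<le> t" "t \<le> real j" "i < d"
  let ?N = "nat \<lfloor>real K * t\<rfloor>"
  have "\<bar>gpath K v t i - gpath K v' t i\<bar> \<le> (\<Sum>l<?N. \<bar>v (i, l) - v' (i, l)\<bar>)"
    unfolding gpath_def sum_subtractf[symmetric] by (rule sum_abs)
  also have "\<dots> = (\<Sum>a\<in>{i} \<times> {..<?N}. \<bar>v a - v' a\<bar>)" 
    by (rule sum.reindex_bij_witness[where i=snd and j="\<lambda>l. (i, l)"]) auto
  also have "\<dots> \<le> (\<Sum>a\<in>{..<d} \<times> {..<j * K + 1}. \<bar>v a - v' a\<bar>)"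
  proof (rule sum_mono2)
    show "{i} \<times> {..<?N} \<subseteq> {..<d} \<times> {..<j * K + 1}" using nat_floor_mult_le[OF t(1,2), of K] t(3) by auto
  qed auto
  finally show "min 1 \<bar>gpath K v t i - gpath K v' t i\<bar> \<le> (\<Sum>a\<in>{..<d} \<times> {..<j * K + 1}. \<bar>v a - v' a\<bar>)" by simp
qed

lemma pdist_le_indicator:
  assumes "0 < d" "\<And>t i. 0 \<le> t \<Longrightarrow> t \<le> real j \<Longrightarrow> i < d \<Longrightarrow> \<not> Q \<Longrightarrow> \<bar>a t i - b t i\<bar> \<le> e" "0 \<le> e"
  shows "pdist d j a b \<le> e + (if Q then 1 else 0)"
  by (rule pdist_least[OF assms(1)]) (use assms(2,3) in \<open>auto simp: min_le_iff_disj\<close>)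

definition bmgrid :: "nat \<Rightarrow> (nat \<Rightarrow> real) \<Rightarrow> nat \<times> nat \<Rightarrow> real" where
  "bmgrid K \<omega> a = bm (real (Suc (snd a)) * (1 / real K)) \<omega> (fst a) - bm (real (snd a) * (1 / real K)) \<omega> (fst a)"

lemma gpath_bmgrid: "gpath K (bmgrid K \<omega>) t i = bm (real (nat \<lfloor>real K * t\<rfloor>) / real K) \<omega> i"
  unfolding gpath_def bmgrid_def fst_conv snd_conv
  by (subst sum_lessThan_telescope) (simp add: bm_0)

lemma gpath_bmgrid_conv:
  assumes d: "0 < d"
  shows "(\<lambda>k. pdist d j (gpath (Suc k) (bmgrid (Suc k) \<omega>)) (\<lambda>t. bm t \<omega>)) \<longlonglongrightarrow> 0"
proof (rule LIMSEQ_I)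
  fix e :: real assume e: "0 < e"
  have "\<exists>\<delta>>0. \<forall>s\<in>{0..real j}. \<forall>t\<in>{0..real j}. dist s t < \<delta> \<longrightarrow> dist (bm s \<omega> i) (bm t \<omega> i) < e / 2" for i
  proof -
    have "uniformly_continuous_on {0..real j} (\<lambda>t. bm t \<omega> i)"
      by (rule compact_uniformly_continuous[OF continuous_on_subset[OF bm_continuous]]) auto
    then show ?thesis unfolding uniformly_continuous_on_def using e by (meson half_gt_zero)
  qed
  then obtain D where D: "\<And>i. D i > 0" "\<And>i s t. s \<in> {0..real j} \<Longrightarrow> t \<in> {0..real j} \<Longrightarrow> dist s t < D i \<Longrightarrow> dist (bm s \<omega> i) (bm t \<omega> i) < e / 2"
    by metis
  have "eventually (\<lambda>k. \<forall>i\<in>{..<d}. inverse (real (Suc k)) < D i) sequentially"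
    by (rule eventually_ball_finite) (use D(1) order_tendstoD(2)[OF LIMSEQ_inverse_real_of_nat] in auto)
  then obtain k0 where k0: "\<And>k i. k \<ge> k0 \<Longrightarrow> i < d \<Longrightarrow> inverse (real (Suc k)) < D i" unfolding eventually_sequentially by auto
  have "pdist d j (gpath (Suc k) (bmgrid (Suc k) \<omega>)) (\<lambda>t. bm t \<omega>) \<le> e / 2" if k: "k \<ge> k0" for k
  proof (rule pdist_least[OF d])
    fix t i assume t: "0 \<le> t" "t \<le> real j" "i < d"
    let ?K = "real (Suc k)"
    let ?s = "real (nat \<lfloor>?K * t\<rfloor>) / ?K"
    have K: "?K > 0" by simp
    have fl: "real (nat \<lfloor>?K * t\<rfloor>) = of_int \<lfloor>?K * t\<rfloor>" using t(1) by simp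
    have "of_int \<lfloor>?K * t\<rfloor> \<le> ?K * t" by (rule of_int_floor_le)
    then have s1: "?s \<le> t" unfolding fl using K by (simp add: divide_le_eq mult.commute del: of_nat_Suc)
    have "?K * t < of_int \<lfloor>?K * t\<rfloor> + 1" by linarith
    then have "t < (of_int \<lfloor>?K * t\<rfloor> + 1) / ?K" using K by (simp add: less_divide_eq mult.commute del: of_nat_Suc)
    then have "t - ?s < inverse ?K" unfolding fl by (simp add: add_divide_distrib inverse_eq_divide del: of_nat_Suc)
    then have "dist ?s t < D i" using k0[OF k t(3)] s1 by (simp add: dist_real_def del: of_nat_Suc)
    moreover have "0 \<le> ?s" by simp
    ultimately have "dist (bm ?s \<omega> i) (bm t \<omega> i) < e / 2" using D(2)[of ?s t i] s1 t by simp
    then show "min 1 \<bar>gpath (Suc k) (bmgrid (Suc k) \<omega>) t i - bm t \<omega> i\<bar> \<le> e / 2"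
      unfolding gpath_bmgrid dist_real_def by (simp add: min_def)
  qed
  then have "norm (pdist d j (gpath (Suc k) (bmgrid (Suc k) \<omega>)) (\<lambda>t. bm t \<omega>) - 0) < e" if "k \<ge> k0" for k
    using pdist_nonneg[OF d] that e by (smt (verit) field_sum_of_halves real_norm_def)
  then show "\<exists>k0. \<forall>k\<ge>k0. norm (pdist d j (gpath (Suc k) (bmgrid (Suc k) \<omega>)) (\<lambda>t. bm t \<omega>) - 0) < e" by blast
qed

context exp_clocks
begin

section \<open>Minorants along the walks and the oscillation inside grid cells\<close>

definition gap_functional :: "((real \<Rightarrow> nat \<Rightarrow> real) \<Rightarrow> real) \<Rightarrow> (nat \<Rightarrow> int) \<Rightarrow> nat \<times> 'a \<Rightarrow> real" where
  "gap_functional f x0 p = f (zpath d x0 (fst p) (Ew (snd p)))"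

definition clock_walk :: "nat \<times> 'a \<Rightarrow> real \<Rightarrow> nat \<Rightarrow> real" where "clock_walk p = walk (Ew (snd p)) (fst p)"

text \<open>If the bound fails for infinitely many j, near-minimisers of the infimum provide walks
  on scales n > j whose distance to \<open>b\<close> up to time j is below 2 B / j. They converge to
  \<open>b\<close> locally uniformly, so the gap paths converge to the reflected path and continuity
  of \<open>f\<close> contradicts values below its limit minus e. The index set starting at
  \<open>Suc j\<close> is what sends the scales to infinity.\<close>

lemma env_eventually_ge:
  assumes x0: "\<And>i. Suc i < d \<Longrightarrow> x0 i < x0 (Suc i)"
    and G: "\<And>\<omega>. \<omega> \<in> G \<Longrightarrow> generic d (Ew \<omega>)" "G \<noteq> {}"
    and f: "\<And>x. \<bar>f x\<bar> \<le> B" "sk_continuous (d - 1) f"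
    and b: "\<And>i. i < d \<Longrightarrow> continuous_on {0..} (\<lambda>t. b t i)" and e: "0 < e"
  shows "eventually (\<lambda>j. f (reflmap (\<lambda>t i. b t i - b t (Suc i))) - e \<le> lip_env d B (gap_functional f x0) clock_walk ({Suc j..} \<times> G) j b) sequentially"
proof (rule ccontr)
  let ?c = "f (reflmap (\<lambda>t i. b t i - b t (Suc i)))"
  let ?F = "\<lambda>j. lip_env d B (gap_functional f x0) clock_walk ({Suc j..} \<times> G) j b"
  assume "\<not> eventually (\<lambda>j. ?c - e \<le> ?F j) sequentially"
  then obtain r :: "nat \<Rightarrow> nat" where r: "strict_mono r" "\<And>k. \<not> ?c - e \<le> ?F (r k)"
    using not_eventually_sequentiallyD by blast
  have "\<exists>p\<in>{Suc (r k)..} \<times> G. min B (gap_functional f x0 p + real (r k) * pdist d (r k) (clock_walk p) b) < ?c - e" for k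
  proof -
    have ne: "(\<lambda>p. min B (gap_functional f x0 p + real (r k) * pdist d (r k) (clock_walk p) b)) ` ({Suc (r k)..} \<times> G) \<noteq> {}" using G(2) by auto
    have "?F (r k) < ?c - e" using r(2)[of k] by simp
    from cInf_lessD[OF ne this[unfolded lip_env_def]] show ?thesis by blast
  qed
  then have "\<forall>k. \<exists>q. q \<in> {Suc (r k)..} \<times> G \<and> min B (gap_functional f x0 q + real (r k) * pdist d (r k) (clock_walk q) b) < ?c - e"
    by (simp only: Bex_def) blast
  from choice[OF this] obtain p where p': "\<forall>k. p k \<in> {Suc (r k)..} \<times> G \<and> min B (gap_functional f x0 (p k) + real (r k) * pdist d (r k) (clock_walk (p k)) b) < ?c - e" ..
  have p: "p k \<in> {Suc (r k)..} \<times> G" "min B (gap_functional f x0 (p k) + real (r k) * pdist d (r k) (clock_walk (p k)) b) < ?c - e" for k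
    using spec[OF p', of k] by (rule conjunct1, rule conjunct2)
  have cB: "?c \<le> B" "- B \<le> gap_functional f x0 q" for q
  proof -
    show "?c \<le> B" by (rule abs_le_D1[OF f(1)])
    have "- gap_functional f x0 q \<le> B" unfolding gap_functional_def by (rule abs_le_D2[OF f(1)])
    then show "- B \<le> gap_functional f x0 q" by simp
  qed
  have p2: "gap_functional f x0 (p k) + real (r k) * pdist d (r k) (clock_walk (p k)) b < ?c - e" for k
    using p(2)[of k] cB(1) e by (auto simp: min_less_iff_disj)
  have Hlt: "gap_functional f x0 (p k) < ?c - e" for k
    using p2[of k] mult_nonneg_nonneg[of "real (r k)" "pdist d (r k) (clock_walk (p k)) b"] pdist_nonneg[OF d_pos] by fastforce
  have plt: "real (r k) * pdist d (r k) (clock_walk (p k)) b < 2 * B" for k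
    using p2[of k] cB(1) cB(2)[of "p k"] e by linarith
  have rk: "k \<le> r k" for k by (rule strict_mono_imp_increasing[OF r(1)])
  have lu: "lu_conv (d - 1) (\<lambda>k. zpath d x0 (fst (p k)) (Ew (snd (p k)))) (reflmap (\<lambda>t i. b t i - b t (Suc i)))"
  proof (rule zpath_lu_conv[where b=b and nn="\<lambda>k. fst (p k)" and e="\<lambda>k. Ew (snd (p k))"])
    have "k \<le> fst (p k)" for k using p(1)[of k] rk[of k] by auto
    then show "filterlim (\<lambda>k. fst (p k)) at_top sequentially" by (intro filterlim_at_top_mono[OF filterlim_ident]) simp
    show "0 < fst (p k)" for k using p(1)[of k] by auto
    show "generic d (Ew (snd (p k)))" for k by (rule G(1)) (use p(1)[of k] in auto)
    fix T \<epsilon> :: real and i assume T: "0 < T" and \<epsilon>: "0 < \<epsilon>" and i: "i < d"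
    \<comment> \<open>A truncated distance below 1/2 equals the true distance.\<close>
    have ev: "eventually (\<lambda>k. max T (2 * B / min (1 / 2) \<epsilon>) \<le> real k) sequentially"
      by (rule eventually_sequentiallyI[of "nat \<lceil>max T (2 * B / min (1 / 2) \<epsilon>)\<rceil>"]) linarith
    show "eventually (\<lambda>k. \<forall>t\<in>{0..T}. \<bar>walk (Ew (snd (p k))) (fst (p k)) t i - b t i\<bar> \<le> \<epsilon>) sequentially"
      using ev
    proof eventually_elim
      case (elim k)
      have kr: "real k \<le> real (r k)" using rk by simp
      have rT: "T \<le> real (r k)" and rB: "2 * B / min (1 / 2) \<epsilon> \<le> real (r k)" using elim kr by linarith+
      have m0: "min (1 / 2) \<epsilon> > 0" using \<epsilon> by simp
      have "2 * B \<le> real (r k) * min (1 / 2) \<epsilon>" using rB m0 by (simp add: divide_le_eq)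
      then have "real (r k) * pdist d (r k) (clock_walk (p k)) b < real (r k) * min (1 / 2) \<epsilon>" using plt[of k] by linarith
      then have pm: "pdist d (r k) (clock_walk (p k)) b < min (1 / 2) \<epsilon>" using mult_less_cancel_left_pos[of "real (r k)"] rT T by simp
      show ?case
      proof
        fix t assume "t \<in> {0..T}"
        then have "min 1 \<bar>clock_walk (p k) t i - b t i\<bar> \<le> pdist d (r k) (clock_walk (p k)) b" using rT i by (intro pdist_upper) auto
        then have "min 1 \<bar>clock_walk (p k) t i - b t i\<bar> < min (1 / 2) \<epsilon>" using pm by linarith
        then show "\<bar>walk (Ew (snd (p k))) (fst (p k)) t i - b t i\<bar> \<le> \<epsilon>" unfolding clock_walk_def by (simp add: min_def split: if_splits)
      qed
    qed
  qed (use x0 b in simp_all)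
  have "(\<lambda>k. f (zpath d x0 (fst (p k)) (Ew (snd (p k))))) \<longlonglongrightarrow> ?c"
  proof -
    have "zpath d x0 (fst (p k)) (Ew (snd (p k))) \<in> Dspace (d - 1)" for k
      by (rule zpath_Dspace) (use p(1)[of k] G(1) in auto)
    moreover have "reflmap (\<lambda>t i. b t i - b t (Suc i)) \<in> Dspace (d - 1)"
      by (rule continuous_Dspace, rule reflmap_continuous, rule continuous_on_diff) (use b in auto)
    ultimately show ?thesis by (intro f(2)[unfolded sk_continuous_def, rule_format, OF _ _ lu_imp_sk[OF lu]])
  qed
  then have "(\<lambda>k. gap_functional f x0 (p k)) \<longlonglongrightarrow> ?c" unfolding gap_functional_def .
  then have "?c \<le> ?c - e" by (rule LIMSEQ_le_const2) (use Hlt in \<open>auto intro: less_imp_le\<close>)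
  then show False using e by simp
qed

text \<open>Some clock moves by e sqrt n or more within one cell. A cell has at most n div K + 1
  terms, the last one due to rounded boundaries.\<close>

definition bad :: "nat \<Rightarrow> nat \<Rightarrow> real \<Rightarrow> nat \<Rightarrow> 'a set" where
  "bad j K e n = (\<Union>a\<in>{..<d} \<times> {..j * K}. {\<omega>\<in>space P. \<exists>q\<le>n div K + 1. \<bar>bsum (fst a) (n * snd a div K) (n * snd a div K + q) \<omega>\<bar> \<ge> e * sqrt (real n)})"

lemma bad_sets: "bad j K e n \<in> sets P"
  unfolding bad_def
proof (rule sets.finite_UN)
  fix a assume "a \<in> {..<d} \<times> {..j * K}"
  then have i: "fst a < d" by auto
  note [measurable] = bsum_measurable[OF i]
  show "{\<omega>\<in>space P. \<exists>q\<le>n div K + 1. \<bar>bsum (fst a) (n * snd a div K) (n * snd a div K + q) \<omega>\<bar> \<ge> e * sqrt (real n)} \<in> sets P"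
    by measurable
qed simp

text \<open>There are about j K cells per clock, each with probability of order K^-2 by the fourth
  moment, so the total is of order 1/K uniformly in n; second moments would only give K^-1 per cell.
  The constant is 1152 = 18 * 4 * 16.\<close>

lemma bad_prob:
  assumes e: "0 < e" and K: "0 < K" "16 / e\<^sup>2 \<le> real K" and n: "K \<le> n"
  shows "prob (bad j K e n) \<le> real (d * (j * K + 1)) * (1152 / ((real K)\<^sup>2 * e ^ 4))"
proof -
  let ?S = "\<lambda>a. {\<omega>\<in>space P. \<exists>q\<le>n div K + 1. \<bar>bsum (fst a) (n * snd a div K) (n * snd a div K + q) \<omega>\<bar> \<ge> e * sqrt (real n)}"
  \<comment> \<open>Half the oscillation, as the maximal inequality controls 2 lam. Its condition on
    lam is what 16 / e^2 \<le> K provides, together with n div K + 1 \<le> 2 n / K.\<close>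
  let ?lam = "e * sqrt (real n) / 2"
  have n0: "0 < real n" using K n by simp
  have K0: "0 < real K" using K by simp
  have M: "real (n div K + 1) \<le> 2 * real n / real K"
  proof -
    have "real (n div K) \<le> real n / real K" by (rule of_nat_div_le_of_nat)
    moreover have "1 \<le> real n / real K" using K0 n by simp
    ultimately show ?thesis by simp
  qed
  have lam2: "?lam\<^sup>2 = e\<^sup>2 * real n / 4" by (simp add: power_mult_distrib power_divide)
  have "16 \<le> real K * e\<^sup>2" using K(2) e by (simp add: divide_le_eq)
  then have "16 * real n \<le> real K * e\<^sup>2 * real n" using n0 by (intro mult_right_mono) auto
  then have "4 * real n / real K \<le> ?lam\<^sup>2" unfolding lam2 using K0 by (simp add: divide_le_eq field_simps)
  then have m: "2 * real (n div K + 1) \<le> ?lam\<^sup>2" using M by simp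
  have one: "prob (?S a) \<le> 1152 / ((real K)\<^sup>2 * e ^ 4)" if a: "a \<in> {..<d} \<times> {..j * K}" for a
  proof -
    have i: "fst a < d" using a by auto
    have l0: "?lam > 0" using e n0 by simp
    have "prob (?S a) \<le> 18 * (real (n div K + 1))\<^sup>2 / ?lam ^ 4"
      using bsum_max[OF i l0 m, of "n * snd a div K"] by simp
    also have "\<dots> \<le> 18 * (2 * real n / real K)\<^sup>2 / ?lam ^ 4"
      using M l0 by (intro divide_right_mono mult_left_mono power_mono) auto
    also have "?lam ^ 4 = (e\<^sup>2 * real n / 4)\<^sup>2" unfolding lam2[symmetric] by simp
    also have "18 * (2 * real n / real K)\<^sup>2 / (e\<^sup>2 * real n / 4)\<^sup>2 = 1152 / ((real K)\<^sup>2 * e ^ 4)"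
    proof -
      have "18 * (2 * x / y)\<^sup>2 / (e\<^sup>2 * x / 4)\<^sup>2 = 1152 / (y\<^sup>2 * e ^ 4)" if "x > 0" "y > 0" for x y :: real
        using that e by (simp add: power2_eq_square power4_eq_xxxx field_simps)
      from this[OF n0 K0] show ?thesis .
    qed
    finally show ?thesis .
  qed
  have "prob (bad j K e n) \<le> (\<Sum>a\<in>{..<d} \<times> {..j * K}. prob (?S a))"
    unfolding bad_def
  proof (rule finite_measure_subadditive_finite)
    show "?S ` ({..<d} \<times> {..j * K}) \<subseteq> events"
    proof safe
      fix a assume "(fst a, snd a) \<in> {..<d} \<times> {..j * K}"
    qed (use bsum_measurable in \<open>measurable\<close>)
  qed simp
  also have "\<dots> \<le> (\<Sum>a\<in>{..<d} \<times> {..j * K}. 1152 / ((real K)\<^sup>2 * e ^ 4))" by (rule sum_mono) (rule one)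
  also have "\<dots> = real (d * (j * K + 1)) * (1152 / ((real K)\<^sup>2 * e ^ 4))" by simp
  finally show ?thesis .
qed

lemma walk_bsum: "walk (Ew \<omega>) n t i = bsum i 0 (nat \<lfloor>real n * t\<rfloor>) \<omega> / sqrt (real n)"
  by (simp add: walk_def psum_def bsum_eq atLeast0LessThan)

lemma gpath_blk:
  "gpath K (\<lambda>a. blk K n a \<omega>) t i = bsum i 0 (n * nat \<lfloor>real K * t\<rfloor> div K) \<omega> / sqrt (real n)"
proof -
  have "(\<Sum>l<L. bsum i (n * l div K) (n * Suc l div K) \<omega>) = bsum i 0 (n * L div K) \<omega>" for L
  proof (induction L)
    case 0
    then show ?case by (simp add: bsum_def)
  next
    case (Suc L)
    have "n * L div K \<le> n * Suc L div K" by (intro div_le_mono) simp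
    from bsum_split[OF _ this, of 0 i \<omega>] Suc show ?case by simp
  qed
  then show ?thesis unfolding gpath_def blk_def fst_conv snd_conv sum_divide_distrib[symmetric] by simp
qed

text \<open>At time t the walk has used floor(n t) terms, the grid path those up to the last cell
  boundary. The difference is a partial sum from that boundary of at most n div K + 1 terms, which
  is small off \<open>bad\<close>.\<close>

lemma walk_gpath_close:
  assumes K: "0 < K" and n: "0 < n" and w: "\<omega> \<in> space P" "\<omega> \<notin> bad j K e n" and t: "0 \<le> t" "t \<le> real j" "i < d"
  shows "\<bar>walk (Ew \<omega>) n t i - gpath K (\<lambda>a. blk K n a \<omega>) t i\<bar> \<le> e"
proof -
  define l where "l = nat \<lfloor>real K * t\<rfloor>"
  define N where "N = nat \<lfloor>real n * t\<rfloor>"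
  have l: "l \<le> j * K" unfolding l_def by (rule nat_floor_mult_le[OF t(1,2)])
  have l1: "real l \<le> real K * t" unfolding l_def using t(1) by simp
  have l2: "real K * t < real (Suc l)" unfolding l_def using t(1) by simp linarith
  have N1: "real N \<le> real n * t" unfolding N_def using t(1) by simp
  have N2: "real n * t < real (Suc N)" unfolding N_def using t(1) by simp linarith
  have "real (n * l) \<le> real K * (real n * t)" using mult_left_mono[OF l1, of "real n"] by (simp add: mult_ac)
  also have "\<dots> < real K * real (Suc N)" using N2 K by (intro mult_strict_left_mono) auto
  finally have "n * l < K * Suc N" by (metis of_nat_less_iff of_nat_mult)
  then have aN: "n * l div K \<le> N" using K by (metis div_less_iff_less_mult less_Suc_eq_le mult.commute)
  have "real K * real N \<le> real K * (real n * t)" using N1 by (intro mult_left_mono) auto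
  also have "\<dots> = real n * (real K * t)" by simp
  also have "\<dots> < real n * real (Suc l)" using l2 n by (intro mult_strict_left_mono) auto
  finally have "K * N < n * Suc l" by (metis of_nat_less_iff of_nat_mult)
  then have "N \<le> (n * l + n) div K" using K by (simp add: less_eq_div_iff_mult_less_eq mult.commute add.commute)
  \<comment> \<open>The two remainders together exceed K at most once, which accounts for the extra
    term.\<close>
  also have "\<dots> \<le> n * l div K + n div K + 1"
  proof -
    have "(n * l + n) div K = n * l div K + n div K + (n * l mod K + n mod K) div K" by (rule div_add1_eq)
    moreover have "(n * l mod K + n mod K) div K \<le> 1"
      using mod_less_divisor[OF K, of "n * l"] mod_less_divisor[OF K, of n] K
      by (simp add: less_Suc_eq_le[symmetric] div_less_iff_less_mult del: mod_less_divisor)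
    ultimately show ?thesis by simp
  qed
  finally have q: "N - n * l div K \<le> n div K + 1" by simp
  have "bsum i 0 N \<omega> = bsum i 0 (n * l div K) \<omega> + bsum i (n * l div K) N \<omega>" by (rule bsum_split[OF _ aN]) simp
  then have "walk (Ew \<omega>) n t i - gpath K (\<lambda>a. blk K n a \<omega>) t i = bsum i (n * l div K) (n * l div K + (N - n * l div K)) \<omega> / sqrt (real n)"
    unfolding walk_bsum gpath_blk l_def[symmetric] N_def[symmetric] using aN by (simp add: add_divide_distrib)
  moreover have "\<bar>bsum i (n * l div K) (n * l div K + (N - n * l div K)) \<omega>\<bar> < e * sqrt (real n)"
  proof (rule ccontr)
    assume *: "\<not> ?thesis"
    have "\<omega> \<in> bad j K e n" unfolding bad_def
      by (rule UN_I[of "(i, l)"]) (use * q w(1) l t(3) in \<open>auto simp del: add_diff_inverse_nat le_add_diff_inverse simp: not_less intro!: exI[of _ "N - n * l div K"]\<close>)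
    then show False using w(2) by simp
  qed
  moreover have "sqrt (real n) > 0" using n by simp
  ultimately show ?thesis by (simp add: divide_le_eq less_imp_le)
qed

end

lemma bmW_functional_measurable:
  assumes f: "bounded (range f)" "sk_continuous m f"
  shows "(\<lambda>\<omega>. f (\<lambda>t. bmW t \<omega>)) \<in> borel_measurable (completion gauss)"
proof (rule sk_functional_limit(2)[OF prob_space_gauss f])
  have S: "is_filtration gauss (bm_filt (Suc m))" "adapted gauss (bm_filt (Suc m)) m bmW"
    using srbm_exists[of m] by (auto simp: srbm_def)
  show "(\<lambda>\<omega>. bmW t \<omega> i) \<in> borel_measurable gauss" if "0 \<le> t" "i < m" for t i
    by (rule adapted_borel_measurable[OF S that])
  have "continuous_on {0..} (\<lambda>t. bmW t \<omega> i)" for \<omega> i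
    unfolding bmW_def by (rule reflmap_continuous) (rule bmX_continuous)
  then have "(\<lambda>t. bmW t \<omega>) \<in> Dspace m \<and> sk_conv m (\<lambda>k. disc m (Suc k) (\<lambda>t. bmW t \<omega>)) (\<lambda>t. bmW t \<omega>)" for \<omega>
    by (intro conjI continuous_Dspace lu_imp_sk disc_lu_conv)
  then show "AE \<omega> in gauss. (\<lambda>t. bmW t \<omega>) \<in> Dspace m \<and> sk_conv m (\<lambda>k. disc m (Suc k) (\<lambda>t. bmW t \<omega>)) (\<lambda>t. bmW t \<omega>)" by simp
qed

lemma eventually_le_of_tendsto: "X \<longlonglongrightarrow> (L :: real) \<Longrightarrow> 0 < e \<Longrightarrow> eventually (\<lambda>n. L - e \<le> X n) sequentially"
  using order_tendstoD(1)[of X L sequentially "L - e"] by (auto elim: eventually_mono)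

context exp_clocks
begin

text \<open>The minorant at the grid path exceeds its value at the walk by at most j times their
  distance, and at the walk itself it is below the functional of the gap path. Integration replaces
  the distance by e plus the probability of the bad event.\<close>

lemma zpath_lower:
  assumes x0: "\<And>i. Suc i < d \<Longrightarrow> x0 i < x0 (Suc i)"
    and G: "AE \<omega> in P. \<omega> \<in> G" "\<And>\<omega>. \<omega> \<in> G \<Longrightarrow> generic d (Ew \<omega>)" "G \<noteq> {}"
    and f: "\<And>x. \<bar>f x\<bar> \<le> B" "sk_continuous (d - 1) f"
    and K: "0 < K" and e: "0 \<le> e" and n: "Suc j \<le> n"
    and m\<phi>: "(\<lambda>\<omega>. lip_env d B (gap_functional f x0) clock_walk ({Suc j..} \<times> G) j (gpath K (\<lambda>a. blk K n a \<omega>))) \<in> borel_measurable P"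
  shows "(\<integral>\<omega>. lip_env d B (gap_functional f x0) clock_walk ({Suc j..} \<times> G) j (gpath K (\<lambda>a. blk K n a \<omega>)) \<partial>P) - real j * e - real j * prob (bad j K e n)
     \<le> (\<integral>\<omega>. f (zpath d x0 n (Ew \<omega>)) \<partial>completion P)"
proof -
  let ?F = "lip_env d B (gap_functional f x0) clock_walk ({Suc j..} \<times> G) j"
  let ?\<phi> = "\<lambda>\<omega>. ?F (gpath K (\<lambda>a. blk K n a \<omega>))"
  interpret C: prob_space "completion P" by (rule prob_space_completion)
  have H: "\<bar>gap_functional f x0 p\<bar> \<le> B" for p unfolding gap_functional_def by (rule f(1))
  have I: "{Suc j..} \<times> G \<noteq> {}" using G(3) by auto
  note badm[measurable] = bad_sets[of j K e n]
  have i1: "integrable P ?\<phi>" by (rule prob_integrable_bounded[OF prob_space_axioms m\<phi>, where c=B]) (use env_bounded[OF d_pos H I] in simp)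
  have i2: "integrable P (\<lambda>\<omega>. indicator (bad j K e n) \<omega> :: real)" by (rule integrable_real_indicator) (use emeasure_finite in \<open>auto simp: less_top[symmetric]\<close>)
  have int: "integrable P (\<lambda>\<omega>. ?\<phi> \<omega> - real j * e - real j * indicator (bad j K e n) \<omega>)"
    using i1 i2 by (intro Bochner_Integration.integrable_diff integrable_mult_right integrable_const) auto
  have "(\<integral>\<omega>. ?\<phi> \<omega> \<partial>P) - real j * e - real j * prob (bad j K e n) = (\<integral>\<omega>. ?\<phi> \<omega> - real j * e - real j * indicator (bad j K e n) \<omega> \<partial>P)"
    using i1 i2 badm by (simp add: Bochner_Integration.integral_diff prob_space)
  also have "\<dots> = (\<integral>\<omega>. ?\<phi> \<omega> - real j * e - real j * indicator (bad j K e n) \<omega> \<partial>completion P)"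
    by (rule integral_completion[symmetric]) (rule borel_measurable_integrable[OF int])
  also have "\<dots> \<le> (\<integral>\<omega>. f (zpath d x0 n (Ew \<omega>)) \<partial>completion P)"
  proof (rule integral_mono_AE)
    show "integrable (completion P) (\<lambda>\<omega>. ?\<phi> \<omega> - real j * e - real j * indicator (bad j K e n) \<omega>)"
      using int by (simp add: integrable_completion borel_measurable_integrable)
    have bd: "bounded (range f)" unfolding bounded_iff by (rule exI[of _ B]) (use f(1) in auto)
    have n0: "0 < n" using n by simp
    show "integrable (completion P) (\<lambda>\<omega>. f (zpath d x0 n (Ew \<omega>)))"
      by (rule prob_integrable_bounded[OF C.prob_space_axioms zpath_functional_measurable[where ?x0.0=x0, OF x0 n0 bd f(2)], where c=B]) (use f(1) in auto)
    have "AE \<omega> in P. ?\<phi> \<omega> - real j * e - real j * indicator (bad j K e n) \<omega> \<le> f (zpath d x0 n (Ew \<omega>))"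
      using G(1) AE_space
    proof eventually_elim
      case (elim \<omega>)
      let ?b = "\<lambda>\<omega>. gpath K (\<lambda>a. blk K n a \<omega>)"
      have p: "(n, \<omega>) \<in> {Suc j..} \<times> G" using elim n by simp
      have "pdist d j (?b \<omega>) (clock_walk (n, \<omega>)) \<le> e + (if \<omega> \<in> bad j K e n then 1 else 0)"
      proof (rule pdist_le_indicator[OF d_pos _ e])
        fix t i assume "0 \<le> t" "t \<le> real j" "i < d" "\<omega> \<notin> bad j K e n"
        then show "\<bar>?b \<omega> t i - clock_walk (n, \<omega>) t i\<bar> \<le> e"
          unfolding clock_walk_def fst_conv snd_conv using walk_gpath_close[OF K n0 elim(2)] by (subst abs_minus_commute) blast
      qed
      then have "real j * pdist d j (?b \<omega>) (clock_walk (n, \<omega>)) \<le> real j * (e + indicator (bad j K e n) \<omega>)"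
        by (intro mult_left_mono) (auto simp: indicator_def)
      moreover have "?\<phi> \<omega> \<le> ?F (clock_walk (n, \<omega>)) + real j * pdist d j (?b \<omega>) (clock_walk (n, \<omega>))" by (rule env_lipschitz[OF d_pos H I])
      moreover have "?F (clock_walk (n, \<omega>)) \<le> gap_functional f x0 (n, \<omega>)" by (rule env_le[OF d_pos H I p])
      ultimately have "?\<phi> \<omega> \<le> gap_functional f x0 (n, \<omega>) + real j * (e + indicator (bad j K e n) \<omega>)" by linarith
      then show ?case by (simp add: gap_functional_def distrib_left)
    qed
    then show "AE \<omega> in completion P. ?\<phi> \<omega> - real j * e - real j * indicator (bad j K e n) \<omega> \<le> f (zpath d x0 n (Ew \<omega>))"
      by (rule AE_completion)
  qed
  finally show ?thesis .
qed

text \<open>The tolerance is split into five parts: passing from \<open>f\<close> to the minorant,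
  from the Brownian path to its grid increments, from these to blocks of waiting times, and the two
  errors of \<open>zpath_lower\<close>. The parameters are fixed in the order j, e, K, and only then
  n grows.\<close>

lemma zpath_liminf:
  assumes x0: "\<And>i. Suc i < d \<Longrightarrow> x0 i < x0 (Suc i)"
    and f: "bounded (range f)" "sk_continuous (d - 1) f" and \<delta>: "0 < \<delta>"
  shows "eventually (\<lambda>n. (\<integral>\<omega>. f (\<lambda>t. bmW t \<omega>) \<partial>completion gauss) - \<delta> \<le> (\<integral>\<omega>. f (zpath d x0 n (Ew \<omega>)) \<partial>completion P)) sequentially"
proof -
  interpret Ga: prob_space gauss by (rule prob_space_gauss)
  interpret C: prob_space "completion gauss" by (rule Ga.prob_space_completion)
  obtain G where G: "AE \<omega> in P. \<omega> \<in> G" "\<And>\<omega>. \<omega> \<in> G \<Longrightarrow> generic d (Ew \<omega>)" "G \<noteq> {}" using generic_set by blast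
  obtain B where B: "\<And>x. \<bar>f x\<bar> \<le> B" using f(1) by (auto simp: bounded_iff)
  define F where "F j = lip_env d B (gap_functional f x0) clock_walk ({Suc j..} \<times> G) j" for j
  have H: "\<bar>gap_functional f x0 p\<bar> \<le> B" for p unfolding gap_functional_def by (rule B)
  have I: "{Suc j..} \<times> G \<noteq> {}" for j using G(3) by auto
  have FB: "\<bar>F j b\<bar> \<le> B" for j b unfolding F_def by (rule env_bounded[OF d_pos H I])
  have Fdiff: "\<bar>F j b - F j b'\<bar> \<le> real j * pdist d j b b'" for j b b' unfolding F_def by (rule env_abs_diff[OF d_pos H I])
  have lip: "\<bar>F j (gpath K v) - F j (gpath K v')\<bar> \<le> real j * (\<Sum>a\<in>{..<d} \<times> {..<j * K + 1}. \<bar>v a - v' a\<bar>)" for j K v v'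
    by (rule order_trans[OF Fdiff]) (intro mult_left_mono gpath_lipschitz d_pos, simp)
  have gm: "(\<lambda>\<omega>. F j (gpath K (bmgrid K \<omega>))) \<in> borel_measurable gauss" for j K
  proof -
    have "(\<lambda>\<omega>. F j (gpath K (\<lambda>a. bmgrid K \<omega> a))) \<in> borel_measurable gauss"
      by (rule lipschitz_measurable[where \<phi>="\<lambda>v. F j (gpath K v)", OF _ _ lip]) (auto simp: bmgrid_def)
    then show ?thesis by simp
  qed
  have Flim: "(\<lambda>k. F j (gpath (Suc k) (bmgrid (Suc k) \<omega>))) \<longlonglongrightarrow> F j (\<lambda>t. bm t \<omega>)" for j \<omega>
  proof -
    have "(\<lambda>k. real j * pdist d j (gpath (Suc k) (bmgrid (Suc k) \<omega>)) (\<lambda>t. bm t \<omega>)) \<longlonglongrightarrow> real j * 0"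
      by (intro tendsto_mult tendsto_const gpath_bmgrid_conv d_pos)
    then have "(\<lambda>k. F j (gpath (Suc k) (bmgrid (Suc k) \<omega>)) - F j (\<lambda>t. bm t \<omega>)) \<longlonglongrightarrow> 0"
      by (intro Lim_null_comparison[where f="\<lambda>k. F j (gpath (Suc k) (bmgrid (Suc k) \<omega>)) - F j (\<lambda>t. bm t \<omega>)" and g="\<lambda>k. real j * pdist d j (gpath (Suc k) (bmgrid (Suc k) \<omega>)) (\<lambda>t. bm t \<omega>)"])
         (use Fdiff in simp_all)
    then show ?thesis by (simp add: LIM_zero_iff)
  qed
  have Fm: "(\<lambda>\<omega>. F j (\<lambda>t. bm t \<omega>)) \<in> borel_measurable gauss" for j
    by (rule borel_measurable_LIMSEQ_real[OF Flim gm])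
  define c where "c j = (\<integral>\<omega>. F j (\<lambda>t. bm t \<omega>) \<partial>gauss)" for j
  have cK: "(\<lambda>k. \<integral>\<omega>. F j (gpath (Suc k) (bmgrid (Suc k) \<omega>)) \<partial>gauss) \<longlonglongrightarrow> c j" for j
    unfolding c_def by (rule integral_dominated_convergence[where w="\<lambda>_. B"]) (use Fm gm Flim FB in auto)
  define h where "h \<omega> = f (\<lambda>t. bmW t \<omega>)" for \<omega>
  have hm: "h \<in> borel_measurable (completion gauss)" unfolding h_def by (rule bmW_functional_measurable[OF f])
  have FmC: "(\<lambda>\<omega>. F j (\<lambda>t. bm t \<omega>)) \<in> borel_measurable (completion gauss)" for j by (rule measurable_completion[OF Fm])
  have hB: "\<bar>h \<omega>\<bar> \<le> B" for \<omega> unfolding h_def by (rule B)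
  have minm: "(\<lambda>\<omega>. min (F j (\<lambda>t. bm t \<omega>)) (h \<omega>)) \<in> borel_measurable (completion gauss)" for j
    using FmC[of j] hm by measurable
  \<comment> \<open>Only a lower bound for the limit inferior of the minorants at the Brownian path
    is available; the minimum with \<open>h\<close> turns it into pointwise convergence, so that
    dominated convergence applies.\<close>
  have minlim: "(\<lambda>j. min (F j (\<lambda>t. bm t \<omega>)) (h \<omega>)) \<longlonglongrightarrow> h \<omega>" for \<omega>
  proof (rule LIMSEQ_I)
    fix r :: real assume r: "0 < r"
    have he: "h \<omega> = f (reflmap (\<lambda>t i. bm t \<omega> i - bm t \<omega> (Suc i)))" unfolding h_def by (simp add: bmW_def[abs_def] bmX_def[abs_def])
    have "eventually (\<lambda>j. h \<omega> - r / 2 \<le> F j (\<lambda>t. bm t \<omega>)) sequentially"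
      unfolding he F_def by (rule env_eventually_ge[where ?x0.0=x0 and G=G and f=f and B=B and b="\<lambda>t. bm t \<omega>", OF x0 G(2,3) B f(2) bm_continuous]) (use r in auto)
    then obtain j0 where "\<And>j. j \<ge> j0 \<Longrightarrow> h \<omega> - r / 2 \<le> F j (\<lambda>t. bm t \<omega>)" unfolding eventually_sequentially by blast
    then have "norm (min (F j (\<lambda>t. bm t \<omega>)) (h \<omega>) - h \<omega>) < r" if "j \<ge> j0" for j
      using that r by (fastforce simp: min_def abs_if)
    then show "\<exists>j0. \<forall>j\<ge>j0. norm (min (F j (\<lambda>t. bm t \<omega>)) (h \<omega>) - h \<omega>) < r" by blast
  qed
  have "(\<lambda>j. \<integral>\<omega>. min (F j (\<lambda>t. bm t \<omega>)) (h \<omega>) \<partial>completion gauss) \<longlonglongrightarrow> (\<integral>\<omega>. h \<omega> \<partial>completion gauss)"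
  proof (rule integral_dominated_convergence[where w="\<lambda>_. B"])
    show "(\<lambda>\<omega>. min (F j (\<lambda>t. bm t \<omega>)) (h \<omega>)) \<in> borel_measurable (completion gauss)" for j
      by (rule minm)
    have "\<bar>min (F j (\<lambda>t. bm t \<omega>)) (h \<omega>)\<bar> \<le> B" for j \<omega> using FB[of j "\<lambda>t. bm t \<omega>"] hB[of \<omega>] by (simp add: min_def)
    then show "AE \<omega> in completion gauss. norm (min (F j (\<lambda>t. bm t \<omega>)) (h \<omega>)) \<le> B" for j by simp
  qed (use hm minlim in auto)
  moreover have "0 < \<delta> / 5" using \<delta> by simp
  ultimately have "eventually (\<lambda>j. (\<integral>\<omega>. h \<omega> \<partial>completion gauss) - \<delta> / 5 \<le> (\<integral>\<omega>. min (F j (\<lambda>t. bm t \<omega>)) (h \<omega>) \<partial>completion gauss)) sequentially"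
    by (rule eventually_le_of_tendsto)
  then obtain j where j: "(\<integral>\<omega>. h \<omega> \<partial>completion gauss) - \<delta> / 5 \<le> (\<integral>\<omega>. min (F j (\<lambda>t. bm t \<omega>)) (h \<omega>) \<partial>completion gauss)"
    using eventually_happens'[OF sequentially_bot] by blast
  have "(\<integral>\<omega>. min (F j (\<lambda>t. bm t \<omega>)) (h \<omega>) \<partial>completion gauss) \<le> (\<integral>\<omega>. F j (\<lambda>t. bm t \<omega>) \<partial>completion gauss)"
  proof (rule integral_mono)
    have "\<bar>min (F j (\<lambda>t. bm t \<omega>)) (h \<omega>)\<bar> \<le> B" for \<omega> using FB[of j "\<lambda>t. bm t \<omega>"] hB[of \<omega>] by (simp add: min_def)
    then show "integrable (completion gauss) (\<lambda>\<omega>. min (F j (\<lambda>t. bm t \<omega>)) (h \<omega>))"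
      by (intro prob_integrable_bounded[OF C.prob_space_axioms minm, where c=B]) simp
    show "integrable (completion gauss) (\<lambda>\<omega>. F j (\<lambda>t. bm t \<omega>))"
      by (rule prob_integrable_bounded[OF C.prob_space_axioms FmC, where c=B]) (use FB in simp)
  qed simp
  also have "\<dots> = c j" unfolding c_def by (rule integral_completion[OF Fm])
  finally have cj: "(\<integral>\<omega>. h \<omega> \<partial>completion gauss) - \<delta> / 5 \<le> c j" using j by linarith
  \<comment> \<open>The denominator 5 (j + 1) makes the Lipschitz factor j cost at most \<delta> /
    5.\<close>
  define e where "e = \<delta> / (5 * (real j + 1))"
  have e: "0 < e" unfolding e_def using \<delta> by simp
  have je: "real j * e \<le> \<delta> / 5"
  proof -
    have "real j * e = (real j / (real j + 1)) * (\<delta> / 5)" by (simp add: e_def)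
    also have "\<dots> \<le> 1 * (\<delta> / 5)" using \<delta> by (intro mult_right_mono) auto
    finally show ?thesis by simp
  qed
  \<comment> \<open>Collects everything except K in the bound for j times the probability of
    \<open>bad\<close>, which then is at most A / K.\<close>
  define A where "A = real j * real d * (real j + 1) * 1152 / e ^ 4"
  have "eventually (\<lambda>k. c j - \<delta> / 5 \<le> (\<integral>\<omega>. F j (gpath (Suc k) (bmgrid (Suc k) \<omega>)) \<partial>gauss)) sequentially"
    by (rule eventually_le_of_tendsto[OF cK]) (use \<delta> in simp)
  moreover have "eventually (\<lambda>k. max (16 / e\<^sup>2) (5 * A / \<delta>) \<le> real (Suc k)) sequentially"
    by (rule eventually_sequentiallyI[of "nat \<lceil>max (16 / e\<^sup>2) (5 * A / \<delta>)\<rceil>"]) linarith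
  ultimately have "eventually (\<lambda>k. c j - \<delta> / 5 \<le> (\<integral>\<omega>. F j (gpath (Suc k) (bmgrid (Suc k) \<omega>)) \<partial>gauss) \<and> max (16 / e\<^sup>2) (5 * A / \<delta>) \<le> real (Suc k)) sequentially"
    by (rule eventually_conj)
  then obtain k where k: "c j - \<delta> / 5 \<le> (\<integral>\<omega>. F j (gpath (Suc k) (bmgrid (Suc k) \<omega>)) \<partial>gauss)" "max (16 / e\<^sup>2) (5 * A / \<delta>) \<le> real (Suc k)"
    using eventually_happens'[OF sequentially_bot] by blast
  define K where "K = Suc k"
  have K0: "0 < K" and K16: "16 / e\<^sup>2 \<le> real K" and KA: "5 * A / \<delta> \<le> real K" using k(2) unfolding K_def by simp_all
  have bad: "real j * prob (bad j K e n) \<le> \<delta> / 5" if n: "K \<le> n" for n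
  proof -
    have "real j * prob (bad j K e n) \<le> real j * (real (d * (j * K + 1)) * (1152 / ((real K)\<^sup>2 * e ^ 4)))"
      by (intro mult_left_mono bad_prob[OF e K0 K16 n]) simp
    also have "\<dots> \<le> real j * (real d * ((real j + 1) * real K) * (1152 / ((real K)\<^sup>2 * e ^ 4)))"
    proof (intro mult_left_mono mult_right_mono)
      have "1 \<le> real K" using K0 by simp
      then have "real d * (real j * real K + 1) \<le> real d * (real j * real K + real K)" by (intro mult_left_mono) auto
      then show "real (d * (j * K + 1)) \<le> real d * ((real j + 1) * real K)" by (simp add: algebra_simps)
    qed (use e in simp_all)
    also have "\<dots> = A / real K" 
    proof -
      have "x * (y * (z * k) * (1152 / (k\<^sup>2 * e ^ 4))) = x * y * z * 1152 / e ^ 4 / k" if "k > 0" for x y z k :: real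
        using that by (simp add: power2_eq_square mult_ac)
      from this[of "real K" "real j" "real d" "real j + 1"] show ?thesis using K0 unfolding A_def by simp
    qed
    also have "\<dots> \<le> \<delta> / 5" using KA K0 \<delta> by (simp add: divide_le_eq mult.commute)
    finally show ?thesis .
  qed
  have blim: "(\<lambda>n. \<integral>\<omega>. F j (gpath K (\<lambda>a. blk K n a \<omega>)) \<partial>P) \<longlonglongrightarrow> (\<integral>\<omega>. F j (gpath K (bmgrid K \<omega>)) \<partial>gauss)"
    using blk_fdd[where \<phi>="\<lambda>v. F j (gpath K v)", OF K0 _ lip FB] unfolding bmgrid_def[abs_def] by simp
  have bm: "(\<lambda>\<omega>. F j (gpath K (\<lambda>a. blk K n a \<omega>))) \<in> borel_measurable P" for n
    by (rule lipschitz_measurable[where \<phi>="\<lambda>v. F j (gpath K v)", OF _ _ lip]) (auto intro: blk_measurable)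
  have "eventually (\<lambda>n. (\<integral>\<omega>. F j (gpath K (bmgrid K \<omega>)) \<partial>gauss) - \<delta> / 5 \<le> (\<integral>\<omega>. F j (gpath K (\<lambda>a. blk K n a \<omega>)) \<partial>P)) sequentially"
    by (rule eventually_le_of_tendsto[OF blim]) (use \<delta> in simp)
  then show ?thesis
    using eventually_ge_at_top[of "max K (Suc j)"]
  proof eventually_elim
    case (elim n)
    have "(\<integral>\<omega>. F j (gpath K (\<lambda>a. blk K n a \<omega>)) \<partial>P) - real j * e - real j * prob (bad j K e n) \<le> (\<integral>\<omega>. f (zpath d x0 n (Ew \<omega>)) \<partial>completion P)"
      unfolding F_def by (rule zpath_lower[where ?x0.0=x0, OF x0 G B f(2) K0]) (use e elim(2) bm[unfolded F_def] in auto)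
    then show ?case using elim(1) bad[of n] elim(2) je k(1)[folded K_def] cj unfolding h_def by simp
  qed
qed

text \<open>The lower bound for - f is the upper bound for f.\<close>

lemma zpath_limit:
  assumes x0: "\<And>i. Suc i < d \<Longrightarrow> x0 i < x0 (Suc i)"
    and f: "bounded (range f)" "sk_continuous (d - 1) f"
  shows "(\<lambda>n. \<integral>\<omega>. f (zpath d x0 n (Ew \<omega>)) \<partial>completion P) \<longlonglongrightarrow> (\<integral>\<omega>. f (\<lambda>t. bmW t \<omega>) \<partial>completion gauss)"
proof (rule LIMSEQ_I)
  fix r :: real assume "0 < r"
  then have r: "0 < r / 2" by simp
  have f': "bounded (range (\<lambda>x. - f x))" "sk_continuous (d - 1) (\<lambda>x. - f x)"
  proof -
    show "bounded (range (\<lambda>x. - f x))" using f(1) unfolding bounded_iff by simp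
    show "sk_continuous (d - 1) (\<lambda>x. - f x)" 
      unfolding sk_continuous_def
      by (intro allI impI tendsto_minus f(2)[unfolded sk_continuous_def, rule_format]) blast
  qed
  have l1: "eventually (\<lambda>n. (\<integral>\<omega>. f (\<lambda>t. bmW t \<omega>) \<partial>completion gauss) - r / 2 \<le> (\<integral>\<omega>. f (zpath d x0 n (Ew \<omega>)) \<partial>completion P)) sequentially"
    by (rule zpath_liminf[OF _ f r]) (rule x0)
  have l2: "eventually (\<lambda>n. (\<integral>\<omega>. - f (\<lambda>t. bmW t \<omega>) \<partial>completion gauss) - r / 2 \<le> (\<integral>\<omega>. - f (zpath d x0 n (Ew \<omega>)) \<partial>completion P)) sequentially"
    by (rule zpath_liminf[OF _ f' r]) (rule x0)
  have "eventually (\<lambda>n. norm ((\<integral>\<omega>. f (zpath d x0 n (Ew \<omega>)) \<partial>completion P) - (\<integral>\<omega>. f (\<lambda>t. bmW t \<omega>) \<partial>completion gauss)) < r) sequentially"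
    using l1 l2
  proof eventually_elim
    case (elim n)
    then show ?case using r by (simp add: abs_if)
  qed
  then show "\<exists>n0. \<forall>n\<ge>n0. norm ((\<integral>\<omega>. f (zpath d x0 n (Ew \<omega>)) \<partial>completion P) - (\<integral>\<omega>. f (\<lambda>t. bmW t \<omega>) \<partial>completion gauss)) < r"
    unfolding eventually_sequentially .
qed

end

theorem theorem2p6:
  fixes d :: nat and x0 :: "nat \<Rightarrow> int" and P :: "'a measure" and E :: "nat \<Rightarrow> nat \<Rightarrow> 'a \<Rightarrow> real"
  assumes "d \<ge> 2"
    and "\<And>i. Suc i < d \<Longrightarrow> x0 i < x0 (Suc i)"
    and "prob_space P"
    and "\<And>i k. i < d \<Longrightarrow> distributed P lborel (E i k) (exponential_density 1)"
    and "prob_space.indep_vars P (\<lambda>_. borel) (\<lambda>(i, k). E i k) ({..<d} \<times> UNIV)"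
  shows "(\<exists>(M :: (nat \<Rightarrow> real) measure) F W X Y.
            srbm M F (d - 1) (\<lambda>_. 0) (Sigma_PT d) (R_PT d)
              (return (PiM {..<d - 1} (\<lambda>_. borel)) (\<lambda>i\<in>{..<d - 1}. 0)) W X Y)
       \<and> (\<forall>(M :: 'b measure) F W X Y.
            srbm M F (d - 1) (\<lambda>_. 0) (Sigma_PT d) (R_PT d)
              (return (PiM {..<d - 1} (\<lambda>_. borel)) (\<lambda>i\<in>{..<d - 1}. 0)) W X Y \<longrightarrow>
            conv_distr_D (d - 1) P
              (\<lambda>n \<omega> t. (\<lambda>i. gaps d (pt_config d x0 (\<lambda>i k. E i k \<omega>) (real n * t)) i / sqrt (real n)))
              M (\<lambda>\<omega> t. W t \<omega>))"
proof -
  interpret exp_clocks P d E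
    using assms by (intro exp_clocks.intro exp_clocks_axioms.intro) auto
  have S: "srbm gauss (bm_filt (Suc (d - 1))) (d - 1) (\<lambda>_. 0) (Sigma_PT d) (R_PT d) (delta0 (d - 1)) bmW bmX bmY"
    unfolding Sigma_PT_def R_PT_def by (rule srbm_exists)
  have "conv_distr_D (d - 1) P
              (\<lambda>n \<omega> t. (\<lambda>i. gaps d (pt_config d x0 (\<lambda>i k. E i k \<omega>) (real n * t)) i / sqrt (real n)))
              M (\<lambda>\<omega> t. W t \<omega>)"
    if "srbm M F (d - 1) (\<lambda>_. 0) (Sigma_PT d) (R_PT d) (delta0 (d - 1)) W X Y" for M :: "'b measure" and F W X Y
    unfolding conv_distr_D_def
  proof (intro allI impI)
    fix f :: "(real \<Rightarrow> nat \<Rightarrow> real) \<Rightarrow> real" assume f: "bounded (range f)" "sk_continuous (d - 1) f"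
    \<comment> \<open>The limit found for the explicit SRBM is the same number for any other SRBM
      with these data.\<close>
    have "(\<integral>\<omega>. f (\<lambda>t. bmW t \<omega>) \<partial>completion gauss) = (\<integral>\<omega>. f (\<lambda>t. W t \<omega>) \<partial>completion M)"
      by (rule srbm_law_unique[OF S[unfolded R_PT_def] that[unfolded R_PT_def] f])
    with zpath_limit[where ?x0.0=x0, OF assms(2) f]
    show "(\<lambda>n. \<integral>\<omega>. f (\<lambda>t i. gaps d (pt_config d x0 (\<lambda>i k. E i k \<omega>) (real n * t)) i / sqrt (real n)) \<partial>completion P)
        \<longlonglongrightarrow> (\<integral>\<omega>. f (\<lambda>t. W t \<omega>) \<partial>completion M)"
      by (simp add: zpath_def[abs_def])
  qed
  with S show ?thesis by blast
qed

end
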